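(* Let $L\subset A\times I$ be the closure of a $3$-braid. If $\dim\mathrm{AKh}(L;\mathbb{Z}/2\mathbb{Z})=6$, then $L$ is isotopic in $A\times I$ to $\widehat{\sigma_1\sigma_2}$ or to $\widehat{\sigma_1^{-1}\sigma_2^{-1}}$.
   Context: $A\times I$ is the thickened annulus, identified with the complement of an unknot $U$ (the annular axis) in $S^3$; a braid closure $\widehat{\beta}$ is viewed as a link in $A\times I$ with $U$ as braid axis. $\mathrm{AKh}(L;R)$ denotes the annular Khovanov homology (Asaeda–Przytycki–Sikora) of the annular link $L$ with coefficients in $R$. *)

theory Defs
  imports "HOL-Analysis.Analysis"
begin

text \<open>Artin generators of the 3-strand braid group; a braid word is a list of
  generators with a sign (True = sigma_i, False = sigma_i inverse).\<close>

datatype gen3 = Sig1 | Sig2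

type_synonym braid3 = "(gen3 \<times> bool) list"

fun gidx :: "gen3 \<Rightarrow> nat" where
  "gidx Sig1 = 0"
| "gidx Sig2 = 1"

text \<open>The thickened annulus A x I is identified with the complement of the
  braid axis U (the z-axis, closed up at infinity) in S^3, i.e. with the
  complement of the z-axis in R^3.\<close>

type_synonym R3 = "real \<times> real \<times> real"

definition annular_space :: "R3 set" where
  "annular_space = {p. (fst p, fst (snd p)) \<noteq> (0, 0)}"

definition cyl :: "real \<Rightarrow> real \<Rightarrow> real \<Rightarrow> R3" where
  "cyl r \<theta> z = (r * cos \<theta>, r * sin \<theta>, z)"

text \<open>The closure of a word of length n is drawn in n+1 angular slots; slot k < n
  carries the k-th letter, slot n is an identity slot.  Strand position j (j<3)
  sits at radius j+1.  In a slot carrying sigma_(i+1)^(+-1) the strands at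
  positions i and i+1 swap, passing at heights +-sin(pi t).
  strand_pos returns (radius, height).\<close>

definition strand_pos :: "braid3 \<Rightarrow> nat \<Rightarrow> nat \<Rightarrow> real \<Rightarrow> real \<times> real" where
  "strand_pos w k j t =
     (if k < length w then
        (let i = gidx (fst (w ! k)); e = (if snd (w ! k) then 1 else -1 :: real) in
         if j = i then (real j + 1 + t, e * sin (pi * t))
         else if j = Suc i then (real j + 1 - t, - e * sin (pi * t))
         else (real j + 1, 0))
      else (real j + 1, 0))"

definition braid_closure :: "braid3 \<Rightarrow> R3 set" where
  "braid_closure w =
     {cyl (fst (strand_pos w k j t)) (2 * pi * (real k + t) / real (Suc (length w)))
          (snd (strand_pos w k j t)) | k j t.
        k \<le> length w \<and> j < 3 \<and> 0 \<le> t \<and> t \<le> 1}"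

definition annular_isotopic :: "R3 set \<Rightarrow> R3 set \<Rightarrow> bool" where
  "annular_isotopic L L' \<longleftrightarrow>
     L \<subseteq> annular_space \<and> L' \<subseteq> annular_space \<and>
     (\<exists>H :: real \<Rightarrow> R3 \<Rightarrow> R3.
        continuous_on ({0..1} \<times> annular_space) (\<lambda>(t, p). H t p) \<and>
        (\<forall>t\<in>{0..1}. \<exists>g. homeomorphism annular_space annular_space (H t) g) \<and>
        (\<forall>p\<in>annular_space. H 0 p = p) \<and>
        H 1 ` L = L')"

text \<open>Nodes of the resolved diagram: (slot k, strand position j, bottom?).
  Within slot k the top endpoints are (k,j,False), bottom ones (k,j,True);
  bottom of slot k is joined to top of slot k+1 (mod n+1).\<close>

type_synonym node = "nat \<times> nat \<times> bool"

definition diag_nodes :: "braid3 \<Rightarrow> node set" where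
  "diag_nodes w = {..length w} \<times> {..<3} \<times> UNIV"

text \<open>A resolution is the set s of crossings given the 1-smoothing.  Convention:
  for a positive crossing the 0-smoothing is the oriented (vertical) one, for a
  negative crossing the 1-smoothing is the oriented one.\<close>

definition vertical_smoothing :: "braid3 \<Rightarrow> nat set \<Rightarrow> nat \<Rightarrow> bool" where
  "vertical_smoothing w s k \<longleftrightarrow> (snd (w ! k) \<longleftrightarrow> k \<notin> s)"

definition res_edge :: "braid3 \<Rightarrow> nat set \<Rightarrow> node \<Rightarrow> node \<Rightarrow> bool" where
  "res_edge w s a b \<longleftrightarrow> a \<in> diag_nodes w \<and> b \<in> diag_nodes w \<and>
    ((\<exists>k j. a = (k, j, True) \<and> b = (Suc k mod Suc (length w), j, False))
   \<or> (\<exists>k j. a = (k, j, False) \<and> b = (k, j, True) \<and>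
        (k = length w \<or> (j \<noteq> gidx (fst (w ! k)) \<and> j \<noteq> Suc (gidx (fst (w ! k))))
         \<or> vertical_smoothing w s k))
   \<or> (\<exists>k i. k < length w \<and> i = gidx (fst (w ! k)) \<and> \<not> vertical_smoothing w s k \<and>
        ((a = (k, i, False) \<and> b = (k, Suc i, False)) \<or> (a = (k, i, True) \<and> b = (k, Suc i, True)))))"

definition res_adj :: "braid3 \<Rightarrow> nat set \<Rightarrow> node \<Rightarrow> node \<Rightarrow> bool" where
  "res_adj w s a b \<longleftrightarrow> res_edge w s a b \<or> res_edge w s b a"

definition circles :: "braid3 \<Rightarrow> nat set \<Rightarrow> node set set" where
  "circles w s = (\<lambda>x. {y \<in> diag_nodes w. (res_adj w s)\<^sup>*\<^sup>* x y}) ` diag_nodes w"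

text \<open>A circle is essential iff it meets the radial seam (between the last slot
  and slot 0) an odd number of times.\<close>

definition essential :: "braid3 \<Rightarrow> node set \<Rightarrow> bool" where
  "essential w c \<longleftrightarrow> odd (card {j. (length w, j, True) \<in> c})"

text \<open>Generators: a resolution together with the set of circles labelled v+
  (the others are labelled v-).\<close>

definition gens :: "braid3 \<Rightarrow> (nat set \<times> node set set) set" where
  "gens w = {(s, P). s \<subseteq> {..<length w} \<and> P \<subseteq> circles w s}"

definition kgr :: "braid3 \<Rightarrow> nat set \<times> node set set \<Rightarrow> int" where
  "kgr w x = int (card {c \<in> snd x. essential w c})
             - int (card {c \<in> circles w (fst x) - snd x. essential w c})"

text \<open>y occurs (with coefficient 1) in the Khovanov differential of x:
  edge of the cube, merge m or split Delta, other labels unchanged.\<close>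

definition kh_term :: "braid3 \<Rightarrow> nat set \<times> node set set \<Rightarrow> nat set \<times> node set set \<Rightarrow> bool" where
  "kh_term w x y \<longleftrightarrow>
    (let s = fst x; P = snd x; s' = fst y; P' = snd y;
         Old = circles w s - circles w s'; New = circles w s' - circles w s;
         Unch = circles w s \<inter> circles w s' in
     (\<exists>k<length w. k \<notin> s \<and> s' = insert k s) \<and> P \<inter> Unch = P' \<inter> Unch \<and>
     ((\<exists>a b c. a \<noteq> b \<and> Old = {a, b} \<and> New = {c} \<and> (a \<in> P \<or> b \<in> P) \<and>
          (c \<in> P' \<longleftrightarrow> a \<in> P \<and> b \<in> P))
    \<or> (\<exists>a c d. c \<noteq> d \<and> Old = {a} \<and> New = {c, d} \<and>
          (if a \<in> P then (c \<in> P' \<longleftrightarrow> d \<notin> P') else c \<notin> P' \<and> d \<notin> P'))))"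

text \<open>Annular differential: the part of the Khovanov differential preserving
  the annular grading (Asaeda-Przytycki-Sikora).\<close>

definition akh_diff :: "braid3 \<Rightarrow> nat set \<times> node set set \<Rightarrow> nat set \<times> node set set \<Rightarrow> bool" where
  "akh_diff w y x \<longleftrightarrow> x \<in> gens w \<and> y \<in> gens w \<and> kh_term w x y \<and> kgr w y = kgr w x"

text \<open>Chains over Z/2 are subsets of the basis (addition = symmetric difference).\<close>

definition akh_apply :: "braid3 \<Rightarrow> (nat set \<times> node set set) set \<Rightarrow> (nat set \<times> node set set) set" where
  "akh_apply w S = {y \<in> gens w. odd (card {x \<in> S. akh_diff w y x})}"

definition gf2_dim :: "'a set \<Rightarrow> nat" where
  "gf2_dim V = (THE n. card V = 2 ^ n)"

definition akh_dim :: "braid3 \<Rightarrow> nat" where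
  "akh_dim w = gf2_dim {S. S \<subseteq> gens w \<and> akh_apply w S = {}}
             - gf2_dim (akh_apply w ` Pow (gens w))"

end

(* Annular Khovanov homology splits by the annular grading into the parts k = 3, 1, -1, -3; the outer parts have
   dimension one and the two inner parts are isomorphic, so dimension 6 means that the part k = 1 has dimension two.
   This part is the twisted cyclic complex of a braid action over the zigzag algebra of type A2. Its graded Euler
   characteristic is one plus the trace of the reduced Burau matrix, and the sum of the three generators of the
   braid-like resolution always survives in bidegree (0, 0). Hence the Burau trace is a single signed monomial.
   Evaluated at a fourth root of unity this forces, by reduction of words in PSL2(Z), the braid to be conjugate to
   a power of the full twist times (s1 s2) or its inverse. The degree of the monomial is then known from the
   evaluation at 2, and if the power is not trivial the braid is a positive or a negative word of large degree;
   this is excluded by a second explicit homology class, in bidegree (1, 2) or (-1, -2), which is transported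
   along conjugation, cancellation and the braid relation.
   On the topological side, conjugation, cancellation and the braid relation are homotopies of paths of three
   distinct points in a half-plane; a small motion of these points extends to an ambient isotopy. *)

theory Submission
  imports Defs "HOL-Library.Z2" "HOL-Library.Function_Algebras"
begin

section \<open>The twisted complex of a word\<close>

text \<open>The Euler characteristic alone cannot finish the proof: the Burau trace of every power
  of the full twist times \<open>wy\<close> is a signed monomial, so infinitely many conjugacy
  classes survive and must be refuted by an actual class. Such classes come from enlarging the
  complex by two generators. The one of index 3 is never hit by the differential, so its boundary is
  a cycle of the original complex that may fail to bound there. The one of index 4 is a cycle, and a
  chain bounded by it alone becomes a cycle once it is divided out. The first situation is visible
  by inspection for a positive word, the second for a negative word; both pass to conjugate words
  through chain maps that respect the two generators. Rotation is the delicate move. The inductive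
  form of the differential turns the other moves into identities of functions, but it singles out a
  first letter; a second form, a sum over the letters in cyclic order, is blind to it. This form is
  also the one matched with merges and splits of circles, since every trivial circle runs between
  cyclically consecutive cup-caps.\<close>

declare add_bit_eq_xor [simp del] plus_fun_apply [simp del] zero_fun_apply [simp del]

text \<open>A state is a list with one entry per letter, None for a vertical slot and Some d for a cup-cap, where
  d is the degree of the arc that comes from the cyclically preceding cup-cap, an element of the zigzag algebra
  of type A2: degrees 0 and 2 are the labels + and - of a trivial circle, degree 1 is an arc of the essential
  circle joining cup-caps at different positions. The index of a state is 0, except when all slots are vertical:
  then the indices 0, 1, 2 say which of the three essential strands has the exceptional label. Two further
  generators with indices 3 and 4 (see ecoef and ehat) do not belong to annular Khovanov homology; they serve
  to construct the classes that detect positive and negative words.\<close>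

type_synonym vec = "nat option list \<Rightarrow> nat \<Rightarrow> bit"

lemma vec_apply: "(0::vec) \<tau> x = 0" "(u + v :: vec) \<tau> x = u \<tau> x + v \<tau> x"
  unfolding plus_fun_def zero_fun_def by (rule refl)+

lemma Suc_Suc_0 [simp]: "Suc (Suc 0) = 2"
  by simp

lemma bit_self [simp]: "(x::bit) + x = 0"
  by (cases x) auto

lemma vec_self [simp]: "(v::vec) + v = 0"
  by (intro ext) (simp add: vec_apply)

lemma vec_self_left [simp]: "(v::vec) + (v + u) = u"
  by (simp add: add.assoc [symmetric])

text \<open>Between two positions the zigzag algebra is at most one-dimensional in each degree:
  degrees 0 and 2 on the diagonal, degree 1 off it. A basis element is therefore recorded by its
  degree, and a product by the sum of the degrees, being zero beyond 2.\<close>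

definition par :: "gen3 \<Rightarrow> gen3 \<Rightarrow> nat \<Rightarrow> bool" where
  "par i j e \<longleftrightarrow> (even e \<longleftrightarrow> i = j) \<and> e \<le> 2"

lemma gidx_eq_iff [simp]: "gidx i = gidx j \<longleftrightarrow> i = j"
  by (cases i; cases j) auto

lemma par_gidx: "par i j e \<longleftrightarrow> even (e + gidx i + gidx j) \<and> e \<le> 2"
  by (cases i; cases j) (auto simp: par_def)

definition sub :: "nat option \<Rightarrow> vec \<Rightarrow> vec" where
  "sub t v = (\<lambda>\<tau>. v (t # \<tau>))"

text \<open>Opens a closed chain at a cup-cap in the first slot: the degree of the arc that ends
  there becomes the trailing index of the open word.\<close>

definition uh :: "vec \<Rightarrow> vec" where
  "uh c = (\<lambda>\<tau> e. c (Some e # \<tau>) 0)"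

text \<open>A \<open>vec\<close> is an arbitrary function, also on lists and indices that are no
  states. \<open>nl\<close> and \<open>off\<close> name these junk coefficients, so that equations
  of chains can be proved as equations of functions.\<close>

definition nl :: "vec \<Rightarrow> nat \<Rightarrow> bit" where
  "nl v x = v [] x"

definition off :: "vec \<Rightarrow> nat option list \<Rightarrow> nat \<Rightarrow> nat \<Rightarrow> bit" where
  "off v \<tau> x e = (if x = 0 then 0 else v (Some e # \<tau>) x)"

text \<open>Right multiplication acts on the last arc. \<open>rmul 0\<close> is not quite the
  identity: it cuts off the indices above 2.\<close>

definition rmul :: "nat \<Rightarrow> vec \<Rightarrow> vec" where
  "rmul e v = (\<lambda>\<tau> x. if e \<le> x \<and> x \<le> 2 then v \<tau> (x - e) else 0)"

text \<open>Left multiplication acts on the first arc, which ends at the first cup-cap behind the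
  vertical slots, or is the trailing index if there is no cup-cap.\<close>

fun lmul :: "braid3 \<Rightarrow> gen3 \<Rightarrow> nat \<Rightarrow> vec \<Rightarrow> vec" where
  "lmul [] j e v \<tau> x = (if e \<le> x \<and> x \<le> 2 then v \<tau> (x - e) else 0)"
| "lmul (a # w) j e v [] x = 0"
| "lmul (a # w) j e v (None # \<tau>) x = lmul w j e (sub None v) \<tau> x"
| "lmul (a # w) j e v (Some f # \<tau>) x =
     (if par j (fst a) f \<and> e \<le> f then v (Some (f - e) # \<tau>) x else 0)"

text \<open>In dM the word is cut open: j is the position of the cup-cap before the word, the index is the degree of
  the last arc. The closed word is treated by dC, which opens it at the first cup-cap.\<close>

fun dM :: "braid3 \<Rightarrow> gen3 \<Rightarrow> vec \<Rightarrow> vec" where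
  "dM [] j v \<tau> x = 0"
| "dM (a # w) j v [] x = 0"
| "dM (a # w) j v (None # \<tau>) x = dM w j (sub None v) \<tau> x +
     (if snd a then 0
      else if fst a = j then lmul w j 0 (sub (Some 0) v) \<tau> x + lmul w j 2 (sub (Some 2) v) \<tau> x
      else lmul w j 1 (sub (Some 1) v) \<tau> x)"
| "dM (a # w) j v (Some e # \<tau>) x =
     (if par j (fst a) e then dM w (fst a) (sub (Some e) v) \<tau> x +
        (if snd a then lmul w (fst a) (2 - e) (sub None v) \<tau> x else 0) else 0)"

text \<open>The coproduct that inserts a cup-cap at position \<open>j\<close> in front of a closed
  word; the degrees of the two new arcs exceed that of the old arc by 2 in total. Over a vertical
  word it merges two strands into a circle with label -; label + is reached there only from the
  generator 3.\<close>

fun del :: "braid3 \<Rightarrow> gen3 \<Rightarrow> vec \<Rightarrow> vec" where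
  "del [] i c \<tau> x = (if x = 2 then c \<tau> (gidx i) + c \<tau> (Suc (gidx i)) else if x = 0 then c \<tau> 3 else 0)"
| "del (a # w) j c [] x = 0"
| "del (a # w) j c (None # \<tau>) x = del w j (sub None c) \<tau> x"
| "del (a # w) j c (Some e # \<tau>) x = (if par j (fst a) e then rmul (2 - e) (uh c) \<tau> x else 0)"

text \<open>The product that removes a cup-cap at position \<open>j\<close> and closes the word: the
  trailing arc is composed with the first one. Over a vertical word label + gives either of two
  strands, and label - gives the generator 4, where the annular differential has 0.\<close>

fun mu :: "braid3 \<Rightarrow> gen3 \<Rightarrow> vec \<Rightarrow> vec" where
  "mu [] i n \<tau> x = (if x = gidx i \<or> x = Suc (gidx i) then n \<tau> 0 else if x = 4 then n \<tau> 2 else 0)"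
| "mu (a # w) j n [] x = 0"
| "mu (a # w) j n (None # \<tau>) x = mu w j (sub None n) \<tau> x"
| "mu (a # w) j n (Some e # \<tau>) x = (if x = 0 \<and> e \<le> 2 then
     (if fst a = j then rmul 0 (sub (Some 0) n) \<tau> e + rmul 2 (sub (Some 2) n) \<tau> e
      else rmul 1 (sub (Some 1) n) \<tau> e) else 0)"

fun dC :: "braid3 \<Rightarrow> vec \<Rightarrow> vec" where
  "dC [] c \<tau> x = 0"
| "dC (a # w) c [] x = 0"
| "dC (a # w) c (None # \<tau>) x = dC w (sub None c) \<tau> x + (if snd a then 0 else mu w (fst a) (uh c) \<tau> x)"
| "dC (a # w) c (Some e # \<tau>) x = (if x = 0 \<and> e \<le> 2 then
     dM w (fst a) (uh c) \<tau> e + (if snd a then del w (fst a) (sub None c) \<tau> e else 0) else 0)"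

section \<open>Parts of a chain, extensionality and linearity\<close>

lemma sub_add [simp]: "sub t (u + v) = sub t u + sub t v"
  by (simp add: sub_def plus_fun_def)
lemma sub_0 [simp]: "sub t 0 = 0"
  by (simp add: sub_def zero_fun_def)
lemma uh_add [simp]: "uh (u + v) = uh u + uh v"
  by (simp add: uh_def plus_fun_def)
lemma uh_0 [simp]: "uh 0 = 0"
  by (simp add: uh_def zero_fun_def)
lemma rmul_add [simp]: "rmul e (u + v) = rmul e u + rmul e v"
  by (intro ext) (simp add: vec_apply rmul_def plus_fun_def)
lemma rmul_0 [simp]: "rmul e 0 = 0"
  by (intro ext) (simp add: vec_apply rmul_def zero_fun_def)

lemma nl_off_simps [simp]:
  "nl (u + v) x = nl u x + nl v x" "nl 0 x = 0"
  "nl (rmul e v) x = (if e \<le> x \<and> x \<le> 2 then nl v (x - e) else 0)"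
  "nl (lmul (a # w) j e v) x = 0" "nl (dM (a # w) j v) x = 0" "nl (del (a # w) j v) x = 0"
  "nl (mu (a # w) j v) x = 0" "nl (dC (a # w) v) x = 0"
  "off (u + v) \<tau> x e = off u \<tau> x e + off v \<tau> x e" "off 0 \<tau> x e = 0"
  "off (mu (a # w) j v) \<tau> x e = 0" "off (dC (a # w) v) \<tau> x e = 0"
  by (auto simp: nl_def off_def rmul_def vec_apply)

text \<open>The induction principle for open words: chains over \<open>a # w\<close> are compared
  part by part, and each part is a chain over \<open>w\<close>.\<close>

lemma vec_cons_eqI:
  assumes "\<And>x. nl u x = nl v x" "sub None u = sub None v"
    "\<And>e. sub (Some e) u = sub (Some e) v"
  shows "u = v"
proof (intro ext)
  fix \<tau> x
  show "u \<tau> x = v \<tau> x"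
  proof (cases \<tau>)
    case Nil
    then show ?thesis using assms(1) by (simp add: nl_def)
  next
    case (Cons t \<tau>')
    then show ?thesis
      using fun_cong [OF fun_cong [OF assms(2), of \<tau>'], of x]
        fun_cong [OF fun_cong [OF assms(3), of "the t" \<tau>'], of x]
      by (cases t) (auto simp: sub_def)
  qed
qed

lemma lmul_sub [simp]:
  "sub None (lmul (a # w) j e v) = lmul w j e (sub None v)"
  "sub (Some f) (lmul (a # w) j e v) = (if par j (fst a) f \<and> e \<le> f then sub (Some (f - e)) v else 0)"
  by (auto simp: sub_def vec_apply intro!: ext)

lemma dM_sub [simp]:
  "sub None (dM (a # w) j v) = dM w j (sub None v) +
     (if snd a then 0
      else if fst a = j then lmul w j 0 (sub (Some 0) v) + lmul w j 2 (sub (Some 2) v)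
      else lmul w j 1 (sub (Some 1) v))"
  "sub (Some e) (dM (a # w) j v) = (if par j (fst a) e then dM w (fst a) (sub (Some e) v) +
        (if snd a then lmul w (fst a) (2 - e) (sub None v) else 0) else 0)"
  by (auto simp: sub_def vec_apply intro!: ext)

lemma del_sub [simp]:
  "sub None (del (a # w) j c) = del w j (sub None c)"
  "sub (Some e) (del (a # w) j c) = (if par j (fst a) e then rmul (2 - e) (uh c) else 0)"
  by (auto simp: sub_def vec_apply intro!: ext)

lemma mu_sub [simp]:
  "sub None (mu (a # w) j n) = mu w j (sub None n)"
  "uh (mu (a # w) j n) = (if fst a = j then rmul 0 (sub (Some 0) n) + rmul 2 (sub (Some 2) n)
      else rmul 1 (sub (Some 1) n))"
  by (auto simp: sub_def uh_def rmul_def vec_apply intro!: ext)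

lemma dC_sub [simp]:
  "sub None (dC (a # w) c) = dC w (sub None c) + (if snd a then 0 else mu w (fst a) (uh c))"
  by (auto simp: sub_def vec_apply intro!: ext)

lemma lmul_add [simp]: "lmul w j e (u + v) = lmul w j e u + lmul w j e v"
proof (induction w arbitrary: u v)
  case Nil
  show ?case by (intro ext) (simp add: vec_apply)
next
  case (Cons a w)
  show ?case by (rule vec_cons_eqI) (simp_all add: Cons)
qed

lemma lmul_0 [simp]: "lmul w j e 0 = 0"
proof (induction w)
  case Nil
  show ?case by (intro ext) (simp add: vec_apply)
next
  case (Cons a w)
  show ?case by (rule vec_cons_eqI) (simp_all add: Cons)
qed

lemma dM_add [simp]: "dM w j (u + v) = dM w j u + dM w j v"
proof (induction w arbitrary: j u v)
  case Nil
  show ?case by (intro ext) (simp add: vec_apply)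
next
  case (Cons a w)
  show ?case by (rule vec_cons_eqI) (simp_all add: Cons add_ac)
qed

lemma dM_0 [simp]: "dM w j 0 = 0"
proof (induction w arbitrary: j)
  case Nil
  show ?case by (intro ext) (simp add: vec_apply)
next
  case (Cons a w)
  show ?case by (rule vec_cons_eqI) (simp_all add: Cons)
qed

lemma del_add [simp]: "del w j (u + v) = del w j u + del w j v"
proof (induction w arbitrary: u v)
  case Nil
  show ?case by (intro ext) (simp add: vec_apply add_ac)
next
  case (Cons a w)
  show ?case by (rule vec_cons_eqI) (simp_all add: Cons)
qed

lemma del_0 [simp]: "del w j 0 = 0"
proof (induction w)
  case Nil
  show ?case by (intro ext) (simp add: vec_apply)
next
  case (Cons a w)
  show ?case by (rule vec_cons_eqI) (simp_all add: Cons)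
qed

text \<open>For closed words the part with a cup-cap in the first slot is compared after opening it
  there, which turns it into a chain over an open word; \<open>off\<close> covers the indices that
  \<open>uh\<close> does not read.\<close>

lemma cyc_eqI:
  assumes "\<And>x. nl u x = nl v x" "sub None u = sub None v"
    "uh u = uh v" "\<And>\<tau> x e. off u \<tau> x e = off v \<tau> x e"
  shows "u = v"
proof (rule vec_cons_eqI)
  show "sub (Some e) u = sub (Some e) v" for e
  proof (intro ext)
    fix \<tau> x
    show "sub (Some e) u \<tau> x = sub (Some e) v \<tau> x"
      using fun_cong [OF fun_cong [OF assms(3), of \<tau>], of e] assms(4) [of \<tau> x e]
      by (cases "x = 0") (auto simp: sub_def uh_def off_def)
  qed
qed (use assms in auto)

lemma mu_add [simp]: "mu w j (u + v) = mu w j u + mu w j v"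
proof (induction w arbitrary: u v)
  case Nil
  show ?case by (intro ext) (simp add: vec_apply add_ac)
next
  case (Cons a w)
  show ?case by (rule cyc_eqI) (simp_all add: Cons add_ac)
qed

lemma mu_0 [simp]: "mu w j 0 = 0"
proof (induction w)
  case Nil
  show ?case by (intro ext) (simp add: vec_apply)
next
  case (Cons a w)
  show ?case by (rule cyc_eqI) (simp_all add: Cons)
qed

section \<open>Compatibility of the multiplications, the coproduct and the differentials\<close>

lemma rmul_rmul [simp]: "rmul a (rmul b v) = rmul (a + b) v"
  by (intro ext) (auto simp: rmul_def)

lemma rmul_big: "e > 2 \<Longrightarrow> rmul e v = 0"
  by (intro ext, simp add: rmul_def vec_apply, linarith)

lemma lmul_big: "e > 2 \<Longrightarrow> lmul w j e v = 0"
proof (induction w arbitrary: v)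
  case Nil
  then show ?case by (intro ext, simp add: vec_apply, linarith)
next
  case (Cons a w)
  show ?case by (rule vec_cons_eqI) (use Cons in \<open>auto simp: par_def\<close>)
qed

text \<open>Associativity of the zigzag algebra. The parity of \<open>a\<close> makes the validity
  tests at the positions \<open>j'\<close> and \<open>j''\<close> agree.\<close>

lemma lmul_lmul: "par j'' j' a \<Longrightarrow> lmul w j'' a (lmul w j' b v) = lmul w j'' (a + b) v"
proof (induction w arbitrary: v)
  case Nil
  then show ?case by (intro ext) (auto simp: vec_apply)
next
  case (Cons c w)
  show ?case
    by (rule vec_cons_eqI) (use Cons in \<open>auto simp: par_gidx diff_diff_add add.commute\<close>)
qed

lemma sub_rmul [simp]: "sub t (rmul e v) = rmul e (sub t v)"
  by (auto simp: sub_def rmul_def)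

lemma lmul_rmul: "lmul w j a (rmul b v) = rmul b (lmul w j a v)"
proof (induction w arbitrary: v)
  case Nil
  then show ?case by (intro ext, auto simp: rmul_def, metis add.commute)
next
  case (Cons c w)
  show ?case
    by (rule vec_cons_eqI) (auto simp: Cons)
qed

text \<open>The differential is made of bimodule maps, so it commutes with multiplication by an
  element from \<open>j'\<close> to \<open>j\<close>; only the position in front of the word
  changes.\<close>

lemma dM_lmul: "par j' j e \<Longrightarrow> dM w j' (lmul w j' e v) = lmul w j' e (dM w j v)"
proof (induction w arbitrary: j j' e v)
  case Nil
  then show ?case by (intro ext) (auto simp: vec_apply)
next
  case (Cons a w)
  obtain i b where a: "a = (i, b)" by (cases a)
  show ?case
  proof (rule vec_cons_eqI)
    show "sub None (dM (a # w) j' (lmul (a # w) j' e v)) = sub None (lmul (a # w) j' e (dM (a # w) j v))"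
    proof -
      have e: "e = 0 \<or> e = 1 \<or> e = 2" using Cons.prems by (auto simp: par_def)
      have "lmul w j' e (lmul w j b u) = lmul w j' (e + b) u" for b u
        using Cons.prems by (rule lmul_lmul)
      moreover have "dM w j' (lmul w j' e u) = lmul w j' e (dM w j u)" for u
        using Cons.prems by (rule Cons.IH)
      ultimately show ?thesis
        using Cons.prems e
        by (cases i; cases j; cases j') (auto simp: a par_def lmul_big)
    qed
  next
    fix f
    \<comment> \<open>If \<open>e\<close> exceeds \<open>f\<close>, the total degree exceeds 2 and
      the product vanishes.\<close>
    have *: "lmul w i (2 - f) (lmul w j' e (sub None v)) = (if e \<le> f then lmul w i (2 - (f - e)) (sub None v) else 0)"
      if "par j' i f"
      using that lmul_lmul [of i j' "2 - f" w e "sub None v"]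
      by (auto simp: par_def lmul_big)
    show "sub (Some f) (dM (a # w) j' (lmul (a # w) j' e v)) = sub (Some f) (lmul (a # w) j' e (dM (a # w) j v))"
      using Cons.prems *
      by (cases "e \<le> f") (auto simp: a par_gidx)
  qed simp
qed

lemma dM_rmul: "dM w j (rmul e v) = rmul e (dM w j v)"
proof (induction w arbitrary: j v)
  case Nil
  then show ?case by (intro ext) (auto simp: vec_apply rmul_def)
next
  case (Cons a w)
  show ?case
    by (rule vec_cons_eqI) (auto simp: Cons.IH lmul_rmul)
qed

text \<open>A change of smoothing in the first slot is a multiplication, which commutes with the
  changes behind it by \<open>dM_lmul\<close>; over Z/2 the two orders cancel.\<close>

lemma dM_dM: "dM w j (dM w j v) = 0"
proof (induction w arbitrary: j v)
  case Nil
  then show ?case by (intro ext) (auto simp: vec_apply)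
next
  case (Cons a w)
  obtain i b where a: "a = (i, b)" by (cases a)
  show ?case
  proof (rule vec_cons_eqI)
    show "sub None (dM (a # w) j (dM (a # w) j v)) = sub None 0"
      by (auto simp: a Cons.IH par_def dM_lmul [of j i] add_ac)
    show "sub (Some e) (dM (a # w) j (dM (a # w) j v)) = sub (Some e) 0" for e
      using dM_lmul [of i j "2 - e" w "sub None v"]
      by (auto simp: a Cons.IH par_def)
  qed simp
qed

lemma par_cases:
  assumes "par i j e"
  obtains "e = 0" "i = j" | "e = 1" "i \<noteq> j" | "e = 2" "i = j"
proof -
  have "e = 0 \<or> e = 1 \<or> e = 2" using assms by (auto simp: par_def)
  then show thesis using assms that by (auto simp: par_def)
qed

text \<open>The coproduct of 1 is a Casimir element: a factor at its right end may be replaced by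
  the same factor at its left end.\<close>

lemma rmul_del: "par i j e \<Longrightarrow> rmul e (del w i c) = lmul w i e (del w j c)"
proof (induction w arbitrary: c)
  case Nil
  then show ?case
    by (elim par_cases; intro ext; cases i; cases j) (auto simp: rmul_def)
next
  case (Cons a w)
  show ?case
  proof (rule vec_cons_eqI)
    fix f
    show "sub (Some f) (rmul e (del (a # w) i c)) = sub (Some f) (lmul (a # w) i e (del (a # w) j c))"
      using Cons.prems by (cases "e \<le> f") (auto simp: par_gidx rmul_big)
  qed (simp_all add: Cons)
qed

text \<open>The trace property: in a closed word a factor may be moved from the front to the
  end.\<close>

lemma mu_lmul: "par i j e \<Longrightarrow> mu w i (lmul w i e n) = mu w j (rmul e n)"
proof (induction w arbitrary: n)
  case Nil
  then show ?case
    by (elim par_cases; intro ext; cases i; cases j) (auto simp: rmul_def)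
next
  case (Cons a w)
  obtain l b where a: "a = (l, b)" by (cases a)
  show ?case
  proof (rule cyc_eqI)
    have "e = 0 \<or> e = 1 \<or> e = 2" using Cons.prems by (auto simp: par_def)
    then show "uh (mu (a # w) i (lmul (a # w) i e n)) = uh (mu (a # w) j (rmul e n))"
      using Cons.prems by (cases i; cases j; cases l; auto simp: a par_def rmul_big)
  qed (simp_all add: Cons)
qed

lemma mu_lmul0 [simp]: "mu w i (lmul w i 0 n) = mu w i n"
proof (induction w arbitrary: n)
  case Nil
  then show ?case by (intro ext) (auto simp: vec_apply)
next
  case (Cons a w)
  obtain l b where a: "a = (l, b)" by (cases a)
  show ?case
    by (rule cyc_eqI) (auto simp: Cons a par_def)
qed

lemma mu_rmul0 [simp]: "mu w i (rmul 0 n) = mu w i n"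
  using mu_lmul [of i i 0 w n] by (simp add: par_def)

lemma rmul0_del [simp]: "rmul 0 (del w i c) = del w i c"
proof (induction w arbitrary: c)
  case Nil
  then show ?case by (intro ext) (auto simp: rmul_def)
next
  case (Cons a w)
  show ?case by (rule vec_cons_eqI) (auto simp: Cons)
qed

lemma lmul0_del [simp]: "lmul w i 0 (del w i c) = del w i c"
  using rmul_del [of i i 0 w c] by (simp add: par_def)

text \<open>Closing at \<open>i\<close> and reopening at \<open>j\<close> inserts the coproduct of
  1, the sum of all pairs of factors of total degree 2. The two extra generators do not disturb
  this, because \<open>mu\<close> never produces index 3 and \<open>del\<close> never reads index
  4.\<close>

lemma del_mu: "del w j (mu w i n) =
   (if i = j then rmul 2 (lmul w j 0 n) + rmul 0 (lmul w j 2 n) else rmul 1 (lmul w j 1 n))"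
proof (induction w arbitrary: n)
  case Nil
  have "x < 3 \<Longrightarrow> x = 0 \<or> x = 1 \<or> x = 2" for x :: nat by linarith
  then show ?case
    by (intro ext, cases i; cases j) (simp_all add: vec_apply, auto simp: rmul_def)
next
  case (Cons a w)
  obtain l b where a: "a = (l, b)" by (cases a)
  show ?case
  proof (rule vec_cons_eqI)
    fix f
    show "sub (Some f) (del (a # w) j (mu (a # w) i n)) = sub (Some f) (if i = j then rmul 2 (lmul (a # w) j 0 n) + rmul 0 (lmul (a # w) j 2 n) else rmul 1 (lmul (a # w) j 1 n))"
    proof (cases "par j l f")
      case True
      then have "f = 0 \<or> f = 1 \<or> f = 2" by (auto simp: par_def)
      then show ?thesis using True by (cases i; cases j; cases l; auto simp: a par_def rmul_big)
    qed (simp add: a)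
  next
    show "sub None (del (a # w) j (mu (a # w) i n)) = sub None (if i = j then rmul 2 (lmul (a # w) j 0 n) + rmul 0 (lmul (a # w) j 2 n) else rmul 1 (lmul (a # w) j 1 n))"
      by (simp add: Cons)
  qed auto
qed

lemma del_big: "x > 2 \<Longrightarrow> del w i c \<tau> x = 0"
  using fun_cong [OF fun_cong [OF rmul0_del [of w i c], of \<tau>], of x] by (simp add: rmul_def)

lemma dC_uh [simp]: "uh (dC (a # w) c) = rmul 0 (dM w (fst a) (uh c)) +
   (if snd a then del w (fst a) (sub None c) else 0)"
  by (intro ext, cases "snd a") (simp_all add: uh_def rmul_def vec_apply del_big)

lemma dC_add [simp]: "dC w (u + v) = dC w u + dC w v"
proof (induction w arbitrary: u v)
  case Nil
  show ?case by (intro ext) (simp add: vec_apply add_ac)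
next
  case (Cons a w)
  show ?case by (rule cyc_eqI) (simp_all add: Cons add_ac)
qed

lemma dC_0 [simp]: "dC w 0 = 0"
proof (induction w)
  case Nil
  show ?case by (intro ext) (simp add: vec_apply)
next
  case (Cons a w)
  show ?case by (rule cyc_eqI) (simp_all add: Cons)
qed

text \<open>\<open>del\<close> and \<open>mu\<close> are chain maps. Their cross terms are matched
  by \<open>del_mu\<close>, the remaining ones by the Casimir property \<open>rmul_del\<close> and
  the trace property \<open>mu_lmul\<close>.\<close>

lemma del_dC_mu_dM:
  "del w j (dC w c) = dM w j (del w j c) \<and> mu w j (dM w j n) = dC w (mu w j n)"
proof (induction w arbitrary: j c n)
  case Nil
  then show ?case by (auto simp: vec_apply intro!: ext)
next
  case (Cons a w)
  obtain l b where a: "a = (l, b)" by (cases a)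
  show ?case
  proof
    show "del (a # w) j (dC (a # w) c) = dM (a # w) j (del (a # w) j c)"
    proof (rule vec_cons_eqI)
      show "sub None (del (a # w) j (dC (a # w) c)) = sub None (dM (a # w) j (del (a # w) j c))"
        by (auto simp: a Cons del_mu par_def lmul_rmul add_ac)
    next
      fix e
      show "sub (Some e) (del (a # w) j (dC (a # w) c)) = sub (Some e) (dM (a # w) j (del (a # w) j c))"
        using rmul_del [of l j "2 - e" w "sub None c"]
        by (auto simp: a Cons par_def dM_rmul)
    qed simp
    show "mu (a # w) j (dM (a # w) j n) = dC (a # w) (mu (a # w) j n)"
    proof (rule cyc_eqI)
      show "sub None (mu (a # w) j (dM (a # w) j n)) = sub None (dC (a # w) (mu (a # w) j n))"
        using Cons [of j] mu_lmul [of j l _ w]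
        by (auto simp: a par_def)
      show "uh (mu (a # w) j (dM (a # w) j n)) = uh (dC (a # w) (mu (a # w) j n))"
        by (auto simp: a par_def dM_rmul del_mu lmul_rmul add_ac)
    qed auto
  qed
qed

lemmas del_dC = del_dC_mu_dM [THEN conjunct1]
lemmas mu_dM = del_dC_mu_dM [THEN conjunct2]

text \<open>The complex over \<open>a # w\<close> is the cone of \<open>del\<close> for a positive
  and of \<open>mu\<close> for a negative letter, so the square vanishes because these are chain
  maps.\<close>

lemma dC_dC: "dC w (dC w c) = 0"
proof (induction w arbitrary: c)
  case Nil
  then show ?case by (auto simp: vec_apply intro!: ext)
next
  case (Cons a w)
  obtain l b where a: "a = (l, b)" by (cases a)
  show ?case
    by (rule cyc_eqI) (auto simp: a Cons mu_dM del_dC dM_dM simp flip: dM_rmul)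
qed

section \<open>Invariance under the moves at the front of a word\<close>

text \<open>\<open>jn\<close> and \<open>jm\<close> assemble a chain over a longer word from its
  parts, \<open>jn\<close> for closed and \<open>jm\<close> for open words.\<close>

definition jn :: "vec \<Rightarrow> vec \<Rightarrow> vec" where
  "jn c n = (\<lambda>l x. case l of [] \<Rightarrow> 0 | None # \<tau> \<Rightarrow> c \<tau> x
     | Some e # \<tau> \<Rightarrow> (if x = 0 then n \<tau> e else 0))"

definition jm :: "vec \<Rightarrow> (nat \<Rightarrow> vec) \<Rightarrow> vec" where
  "jm n nf = (\<lambda>l x. case l of [] \<Rightarrow> 0 | None # \<tau> \<Rightarrow> n \<tau> x | Some f # \<tau> \<Rightarrow> nf f \<tau> x)"

lemma jn_jm_simps [simp]:
  "sub None (jn c n) = c" "uh (jn c n) = n" "nl (jn c n) x = 0" "off (jn c n) \<tau> x e = 0"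
  "sub None (jm m nf) = m" "sub (Some f) (jm m nf) = nf f" "nl (jm m nf) x = 0"
  by (auto simp: sub_def uh_def nl_def off_def jn_def jm_def)

lemma jn_0 [simp]: "jn 0 0 = 0"
  by (rule cyc_eqI) simp_all

lemma jm_0 [simp]: "jm 0 (\<lambda>f. 0) = 0"
  by (rule vec_cons_eqI) simp_all

definition ecoef :: "braid3 \<Rightarrow> vec \<Rightarrow> bit" where
  "ecoef w c = c (replicate (length w) None) 3"

definition ehat :: "braid3 \<Rightarrow> vec" where
  "ehat w = (\<lambda>\<tau> x. of_bool (\<tau> = replicate (length w) None \<and> x = 4))"

text \<open>What is needed to carry a chain with coefficient 1 at the generator 3, or a chain with
  boundary \<open>ehat\<close>, from one word to another.\<close>

definition transports :: "braid3 \<Rightarrow> braid3 \<Rightarrow> bool" where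
  "transports w w' \<longleftrightarrow> (\<exists>F. F 0 = 0 \<and> (\<forall>c. dC w' (F c) = F (dC w c)) \<and>
     (\<forall>c. ecoef w' (F c) = ecoef w c) \<and> F (ehat w) = ehat w')"

lemma transports_refl: "transports w w"
  unfolding transports_def by (rule exI [of _ "\<lambda>c. c"]) auto

lemma transports_trans: "transports u v \<Longrightarrow> transports v w \<Longrightarrow> transports u w"
  unfolding transports_def
proof (elim exE conjE)
  fix F G
  assume "F 0 = 0" "\<forall>c. dC v (F c) = F (dC u c)" "\<forall>c. ecoef v (F c) = ecoef u c" "F (ehat u) = ehat v"
    "G 0 = 0" "\<forall>c. dC w (G c) = G (dC v c)" "\<forall>c. ecoef w (G c) = ecoef v c" "G (ehat v) = ehat w"
  then show "\<exists>F. F 0 = 0 \<and> (\<forall>c. dC w (F c) = F (dC u c)) \<and>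
     (\<forall>c. ecoef w (F c) = ecoef u c) \<and> F (ehat u) = ehat w"
    by (intro exI [of _ "\<lambda>c. G (F c)"]) auto
qed

lemma ecoef_Cons: "ecoef (a # w) c = ecoef w (sub None c)"
  by (simp add: ecoef_def sub_def)

lemma ecoef_add: "ecoef w (u + v) = ecoef w u + ecoef w v"
  by (simp add: ecoef_def vec_apply)

lemma mu_None: "mu w i n (replicate (length w) None) x =
    (if x = gidx i \<or> x = Suc (gidx i) then n (replicate (length w) None) 0
     else if x = 4 then n (replicate (length w) None) 2 else 0)"
  by (induction w arbitrary: n) (auto simp: sub_def)

lemma ecoef_mu: "ecoef w (mu w i n) = 0"
  by (cases i) (simp_all add: ecoef_def mu_None)

lemma ehat_Cons: "ehat (a # w) = jn (ehat w) 0"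
  by (intro ext) (auto simp: ehat_def jn_def vec_apply split: list.split option.split)

lemma sub_ehat [simp]: "sub None (ehat (a # w)) = ehat w" "uh (ehat (a # w)) = 0"
  by (simp_all add: ehat_Cons)

lemma off_ehat [simp]: "off (ehat (a # w)) \<tau> x e = 0"
  by (simp add: ehat_Cons)

lemma del_ehat [simp]: "del w i (ehat w) = 0"
proof (induction w)
  case Nil
  show ?case by (intro ext) (cases i; auto simp: ehat_def vec_apply)
next
  case (Cons a w)
  show ?case by (rule vec_cons_eqI) (use Cons in auto)
qed

text \<open>Gaussian elimination for the second Reidemeister move. The inclusion of the shorter
  complex is corrected by \<open>del\<close> on the states with two cup-caps, using the unit, label
  +, on the circle between them.\<close>

lemma transports_cancel:
  "transports u ((i, b) # (i, \<not> b) # u)"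
proof -
  let ?F = "\<lambda>c. jn (jn c 0) (jm 0 (\<lambda>f. if f = 0 then del u i c else 0))"
  have "?F 0 = 0"
    by (simp cong: if_cong)
  moreover have "dC ((i, b) # (i, \<not> b) # u) (?F c) = ?F (dC u c)" for c
  proof (rule cyc_eqI)
    show "sub None (dC ((i, b) # (i, \<not> b) # u) (?F c)) = sub None (?F (dC u c))"
    proof (rule cyc_eqI)
      show "sub None (sub None (dC ((i, b) # (i, \<not> b) # u) (?F c))) = sub None (sub None (?F (dC u c)))"
        by simp
      show "uh (sub None (dC ((i, b) # (i, \<not> b) # u) (?F c))) = uh (sub None (?F (dC u c)))"
        by (cases b) simp_all
    qed (cases b; simp)+
    show "uh (dC ((i, b) # (i, \<not> b) # u) (?F c)) = uh (?F (dC u c))"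
    proof (rule vec_cons_eqI)
      show "sub (Some f) (uh (dC ((i, b) # (i, \<not> b) # u) (?F c))) = sub (Some f) (uh (?F (dC u c)))" for f
        by (cases b) (auto simp: par_def del_dC simp flip: dM_rmul)
    qed (cases b; simp)+
  qed simp_all
  moreover have "ecoef ((i, b) # (i, \<not> b) # u) (?F c) = ecoef u c" for c
    by (simp add: ecoef_Cons)
  moreover have "?F (ehat u) = ehat ((i, b) # (i, \<not> b) # u)"
    by (simp add: ehat_Cons cong: if_cong)
  ultimately show ?thesis
    unfolding transports_def by (intro exI [of _ ?F] conjI allI)
qed

text \<open>The projection of the same elimination: the circle between the two cup-caps is removed
  by the counit, which reads the coefficient of label -.\<close>

lemma transports_uncancel:
  "transports ((i, b) # (i, \<not> b) # u) u"
proof -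
  let ?F = "\<lambda>c. sub None (sub None c) + mu u i (sub (Some 2) (uh c))"
  have "?F 0 = 0" by simp
  moreover have "dC u (?F c) = ?F (dC ((i, b) # (i, \<not> b) # u) c)" for c
    by (cases b) (simp_all add: par_def mu_dM add_ac)
  moreover have "ecoef u (?F c) = ecoef ((i, b) # (i, \<not> b) # u) c" for c
    by (simp add: ecoef_Cons ecoef_add ecoef_mu)
  moreover have "?F (ehat ((i, b) # (i, \<not> b) # u)) = ehat u"
    by simp
  ultimately show ?thesis
    unfolding transports_def by (intro exI [of _ ?F] conjI allI)
qed

lemma transports_braid:
  assumes ij: "i \<noteq> j"
  shows "transports ((j, True) # (i, True) # (j, True) # u) ((i, True) # (j, True) # (i, True) # u)"
proof -
  \<comment> \<open>Multiplication by degree 0 on both sides changes no coefficient at a state; it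
    only cuts off junk, as the closed differential does too.\<close>
  let ?P = "\<lambda>s n. rmul 0 (lmul u s 0 n)"
  \<comment> \<open>The letters of the source word are called A, B, C, and the names list those with
    a cup-cap.\<close>
  let ?nC = "\<lambda>c. uh (sub None (sub None c))"
  let ?nB = "\<lambda>c. ?P i (sub None (uh (sub None c)))"
  let ?nA = "\<lambda>c. ?P j (sub None (sub None (uh c)))"
  let ?nBC = "\<lambda>c. ?P j (sub (Some 1) (uh (sub None c)))"
  let ?nAC = "\<lambda>c. sub (Some 2) (sub None (uh c))"
  let ?nAB = "\<lambda>c. ?P i (sub None (sub (Some 1) (uh c)))"
  let ?NAC = "\<lambda>c. rmul 1 (?nAB c) + lmul u i 1 (?nBC c) + lmul u i 1 (rmul 1 (?nAC c))"
  \<comment> \<open>A cup-cap in the middle goes to both outer slots of the new word, one in the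
    first slot goes to the middle, and one in the last slot goes to 0. The values on two cup-caps
    restore compatibility with the differential; no state with three cup-caps occurs on either
    side.\<close>
  let ?F = "\<lambda>c. jn (jn (jn (sub None (sub None (sub None c))) (?nB c))
       (jm (?nA c) (\<lambda>f. if f = 1 then ?nAB c else 0)))
     (jm (jm (?nB c) (\<lambda>f. if f = 0 then ?NAC c else 0))
       (\<lambda>f. if f = 1 then jm (?nBC c + rmul 1 (?P j (?nAC c))) (\<lambda>g. 0) else 0))"
  have L: "lmul u i (Suc 0) (lmul u j b v) = lmul u i (Suc b) v"
    "lmul u j (Suc 0) (lmul u i b v) = lmul u j (Suc b) v"
    "lmul u i 0 (lmul u i b v) = lmul u i b v"
    "lmul u j 0 (lmul u j b v) = lmul u j b v"
    "lmul u i 2 (lmul u i b v) = lmul u i (2 + b) v"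
    "lmul u j 2 (lmul u j b v) = lmul u j (2 + b) v" for b v
    using ij by (subst lmul_lmul; simp add: par_def)+
  have D: "dM u i (lmul u i (Suc 0) v) = lmul u i (Suc 0) (dM u j v)"
    "dM u j (lmul u j (Suc 0) v) = lmul u j (Suc 0) (dM u i v)"
    "dM u i (lmul u i 0 v) = lmul u i 0 (dM u i v)"
    "dM u j (lmul u j 0 v) = lmul u j 0 (dM u j v)" for v
    using ij by (subst dM_lmul; simp add: par_def)+
  have par: "par i j f \<longleftrightarrow> f = 1" "par j i f \<longleftrightarrow> f = 1" "par i i f \<longleftrightarrow> f = 0 \<or> f = 2" "par j j f \<longleftrightarrow> f = 0 \<or> f = 2" for f
    using ij by (auto simp: par_def elim!: oddE evenE)
  have "?F 0 = 0"
    by (simp cong: if_cong)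
  moreover have "dC ((i, True) # (j, True) # (i, True) # u) (?F c) = ?F (dC ((j, True) # (i, True) # (j, True) # u) c)" for c
  proof (rule cyc_eqI)
    show "sub None (dC ((i, True) # (j, True) # (i, True) # u) (?F c)) = sub None (?F (dC ((j, True) # (i, True) # (j, True) # u) c))"
      by (rule cyc_eqI, simp, rule cyc_eqI, simp, (auto simp: ij ij [symmetric] par L D dM_rmul lmul_rmul del_dC add_ac)[1], (auto simp: ij ij [symmetric] par L D dM_rmul lmul_rmul del_dC add_ac)[1], simp,
          rule vec_cons_eqI, simp, (auto simp: ij ij [symmetric] par L D dM_rmul lmul_rmul del_dC add_ac)[1], (auto simp: ij ij [symmetric] par L D dM_rmul lmul_rmul del_dC add_ac)[1], simp)
    show "uh (dC ((i, True) # (j, True) # (i, True) # u) (?F c)) = uh (?F (dC ((j, True) # (i, True) # (j, True) # u) c))"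
      by (rule vec_cons_eqI, simp, rule vec_cons_eqI, simp, (auto simp: ij ij [symmetric] par L D dM_rmul lmul_rmul del_dC add_ac)[1], (auto simp: ij ij [symmetric] par L D dM_rmul lmul_rmul del_dC add_ac)[1],
          rule vec_cons_eqI, (auto simp: ij ij [symmetric] par L D dM_rmul lmul_rmul del_dC add_ac)[1], (auto simp: ij ij [symmetric] par L D dM_rmul lmul_rmul del_dC add_ac)[1], (auto simp: ij ij [symmetric] par L D dM_rmul lmul_rmul del_dC add_ac)[1])
  qed simp_all
  moreover have "ecoef ((i, True) # (j, True) # (i, True) # u) (?F c) = ecoef ((j, True) # (i, True) # (j, True) # u) c" for c
    by (simp add: ecoef_Cons)
  moreover have "?F (ehat ((j, True) # (i, True) # (j, True) # u)) = ehat ((i, True) # (j, True) # (i, True) # u)"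
    by (simp add: ehat_Cons cong: if_cong)
  ultimately show ?thesis
    unfolding transports_def by (intro exI [of _ ?F] conjI allI)
qed

section \<open>Linear algebra over the field with two elements\<close>

definition ap :: "('b \<Rightarrow> 'b \<Rightarrow> bool) \<Rightarrow> 'b set \<Rightarrow> 'b set \<Rightarrow> 'b set" where
  "ap rel B S = {y \<in> B. odd (card {x \<in> S. rel y x})}"

abbreviation sd :: "'b set \<Rightarrow> 'b set \<Rightarrow> 'b set" where
  "sd S T \<equiv> (S - T) \<union> (T - S)"

definition rk :: "('b \<Rightarrow> 'b \<Rightarrow> bool) \<Rightarrow> 'b set \<Rightarrow> 'b set \<Rightarrow> nat" where
  "rk rel B A = gf2_dim (ap rel B ` Pow A)"

lemma even_card_sd:
  assumes "finite S" "finite T"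
  shows "odd (card (sd S T)) \<longleftrightarrow> odd (card S) \<noteq> odd (card T)"
proof -
  have "card (sd S T) = card (S - T) + card (T - S)"
    using assms by (intro card_Un_disjoint) auto
  moreover have "card S = card (S - T) + card (S \<inter> T)"
    using assms by (metis card_Int_Diff add.commute)
  moreover have "card T = card (T - S) + card (S \<inter> T)"
    using assms by (metis card_Int_Diff add.commute Int_commute)
  ultimately show ?thesis by auto
qed

lemma ap_sd:
  assumes "finite S" "finite T"
  shows "ap rel B (sd S T) = sd (ap rel B S) (ap rel B T)"
proof -
  have "{x \<in> sd S T. rel y x} = sd {x \<in> S. rel y x} {x \<in> T. rel y x}" for y by auto
  then have "odd (card {x \<in> sd S T. rel y x}) \<longleftrightarrow>
      odd (card {x \<in> S. rel y x}) \<noteq> odd (card {x \<in> T. rel y x})" for y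
    using even_card_sd [of "{x \<in> S. rel y x}" "{x \<in> T. rel y x}"] assms by simp
  then show ?thesis by (auto simp: ap_def)
qed

lemma sd_sd: "sd (sd S T) T = S"
  by (rule set_eqI) (simp; blast)

lemma ap_empty [simp]: "ap rel B {} = {}"
  by (simp add: ap_def)

text \<open>Rank and nullity by counting: the fibres of an additive map are translates of its kernel
  by symmetric difference.\<close>

lemma card_ker_image:
  assumes "finite A"
  shows "card {S. S \<subseteq> A \<and> ap rel B S = {}} * card (ap rel B ` Pow A) = 2 ^ card A"
proof -
  let ?K = "{S. S \<subseteq> A \<and> ap rel B S = {}}"
  have fin: "finite S" if "S \<subseteq> A" for S using that assms finite_subset by auto
  have fib: "card {S \<in> Pow A. ap rel B S = T} = card ?K" if T: "T \<in> ap rel B ` Pow A" for T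
  proof -
    obtain S0 where S0: "S0 \<subseteq> A" "T = ap rel B S0" using T by auto
    have "bij_betw (\<lambda>S. sd S S0) ?K {S \<in> Pow A. ap rel B S = T}"
    proof (rule bij_betw_byWitness [where f' = "\<lambda>S. sd S S0"])
      have *: "ap rel B (sd S S0) = sd (ap rel B S) T" if "S \<subseteq> A" for S
        using ap_sd [OF fin [OF that] fin [OF S0(1)]] S0(2) by simp
      have sub: "sd S S0 \<subseteq> A" if "S \<subseteq> A" for S using that S0(1) by blast
      show "(\<lambda>S. sd S S0) ` ?K \<subseteq> {S \<in> Pow A. ap rel B S = T}"
      proof (rule image_subsetI)
        fix S assume "S \<in> ?K"
        then show "sd S S0 \<in> {S \<in> Pow A. ap rel B S = T}" using * [of S] sub [of S] by simp
      qed
      show "(\<lambda>S. sd S S0) ` {S \<in> Pow A. ap rel B S = T} \<subseteq> ?K"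
      proof (rule image_subsetI)
        fix S assume "S \<in> {S \<in> Pow A. ap rel B S = T}"
        then show "sd S S0 \<in> ?K" using * [of S] sub [of S] by simp
      qed
    qed (simp_all add: sd_sd)
    then show ?thesis by (rule bij_betw_same_card [symmetric])
  qed
  have "2 ^ card A = card (Pow A)" using assms by (simp add: card_Pow)
  also have "\<dots> = (\<Sum>T\<in>ap rel B ` Pow A. card {S \<in> Pow A. ap rel B S = T})"
    using assms sum.image_gen [of "Pow A" "\<lambda>_. 1::nat" "ap rel B"] by simp
  also have "\<dots> = (\<Sum>T\<in>ap rel B ` Pow A. card ?K)"
    using fib by (intro sum.cong) auto
  finally show ?thesis by simp
qed

lemma gf2_dim_eq: "card V = 2 ^ n \<Longrightarrow> gf2_dim V = n"
  unfolding gf2_dim_def by (rule the_equality) auto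

text \<open>Dimensions are defined through cardinalities, so a power of 2 must be found first: the
  size of the image divides a power of the prime 2.\<close>

lemma card_image_rk:
  assumes "finite A"
  shows "card (ap rel B ` Pow A) = 2 ^ rk rel B A" "rk rel B A \<le> card A"
    and "card {S. S \<subseteq> A \<and> ap rel B S = {}} = 2 ^ (card A - rk rel B A)"
proof -
  let ?I = "card (ap rel B ` Pow A)" and ?K = "card {S. S \<subseteq> A \<and> ap rel B S = {}}"
  have *: "?K * ?I = 2 ^ card A" by (rule card_ker_image [OF assms])
  then have "?I dvd 2 ^ card A" by (metis dvd_triv_right)
  then obtain r where r: "r \<le> card A" "?I = 2 ^ r"
    using divides_primepow_nat [of 2 ?I "card A"] two_is_prime_nat by auto
  have rk: "rk rel B A = r" unfolding rk_def by (rule gf2_dim_eq [OF r(2)])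
  show "?I = 2 ^ rk rel B A" "rk rel B A \<le> card A" using r rk by auto
  have "(2::nat) ^ card A = 2 ^ (card A - r) * 2 ^ r" using r(1) by (simp flip: power_add)
  then show "?K = 2 ^ (card A - rk rel B A)" using * r(2) rk by simp
qed

lemma rk_empty [simp]: "rk rel B {} = 0"
  unfolding rk_def by (rule gf2_dim_eq) simp

lemma rk_zero:
  assumes "\<And>x y. x \<in> A \<Longrightarrow> y \<in> B \<Longrightarrow> \<not> rel y x"
  shows "rk rel B A = 0"
proof -
  have "ap rel B S = {}" if "S \<subseteq> A" for S
  proof -
    have "card {x \<in> S. rel y x} = 0" if "y \<in> B" for y
    proof -
      have "{x \<in> S. rel y x} = {}" using assms that \<open>S \<subseteq> A\<close> by blast
      then show ?thesis by (simp only: card.empty)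
    qed
    then have "even (card {x \<in> S. rel y x})" if "y \<in> B" for y using that by presburger
    then show ?thesis unfolding ap_def by blast
  qed
  then have "ap rel B ` Pow A = {{}}" by auto
  then show ?thesis unfolding rk_def by (intro gf2_dim_eq) simp
qed

text \<open>The predicate \<open>Q\<close> separates the boundaries of \<open>A\<close> from those
  of \<open>A'\<close>, so the image is a product of the two images.\<close>

lemma rk_Un:
  assumes fin: "finite A" "finite A'" and disj: "A \<inter> A' = {}"
    and Q: "\<And>x y. x \<in> A \<Longrightarrow> y \<in> B \<Longrightarrow> rel y x \<Longrightarrow> Q y"
      "\<And>x y. x \<in> A' \<Longrightarrow> y \<in> B \<Longrightarrow> rel y x \<Longrightarrow> \<not> Q y"
  shows "rk rel B (A \<union> A') = rk rel B A + rk rel B A'"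
proof -
  have split: "ap rel B S \<inter> {y. Q y} = ap rel B (S \<inter> A)" "ap rel B S - {y. Q y} = ap rel B (S \<inter> A')"
    if "S \<subseteq> A \<union> A'" for S
  proof -
    have 1: "card {x \<in> S. rel y x} = card {x \<in> S \<inter> A. rel y x}" "card {x \<in> S \<inter> A'. rel y x} = 0" if "y \<in> B" "Q y" for y
    proof -
      have "{x \<in> S. rel y x} = {x \<in> S \<inter> A. rel y x}" "{x \<in> S \<inter> A'. rel y x} = {}"
        using that Q(2) \<open>S \<subseteq> A \<union> A'\<close> by blast+
      then show "card {x \<in> S. rel y x} = card {x \<in> S \<inter> A. rel y x}" "card {x \<in> S \<inter> A'. rel y x} = 0"
        by (simp_all only: card.empty)
    qed
    have 2: "card {x \<in> S. rel y x} = card {x \<in> S \<inter> A'. rel y x}" "card {x \<in> S \<inter> A. rel y x} = 0" if "y \<in> B" "\<not> Q y" for y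
    proof -
      have "{x \<in> S. rel y x} = {x \<in> S \<inter> A'. rel y x}" "{x \<in> S \<inter> A. rel y x} = {}"
        using that Q(1) \<open>S \<subseteq> A \<union> A'\<close> by blast+
      then show "card {x \<in> S. rel y x} = card {x \<in> S \<inter> A'. rel y x}" "card {x \<in> S \<inter> A. rel y x} = 0"
        by (simp_all only: card.empty)
    qed
    show "ap rel B S \<inter> {y. Q y} = ap rel B (S \<inter> A)"
    proof (rule set_eqI)
      fix y show "y \<in> ap rel B S \<inter> {y. Q y} \<longleftrightarrow> y \<in> ap rel B (S \<inter> A)"
        using 1(1) [of y] 2(2) [of y] by (cases "Q y"; cases "y \<in> B") (simp_all add: ap_def)
    qed
    show "ap rel B S - {y. Q y} = ap rel B (S \<inter> A')"
    proof (rule set_eqI)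
      fix y show "y \<in> ap rel B S - {y. Q y} \<longleftrightarrow> y \<in> ap rel B (S \<inter> A')"
        using 1(2) [of y] 2(1) [of y] by (cases "Q y"; cases "y \<in> B") (simp_all add: ap_def)
    qed
  qed
  have "bij_betw (\<lambda>T. (T \<inter> {y. Q y}, T - {y. Q y})) (ap rel B ` Pow (A \<union> A'))
      ((ap rel B ` Pow A) \<times> (ap rel B ` Pow A'))"
  proof (rule bij_betw_imageI)
    show "inj_on (\<lambda>T. (T \<inter> {y. Q y}, T - {y. Q y})) (ap rel B ` Pow (A \<union> A'))"
      by (rule inj_onI) auto
    show "(\<lambda>T. (T \<inter> {y. Q y}, T - {y. Q y})) ` ap rel B ` Pow (A \<union> A') = (ap rel B ` Pow A) \<times> (ap rel B ` Pow A')"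
    proof
      show "(\<lambda>T. (T \<inter> {y. Q y}, T - {y. Q y})) ` ap rel B ` Pow (A \<union> A') \<subseteq> (ap rel B ` Pow A) \<times> (ap rel B ` Pow A')"
        by (auto simp: split)
      show "(ap rel B ` Pow A) \<times> (ap rel B ` Pow A') \<subseteq> (\<lambda>T. (T \<inter> {y. Q y}, T - {y. Q y})) ` ap rel B ` Pow (A \<union> A')"
      proof clarify
        fix S S' assume S: "S \<subseteq> A" "S' \<subseteq> A'"
        then have sub: "S \<union> S' \<subseteq> A \<union> A'" by auto
        have "(S \<union> S') \<inter> A = S" "(S \<union> S') \<inter> A' = S'" using S disj by auto
        then have "(ap rel B S, ap rel B S') = (\<lambda>T. (T \<inter> {y. Q y}, T - {y. Q y})) (ap rel B (S \<union> S'))"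
          using split [OF sub] by simp
        then show "(ap rel B S, ap rel B S') \<in> (\<lambda>T. (T \<inter> {y. Q y}, T - {y. Q y})) ` ap rel B ` Pow (A \<union> A')"
          using sub by blast
      qed
    qed
  qed
  then have "card (ap rel B ` Pow (A \<union> A')) = card (ap rel B ` Pow A) * card (ap rel B ` Pow A')"
    by (simp only: bij_betw_same_card card_cartesian_product)
  also have "\<dots> = 2 ^ (rk rel B A + rk rel B A')"
    using fin by (simp add: card_image_rk power_add)
  finally show ?thesis unfolding rk_def [of _ _ "A \<union> A'"] by (rule gf2_dim_eq)
qed

text \<open>\<open>s\<close> is the shift of the grading by the differential; its injectivity keeps
  the boundaries of different pieces apart.\<close>

lemma rk_UN:
  assumes "finite I" "finite B" "\<And>x y. x \<in> B \<Longrightarrow> y \<in> B \<Longrightarrow> rel y x \<Longrightarrow> gr y = s (gr x)" "inj s"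
  shows "rk rel B {x \<in> B. gr x \<in> I} = (\<Sum>g\<in>I. rk rel B {x \<in> B. gr x = g})"
  using assms(1)
proof (induction I rule: finite_induct)
  case empty
  then show ?case by simp
next
  case (insert g I)
  have "{x \<in> B. gr x \<in> insert g I} = {x \<in> B. gr x = g} \<union> {x \<in> B. gr x \<in> I}" by auto
  also have "rk rel B \<dots> = rk rel B {x \<in> B. gr x = g} + rk rel B {x \<in> B. gr x \<in> I}"
  proof (rule rk_Un [where Q = "\<lambda>y. gr y = s g"])
    fix x y assume x: "x \<in> {x \<in> B. gr x \<in> I}" and y: "y \<in> B" "rel y x"
    then have "gr y = s (gr x)" "gr x \<noteq> g" using assms(3) insert.hyps by blast+
    then show "gr y \<noteq> s g" using assms(4) by (metis injD)
  next
    fix x y assume "x \<in> {x \<in> B. gr x = g}" "y \<in> B" "rel y x"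
    then show "gr y = s g" using assms(3) by blast
  next
    show "{x \<in> B. gr x = g} \<inter> {x \<in> B. gr x \<in> I} = {}" using insert.hyps by blast
  qed (use assms(2) in simp_all)
  finally show ?case using insert by simp
qed

text \<open>The last condition says that no boundary leaves the image of \<open>A\<close>, which is
  thus a subcomplex that can be treated on its own.\<close>

lemma rk_bij:
  assumes \<phi>: "inj_on \<phi> A" "\<phi> ` A \<subseteq> G" and fin: "finite A"
    and rel: "\<And>x y. x \<in> A \<Longrightarrow> y \<in> A \<Longrightarrow> rel' (\<phi> y) (\<phi> x) \<longleftrightarrow> rel y x"
    and out: "\<And>x z. x \<in> A \<Longrightarrow> z \<in> G \<Longrightarrow> rel' z (\<phi> x) \<Longrightarrow> z \<in> \<phi> ` A"
  shows "rk rel' G (\<phi> ` A) = rk rel A A"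
proof -
  have *: "ap rel' G (\<phi> ` S) = \<phi> ` ap rel A S" if S: "S \<subseteq> A" for S
  proof -
    have card: "card {x \<in> \<phi> ` S. rel' (\<phi> y) x} = card {x \<in> S. rel y x}" if "y \<in> A" for y
    proof -
      have "{x \<in> \<phi> ` S. rel' (\<phi> y) x} = \<phi> ` {x \<in> S. rel y x}"
        using S rel that by auto
      moreover have "inj_on \<phi> {x \<in> S. rel y x}" using \<phi>(1) S by (auto intro: inj_on_subset)
      ultimately show ?thesis by (simp add: card_image)
    qed
    have "z \<in> \<phi> ` A" if "z \<in> ap rel' G (\<phi> ` S)" for z
    proof -
      have "odd (card {x \<in> \<phi> ` S. rel' z x})" "z \<in> G" using that by (auto simp: ap_def)
      then have "{x \<in> \<phi> ` S. rel' z x} \<noteq> {}" by (metis card.empty even_zero)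
      then show ?thesis using out \<open>z \<in> G\<close> S by auto
    qed
    then show ?thesis using card \<phi>(2) unfolding ap_def by fastforce
  qed
  have "ap rel' G ` Pow (\<phi> ` A) = (\<lambda>S. \<phi> ` S) ` (ap rel A ` Pow A)"
  proof -
    have "Pow (\<phi> ` A) = (\<lambda>S. \<phi> ` S) ` Pow A" by (auto simp: image_Pow_surj)
    then show ?thesis using * by (auto simp: image_image)
  qed
  moreover have "inj_on (\<lambda>S. \<phi> ` S) (ap rel A ` Pow A)"
    by (rule inj_on_subset [OF inj_on_image_Pow [OF \<phi>(1)]]) (auto simp: ap_def)
  ultimately have "card (ap rel' G ` Pow (\<phi> ` A)) = card (ap rel A ` Pow A)"
    by (simp add: card_image)
  also have "\<dots> = 2 ^ rk rel A A" using fin by (simp add: card_image_rk)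
  finally show ?thesis unfolding rk_def [of rel'] by (rule gf2_dim_eq)
qed

locale graded_complex =
  fixes rel :: "'b \<Rightarrow> 'b \<Rightarrow> bool" and B :: "'b set" and gr :: "'b \<Rightarrow> int \<times> int"
  assumes finB: "finite B"
    and graded: "x \<in> B \<Longrightarrow> y \<in> B \<Longrightarrow> rel y x \<Longrightarrow> gr y = (fst (gr x) + 1, snd (gr x))"
    and square: "S \<subseteq> B \<Longrightarrow> ap rel B (ap rel B S) = {}"
begin

definition piece :: "int \<times> int \<Rightarrow> 'b set" where "piece g = {x \<in> B. gr x = g}"

definition nxt :: "int \<times> int \<Rightarrow> int \<times> int" where "nxt g = (fst g + 1, snd g)"
definition prv :: "int \<times> int \<Rightarrow> int \<times> int" where "prv g = (fst g - 1, snd g)"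

definition exact_at :: "int \<times> int \<Rightarrow> bool" where
  "exact_at g \<longleftrightarrow> (\<forall>S\<subseteq>piece g. ap rel B S = {} \<longrightarrow> (\<exists>T\<subseteq>piece (prv g). ap rel B T = S))"

definition r :: "int \<times> int \<Rightarrow> nat" where "r g = rk rel B (piece g)"

text \<open>The dimension of homology in grade \<open>g\<close>, taken as an integer to avoid
  truncated subtraction.\<close>

definition hd :: "int \<times> int \<Rightarrow> int" where
  "hd g = int (card (piece g)) - int (r g) - int (r (prv g))"

lemma fin_piece [simp]: "finite (piece g)" using finB by (simp add: piece_def)

lemma prv_nxt [simp]: "prv (nxt g) = g" "nxt (prv g) = g" by (auto simp: nxt_def prv_def)

lemma ap_piece: "S \<subseteq> piece g \<Longrightarrow> ap rel B S \<subseteq> piece (nxt g)"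
proof
  fix y assume S: "S \<subseteq> piece g" and y: "y \<in> ap rel B S"
  then have "odd (card {x \<in> S. rel y x})" "y \<in> B" by (auto simp: ap_def)
  then have "{x \<in> S. rel y x} \<noteq> {}" by (metis card.empty even_zero)
  then obtain x where "x \<in> S" "rel y x" by auto
  then show "y \<in> piece (nxt g)" using graded [of x y] S \<open>y \<in> B\<close> by (auto simp: piece_def nxt_def)
qed

lemma image_ker: "ap rel B ` Pow (piece (prv g)) \<subseteq> {S. S \<subseteq> piece g \<and> ap rel B S = {}}"
proof (rule image_subsetI)
  fix S assume "S \<in> Pow (piece (prv g))"
  then have S: "S \<subseteq> piece (prv g)" by simp
  then have "S \<subseteq> B" by (auto simp: piece_def)
  then show "ap rel B S \<in> {S. S \<subseteq> piece g \<and> ap rel B S = {}}"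
    using ap_piece [OF S] square by simp
qed

lemma fin_ker: "finite {S. S \<subseteq> piece g \<and> ap rel B S = {}}"
  by (rule finite_subset [of _ "Pow (piece g)"]) auto

lemma hd_nonneg: "hd g \<ge> 0"
proof -
  have "2 ^ r (prv g) \<le> (2::nat) ^ (card (piece g) - r g)"
    using card_mono [OF fin_ker image_ker, of g]
    by (simp add: card_image_rk r_def)
  then have "r (prv g) \<le> card (piece g) - r g" by simp
  moreover have "r g \<le> card (piece g)" by (simp add: card_image_rk r_def)
  ultimately show ?thesis unfolding hd_def by linarith
qed

lemma exact_at_iff: "exact_at g \<longleftrightarrow> hd g = 0"
proof -
  have "exact_at g \<longleftrightarrow> ap rel B ` Pow (piece (prv g)) = {S. S \<subseteq> piece g \<and> ap rel B S = {}}"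
  proof
    assume e: "exact_at g"
    have "{S. S \<subseteq> piece g \<and> ap rel B S = {}} \<subseteq> ap rel B ` Pow (piece (prv g))"
    proof
      fix S assume "S \<in> {S. S \<subseteq> piece g \<and> ap rel B S = {}}"
      then have "S \<subseteq> piece g \<and> ap rel B S = {}" by simp
      then have "\<exists>T\<subseteq>piece (prv g). ap rel B T = S" using e unfolding exact_at_def by blast
      then show "S \<in> ap rel B ` Pow (piece (prv g))" by (auto simp only: image_iff Pow_iff)
    qed
    then show "ap rel B ` Pow (piece (prv g)) = {S. S \<subseteq> piece g \<and> ap rel B S = {}}"
      using image_ker [of g] by (rule subset_antisym [rotated])
  next
    assume e: "ap rel B ` Pow (piece (prv g)) = {S. S \<subseteq> piece g \<and> ap rel B S = {}}"
    show "exact_at g" unfolding exact_at_def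
    proof (intro allI impI)
      fix S assume "S \<subseteq> piece g" "ap rel B S = {}"
      then have "S \<in> ap rel B ` Pow (piece (prv g))" unfolding e by simp
      then show "\<exists>T\<subseteq>piece (prv g). ap rel B T = S" by auto
    qed
  qed
  also have "\<dots> \<longleftrightarrow> card (ap rel B ` Pow (piece (prv g))) = card {S. S \<subseteq> piece g \<and> ap rel B S = {}}"
    using card_subset_eq [OF fin_ker image_ker, of g] by auto
  also have "\<dots> \<longleftrightarrow> r (prv g) = card (piece g) - r g"
    by (simp add: card_image_rk r_def)
  also have "\<dots> \<longleftrightarrow> hd g = 0"
  proof -
    have "r g \<le> card (piece g)" by (simp add: card_image_rk r_def)
    then show ?thesis unfolding hd_def by arith
  qed
  finally show ?thesis .
qed

lemma r_prv_empty: "piece g = {} \<Longrightarrow> r (prv g) = 0"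
  using hd_nonneg [of g] by (simp add: hd_def)

lemma r_empty: "piece g = {} \<Longrightarrow> r g = 0"
  by (simp add: r_def)

lemma piece_empty: "g \<notin> gr ` B \<Longrightarrow> piece g = {}"
  by (auto simp: piece_def)

text \<open>A shift of the summation index. Both sums are first extended to \<open>?J\<close>,
  because \<open>nxt\<close> may leave the set of occurring grades; the added ranks vanish.\<close>

lemma sum_prv: "(\<Sum>g\<in>gr ` B. (f g :: complex) * of_nat (r (prv g))) = (\<Sum>g\<in>gr ` B. f (nxt g) * of_nat (r g))"
proof -
  let ?J = "gr ` B \<union> nxt ` gr ` B"
  have "(\<Sum>g\<in>gr ` B. f g * of_nat (r (prv g))) = (\<Sum>g\<in>?J. f g * of_nat (r (prv g)))"
    using finB by (intro sum.mono_neutral_left) (auto simp: r_prv_empty piece_empty)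
  also have "\<dots> = (\<Sum>g\<in>nxt ` gr ` B. f g * of_nat (r (prv g)))"
  proof (intro sum.mono_neutral_right)
    show "\<forall>g\<in>?J - nxt ` gr ` B. f g * of_nat (r (prv g)) = 0"
    proof
      fix g assume g: "g \<in> ?J - nxt ` gr ` B"
      have "prv g \<notin> gr ` B"
      proof
        assume "prv g \<in> gr ` B"
        then have "nxt (prv g) \<in> nxt ` gr ` B" by blast
        then show False using g by simp
      qed
      then show "f g * of_nat (r (prv g)) = 0" by (simp add: r_empty piece_empty)
    qed
  qed (use finB in auto)
  also have "\<dots> = (\<Sum>g\<in>gr ` B. f (nxt g) * of_nat (r g))"
    by (subst sum.reindex) (auto simp: inj_on_def nxt_def prod_eq_iff prv_def)
  finally show ?thesis .
qed

lemma sum_pieces: "(\<Sum>g\<in>gr ` B. (f g :: complex) * of_nat (card (piece g))) = (\<Sum>x\<in>B. f (gr x))"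
proof -
  have "(\<Sum>x\<in>B. f (gr x)) = (\<Sum>g\<in>gr ` B. \<Sum>x\<in>{x \<in> B. gr x = g}. f (gr x))"
    by (rule sum.image_gen [OF finB])
  also have "\<dots> = (\<Sum>g\<in>gr ` B. f g * of_nat (card (piece g)))"
    by (intro sum.cong) (auto simp: piece_def)
  finally show ?thesis by simp
qed

lemma rk_total: "rk rel B B = (\<Sum>g\<in>gr ` B. r g)"
proof -
  have "rk rel B {x \<in> B. gr x \<in> gr ` B} = (\<Sum>g\<in>gr ` B. rk rel B {x \<in> B. gr x = g})"
    by (rule rk_UN [where s = "\<lambda>g. (fst g + 1, snd g)"]) (use finB graded in \<open>auto simp: inj_def prod_eq_iff\<close>)
  moreover have "{x \<in> B. gr x \<in> gr ` B} = B" by auto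
  ultimately show ?thesis by (simp add: r_def piece_def)
qed

lemma total_hd: "(\<Sum>g\<in>gr ` B. hd g) = int (card B) - 2 * int (rk rel B B)"
proof -
  have "of_int (\<Sum>g\<in>gr ` B. hd g) = (of_int (int (card B) - 2 * int (rk rel B B)) :: complex)"
    using sum_prv [of "\<lambda>_. 1"] sum_pieces [of "\<lambda>_. 1"]
    by (simp add: hd_def sum_subtractf rk_total)
  then show ?thesis by (metis of_int_eq_iff)
qed

text \<open>Every rank is counted at its source and at its target, with opposite signs of
  \<open>f\<close>, so only the generators remain.\<close>

lemma euler_hd:
  assumes "\<And>g. f (nxt g) = - (f g :: complex)"
  shows "(\<Sum>g\<in>gr ` B. f g * of_int (hd g)) = (\<Sum>x\<in>B. f (gr x))"
  using sum_prv [of f] sum_pieces [of f] assms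
  by (simp add: hd_def sum_subtractf right_diff_distrib sum_negf)

lemma two_dimensional:
  assumes "card B = 2 * rk rel B B + 2" and "\<not> exact_at (0, 0)"
  obtains g0 where "\<And>f. (\<And>g. f (nxt g) = - f g) \<Longrightarrow> (\<Sum>x\<in>B. f (gr x)) = (f (0, 0) + f g0 :: complex)"
    "\<And>g. g \<noteq> (0, 0) \<Longrightarrow> g \<noteq> g0 \<Longrightarrow> exact_at g"
proof -
  let ?I = "gr ` B"
  have fI: "finite ?I" using finB by simp
  have sum2: "(\<Sum>g\<in>?I. hd g) = 2" using total_hd assms(1) by simp
  have h0: "hd (0, 0) \<ge> 1" using assms(2) exact_at_iff [of "(0, 0)"] hd_nonneg [of "(0, 0)"] by linarith
  have out: "hd g = 0" if "g \<notin> ?I" for g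
    using that by (simp add: hd_def r_prv_empty r_empty piece_empty)
  have mem: "(0, 0) \<in> ?I" using h0 out by force
  have rest: "hd (0, 0) + (\<Sum>g\<in>?I - {(0, 0)}. hd g) = 2"
    using sum2 sum.remove [OF fI mem, of hd] by simp
  have rest0: "(\<Sum>g\<in>?I - {(0, 0)}. hd g) \<ge> 0" by (intro sum_nonneg hd_nonneg)
  \<comment> \<open>The sum of two indicators also covers the case that both classes have grade (0,
    0); then \<open>g0\<close> is this grade.\<close>
  have "\<exists>g0. \<forall>g. hd g = of_bool (g = (0, 0)) + of_bool (g = g0)"
  proof (cases "hd (0, 0) = 2")
    case True
    then have "(\<Sum>g\<in>?I - {(0, 0)}. hd g) = 0" using rest by simp
    then have "\<forall>g\<in>?I - {(0, 0)}. hd g = 0"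
      using sum_nonneg_eq_0_iff [of "?I - {(0, 0)}" hd] fI hd_nonneg by auto
    then have "hd g = of_bool (g = (0, 0)) + of_bool (g = (0, 0))" for g
      using True out [of g] by (cases "g \<in> ?I"; cases "g = (0, 0)") (simp_all add: mem)
    then show ?thesis by blast
  next
    case False
    then have one: "hd (0, 0) = 1" "(\<Sum>g\<in>?I - {(0, 0)}. hd g) = 1" using rest rest0 h0 by linarith+
    then obtain g0 where g0: "g0 \<in> ?I - {(0, 0)}" "hd g0 \<noteq> 0"
      by (metis sum.neutral zero_neq_one)
    have s: "hd g0 + (\<Sum>g\<in>?I - {(0, 0)} - {g0}. hd g) = 1"
      using one(2) sum.remove [of "?I - {(0, 0)}" g0 hd] fI g0(1) by simp
    moreover have "(\<Sum>g\<in>?I - {(0, 0)} - {g0}. hd g) \<ge> 0" by (intro sum_nonneg hd_nonneg)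
    ultimately have "hd g0 = 1" "(\<Sum>g\<in>?I - {(0, 0)} - {g0}. hd g) = 0"
      using hd_nonneg [of g0] g0(2) by linarith+
    moreover from this(2) have "\<forall>g\<in>?I - {(0, 0)} - {g0}. hd g = 0"
      using sum_nonneg_eq_0_iff [of "?I - {(0, 0)} - {g0}" hd] fI hd_nonneg by auto
    ultimately have "hd g = of_bool (g = (0, 0)) + of_bool (g = g0)" for g
      using one(1) out [of g] g0(1) by (cases "g \<in> ?I"; cases "g = (0, 0)"; cases "g = g0") (simp_all add: mem)
    then show ?thesis by blast
  qed
  then obtain g0 where g0: "\<And>g. hd g = of_bool (g = (0, 0)) + of_bool (g = g0)" by auto
  show thesis
  proof (rule that)
    show "exact_at g" if "g \<noteq> (0, 0)" "g \<noteq> g0" for g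
      using that g0 by (simp add: exact_at_iff)
    fix f :: "int \<times> int \<Rightarrow> complex"
    assume f: "\<And>g. f (nxt g) = - f g"
    have "(\<Sum>x\<in>B. f (gr x)) = (\<Sum>g\<in>?I. f g * of_int (hd g))" using euler_hd [of f] f by simp
    also have "\<dots> = (\<Sum>g\<in>?I. f g * of_bool (g = (0, 0))) + (\<Sum>g\<in>?I. f g * of_bool (g = g0))"
      by (simp add: g0 distrib_left sum.distrib)
    also have "\<dots> = f (0, 0) + f g0"
    proof -
      have "hd g0 \<noteq> 0" using g0 [of g0] by (cases "g0 = (0, 0)") simp_all
      then have "g0 \<in> ?I" using out [of g0] by blast
      then show ?thesis using mem fI by (simp add: of_bool_def sum.delta' if_distrib cong: if_cong)
    qed
    finally show "(\<Sum>x\<in>B. f (gr x)) = f (0, 0) + f g0" .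
  qed
qed

end

section \<open>The complex on valid states\<close>

text \<open>The position \<open>k\<close> is that of the cup-cap following the word; it fixes the
  parity of the trailing index.\<close>

fun validM :: "braid3 \<Rightarrow> gen3 \<Rightarrow> gen3 \<Rightarrow> nat option list \<Rightarrow> nat \<Rightarrow> bool" where
  "validM [] j k [] x \<longleftrightarrow> par j k x"
| "validM [] j k (t # \<tau>) x \<longleftrightarrow> False"
| "validM (a # w) j k [] x \<longleftrightarrow> False"
| "validM (a # w) j k (None # \<tau>) x \<longleftrightarrow> validM w j k \<tau> x"
| "validM (a # w) j k (Some e # \<tau>) x \<longleftrightarrow> par j (fst a) e \<and> validM w (fst a) k \<tau> x"

fun validC :: "braid3 \<Rightarrow> nat option list \<Rightarrow> nat \<Rightarrow> bool" where
  "validC [] [] x \<longleftrightarrow> x \<le> 4"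
| "validC [] (t # \<tau>) x \<longleftrightarrow> False"
| "validC (a # w) [] x \<longleftrightarrow> False"
| "validC (a # w) (None # \<tau>) x \<longleftrightarrow> validC w \<tau> x"
| "validC (a # w) (Some e # \<tau>) x \<longleftrightarrow> x = 0 \<and> validM w (fst a) (fst a) \<tau> e"

text \<open>The complex of all functions contains more than the states. All structure maps commute
  with the projections \<open>pM\<close> and \<open>pC\<close>, so the part on valid states splits
  off.\<close>

definition pM :: "braid3 \<Rightarrow> gen3 \<Rightarrow> gen3 \<Rightarrow> vec \<Rightarrow> vec" where
  "pM w j k v = (\<lambda>\<tau> x. if validM w j k \<tau> x then v \<tau> x else 0)"

definition pC :: "braid3 \<Rightarrow> vec \<Rightarrow> vec" where
  "pC w c = (\<lambda>\<tau> x. if validC w \<tau> x then c \<tau> x else 0)"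

lemma pM_simps [simp]:
  "sub None (pM (a # w) j k v) = pM w j k (sub None v)"
  "sub (Some e) (pM (a # w) j k v) = (if par j (fst a) e then pM w (fst a) k (sub (Some e) v) else 0)"
  "nl (pM (a # w) j k v) x = 0"
  "sub None (pC (a # w) c) = pC w (sub None c)"
  "uh (pC (a # w) c) = pM w (fst a) (fst a) (uh c)"
  "nl (pC (a # w) c) x = 0" "off (pC (a # w) c) \<tau> x f = 0"
  by (auto simp: sub_def uh_def nl_def off_def pM_def pC_def vec_apply intro!: ext)

lemma p_add [simp]: "pM w j k (u + v) = pM w j k u + pM w j k v" "pC w (u + v) = pC w u + pC w v"
  "pM w j k 0 = 0" "pC w 0 = 0"
  by (intro ext; simp add: pM_def pC_def vec_apply)+

lemma pM_pM [simp]: "pM w j k (pM w j k v) = pM w j k v" "pC w (pC w v) = pC w v"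
  by (intro ext; simp add: pM_def pC_def)+

lemma lmul_pM: "par j' j e \<Longrightarrow> lmul w j' e (pM w j k v) = pM w j' k (lmul w j' e v)"
proof (induction w arbitrary: v)
  case Nil
  show ?case
  proof (intro ext)
    fix \<tau> x
    show "lmul [] j' e (pM [] j k v) \<tau> x = pM [] j' k (lmul [] j' e v) \<tau> x"
      using Nil by (cases \<tau>) (auto simp: pM_def par_gidx)
  qed
next
  case (Cons a w)
  show ?case
    by (rule vec_cons_eqI) (use Cons in \<open>auto simp: par_gidx\<close>)
qed

lemma rmul_pM: "par k k' e \<Longrightarrow> rmul e (pM w j k v) = pM w j k' (rmul e v)"
proof (induction w arbitrary: v j)
  case Nil
  show ?case
  proof (intro ext)
    fix \<tau> x
    show "rmul e (pM [] j k v) \<tau> x = pM [] j k' (rmul e v) \<tau> x"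
      using Nil by (cases \<tau>) (auto simp: pM_def par_gidx rmul_def)
  qed
next
  case (Cons a w)
  show ?case
    by (rule vec_cons_eqI) (use Cons in auto)
qed

lemma dM_pM: "dM w j (pM w j k v) = pM w j k (dM w j v)"
proof (induction w arbitrary: v j)
  case Nil
  show ?case by (intro ext) (simp add: pM_def)
next
  case (Cons a w)
  have "lmul w j e (pM w (fst a) k u) = pM w j k (lmul w j e u)" if "par j (fst a) e" for e u
    using that by (rule lmul_pM)
  moreover have "lmul w (fst a) (2 - e) (pM w j k u) = pM w (fst a) k (lmul w (fst a) (2 - e) u)" if "par j (fst a) e" for e u
    using that by (intro lmul_pM) (auto simp: par_def)
  ultimately show ?case
    by (intro vec_cons_eqI [where u = "dM (a # w) j (pM (a # w) j k v)"]) (auto simp: Cons par_def)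
qed

lemma del_pC: "del w j (pC w c) = pM w j j (del w j c)"
proof (induction w arbitrary: c)
  case Nil
  show ?case
  proof (intro ext)
    fix \<tau> x
    show "del [] j (pC [] c) \<tau> x = pM [] j j (del [] j c) \<tau> x"
      by (cases \<tau>; cases j) (auto simp: pM_def pC_def par_gidx vec_apply)
  qed
next
  case (Cons a w)
  have "rmul (2 - e) (pM w (fst a) (fst a) u) = pM w (fst a) j (rmul (2 - e) u)" if "par j (fst a) e" for e u
    using that by (intro rmul_pM) (auto simp: par_def)
  then show ?case
    by (intro vec_cons_eqI [where u = "del (a # w) j (pC (a # w) c)"]) (auto simp: Cons)
qed

lemma mu_pM: "mu w j (pM w j j n) = pC w (mu w j n)"
proof (induction w arbitrary: n)
  case Nil
  show ?case
  proof (intro ext)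
    fix \<tau> x
    show "mu [] j (pM [] j j n) \<tau> x = pC [] (mu [] j n) \<tau> x"
      by (cases \<tau>; cases j) (auto simp: pM_def pC_def par_gidx vec_apply)
  qed
next
  case (Cons a w)
  have "rmul e (pM w (fst a) j u) = pM w (fst a) (fst a) (rmul e u)" if "par j (fst a) e" for e u
    using that by (intro rmul_pM) (auto simp: par_def)
  then show ?case
    by (intro cyc_eqI [where u = "mu (a # w) j (pM (a # w) j j n)"]) (auto simp: Cons par_def)
qed

lemma dC_pC: "dC w (pC w c) = pC w (dC w c)"
proof (induction w arbitrary: c)
  case Nil
  show ?case by (intro ext) (simp add: pC_def)
next
  case (Cons a w)
  have "rmul 0 (pM w (fst a) (fst a) u) = pM w (fst a) (fst a) (rmul 0 u)" for u
    by (rule rmul_pM) (simp add: par_def)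
  then show ?case
    by (intro cyc_eqI [where u = "dC (a # w) (pC (a # w) c)"]) (auto simp: Cons mu_pM del_pC dM_pM)
qed

section \<open>The cyclically symmetric form of the differential, and rotation of words\<close>

fun lw :: "nat \<Rightarrow> vec \<Rightarrow> vec" where
  "lw e v [] x = (if e \<le> x \<and> x \<le> 2 then v [] (x - e) else 0)"
| "lw e v (None # \<tau>) x = lw e (sub None v) \<tau> x"
| "lw e v (Some f # \<tau>) x = (if e \<le> f then v (Some (f - e) # \<tau>) x else 0)"

definition allN :: "nat option list \<Rightarrow> bool" where
  "allN \<tau> \<longleftrightarrow> set \<tau> \<subseteq> {None}"

lemma allN_simps [simp]: "allN []" "allN (None # \<tau>) \<longleftrightarrow> allN \<tau>" "\<not> allN (Some e # \<tau>)"
  "allN (\<sigma> @ \<tau>) \<longleftrightarrow> allN \<sigma> \<and> allN \<tau>"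
  by (auto simp: allN_def)

lemma lmul_lw: "validM w j k \<tau> x \<Longrightarrow> lmul w j e v \<tau> x = lw e v \<tau> x"
proof (induction w arbitrary: j v \<tau>)
  case Nil
  then show ?case by (cases \<tau>) auto
next
  case (Cons a w)
  then obtain t \<sigma> where "\<tau> = t # \<sigma>" by (cases \<tau>) auto
  then show ?case using Cons by (cases t) auto
qed

lemma lw_cong:
  "(\<And>\<sigma> y. length \<sigma> = length \<tau> \<Longrightarrow> v \<sigma> y = v' \<sigma> y) \<Longrightarrow> lw e v \<tau> x = lw e v' \<tau> x"
proof (induction \<tau> arbitrary: v v')
  case (Cons t \<tau>)
  show ?case
  proof (cases t)
    case None
    have "lw e (sub None v) \<tau> x = lw e (sub None v') \<tau> x"
      by (rule Cons.IH) (simp add: sub_def Cons.prems)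
    then show ?thesis by (simp add: None)
  next
    case (Some f)
    then show ?thesis by (simp add: Cons.prems)
  qed
qed simp

lemma lw_append_Some:
  "y \<le> 2 \<Longrightarrow> lw e v (r @ Some y # r') 0 = lw e (\<lambda>\<sigma> y. v (\<sigma> @ Some y # r') 0) r y"
proof (induction r arbitrary: v)
  case (Cons t r)
  then show ?case by (cases t) (auto simp: sub_def)
qed auto

lemma lw_append_None:
  "lw e v (r @ None # r') x = lw e (\<lambda>\<sigma>. v (take (length r) \<sigma> @ None # drop (length r) \<sigma>)) (r @ r') x"
proof (induction r arbitrary: v)
  case (Cons t r)
  then show ?case by (cases t) (auto simp: sub_def)
qed (simp add: sub_def)

definition LM :: "gen3 \<times> bool \<Rightarrow> (nat option \<Rightarrow> vec) \<Rightarrow> nat option \<Rightarrow> vec" where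
  "LM a cf t r x = (if snd a then (case t of None \<Rightarrow> 0 | Some e \<Rightarrow> lw (2 - e) (cf None) r x)
     else (case t of Some e \<Rightarrow> 0 | None \<Rightarrow> lw 0 (cf (Some 0)) r x + lw 1 (cf (Some 1)) r x + lw 2 (cf (Some 2)) r x))"

text \<open>The contribution of one letter, read after the closed word has been cut at its slot:
  \<open>r\<close> is the rest of the state in cyclic order and \<open>cf h\<close> are the
  coefficients with entry \<open>h\<close> in the slot. Every letter enters in the same way.\<close>

definition L0 :: "gen3 \<times> bool \<Rightarrow> (nat option \<Rightarrow> vec) \<Rightarrow> nat option \<Rightarrow> vec" where
  "L0 a cf t r x = (if snd a then (case t of None \<Rightarrow> 0 | Some e \<Rightarrow>
       if allN r then (if e = 2 then cf None r (gidx (fst a)) + cf None r (Suc (gidx (fst a)))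
          else if e = 0 then cf None r 3 else 0)
       else lw (2 - e) (\<lambda>\<sigma> x. cf None \<sigma> 0) r 0)
     else (case t of Some e \<Rightarrow> 0 | None \<Rightarrow>
       if allN r then (if x = gidx (fst a) \<or> x = Suc (gidx (fst a)) then cf (Some 0) r 0
          else if x = 4 then cf (Some 2) r 0 else 0)
       else lw 0 (\<lambda>\<sigma> x. cf (Some 0) \<sigma> 0) r 0 + lw 1 (\<lambda>\<sigma> x. cf (Some 1) \<sigma> 0) r 0
         + lw 2 (\<lambda>\<sigma> x. cf (Some 2) \<sigma> 0) r 0))"

lemma lw_0: "lw e 0 \<tau> x = 0"
proof (induction \<tau>)
  case (Cons t \<tau>)
  show ?case
  proof (cases t)
    case None
    then show ?thesis by (simp add: Cons)
  next
    case (Some f)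
    then show ?thesis by (simp add: vec_apply)
  qed
qed (simp add: vec_apply)

lemma validM_length: "validM w j k \<tau> x \<Longrightarrow> length \<tau> = length w \<and> x \<le> 2"
  by (induction w j k \<tau> x rule: validM.induct) (auto simp: par_def)

lemma validC_length: "validC w \<tau> x \<Longrightarrow> length \<tau> = length w"
  by (induction w \<tau> x rule: validC.induct) (auto dest: validM_length)

lemma dM_explicit:
  assumes "validM w j k \<tau> x" "v = pM w j k v"
  shows "dM w j v \<tau> x = (\<Sum>l<length w. LM (w ! l) (\<lambda>h \<sigma>. v (take l \<tau> @ h # \<sigma>)) (\<tau> ! l) (drop (Suc l) \<tau>) x)"
  using assms
proof (induction w arbitrary: j v \<tau>)
  case Nil
  then show ?case by simp
next
  case (Cons a w)
  obtain i b where a: "a = (i, b)" by (cases a)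
  have v0: "sub None v = pM w j k (sub None v)"
    by (subst Cons.prems(2)) simp
  have vs: "sub (Some e) v = (if par j i e then pM w i k (sub (Some e) v) else 0)" for e
    by (subst Cons.prems(2)) (simp add: a)
  obtain t \<tau>' where \<tau>: "\<tau> = t # \<tau>'" using Cons.prems(1) by (cases \<tau>) auto
  have split: "(\<Sum>l<length (a # w). LM ((a # w) ! l) (\<lambda>h \<sigma>. v (take l \<tau> @ h # \<sigma>)) (\<tau> ! l) (drop (Suc l) \<tau>) x)
     = LM a (\<lambda>h. sub h v) t \<tau>' x
       + (\<Sum>l<length w. LM (w ! l) (\<lambda>h \<sigma>. sub t v (take l \<tau>' @ h # \<sigma>)) (\<tau>' ! l) (drop (Suc l) \<tau>') x)"
    by (simp add: \<tau> sum.lessThan_Suc_shift sub_def del: sum.lessThan_Suc)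
  show ?case
  proof (cases t)
    case None
    then have val: "validM w j k \<tau>' x" using Cons.prems(1) \<tau> by simp
    \<comment> \<open>Entries of the wrong parity carry no coefficient, so the sum over the degrees
      0, 1, 2 in \<open>LM\<close> is the sum over the admissible ones.\<close>
    have z: "sub (Some e) v = 0" if "\<not> par j i e" for e using vs [of e] that by simp
    have "LM a (\<lambda>h. sub h v) t \<tau>' x = (if b then 0
      else if i = j then lmul w j 0 (sub (Some 0) v) \<tau>' x + lmul w j 2 (sub (Some 2) v) \<tau>' x
      else lmul w j 1 (sub (Some 1) v) \<tau>' x)"
      using z [of 0] z [of 1] z [of 2]
      by (simp add: LM_def a None lmul_lw [OF val] par_def lw_0)
    then show ?thesis
      using Cons.IH [OF val v0] unfolding split by (simp add: \<tau> None a add.commute)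
  next
    case (Some e)
    then have par: "par j i e" and val: "validM w i k \<tau>' x" using Cons.prems(1) \<tau> a by auto
    have vse: "sub (Some e) v = pM w i k (sub (Some e) v)" using vs [of e] par by simp
    have "LM a (\<lambda>h. sub h v) t \<tau>' x = (if b then lmul w i (2 - e) (sub None v) \<tau>' x else 0)"
      by (simp add: LM_def a Some lmul_lw [OF val])
    then show ?thesis
      using Cons.IH [OF val vse] par unfolding split by (simp add: \<tau> Some a add.commute)
  qed
qed

lemma del_explicit: "validM w j k \<tau> e \<Longrightarrow> del w j c \<tau> e =
   (if allN \<tau> then (if e = 2 then c \<tau> (gidx j) + c \<tau> (Suc (gidx j)) else if e = 0 then c \<tau> 3 else 0)
    else lw (2 - e) (\<lambda>\<sigma> x. c \<sigma> 0) \<tau> 0)"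
proof (induction w j k \<tau> e arbitrary: c rule: validM.induct)
  case (5 a w j k f \<tau> x)
  then have "f \<le> 2" "x \<le> 2" by (auto simp: par_def dest: validM_length)
  then have "2 - f \<le> x \<longleftrightarrow> 2 - x \<le> f" "x - (2 - f) = f - (2 - x)" by linarith+
  then show ?case using 5 \<open>x \<le> 2\<close> by (auto simp: rmul_def uh_def)
qed (auto simp: sub_def)

lemma mu_explicit:
  assumes "validC w \<tau> x" "n = pM w j j n"
  shows "mu w j n \<tau> x = (if allN \<tau> then (if x = gidx j \<or> x = Suc (gidx j) then n \<tau> 0
          else if x = 4 then n \<tau> 2 else 0)
       else lw 0 (\<lambda>\<sigma> x. n \<sigma> 0) \<tau> 0 + lw 1 (\<lambda>\<sigma> x. n \<sigma> 1) \<tau> 0 + lw 2 (\<lambda>\<sigma> x. n \<sigma> 2) \<tau> 0)"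
  using assms
proof (induction w \<tau> x arbitrary: n rule: validC.induct)
  case (4 a w \<tau> x)
  have "sub None n = pM w j j (sub None n)"
    by (subst 4(3)) simp
  then show ?case using 4(1) [of "sub None n"] 4(2) by (simp add: sub_def)
next
  case (5 a w f \<tau> x)
  obtain l b where a: "a = (l, b)" by (cases a)
  have x: "x = 0" and f: "f \<le> 2" using 5(1) by (auto dest: validM_length)
  have z: "n (Some e # \<tau>) y = 0" if "\<not> par j l e" for e y
  proof -
    have "n (Some e # \<tau>) y = pM (a # w) j j n (Some e # \<tau>) y" by (subst 5(2)) (rule refl)
    then show ?thesis using that by (simp add: pM_def a)
  qed
  have "f = 0 \<or> f = 1 \<or> f = 2" using f by linarith
  then show ?case
    using z [of 0] z [of 1] z [of 2] x
    by (auto simp: a rmul_def sub_def par_def add_ac)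
qed auto

text \<open>Undoes the cut: if \<open>r\<close> is the cyclic rest behind a slot and
  \<open>m\<close> the number of slots after it, the result is the whole state in its original
  order.\<close>

definition place :: "nat \<Rightarrow> nat option \<Rightarrow> nat option list \<Rightarrow> nat option list" where
  "place m h r = drop m r @ h # take m r"

lemma L0_cong:
  assumes "\<And>h \<sigma> y. length \<sigma> = length r \<Longrightarrow> cf h \<sigma> y = cf' h \<sigma> y"
  shows "L0 a cf t r x = L0 a cf' t r x"
proof -
  have "lw e (\<lambda>\<sigma> x. cf h \<sigma> 0) r 0 = lw e (\<lambda>\<sigma> x. cf' h \<sigma> 0) r 0" for e h
    by (rule lw_cong) (simp add: assms)
  then show ?thesis using assms by (auto simp: L0_def split: option.split)
qed

lemma L0_append_None:
  "L0 a cf t (r @ None # r') x = L0 a (\<lambda>h \<sigma>. cf h (take (length r) \<sigma> @ None # drop (length r) \<sigma>)) t (r @ r') x"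
  unfolding L0_def lw_append_None by (auto split: option.split)

text \<open>The inductive definition opens the word at its first cup-cap and so depends on where the
  word begins. This sum does not, which gives rotation invariance and the comparison with the cube
  of resolutions.\<close>

theorem dC_explicit:
  assumes "validC w \<tau> x" "c = pC w c"
  shows "dC w c \<tau> x = (\<Sum>l<length w. L0 (w ! l) (\<lambda>h \<sigma>. c (place (length w - Suc l) h \<sigma>))
     (\<tau> ! l) (drop (Suc l) \<tau> @ take l \<tau>) x)"
  using assms
proof (induction w arbitrary: c \<tau> x)
  case Nil
  then show ?case by simp
next
  case (Cons a w)
  obtain i b where a: "a = (i, b)" by (cases a)
  have c0: "sub None c = pC w (sub None c)"
    by (subst Cons.prems(2)) simp
  have cu: "uh c = pM w i i (uh c)"
    by (subst Cons.prems(2)) (simp add: a)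
  obtain t \<tau>' where \<tau>: "\<tau> = t # \<tau>'" using Cons.prems(1) by (cases \<tau>) auto
  have len: "length \<tau>' = length w" using validC_length [OF Cons.prems(1)] \<tau> by simp
  have "(\<Sum>l<length (a # w). L0 ((a # w) ! l) (\<lambda>h \<sigma>. c (place (length (a # w) - Suc l) h \<sigma>))
     (\<tau> ! l) (drop (Suc l) \<tau> @ take l \<tau>) x)
     = L0 a (\<lambda>h \<sigma>. c (place (length w) h \<sigma>)) t \<tau>' x
       + (\<Sum>l<length w. L0 (w ! l) (\<lambda>h \<sigma>. c (place (length w - Suc l) h \<sigma>)) (\<tau>' ! l) (drop (Suc l) \<tau>' @ t # take l \<tau>') x)"
    by (simp add: \<tau> sum.lessThan_Suc_shift del: sum.lessThan_Suc)
  moreover have "L0 a (\<lambda>h \<sigma>. c (place (length w) h \<sigma>)) t \<tau>' x = L0 a (\<lambda>h \<sigma>. c (h # \<sigma>)) t \<tau>' x"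
    by (rule L0_cong) (simp add: place_def len)
  ultimately have split: "(\<Sum>l<length (a # w). L0 ((a # w) ! l) (\<lambda>h \<sigma>. c (place (length (a # w) - Suc l) h \<sigma>))
     (\<tau> ! l) (drop (Suc l) \<tau> @ take l \<tau>) x)
     = L0 a (\<lambda>h \<sigma>. c (h # \<sigma>)) t \<tau>' x
       + (\<Sum>l<length w. L0 (w ! l) (\<lambda>h \<sigma>. c (place (length w - Suc l) h \<sigma>)) (\<tau>' ! l) (drop (Suc l) \<tau>' @ t # take l \<tau>') x)"
    by simp
  show ?case
  proof (cases t)
    case None
    then have val: "validC w \<tau>' x" using Cons.prems(1) \<tau> by simp
    have "L0 a (\<lambda>h \<sigma>. c (h # \<sigma>)) t \<tau>' x = (if b then 0 else mu w i (uh c) \<tau>' x)"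
      using mu_explicit [OF val cu] by (simp add: L0_def a None uh_def)
    moreover have "L0 (w ! l) (\<lambda>h \<sigma>. c (place (length w - Suc l) h \<sigma>)) (\<tau>' ! l) (drop (Suc l) \<tau>' @ t # take l \<tau>') x
       = L0 (w ! l) (\<lambda>h \<sigma>. sub None c (place (length w - Suc l) h \<sigma>)) (\<tau>' ! l) (drop (Suc l) \<tau>' @ take l \<tau>') x"
      if "l < length w" for l
    proof -
      have "place (length w - Suc l) h (take (length w - Suc l) \<sigma> @ None # drop (length w - Suc l) \<sigma>)
         = None # place (length w - Suc l) h \<sigma>" if "length \<sigma> = length w - 1" for h \<sigma>
        using that \<open>l < length w\<close> by (simp add: place_def)
      then show ?thesis
        unfolding None L0_append_None using that len
        by (intro L0_cong) (simp add: sub_def)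
    qed
    ultimately show ?thesis
      using Cons.IH [OF val c0] unfolding split by (simp add: \<tau> None a add.commute)
  next
    case (Some e)
    then have val: "validM w i i \<tau>' e" and x: "x = 0" using Cons.prems(1) \<tau> a by auto
    have e: "e \<le> 2" using validM_length [OF val] by simp
    have "L0 a (\<lambda>h \<sigma>. c (h # \<sigma>)) t \<tau>' x = (if b then del w i (sub None c) \<tau>' e else 0)"
      using del_explicit [OF val, of "sub None c"] by (simp add: L0_def a Some sub_def)
    moreover have "L0 (w ! l) (\<lambda>h \<sigma>. c (place (length w - Suc l) h \<sigma>)) (\<tau>' ! l) (drop (Suc l) \<tau>' @ t # take l \<tau>') x
       = LM (w ! l) (\<lambda>h \<sigma>. uh c (take l \<tau>' @ h # \<sigma>)) (\<tau>' ! l) (drop (Suc l) \<tau>') e"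
      if l: "l < length w" for l
    proof -
      \<comment> \<open>The arc that runs past the end of the word ends in the first slot, so its
        degree \<open>e\<close> takes the place of the trailing index.\<close>
      have "lw d (\<lambda>\<sigma> x. c (place (length w - Suc l) h \<sigma>) 0) (drop (Suc l) \<tau>' @ Some e # take l \<tau>') 0
        = lw d (\<lambda>\<sigma>. uh c (take l \<tau>' @ h # \<sigma>)) (drop (Suc l) \<tau>') e" for d h
        unfolding lw_append_Some [OF e]
        using l len by (intro lw_cong) (simp add: place_def uh_def)
      then show ?thesis by (simp add: L0_def LM_def Some split: option.split)
    qed
    ultimately show ?thesis
      using dM_explicit [OF val cu] x e unfolding split by (simp add: \<tau> Some a add.commute)
  qed
qed

definition rot :: "vec \<Rightarrow> vec" where
  "rot c = (\<lambda>\<tau>. c (case \<tau> of [] \<Rightarrow> [] | _ \<Rightarrow> last \<tau> # butlast \<tau>))"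

lemma rot_snoc [simp]: "rot c (\<tau> @ [t]) = c (t # \<tau>)"
  by (cases \<tau>) (simp_all add: rot_def)

lemma validM_append:
  "length \<tau> = length w \<Longrightarrow> validM (w @ [a]) j k (\<tau> @ [t]) x \<longleftrightarrow>
   (case t of None \<Rightarrow> validM w j k \<tau> x | Some f \<Rightarrow> validM w j (fst a) \<tau> f \<and> par (fst a) k x)"
proof (induction w arbitrary: \<tau> j)
  case Nil
  then show ?case by (cases t) auto
next
  case (Cons b w)
  then obtain s \<sigma> where "\<tau> = s # \<sigma>" by (cases \<tau>) auto
  then show ?case using Cons by (cases s; cases t) auto
qed

lemma validC_rot: "length \<tau> = length w \<Longrightarrow> validC (w @ [a]) (\<tau> @ [t]) x \<longleftrightarrow> validC (a # w) (t # \<tau>) x"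
proof (induction w arbitrary: \<tau>)
  case Nil
  then show ?case by (cases t) auto
next
  case (Cons b w)
  then obtain s \<sigma> where s: "\<tau> = s # \<sigma>" by (cases \<tau>) auto
  then show ?case using Cons by (cases s; cases t) (auto simp: validM_append)
qed

text \<open>The terms of \<open>dC_explicit\<close> are permuted by rotation. The chain is projected
  to valid states first, since only there the explicit formula holds.\<close>

lemma transports_rotate: "transports (a # w) (w @ [a])"
proof -
  let ?F = "\<lambda>c. rot (pC (a # w) c)"
  have len: "length \<tau> = length w + 1 \<Longrightarrow> \<exists>\<sigma> t. \<tau> = \<sigma> @ [t] \<and> length \<sigma> = length w" for \<tau> :: "nat option list"
    by (metis Suc_eq_plus1 length_Suc_conv_rev)
  have rot_p: "rot (pC (a # w) c) = pC (w @ [a]) (rot (pC (a # w) c))" for c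
  proof (intro ext)
    fix \<tau> x
    show "rot (pC (a # w) c) \<tau> x = pC (w @ [a]) (rot (pC (a # w) c)) \<tau> x"
    proof (cases "length \<tau> = length w + 1")
      case True
      then obtain \<sigma> t where \<sigma>: "\<tau> = \<sigma> @ [t]" "length \<sigma> = length w" using len by blast
      then show ?thesis using validC_rot [OF \<sigma>(2), of a t x] by (simp add: pC_def)
    next
      case False
      then have "\<not> validC (w @ [a]) \<tau> x" using validC_length [of "w @ [a]" \<tau> x] by auto
      moreover have "rot (pC (a # w) c) \<tau> x = 0"
        using False validC_length [of "a # w" "case \<tau> of [] \<Rightarrow> [] | _ \<Rightarrow> last \<tau> # butlast \<tau>" x]
        by (auto simp: rot_def pC_def split: list.split)
      ultimately show ?thesis by (simp add: pC_def)
    qed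
  qed
  have "dC (w @ [a]) (?F c) = ?F (dC (a # w) c)" for c
  proof -
    let ?c = "pC (a # w) c"
    have "dC (w @ [a]) (?F c) \<tau> x = rot (dC (a # w) ?c) \<tau> x" for \<tau> x
    proof (cases "validC (w @ [a]) \<tau> x")
      case True
      then obtain \<sigma> t where \<sigma>: "\<tau> = \<sigma> @ [t]" "length \<sigma> = length w"
        using len [of \<tau>] validC_length [OF True] by auto
      then have val: "validC (a # w) (t # \<sigma>) x" using True validC_rot [OF \<sigma>(2), of a t x] by simp
      let ?n = "length w"
      have "dC (w @ [a]) (?F c) \<tau> x = (\<Sum>l<Suc ?n. L0 ((w @ [a]) ! l) (\<lambda>h \<sigma>. ?F c (place (Suc ?n - Suc l) h \<sigma>))
          (\<tau> ! l) (drop (Suc l) \<tau> @ take l \<tau>) x)"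
        using dC_explicit [OF True, of "?F c"] rot_p by simp
      also have "\<dots> = (\<Sum>l<?n. L0 (w ! l) (\<lambda>h \<rho>. ?c (place (?n - Suc l) h \<rho>)) (\<sigma> ! l) (drop (Suc l) \<sigma> @ t # take l \<sigma>) x)
          + L0 a (\<lambda>h \<rho>. ?c (h # \<rho>)) t \<sigma> x"
      proof -
        have "L0 ((w @ [a]) ! l) (\<lambda>h \<rho>. ?F c (place (Suc ?n - Suc l) h \<rho>)) (\<tau> ! l) (drop (Suc l) \<tau> @ take l \<tau>) x
          = L0 (w ! l) (\<lambda>h \<rho>. ?c (place (?n - Suc l) h \<rho>)) (\<sigma> ! l) (drop (Suc l) \<sigma> @ t # take l \<sigma>) x"
          if l: "l < ?n" for l
        proof -
          have "?F c (place (Suc ?n - Suc l) h \<rho>) y = ?c (place (?n - Suc l) h \<rho>) y"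
            if "length \<rho> = ?n" for h \<rho> y
          proof -
            let ?m = "?n - Suc l"
            have m: "?n - l = Suc ?m" "?m < length \<rho>" using l that by auto
            have p: "place (Suc ?n - Suc l) h \<rho> = (drop (Suc ?m) \<rho> @ h # take ?m \<rho>) @ [\<rho> ! ?m]"
              using m by (simp add: place_def take_Suc_conv_app_nth)
            have q: "place ?m h \<rho> = \<rho> ! ?m # (drop (Suc ?m) \<rho> @ h # take ?m \<rho>)"
              using m by (simp add: place_def Cons_nth_drop_Suc [symmetric])
            show ?thesis unfolding p q by (simp only: rot_snoc)
          qed
          then show ?thesis using l \<sigma>
            by (simp add: nth_append, intro L0_cong) (simp add: less_imp_le_nat)
        qed
        moreover have "L0 a (\<lambda>h \<rho>. ?F c (place 0 h \<rho>)) t \<sigma> x = L0 a (\<lambda>h \<rho>. ?c (h # \<rho>)) t \<sigma> x"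
          by (rule L0_cong) (simp add: place_def)
        moreover have "(\<sigma> @ [t]) ! ?n = t" using \<sigma>(2) by (metis nth_append_length)
        ultimately show ?thesis using \<sigma> by simp
      qed
      also have "\<dots> = dC (a # w) ?c (t # \<sigma>) x"
      proof -
        have "L0 a (\<lambda>h \<rho>. ?c (place ?n h \<rho>)) t \<sigma> x = L0 a (\<lambda>h \<rho>. ?c (h # \<rho>)) t \<sigma> x"
          by (rule L0_cong) (simp add: place_def \<sigma>)
        then show ?thesis
          using dC_explicit [OF val, of ?c]
          by (simp add: sum.lessThan_Suc_shift add.commute del: sum.lessThan_Suc)
      qed
      finally show ?thesis by (simp add: \<sigma>)
    next
      case False
      have "dC (w @ [a]) (?F c) = pC (w @ [a]) (dC (w @ [a]) (?F c))"
        using rot_p [of c] dC_pC by metis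
      then have "dC (w @ [a]) (?F c) \<tau> x = 0" using False by (metis pC_def)
      moreover have "rot (dC (a # w) ?c) \<tau> x = 0"
        using rot_p [of "dC (a # w) c"] False by (simp add: dC_pC) (metis pC_def)
      ultimately show ?thesis by simp
    qed
    then show ?thesis by (intro ext) (simp add: dC_pC)
  qed
  moreover have "?F 0 = 0" by (intro ext) (simp add: rot_def vec_apply)
  moreover have "ecoef (w @ [a]) (?F c) = ecoef (a # w) c" for c
  proof -
    have "validC v (replicate (length v) None) 3" for v by (induction v) auto
    from this [of "a # w"] show ?thesis
      by (simp add: ecoef_def pC_def replicate_append_same [symmetric])
  qed
  moreover have "?F (ehat (a # w)) = ehat (w @ [a])"
  proof (intro ext)
    fix \<tau> x
    have v: "validC v (replicate (length v) None) 4" for v by (induction v) auto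
    have eq: "pC (a # w) (ehat (a # w)) = ehat (a # w)"
      using v [of "a # w"] by (intro ext) (auto simp: pC_def ehat_def)
    show "?F (ehat (a # w)) \<tau> x = ehat (w @ [a]) \<tau> x"
    proof (cases "length \<tau> = length w + 1")
      case True
      then obtain \<sigma> t where \<sigma>: "\<tau> = \<sigma> @ [t]" "length \<sigma> = length w" using len by blast
      have R: "xs = replicate n None \<longleftrightarrow> length xs = n \<and> set xs \<subseteq> {None}" for xs :: "nat option list" and n
        by (auto intro!: replicate_eqI)
      show ?thesis unfolding eq using \<sigma>
        by (simp add: ehat_def R del: replicate.simps)
    next
      case False
      then have "(case \<tau> of [] \<Rightarrow> [] | _ \<Rightarrow> last \<tau> # butlast \<tau>) \<noteq> replicate (length (a # w)) None"
        "\<tau> \<noteq> replicate (length (w @ [a])) None"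
        by (auto split: list.split dest!: arg_cong [where f = length])
      then show ?thesis unfolding eq by (simp add: ehat_def rot_def)
    qed
  qed
  ultimately show ?thesis unfolding transports_def by (intro exI [of _ ?F] conjI allI)
qed

section \<open>Circles of a resolution\<close>

definition Uset :: "braid3 \<Rightarrow> nat set \<Rightarrow> nat set" where
  "Uset w s = {k. k < length w \<and> \<not> vertical_smoothing w s k}"

definition gi :: "braid3 \<Rightarrow> nat \<Rightarrow> nat" where
  "gi w k = gidx (fst (w ! k))"

text \<open>The first cup-cap met when going around from \<open>x\<close>; the second branch is the
  passage across the seam.\<close>

definition nx :: "nat set \<Rightarrow> nat \<Rightarrow> nat" where
  "nx K x = (if \<exists>y\<in>K. x \<le> y then Min {y \<in> K. x \<le> y} else Min K)"

lemma gi_01: "gi w k = 0 \<or> gi w k = 1"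
  by (cases "fst (w ! k)") (auto simp: gi_def)

lemma nx_eq_iff:
  assumes "finite K" "K \<noteq> {}"
  shows "nx K x = q \<longleftrightarrow> q \<in> K \<and> ((x \<le> q \<and> (\<forall>l\<in>K. \<not> (x \<le> l \<and> l < q))) \<or> (\<forall>l\<in>K. l < x \<and> q \<le> l))"
proof (cases "\<exists>y\<in>K. x \<le> y")
  case True
  then have "{y \<in> K. x \<le> y} \<noteq> {}" by auto
  then have "Min {y \<in> K. x \<le> y} = q \<longleftrightarrow> q \<in> K \<and> x \<le> q \<and> (\<forall>l\<in>K. x \<le> l \<longrightarrow> q \<le> l)"
    using assms(1) by (subst eq_commute) (subst eq_Min_iff; auto)
  then show ?thesis using True by (auto simp: nx_def not_less)
next
  case False
  have "Min K = q \<longleftrightarrow> q \<in> K \<and> (\<forall>l\<in>K. q \<le> l)"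
    using assms by (subst eq_commute) (subst eq_Min_iff; auto)
  then show ?thesis using False by (auto simp: nx_def not_le)
qed

lemma nx_in: "finite K \<Longrightarrow> K \<noteq> {} \<Longrightarrow> nx K x \<in> K"
  using nx_eq_iff [of K x "nx K x"] by auto

lemma nx_self: "finite K \<Longrightarrow> x \<in> K \<Longrightarrow> nx K x = x"
  by (subst nx_eq_iff) auto

lemma nx_Suc:
  assumes "finite K" "K \<noteq> {}" "x \<notin> K"
  shows "nx K (Suc x) = nx K x"
proof -
  let ?q = "nx K x"
  have q: "?q \<in> K \<and> ((x \<le> ?q \<and> (\<forall>l\<in>K. \<not> (x \<le> l \<and> l < ?q))) \<or> (\<forall>l\<in>K. l < x \<and> ?q \<le> l))"
    using nx_eq_iff [OF assms(1,2), of x ?q] by simp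
  moreover have "l \<noteq> x" if "l \<in> K" for l using that assms(3) by auto
  ultimately have "?q \<in> K \<and> ((Suc x \<le> ?q \<and> (\<forall>l\<in>K. \<not> (Suc x \<le> l \<and> l < ?q))) \<or> (\<forall>l\<in>K. l < Suc x \<and> ?q \<le> l))"
    by (metis Suc_leD Suc_leI le_neq_implies_less less_SucI)
  then show ?thesis using nx_eq_iff [OF assms(1,2), of "Suc x" ?q] by simp
qed

lemma nx_wrap:
  assumes "finite K" "K \<noteq> {}" "\<And>y. y \<in> K \<Longrightarrow> y < n"
  shows "nx K n = nx K 0" "nx K (Suc n) = nx K 0"
proof -
  have "\<not> (\<exists>y\<in>K. n \<le> y)" "\<not> (\<exists>y\<in>K. Suc n \<le> y)" using assms(3) by force+
  then show "nx K n = nx K 0" "nx K (Suc n) = nx K 0" using assms(2) by (auto simp: nx_def)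
qed

lemma nx_Suc_inj:
  assumes K: "finite K" "K \<noteq> {}" and p: "p \<in> K" "p' \<in> K" and eq: "nx K (Suc p) = nx K (Suc p')"
  shows "p = p'"
proof (rule ccontr)
  have "False" if "p < p'" "p \<in> K" "p' \<in> K" "nx K (Suc p) = nx K (Suc p')" for p p'
  proof -
    let ?q = "nx K (Suc p)"
    have "?q \<in> K \<and> ((Suc p \<le> ?q \<and> (\<forall>l\<in>K. \<not> (Suc p \<le> l \<and> l < ?q))) \<or> (\<forall>l\<in>K. l < Suc p \<and> ?q \<le> l))"
      using nx_eq_iff [OF K, of "Suc p" ?q] by simp
    then have 1: "Suc p \<le> ?q" "?q \<le> p'" using that by force+
    have "?q \<in> K \<and> ((Suc p' \<le> ?q \<and> (\<forall>l\<in>K. \<not> (Suc p' \<le> l \<and> l < ?q))) \<or> (\<forall>l\<in>K. l < Suc p' \<and> ?q \<le> l))"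
      using nx_eq_iff [OF K, of "Suc p'" ?q] that(4) by simp
    then show False using 1 that(2) by force
  qed
  moreover assume "p \<noteq> p'"
  ultimately show False using p eq by (metis nat_neq_iff)
qed

text \<open>The cyclic successor is an injective self-map of a finite set, hence onto: every cup-cap
  has a predecessor.\<close>

lemma nx_Suc_surj:
  assumes "finite K" "K \<noteq> {}" "q \<in> K"
  shows "\<exists>p\<in>K. nx K (Suc p) = q"
proof -
  have "(\<lambda>p. nx K (Suc p)) ` K = K"
    using assms nx_in [OF assms(1,2)] by (intro endo_inj_surj) (auto simp: inj_on_def intro: nx_Suc_inj)
  then show ?thesis using assms(3) by (metis imageE)
qed

text \<open>The arcs between a cup-cap and its cyclic predecessor close up to a trivial circle
  exactly when both sit at the same position.\<close>

definition tr :: "braid3 \<Rightarrow> nat set \<Rightarrow> nat \<Rightarrow> bool" where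
  "tr w K q \<longleftrightarrow> (\<exists>p\<in>K. nx K (Suc p) = q \<and> gi w p = gi w q)"

lemma tr_iff:
  assumes "finite K" "K \<noteq> {}" "p \<in> K" "nx K (Suc p) = q"
  shows "tr w K q \<longleftrightarrow> gi w p = gi w q"
  using assms nx_Suc_inj [OF assms(1,2)] unfolding tr_def by metis

text \<open>The bottom of slot \<open>k\<close> belongs to the same region as the top of the next
  slot, hence the successor.\<close>

fun npos :: "node \<Rightarrow> nat" where
  "npos (k, j, b) = (if b then Suc k else k)"

text \<open>The name of the circle through a node: a trivial circle is named by the cup-cap at which
  it ends. With three strands and at least one cup-cap all other nodes lie on a single essential
  circle, named \<open>None\<close>.\<close>

definition lab :: "braid3 \<Rightarrow> nat set \<Rightarrow> node \<Rightarrow> nat option" where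
  "lab w K x = (let q = nx K (npos x); j = fst (snd x) in
     if tr w K q \<and> (j = gi w q \<or> j = Suc (gi w q)) then Some q else None)"

lemma in_diag_nodes: "(k, j, b) \<in> diag_nodes w \<longleftrightarrow> k \<le> length w \<and> j < 3"
  by (auto simp: diag_nodes_def)

lemma finite_Uset [simp]: "finite (Uset w s)"
  by (auto simp: Uset_def)

lemma Uset_less: "k \<in> Uset w s \<Longrightarrow> k < length w"
  by (auto simp: Uset_def)

lemma lab_edge:
  assumes K: "Uset w s \<noteq> {}" and e: "res_edge w s a b"
  shows "lab w (Uset w s) a = lab w (Uset w s) b"
proof -
  let ?K = "Uset w s" and ?n = "length w"
  note fin = finite_Uset [of w s]
  have lt: "y < ?n" if "y \<in> ?K" for y using that by (rule Uset_less)
  have trn: "tr w ?K (nx ?K (Suc k)) \<longleftrightarrow> gi w k = gi w (nx ?K (Suc k))" if "k \<in> ?K" for k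
    using tr_iff [OF fin K that refl] .
  consider (arc) k j where "a = (k, j, True)" "b = (Suc k mod Suc ?n, j, False)" "k \<le> ?n"
    | (vert) k j where "a = (k, j, False)" "b = (k, j, True)" "k \<notin> ?K"
    | (third) k j where "a = (k, j, False)" "b = (k, j, True)" "k \<in> ?K" "j \<noteq> gi w k" "j \<noteq> Suc (gi w k)"
    | (cap) k where "k \<in> ?K" "a = (k, gi w k, False)" "b = (k, Suc (gi w k), False)"
    | (cup) k where "k \<in> ?K" "a = (k, gi w k, True)" "b = (k, Suc (gi w k), True)"
    using e unfolding res_edge_def Uset_def gi_def
    by (auto simp: in_diag_nodes) blast+
  then show ?thesis
  proof cases
    case arc
    show ?thesis
    proof (cases "k = ?n")
      case True
      have "nx ?K (Suc ?n) = nx ?K 0" by (rule nx_wrap(2) [OF fin K]) (rule lt)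
      then show ?thesis using arc True by (simp add: lab_def)
    next
      case False
      then have "Suc k mod Suc ?n = Suc k" using arc by simp
      then show ?thesis using arc by (simp add: lab_def)
    qed
  next
    case vert
    then show ?thesis using nx_Suc [OF fin K, of k] by (simp add: lab_def)
  next
    case third
    then show ?thesis using trn [of k] nx_self [OF fin, of k] by (auto simp: lab_def Let_def)
  next
    case cap
    then show ?thesis using nx_self [OF fin, of k] by (auto simp: lab_def Let_def)
  next
    case cup
    then show ?thesis using trn [of k] by (auto simp: lab_def Let_def)
  qed
qed

section \<open>Connected components of a resolution\<close>

abbreviation conn :: "braid3 \<Rightarrow> nat set \<Rightarrow> node \<Rightarrow> node \<Rightarrow> bool" where
  "conn w s \<equiv> (res_adj w s)\<^sup>*\<^sup>*"

lemma conn_sym: "conn w s a b \<Longrightarrow> conn w s b a"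
  by (rule sympD [OF symp_rtranclp]) (auto simp: symp_def res_adj_def)

lemma conn_trans: "conn w s a b \<Longrightarrow> conn w s b c \<Longrightarrow> conn w s a c"
  by (rule rtranclp_trans)

lemma conn_edge: "res_edge w s a b \<Longrightarrow> conn w s a b"
  by (rule r_into_rtranclp) (simp add: res_adj_def)

lemma conn_vert: "k \<le> length w \<Longrightarrow> j < 3 \<Longrightarrow> k \<notin> Uset w s \<Longrightarrow> conn w s (k, j, False) (k, j, True)"
  by (rule conn_edge) (auto simp: res_edge_def in_diag_nodes Uset_def)

lemma conn_third: "k \<in> Uset w s \<Longrightarrow> j < 3 \<Longrightarrow> j \<noteq> gi w k \<Longrightarrow> j \<noteq> Suc (gi w k) \<Longrightarrow>
    conn w s (k, j, False) (k, j, True)"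
  by (rule conn_edge) (auto simp: res_edge_def in_diag_nodes Uset_def gi_def)

lemma conn_arc: "k \<le> length w \<Longrightarrow> j < 3 \<Longrightarrow> conn w s (k, j, True) (Suc k mod Suc (length w), j, False)"
  by (rule conn_edge) (auto simp: res_edge_def in_diag_nodes intro: mod_less_divisor order_le_less_trans [OF _ mod_less_divisor] less_Suc_eq_le [THEN iffD1])

lemma conn_cap: "k \<in> Uset w s \<Longrightarrow> conn w s (k, gi w k, b) (k, Suc (gi w k), b)"
  using gi_01 [of w k] by (intro conn_edge) (cases b; auto simp: res_edge_def in_diag_nodes Uset_def gi_def)

lemma conn_down:
  assumes "p \<le> q" "q \<le> length w" "j < 3" "\<And>l. p \<le> l \<Longrightarrow> l < q \<Longrightarrow> l \<notin> Uset w s"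
  shows "conn w s (p, j, False) (q, j, False)"
  using assms
proof (induction "q - p" arbitrary: q)
  case 0
  then show ?case by simp
next
  case (Suc d)
  have "q = Suc (q - 1)" "p \<le> q - 1" using Suc.hyps(2) by linarith+
  then obtain q' where q': "q = Suc q'" "p \<le> q'" by blast
  have "conn w s (p, j, False) (q', j, False)" using Suc q' by auto
  moreover have "conn w s (q', j, False) (q', j, True)" using Suc.prems q' by (intro conn_vert) auto
  moreover have "conn w s (q', j, True) (q, j, False)" using conn_arc [of q' w j s] Suc.prems q' by simp
  ultimately show ?case by (blast intro: conn_trans)
qed

lemma conn_region:
  assumes K: "Uset w s \<noteq> {}" and x: "(k, j, b) \<in> diag_nodes w"
  shows "conn w s (k, j, b) (nx (Uset w s) (npos (k, j, b)), j, False)"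
proof -
  let ?K = "Uset w s" and ?n = "length w"
  note fin = finite_Uset [of w s]
  have lt: "y < ?n" if "y \<in> ?K" for y using that by (rule Uset_less)
  have wrap: "nx ?K (Suc ?n) = nx ?K 0" by (rule nx_wrap(2) [OF fin K]) (rule lt)
  have j: "j < 3" and k: "k \<le> ?n" using x by (auto simp: in_diag_nodes)
  have top0: "conn w s (0, j, False) (nx ?K 0, j, False)"
  proof -
    have "nx ?K 0 \<in> ?K \<and> (\<forall>l\<in>?K. \<not> l < nx ?K 0)"
      using nx_eq_iff [OF fin K, of 0 "nx ?K 0"] by auto
    then show ?thesis using lt j by (intro conn_down) (auto dest: less_imp_le)
  qed
  have top: "conn w s (p, j, False) (nx ?K p, j, False)" if p: "p \<le> ?n" for p
  proof -
    let ?q = "nx ?K p"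
    have "?q \<in> ?K \<and> ((p \<le> ?q \<and> (\<forall>l\<in>?K. \<not> (p \<le> l \<and> l < ?q))) \<or> (\<forall>l\<in>?K. l < p \<and> ?q \<le> l))"
      using nx_eq_iff [OF fin K, of p ?q] by simp
    then consider "p \<le> ?q" "?q \<in> ?K" "\<And>l. p \<le> l \<Longrightarrow> l < ?q \<Longrightarrow> l \<notin> ?K" | "\<And>l. l \<in> ?K \<Longrightarrow> l < p"
      by blast
    then show ?thesis
    proof cases
      case 1
      then show ?thesis using lt j by (intro conn_down) (auto dest: less_imp_le)
    next
      case 2
      \<comment> \<open>No cup-cap follows before the end: the strand runs through the identity slot
        and across the seam to the first cup-cap.\<close>
      have "nx ?K p = nx ?K 0" by (rule nx_wrap(1) [OF fin K]) (rule 2)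
      moreover have "conn w s (p, j, False) (?n, j, False)"
        using p j 2 by (intro conn_down) (auto dest: leD)
      moreover have "conn w s (?n, j, False) (?n, j, True)"
        using lt j by (intro conn_vert) auto
      moreover have "conn w s (?n, j, True) (0, j, False)"
        using conn_arc [of ?n w j s] j by simp
      ultimately show ?thesis using top0 by (metis conn_trans)
    qed
  qed
  show ?thesis
  proof (cases b)
    case False
    then show ?thesis using top [OF k] by simp
  next
    case b: True
    show ?thesis
    proof (cases "k = ?n")
      case True
      have "conn w s (?n, j, True) (0, j, False)"
        using conn_arc [of ?n w j s] j by simp
      from conn_trans [OF this top0] show ?thesis using b True wrap by simp
    next
      case False
      then have c: "conn w s (k, j, True) (Suc k, j, False)" "Suc k \<le> ?n"
        using conn_arc [of k w j s] j k by simp_all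
      from conn_trans [OF c(1) top [OF c(2)]] show ?thesis using b by simp
    qed
  qed
qed

definition thd :: "braid3 \<Rightarrow> nat \<Rightarrow> nat" where
  "thd w k = (if gi w k = 0 then 2 else 0)"

lemma thd_props: "thd w k < 3" "thd w k \<noteq> gi w k" "thd w k \<noteq> Suc (gi w k)"
  "j < 3 \<Longrightarrow> j \<noteq> gi w k \<Longrightarrow> j \<noteq> Suc (gi w k) \<Longrightarrow> j = thd w k"
  using gi_01 [of w k] by (auto simp: thd_def)

text \<open>In a region that contains a trivial circle only the third strand is left. In any other
  region the two bounding cup-caps join different pairs of strands, so all three strands are
  connected.\<close>

lemma conn_lab_None:
  assumes K: "Uset w s \<noteq> {}" and x: "x \<in> diag_nodes w" and l: "lab w (Uset w s) x = None"
  shows "conn w s x (nx (Uset w s) (npos x), thd w (nx (Uset w s) (npos x)), False)"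
proof -
  let ?K = "Uset w s"
  note fin = finite_Uset [of w s]
  obtain k j b where xe: "x = (k, j, b)" by (cases x)
  let ?q = "nx ?K (npos x)"
  have q: "?q \<in> ?K" by (rule nx_in [OF fin K])
  have j: "j < 3" using x xe by (simp add: in_diag_nodes)
  have c: "conn w s x (?q, j, False)" using conn_region [OF K, of k j b] x xe by simp
  have "conn w s (?q, j, False) (?q, thd w ?q, False)"
  proof (cases "tr w ?K ?q")
    case True
    then have "j = thd w ?q" using l j xe thd_props(4) [where j = j and w = w and k = "?q"] by (auto simp: lab_def Let_def split: if_splits)
    then show ?thesis by simp
  next
    case False
    obtain p where p: "p \<in> ?K" "nx ?K (Suc p) = ?q" using nx_Suc_surj [OF fin K q] by auto
    have ne: "gi w p \<noteq> gi w ?q" using tr_iff [OF fin K p] False by simp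
    have down: "conn w s (p, i, True) (?q, i, False)" if "i < 3" for i
      using conn_region [OF K, of p i True] that p Uset_less [OF p(1)] by (simp add: in_diag_nodes)
    have 1: "conn w s (?q, gi w ?q, False) (?q, Suc (gi w ?q), False)" by (rule conn_cap [OF q])
    have "conn w s (?q, gi w p, False) (?q, Suc (gi w p), False)"
      using down [of "gi w p"] down [of "Suc (gi w p)"] conn_cap [OF p(1), of True] gi_01 [of w p]
      by (metis conn_sym conn_trans lessI less_Suc_eq numeral_2_eq_2 numeral_3_eq_3 One_nat_def)
    then have "conn w s (?q, 0, False) (?q, 1, False) \<and> conn w s (?q, 1, False) (?q, 2, False)"
      using 1 gi_01 [of w p] gi_01 [of w ?q] ne by (elim disjE) simp_all
    then have c012: "conn w s (?q, 0, False) (?q, 1, False)" "conn w s (?q, 2, False) (?q, 1, False)"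
      using conn_sym by blast+
    have "conn w s (?q, i, False) (?q, 1, False)" if "i < 3" for i
    proof -
      have "i = 0 \<or> i = 1 \<or> i = 2" using that by linarith
      then show ?thesis
        using c012 by (elim disjE) simp_all
    qed
    then show ?thesis using j thd_props(1) [of w ?q] by (metis conn_sym conn_trans)
  qed
  then show ?thesis using c by (rule conn_trans [rotated])
qed

text \<open>The third strand leads from each cup-cap to the next. Induction on the distance to the
  last cup-cap never crosses the seam.\<close>

lemma conn_thd:
  assumes K: "Uset w s \<noteq> {}" and q: "q \<in> Uset w s"
  shows "conn w s (q, thd w q, False) (Max (Uset w s), thd w (Max (Uset w s)), False)"
  using q
proof (induction "Max (Uset w s) - q" arbitrary: q rule: less_induct)
  case less
  let ?K = "Uset w s" and ?M = "Max (Uset w s)"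
  note fin = finite_Uset [of w s]
  have le: "y \<le> ?M" if "y \<in> ?K" for y using that fin by simp
  have M: "?M \<in> ?K" using fin K by simp
  show ?case
  proof (cases "q = ?M")
    case True
    then show ?thesis by simp
  next
    case False
    then have lt: "q < ?M" using le [OF less.prems] by simp
    let ?q = "nx ?K (Suc q)"
    have q': "?q \<in> ?K" by (rule nx_in [OF fin K])
    have "Suc q \<le> ?q"
      using nx_eq_iff [OF fin K, of "Suc q" ?q] lt M by force
    then have "?M - ?q < ?M - q" using lt by simp
    then have IH: "conn w s (?q, thd w ?q, False) (?M, thd w ?M, False)" using less.hyps q' by blast
    have x: "(q, thd w q, True) \<in> diag_nodes w"
      using Uset_less [OF less.prems] thd_props(1) by (simp add: in_diag_nodes)
    have "lab w ?K (q, thd w q, True) = None"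
      using tr_iff [where w = w, OF fin K less.prems refl] thd_props(1-3) [of w q] by (auto simp: lab_def Let_def)
    from conn_lab_None [OF K x this]
    have "conn w s (q, thd w q, True) (?q, thd w ?q, False)" by simp
    moreover have "conn w s (q, thd w q, False) (q, thd w q, True)"
      using less.prems thd_props by (intro conn_third) auto
    ultimately show ?thesis using IH by (metis conn_trans)
  qed
qed

lemma conn_iff_lab:
  assumes K: "Uset w s \<noteq> {}" and x: "x \<in> diag_nodes w" and y: "y \<in> diag_nodes w"
  shows "conn w s x y \<longleftrightarrow> lab w (Uset w s) x = lab w (Uset w s) y"
proof
  let ?K = "Uset w s"
  assume "conn w s x y"
  then show "lab w ?K x = lab w ?K y"
    by (induction rule: rtranclp_induct) (auto simp: res_adj_def lab_edge [OF K])
next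
  let ?K = "Uset w s"
  note fin = finite_Uset [of w s]
  assume eq: "lab w ?K x = lab w ?K y"
  show "conn w s x y"
  proof (cases "lab w ?K x")
    case None
    have "conn w s z (Max ?K, thd w (Max ?K), False)" if "z \<in> diag_nodes w" "lab w ?K z = None" for z
      using conn_lab_None [OF K that] conn_thd [OF K nx_in [OF fin K]] by (rule conn_trans)
    then show ?thesis using x y None eq by (metis conn_sym conn_trans)
  next
    case (Some q)
    have "conn w s z (q, gi w q, False)" if z: "z \<in> diag_nodes w" and l: "lab w ?K z = Some q" for z
    proof -
      obtain k j b where ze: "z = (k, j, b)" by (cases z)
      have q: "nx ?K (npos z) = q" and j: "j = gi w q \<or> j = Suc (gi w q)"
        using l ze by (auto simp: lab_def Let_def split: if_splits)
      have "conn w s z (q, j, False)" using conn_region [OF K, of k j b] z ze q by simp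
      moreover have "conn w s (q, Suc (gi w q), False) (q, gi w q, False)"
        using conn_cap [of q w s False] nx_in [OF fin K] q by (metis conn_sym)
      ultimately show ?thesis using j by (metis conn_trans rtranclp.rtrancl_refl)
    qed
    then show ?thesis using x y Some eq by (metis conn_sym conn_trans)
  qed
qed

definition Tset :: "braid3 \<Rightarrow> nat set \<Rightarrow> nat \<Rightarrow> node set" where
  "Tset w K q = {x \<in> diag_nodes w. nx K (npos x) = q \<and> (fst (snd x) = gi w q \<or> fst (snd x) = Suc (gi w q))}"

definition Eset :: "braid3 \<Rightarrow> nat set \<Rightarrow> node set" where
  "Eset w K = {x \<in> diag_nodes w. lab w K x = None}"

lemma lab_Some: "lab w K x = Some q \<longleftrightarrow> tr w K q \<and> nx K (npos x) = q \<and> (fst (snd x) = gi w q \<or> fst (snd x) = Suc (gi w q))"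
  by (auto simp: lab_def Let_def)

lemma Tset_nonempty:
  assumes "finite K" "q \<in> K" "q < length w"
  shows "(q, gi w q, False) \<in> Tset w K q"
  using assms nx_self [OF assms(1,2)] gi_01 [of w q] by (auto simp: Tset_def in_diag_nodes)

lemma Eset_nonempty:
  assumes "finite K" "q \<in> K" "q < length w"
  shows "(q, thd w q, False) \<in> Eset w K"
  using assms nx_self [OF assms(1,2)] thd_props(1-3) [of w q] by (auto simp: Eset_def in_diag_nodes lab_def)

text \<open>By \<open>conn_iff_lab\<close> the circles are the fibres of \<open>lab\<close>, and
  each admissible name is taken by a node at the top of a cup-cap slot.\<close>

theorem circles_Uset:
  assumes K: "Uset w s \<noteq> {}"
  shows "circles w s = Tset w (Uset w s) ` {q \<in> Uset w s. tr w (Uset w s) q} \<union> {Eset w (Uset w s)}"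
proof -
  let ?K = "Uset w s"
  note fin = finite_Uset [of w s]
  have cls: "{y \<in> diag_nodes w. conn w s x y} = (case lab w ?K x of None \<Rightarrow> Eset w ?K | Some q \<Rightarrow> Tset w ?K q)"
    if x: "x \<in> diag_nodes w" for x
  proof -
    have "{y \<in> diag_nodes w. conn w s x y} = {y \<in> diag_nodes w. lab w ?K y = lab w ?K x}"
      using conn_iff_lab [OF K x] by metis
    also have "\<dots> = (case lab w ?K x of None \<Rightarrow> Eset w ?K | Some q \<Rightarrow> Tset w ?K q)"
    proof (cases "lab w ?K x")
      case None
      then show ?thesis by (simp add: Eset_def)
    next
      case (Some q)
      then have "tr w ?K q" by (simp add: lab_Some)
      then show ?thesis by (auto simp: Some lab_Some Tset_def)
    qed
    finally show ?thesis .
  qed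
  obtain q0 where q0: "q0 \<in> ?K" using K by auto
  show ?thesis
  proof
    show "circles w s \<subseteq> Tset w ?K ` {q \<in> ?K. tr w ?K q} \<union> {Eset w ?K}"
    proof
      fix c assume "c \<in> circles w s"
      then obtain x where x: "x \<in> diag_nodes w" "c = {y \<in> diag_nodes w. conn w s x y}"
        unfolding circles_def by auto
      show "c \<in> Tset w ?K ` {q \<in> ?K. tr w ?K q} \<union> {Eset w ?K}"
      proof (cases "lab w ?K x")
        case None
        then show ?thesis using x cls by simp
      next
        case (Some q)
        then have "q \<in> ?K" "tr w ?K q" using nx_in [OF fin K] by (auto simp: lab_Some)
        then show ?thesis using x cls Some by auto
      qed
    qed
    have "Eset w ?K \<in> circles w s"
    proof -
      have "(q0, thd w q0, False) \<in> Eset w ?K" by (rule Eset_nonempty [OF fin q0 Uset_less [OF q0]])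
      then have x0: "(q0, thd w q0, False) \<in> diag_nodes w" "lab w ?K (q0, thd w q0, False) = None"
        by (auto simp: Eset_def)
      show ?thesis unfolding circles_def
        by (rule image_eqI [OF _ x0(1)]) (use cls [OF x0(1)] x0(2) in simp)
    qed
    moreover have "Tset w ?K q \<in> circles w s" if q: "q \<in> ?K" "tr w ?K q" for q
    proof -
      have t: "(q, gi w q, False) \<in> Tset w ?K q" by (rule Tset_nonempty [OF fin q(1) Uset_less [OF q(1)]])
      then have x0: "(q, gi w q, False) \<in> diag_nodes w" "lab w ?K (q, gi w q, False) = Some q"
        using q(2) by (auto simp: Tset_def lab_Some)
      show ?thesis unfolding circles_def
        by (rule image_eqI [OF _ x0(1)]) (use cls [OF x0(1)] x0(2) in simp)
    qed
    ultimately show "Tset w ?K ` {q \<in> ?K. tr w ?K q} \<union> {Eset w ?K} \<subseteq> circles w s" by auto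
  qed
qed

definition Sset :: "braid3 \<Rightarrow> nat \<Rightarrow> node set" where
  "Sset w j = {x \<in> diag_nodes w. fst (snd x) = j}"

theorem circles_empty:
  assumes K: "Uset w s = {}"
  shows "circles w s = Sset w ` {..<3}"
proof -
  let ?n = "length w"
  have edge: "fst (snd a) = fst (snd b)" if "res_edge w s a b" for a b
    using that K unfolding res_edge_def Uset_def by auto
  have same: "fst (snd a) = fst (snd b)" if "conn w s a b" for a b
    using that by (induction rule: rtranclp_induct) (auto simp: res_adj_def edge dest: edge)
  have to0: "conn w s (k, j, b) (0, j, False)" if x: "(k, j, b) \<in> diag_nodes w" for k j b
  proof -
    have j: "j < 3" and k: "k \<le> ?n" using x by (auto simp: in_diag_nodes)
    have top: "conn w s (p, j, False) (0, j, False)" if "p \<le> ?n" for p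
      using conn_down [of 0 p w j s] that j K by (simp add: conn_sym)
    show ?thesis
    proof (cases b)
      case True
      have "Suc k mod Suc ?n \<le> ?n" by (metis less_Suc_eq_le mod_less_divisor zero_less_Suc)
      from conn_trans [OF conn_arc [OF k j] top [OF this]] show ?thesis using True by simp
    qed (use top [OF k] in simp)
  qed
  have cls: "{y \<in> diag_nodes w. conn w s x y} = Sset w (fst (snd x))" if x: "x \<in> diag_nodes w" for x
  proof
    show "{y \<in> diag_nodes w. conn w s x y} \<subseteq> Sset w (fst (snd x))"
    proof
      fix y assume "y \<in> {y \<in> diag_nodes w. conn w s x y}"
      then show "y \<in> Sset w (fst (snd x))" using same [of x y] by (simp add: Sset_def)
    qed
    show "Sset w (fst (snd x)) \<subseteq> {y \<in> diag_nodes w. conn w s x y}"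
    proof
      fix y assume "y \<in> Sset w (fst (snd x))"
      then have y: "y \<in> diag_nodes w" "fst (snd y) = fst (snd x)" by (auto simp: Sset_def)
      obtain k j b k' b' where "x = (k, j, b)" "y = (k', j, b')" using y(2) by (cases x; cases y) auto
      then have "conn w s x y" using to0 x y(1) by (metis conn_sym conn_trans)
      then show "y \<in> {y \<in> diag_nodes w. conn w s x y}" using y by simp
    qed
  qed
  have "circles w s = (\<lambda>x. Sset w (fst (snd x))) ` diag_nodes w"
    unfolding circles_def using cls by (intro image_cong) auto
  also have "\<dots> = Sset w ` (\<lambda>x. fst (snd x)) ` diag_nodes w" by (simp add: image_image)
  also have "(\<lambda>x. fst (snd x)) ` diag_nodes w = {..<3}"
    by (auto simp: diag_nodes_def image_iff)
  finally show ?thesis .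
qed

section \<open>Merges and splits\<close>

text \<open>K is the set of cup-cap slots of a resolution, and k is the slot where the cube edge changes the smoothing.\<close>

locale insertion =
  fixes w :: braid3 and K :: "nat set" and k :: nat
  assumes finK: "finite K" and neK: "K \<noteq> {}" and kK: "k \<notin> K"
    and ltK: "\<And>y. y \<in> insert k K \<Longrightarrow> y < length w"
begin

abbreviation "K' \<equiv> insert k K"

definition q :: nat where "q = nx K k"

lemma finK': "finite K'" "K' \<noteq> {}" using finK by auto

lemma qK: "q \<in> K" unfolding q_def by (rule nx_in [OF finK neK])

lemma q_neq: "q \<noteq> k" using qK kK by auto

lemma nx_K': "nx K' x = k \<or> nx K' x = nx K x"
proof -
  let ?y = "nx K' x"
  have y: "?y \<in> K' \<and> ((x \<le> ?y \<and> (\<forall>l\<in>K'. \<not> (x \<le> l \<and> l < ?y))) \<or> (\<forall>l\<in>K'. l < x \<and> ?y \<le> l))"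
    using nx_eq_iff [OF finK', of x ?y] by simp
  show ?thesis
  proof (cases "?y = k")
    case False
    then have "?y \<in> K \<and> ((x \<le> ?y \<and> (\<forall>l\<in>K. \<not> (x \<le> l \<and> l < ?y))) \<or> (\<forall>l\<in>K. l < x \<and> ?y \<le> l))"
      using y by blast
    then show ?thesis using nx_eq_iff [OF finK neK, of x ?y] by simp
  qed simp
qed

lemma nx_K'_k: "nx K' x = k \<Longrightarrow> nx K x = q"
proof -
  assume "nx K' x = k"
  then have y: "(x \<le> k \<and> (\<forall>l\<in>K'. \<not> (x \<le> l \<and> l < k))) \<or> (\<forall>l\<in>K'. l < x \<and> k \<le> l)"
    using nx_eq_iff [OF finK', of x k] by simp
  have q: "q \<in> K \<and> ((k \<le> q \<and> (\<forall>l\<in>K. \<not> (k \<le> l \<and> l < q))) \<or> (\<forall>l\<in>K. l < k \<and> q \<le> l))"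
    using nx_eq_iff [OF finK neK, of k q] by (simp add: q_def)
  have "q \<in> K \<and> ((x \<le> q \<and> (\<forall>l\<in>K. \<not> (x \<le> l \<and> l < q))) \<or> (\<forall>l\<in>K. l < x \<and> q \<le> l))"
  proof (cases "x \<le> k \<and> (\<forall>l\<in>K'. \<not> (x \<le> l \<and> l < k))")
    case True
    show ?thesis
    proof (cases "k \<le> q \<and> (\<forall>l\<in>K. \<not> (k \<le> l \<and> l < q))")
      case A: True
      have "\<not> (x \<le> l \<and> l < q)" if "l \<in> K" for l
        using True A that by (metis insertCI not_le)
      then show ?thesis using q A True by auto
    next
      case B: False
      then have "\<forall>l\<in>K. l < k \<and> q \<le> l" using q by blast
      then have "\<forall>l\<in>K. l < x \<and> q \<le> l" using True by (metis insertCI not_le)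
      then show ?thesis using q by blast
    qed
  next
    case False
    then have a: "\<forall>l\<in>K'. l < x \<and> k \<le> l" using y by blast
    then have "\<forall>l\<in>K. \<not> l < k" by auto
    then have "\<forall>l\<in>K. \<not> (k \<le> l \<and> l < q)" using q neK by blast
    then have "\<forall>l\<in>K. l < x \<and> q \<le> l" using a by (auto simp: not_less)
    then show ?thesis using q by blast
  qed
  then show "nx K x = q" using nx_eq_iff [OF finK neK, of x q] by simp
qed

text \<open>The new cup-cap cuts the region that ends at \<open>q\<close> in two; all other regions
  are unchanged.\<close>

lemma nx_q: "nx K x = q \<longleftrightarrow> nx K' x = k \<or> nx K' x = q"
  using nx_K' [of x] nx_K'_k [of x] q_neq qK kK by metis

lemma nx_other: "l \<in> K \<Longrightarrow> l \<noteq> q \<Longrightarrow> nx K x = l \<longleftrightarrow> nx K' x = l"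
  using nx_K' [of x] nx_K'_k [of x] kK by metis

lemma nx_next: "nx K' (Suc k) = q"
proof -
  have "nx K (Suc k) = q" unfolding q_def by (rule nx_Suc [OF finK neK kK])
  moreover have "nx K' (Suc k) \<noteq> k"
  proof
    assume "nx K' (Suc k) = k"
    then have "\<forall>l\<in>K'. l < Suc k \<and> k \<le> l" using nx_eq_iff [OF finK', of "Suc k" k] by auto
    then have "K \<subseteq> {k}" by force
    then show False using kK neK by auto
  qed
  ultimately show ?thesis using nx_K' [of "Suc k"] by auto
qed

definition p :: nat where "p = (SOME p. p \<in> K \<and> nx K (Suc p) = q)"

lemma p_props: "p \<in> K" "nx K (Suc p) = q"
proof -
  have "\<exists>p. p \<in> K \<and> nx K (Suc p) = q" using nx_Suc_surj [OF finK neK qK] by blast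
  from someI_ex [OF this] show "p \<in> K" "nx K (Suc p) = q" by (simp_all add: p_def)
qed

lemma nx_prev: "nx K' (Suc p) = k"
proof -
  have "nx K' (Suc p) \<noteq> q"
    using nx_Suc_inj [OF finK', of p k] p_props(1) nx_next kK by (metis insertCI)
  then show ?thesis using nx_K' [of "Suc p"] p_props(2) by auto
qed

lemma tr_q: "tr w K q \<longleftrightarrow> gi w p = gi w q"
  using tr_iff [OF finK neK p_props] .

lemma tr_k: "tr w K' k \<longleftrightarrow> gi w p = gi w k"
  using tr_iff [OF finK' _ nx_prev] p_props(1) by auto

lemma tr_q': "tr w K' q \<longleftrightarrow> gi w k = gi w q"
  using tr_iff [OF finK' _ nx_next] by auto

lemma tr_other:
  assumes "l \<in> K" "l \<noteq> q"
  shows "tr w K' l \<longleftrightarrow> tr w K l"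
proof -
  obtain m where m: "m \<in> K" "nx K (Suc m) = l" using nx_Suc_surj [OF finK neK assms(1)] by blast
  then have m': "nx K' (Suc m) = l" using nx_other [OF assms] by simp
  have "m \<in> K'" using m(1) by simp
  from tr_iff [where w = w, OF finK neK m] tr_iff [where w = w, OF finK' this m'] show ?thesis by simp
qed

lemma Tset_other: "l \<in> K \<Longrightarrow> l \<noteq> q \<Longrightarrow> Tset w K' l = Tset w K l"
  unfolding Tset_def using nx_other by blast

lemma lab_other:
  assumes "nx K (npos x) \<noteq> q"
  shows "lab w K' x = lab w K x"
proof -
  let ?l = "nx K (npos x)"
  have "?l \<in> K" by (rule nx_in [OF finK neK])
  then have "nx K' (npos x) = ?l" "tr w K' ?l = tr w K ?l"
    using nx_other [of ?l "npos x"] tr_other [of ?l] assms by auto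
  then show ?thesis by (simp add: lab_def)
qed

definition Com :: "node set set" where
  "Com = Tset w K ` {l \<in> K. l \<noteq> q \<and> tr w K l}"

definition circ :: "nat set \<Rightarrow> node set set" where
  "circ J = Tset w J ` {l \<in> J. tr w J l} \<union> {Eset w J}"

lemma circ_K: "circ K = Com \<union> {Eset w K} \<union> (if tr w K q then {Tset w K q} else {})"
  using qK by (auto simp: circ_def Com_def)

lemma circ_K': "circ K' = Com \<union> {Eset w K'} \<union> (if tr w K' k then {Tset w K' k} else {})
    \<union> (if tr w K' q then {Tset w K' q} else {})"
proof -
  have "{l \<in> K'. tr w K' l} = {l \<in> K. l \<noteq> q \<and> tr w K l} \<union> (if tr w K' k then {k} else {}) \<union> (if tr w K' q then {q} else {})"
    using tr_other qK kK by auto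
  moreover have "Tset w K' ` {l \<in> K. l \<noteq> q \<and> tr w K l} = Com"
    unfolding Com_def using Tset_other by (intro image_cong) auto
  ultimately show ?thesis by (auto simp: circ_def image_Un)
qed

lemma Tset_disj: "l \<noteq> l' \<Longrightarrow> Tset w J l \<inter> Tset w J l' = {}"
  by (auto simp: Tset_def)

lemma Eset_disj: "tr w J l \<Longrightarrow> Tset w J l \<inter> Eset w J = {}"
  by (auto simp: Tset_def Eset_def lab_def Let_def)

lemma ne:
  "l \<in> K \<Longrightarrow> Tset w K l \<noteq> {}" "l \<in> K' \<Longrightarrow> Tset w K' l \<noteq> {}" "Eset w K \<noteq> {}" "Eset w K' \<noteq> {}"
  using Tset_nonempty [OF finK, of l w] Tset_nonempty [OF finK'(1), of l w]
    Eset_nonempty [OF finK qK, of w] Eset_nonempty [OF finK'(1), of k w] ltK qK by auto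

text \<open>In every case one circle \<open>A\<close> of the smaller resolution or the larger one is
  the disjoint union of two circles \<open>B\<close>, \<open>C\<close> of the other one.\<close>

lemma gi_neq: "gi w a \<noteq> gi w b \<Longrightarrow> gi w b \<noteq> gi w c \<Longrightarrow> gi w a = gi w c"
  using gi_01 [of w a] gi_01 [of w b] gi_01 [of w c] by auto

lemma Tset_split: "gi w k = gi w q \<Longrightarrow> Tset w K q = Tset w K' k \<union> Tset w K' q"
  unfolding Tset_def using nx_q by auto

lemma lab_K: "nx K (npos x) = q \<Longrightarrow> lab w K x =
   (if gi w p = gi w q \<and> (fst (snd x) = gi w q \<or> fst (snd x) = Suc (gi w q)) then Some q else None)"
  by (simp add: lab_def Let_def tr_q)

lemma lab_K'_k: "nx K' (npos x) = k \<Longrightarrow> lab w K' x =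
   (if gi w p = gi w k \<and> (fst (snd x) = gi w k \<or> fst (snd x) = Suc (gi w k)) then Some k else None)"
  by (simp add: lab_def Let_def tr_k)

lemma lab_K'_q: "nx K' (npos x) = q \<Longrightarrow> lab w K' x =
   (if gi w k = gi w q \<and> (fst (snd x) = gi w q \<or> fst (snd x) = Suc (gi w q)) then Some q else None)"
  by (simp add: lab_def Let_def tr_q')

lemma Eset_same:
  assumes "gi w p = gi w k" "gi w k = gi w q"
  shows "Eset w K' = Eset w K"
proof -
  have "lab w K' x = None \<longleftrightarrow> lab w K x = None" for x
  proof (cases "nx K (npos x) = q")
    case True
    then consider "nx K' (npos x) = k" | "nx K' (npos x) = q" using nx_q by blast
    then show ?thesis
      by cases (simp_all add: lab_K [OF True] lab_K'_k lab_K'_q assms)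
  qed (simp add: lab_other)
  then show ?thesis by (simp add: Eset_def)
qed

text \<open>A cup-cap at the other position cuts the trivial circle before \<open>q\<close> into
  arcs between different positions, which belong to the essential circle.\<close>

lemma Eset_merge:
  assumes "gi w p = gi w q" "gi w k \<noteq> gi w q"
  shows "Eset w K' = Tset w K q \<union> Eset w K"
proof -
  have "lab w K' x = None \<longleftrightarrow> lab w K x = None \<or> nx K (npos x) = q \<and> (fst (snd x) = gi w q \<or> fst (snd x) = Suc (gi w q))" for x
  proof (cases "nx K (npos x) = q")
    case True
    then consider "nx K' (npos x) = k" | "nx K' (npos x) = q" using nx_q by blast
    then show ?thesis
      by cases (use assms in \<open>simp_all add: lab_K [OF True] lab_K'_k lab_K'_q True\<close>)
  qed (simp add: lab_other)
  then show ?thesis by (auto simp: Eset_def Tset_def)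
qed

lemma Eset_split_k:
  assumes "gi w p = gi w k" "gi w k \<noteq> gi w q"
  shows "Eset w K = Tset w K' k \<union> Eset w K'"
proof -
  have "lab w K x = None \<longleftrightarrow> lab w K' x = None \<or> nx K' (npos x) = k \<and> (fst (snd x) = gi w k \<or> fst (snd x) = Suc (gi w k))" for x
  proof (cases "nx K (npos x) = q")
    case True
    then consider "nx K' (npos x) = k" | "nx K' (npos x) = q" using nx_q by blast
    then show ?thesis
      by cases (use assms q_neq in \<open>simp_all add: lab_K [OF True] lab_K'_k lab_K'_q\<close>)
  next
    case False
    then show ?thesis using nx_q by (auto simp add: lab_other)
  qed
  then show ?thesis by (auto simp: Eset_def Tset_def)
qed

lemma Eset_split_q:
  assumes "gi w p \<noteq> gi w k" "gi w k = gi w q"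
  shows "Eset w K = Tset w K' q \<union> Eset w K'"
proof -
  have "lab w K x = None \<longleftrightarrow> lab w K' x = None \<or> nx K' (npos x) = q \<and> (fst (snd x) = gi w q \<or> fst (snd x) = Suc (gi w q))" for x
  proof (cases "nx K (npos x) = q")
    case True
    then consider "nx K' (npos x) = k" | "nx K' (npos x) = q" using nx_q by blast
    then show ?thesis
      by cases (use assms q_neq in \<open>simp_all add: lab_K [OF True] lab_K'_k lab_K'_q\<close>)
  next
    case False
    then show ?thesis using nx_q by (auto simp add: lab_other)
  qed
  then show ?thesis by (auto simp: Eset_def Tset_def)
qed

end

text \<open>One notion for both kinds of edges: read from the first family to the second it is a
  split, read backwards it is a merge.\<close>

definition cut :: "'a set set \<Rightarrow> 'a set set \<Rightarrow> 'a set set \<Rightarrow> 'a set \<Rightarrow> 'a set \<Rightarrow> 'a set \<Rightarrow> bool" where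
  "cut \<P> \<P>' \<C> A B C \<longleftrightarrow> B \<noteq> C \<and> \<P> - \<P>' = {A} \<and> \<P>' - \<P> = {B, C} \<and> \<P> \<inter> \<P>' = \<C>"

lemma cutI:
  assumes "\<P> = \<C> \<union> {A}" "\<P>' = \<C> \<union> {B, C}" "A = B \<union> C" "B \<inter> C = {}" "B \<noteq> {}" "C \<noteq> {}"
    and d: "\<And>c. c \<in> \<C> \<Longrightarrow> c \<noteq> {} \<and> c \<inter> A = {}"
  shows "cut \<P> \<P>' \<C> A B C"
proof -
  have "A \<notin> \<C>" "B \<notin> \<C>" "C \<notin> \<C>" "A \<noteq> B" "A \<noteq> C" "B \<noteq> C"
    using assms(3-6) d by blast+
  then show ?thesis unfolding cut_def assms(1,2) by blast
qed

lemma kh_term_split: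
  assumes "cut (circles w s) (circles w s') \<C> A B C"
  shows "kh_term w (s, P) (s', P') \<longleftrightarrow> (\<exists>k<length w. k \<notin> s \<and> s' = insert k s) \<and> P \<inter> \<C> = P' \<inter> \<C> \<and>
     (if A \<in> P then (B \<in> P' \<longleftrightarrow> C \<notin> P') else B \<notin> P' \<and> C \<notin> P')"
proof -
  have *: "B \<noteq> C" "circles w s - circles w s' = {A}" "circles w s' - circles w s = {B, C}" "circles w s \<inter> circles w s' = \<C>"
    using assms by (auto simp: cut_def)
  have 1: "\<not> (\<exists>a b c. a \<noteq> b \<and> {A} = {a, b} \<and> {B, C} = {c} \<and> (a \<in> P \<or> b \<in> P) \<and> (c \<in> P' \<longleftrightarrow> a \<in> P \<and> b \<in> P))"
    by (auto simp: doubleton_eq_iff)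
  have 2: "(\<exists>a c d. c \<noteq> d \<and> {A} = {a} \<and> {B, C} = {c, d} \<and> (if a \<in> P then (c \<in> P' \<longleftrightarrow> d \<notin> P') else c \<notin> P' \<and> d \<notin> P'))
     \<longleftrightarrow> (if A \<in> P then (B \<in> P' \<longleftrightarrow> C \<notin> P') else B \<notin> P' \<and> C \<notin> P')"
    using *(1) by (auto simp: doubleton_eq_iff)
  show ?thesis unfolding kh_term_def Let_def fst_conv snd_conv *(2-4) 2 using 1 by blast
qed

lemma kh_term_merge:
  assumes "cut (circles w s') (circles w s) \<C> A B C"
  shows "kh_term w (s, P) (s', P') \<longleftrightarrow> (\<exists>k<length w. k \<notin> s \<and> s' = insert k s) \<and> P \<inter> \<C> = P' \<inter> \<C> \<and>
     (B \<in> P \<or> C \<in> P) \<and> (A \<in> P' \<longleftrightarrow> B \<in> P \<and> C \<in> P)"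
proof -
  have *: "B \<noteq> C" "circles w s' - circles w s = {A}" "circles w s - circles w s' = {B, C}" "circles w s \<inter> circles w s' = \<C>"
    using assms by (auto simp: cut_def)
  have 1: "\<not> (\<exists>a c d. c \<noteq> d \<and> {B, C} = {a} \<and> {A} = {c, d} \<and> (if a \<in> P then (c \<in> P' \<longleftrightarrow> d \<notin> P') else c \<notin> P' \<and> d \<notin> P'))"
    by (auto simp: doubleton_eq_iff)
  have 2: "(\<exists>a b c. a \<noteq> b \<and> {B, C} = {a, b} \<and> {A} = {c} \<and> (a \<in> P \<or> b \<in> P) \<and> (c \<in> P' \<longleftrightarrow> a \<in> P \<and> b \<in> P))
     \<longleftrightarrow> (B \<in> P \<or> C \<in> P) \<and> (A \<in> P' \<longleftrightarrow> B \<in> P \<and> C \<in> P)"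
    using *(1) by (auto simp: doubleton_eq_iff)
  show ?thesis unfolding kh_term_def Let_def fst_conv snd_conv *(2-4) 2 using 1 by blast
qed

text \<open>The states of weight one: the trivial circle ending in slot \<open>l\<close> carries the label +
  iff \<open>\<tau> ! l = Some 0\<close>; the sign \<open>\<epsilon>\<close> is the label of the essential circle.\<close>

definition lset :: "braid3 \<Rightarrow> bool \<Rightarrow> nat set \<Rightarrow> nat option list \<Rightarrow> node set set" where
  "lset w \<epsilon> J \<tau> = Tset w J ` {l \<in> J. tr w J l \<and> \<tau> ! l = Some 0} \<union> (if \<epsilon> then {Eset w J} else {})"

definition degs :: "braid3 \<Rightarrow> nat set \<Rightarrow> nat option list \<Rightarrow> bool" where
  "degs w J \<tau> \<longleftrightarrow> (\<forall>l\<in>J. \<exists>e\<le>2. \<tau> ! l = Some e \<and> (even e \<longleftrightarrow> tr w J l))"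

context insertion
begin

lemma mem_lset:
  assumes "J = K \<or> J = K'"
  shows "l \<in> J \<Longrightarrow> tr w J l \<Longrightarrow> Tset w J l \<in> lset w \<epsilon> J \<tau> \<longleftrightarrow> \<tau> ! l = Some 0"
    "Eset w J \<in> lset w \<epsilon> J \<tau> \<longleftrightarrow> \<epsilon>"
proof -
  have ne': "Tset w J m \<noteq> {}" "Eset w J \<noteq> {}" if "m \<in> J" for m using assms ne that by auto
  have E: "Tset w J m \<noteq> Eset w J" if "m \<in> J" "tr w J m" for m
    using Eset_disj [OF that(2)] ne' [OF that(1)] by auto
  show "Eset w J \<in> lset w \<epsilon> J \<tau> \<longleftrightarrow> \<epsilon>" using E by (auto simp: lset_def)
  assume l: "l \<in> J" "tr w J l"
  have "Tset w J m = Tset w J l \<longleftrightarrow> m = l" if "m \<in> J" for m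
    using Tset_disj [of m l J] ne' [OF that] by auto
  then show "Tset w J l \<in> lset w \<epsilon> J \<tau> \<longleftrightarrow> \<tau> ! l = Some 0"
    using l E [OF l] by (auto simp: lset_def)
qed

text \<open>The parity of each degree is fixed by the resolution. An odd degree is 1 and an even one
  is determined by the label of its circle, so equal labels on the common circles mean equal
  entries.\<close>

lemma Com_agree:
  assumes "degs w K \<tau>" "degs w K' \<tau>'"
  shows "lset w \<epsilon> K \<tau> \<inter> Com = lset w \<epsilon> K' \<tau>' \<inter> Com \<longleftrightarrow> (\<forall>l\<in>K. l \<noteq> q \<longrightarrow> \<tau> ! l = \<tau>' ! l)"
proof -
  have 1: "Tset w K l \<in> lset w \<epsilon> K \<tau> \<longleftrightarrow> \<tau> ! l = Some 0" "Tset w K l \<in> lset w \<epsilon> K' \<tau>' \<longleftrightarrow> \<tau>' ! l = Some 0"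
    if "l \<in> K" "l \<noteq> q" "tr w K l" for l
    using mem_lset(1) [of K l \<epsilon> \<tau>] mem_lset(1) [of K' l \<epsilon> \<tau>'] Tset_other [of l] tr_other [of l] that by auto
  have 2: "\<tau> ! l = \<tau>' ! l \<longleftrightarrow> (tr w K l \<longrightarrow> (\<tau> ! l = Some 0 \<longleftrightarrow> \<tau>' ! l = Some 0))" if l: "l \<in> K" "l \<noteq> q" for l
  proof -
    obtain e where e: "e \<le> 2" "\<tau> ! l = Some e" "even e \<longleftrightarrow> tr w K l" using assms(1) l by (auto simp: degs_def)
    obtain f where f: "f \<le> 2" "\<tau>' ! l = Some f" "even f \<longleftrightarrow> tr w K' l" using assms(2) l by (auto simp: degs_def)
    have "e = 0 \<or> e = 1 \<or> e = 2" "f = 0 \<or> f = 1 \<or> f = 2" using e(1) f(1) by linarith+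
    then show ?thesis using e f tr_other [OF l] by auto
  qed
  have "lset w \<epsilon> K \<tau> \<inter> Com = lset w \<epsilon> K' \<tau>' \<inter> Com \<longleftrightarrow>
     (\<forall>l\<in>K. l \<noteq> q \<longrightarrow> tr w K l \<longrightarrow> (Tset w K l \<in> lset w \<epsilon> K \<tau> \<longleftrightarrow> Tset w K l \<in> lset w \<epsilon> K' \<tau>'))"
    unfolding Com_def by blast
  also have "\<dots> \<longleftrightarrow> (\<forall>l\<in>K. l \<noteq> q \<longrightarrow> \<tau> ! l = \<tau>' ! l)" using 1 2 by blast
  finally show ?thesis .
qed

definition degprop :: "nat option list \<Rightarrow> nat option list \<Rightarrow> nat \<Rightarrow> nat \<Rightarrow> nat \<Rightarrow> bool" where
  "degprop \<tau> \<tau>' D e f \<longleftrightarrow> (\<tau> ! q = Some D \<and> \<tau>' ! k = Some e \<and> \<tau>' ! q = Some f) \<and>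
    ((D = 0 \<or> D = 1 \<or> D = 2) \<and> (e = 0 \<or> e = 1 \<or> e = 2) \<and> (f = 0 \<or> f = 1 \<or> f = 2)) \<and>
    ((even D \<longleftrightarrow> gi w p = gi w q) \<and> (even e \<longleftrightarrow> gi w p = gi w k) \<and> (even f \<longleftrightarrow> gi w k = gi w q))"

lemma deg_ex:
  assumes "degs w K \<tau>" "degs w K' \<tau>'"
  shows "\<exists>D e f. degprop \<tau> \<tau>' D e f"
proof -
  obtain D where D: "D \<le> 2" "\<tau> ! q = Some D" "even D \<longleftrightarrow> tr w K q"
    using assms(1) qK by (auto simp: degs_def)
  obtain e where e: "e \<le> 2" "\<tau>' ! k = Some e" "even e \<longleftrightarrow> tr w K' k"
    using assms(2) by (auto simp: degs_def)
  obtain f where f: "f \<le> 2" "\<tau>' ! q = Some f" "even f \<longleftrightarrow> tr w K' q"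
    using assms(2) qK by (auto simp: degs_def)
  have le2: "x = 0 \<or> x = 1 \<or> x = 2" if "x \<le> 2" for x :: nat using that by linarith
  show ?thesis
    unfolding degprop_def
    by (intro exI conjI, rule D(2), rule e(2), rule f(2), rule le2 [OF D(1)], rule le2 [OF e(1)], rule le2 [OF f(1)])
      (simp_all only: D(3) e(3) f(3) tr_q tr_k tr_q')
qed

text \<open>There are only two positions, so those of \<open>p\<close>, \<open>k\<close>,
  \<open>q\<close> form four patterns. The essential circle stays out of the change only if all
  three agree.\<close>

lemma circ_cases:
  obtains
    (pkq) "gi w p = gi w k" "gi w k = gi w q"
      "cut (circ K) (circ K') (Com \<union> {Eset w K}) (Tset w K q) (Tset w K' k) (Tset w K' q)" "Eset w K' = Eset w K"
  | (none) "gi w p \<noteq> gi w k" "gi w k \<noteq> gi w q"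
      "cut (circ K') (circ K) Com (Eset w K') (Tset w K q) (Eset w K)"
  | (pk) "gi w p = gi w k" "gi w k \<noteq> gi w q"
      "cut (circ K) (circ K') Com (Eset w K) (Tset w K' k) (Eset w K')"
  | (kq) "gi w p \<noteq> gi w k" "gi w k = gi w q"
      "cut (circ K) (circ K') Com (Eset w K) (Tset w K' q) (Eset w K')"
proof -
  have cK: "c \<noteq> {}" "tr w K q \<Longrightarrow> c \<inter> Tset w K q = {}" "c \<inter> Eset w K = {}" "tr w K' k \<Longrightarrow> c \<inter> Tset w K' k = {}"
    "tr w K' q \<Longrightarrow> c \<inter> Tset w K' q = {}" "c \<inter> Eset w K' = {}" if "c \<in> Com" for c
  proof -
    obtain l where l: "l \<in> K" "l \<noteq> q" "tr w K l" "c = Tset w K l" using \<open>c \<in> Com\<close> by (auto simp: Com_def)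
    have l': "c = Tset w K' l" "tr w K' l" "l \<noteq> k" using l Tset_other [of l] tr_other [of l] kK by auto
    show "c \<noteq> {}" using l ne(1) by simp
    show "c \<inter> Tset w K q = {}" unfolding l(4) by (rule Tset_disj [OF l(2)])
    show "c \<inter> Eset w K = {}" unfolding l(4) by (rule Eset_disj [OF l(3)])
    show "c \<inter> Tset w K' k = {}" unfolding l'(1) by (rule Tset_disj [OF l'(3)])
    show "c \<inter> Tset w K' q = {}" unfolding l'(1) by (rule Tset_disj [OF l(2)])
    show "c \<inter> Eset w K' = {}" unfolding l'(1) by (rule Eset_disj [OF l'(2)])
  qed
  consider "gi w p = gi w k" "gi w k = gi w q" | "gi w p \<noteq> gi w k" "gi w k \<noteq> gi w q"
    | "gi w p = gi w k" "gi w k \<noteq> gi w q" | "gi w p \<noteq> gi w k" "gi w k = gi w q" by blast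
  then show thesis
  proof cases
    case 1
    have t: "tr w K q" "tr w K' k" "tr w K' q" using 1 by (simp_all add: tr_q tr_k tr_q')
    have E: "Eset w K' = Eset w K" by (rule Eset_same [OF 1])
    show ?thesis
    proof (rule pkq [OF 1 _ E], rule cutI)
      show "circ K = Com \<union> {Eset w K} \<union> {Tset w K q}" using circ_K t by simp
      show "circ K' = Com \<union> {Eset w K} \<union> {Tset w K' k, Tset w K' q}" using circ_K' t E by auto
      show "Tset w K q = Tset w K' k \<union> Tset w K' q" by (rule Tset_split [OF 1(2)])
      show "Tset w K' k \<inter> Tset w K' q = {}" using q_neq by (intro Tset_disj) auto
      show "Tset w K' k \<noteq> {}" "Tset w K' q \<noteq> {}" using ne(2) qK by auto
      show "c \<noteq> {} \<and> c \<inter> Tset w K q = {}" if "c \<in> Com \<union> {Eset w K}" for c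
        using that cK [of c] t(1) ne(3) Eset_disj [OF t(1)] by (auto simp: Int_commute)
    qed
  next
    case 2
    have pq: "gi w p = gi w q" using gi_neq 2 by blast
    have t: "tr w K q" "\<not> tr w K' k" "\<not> tr w K' q" using 2 pq by (simp_all add: tr_q tr_k tr_q')
    have E: "Eset w K' = Tset w K q \<union> Eset w K" by (rule Eset_merge [OF pq 2(2)])
    show ?thesis
    proof (rule none [OF 2], rule cutI [OF _ _ E])
      show "circ K' = Com \<union> {Eset w K'}" using circ_K' t by simp
      show "circ K = Com \<union> {Tset w K q, Eset w K}" using circ_K t by auto
      show "Tset w K q \<inter> Eset w K = {}" by (rule Eset_disj [OF t(1)])
      show "Tset w K q \<noteq> {}" "Eset w K \<noteq> {}" using ne qK by auto
      show "c \<noteq> {} \<and> c \<inter> Eset w K' = {}" if "c \<in> Com" for c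
        using cK(1,6) [OF that] by simp
    qed
  next
    case 3
    have pq: "gi w p \<noteq> gi w q" using 3 by simp
    have t: "\<not> tr w K q" "tr w K' k" "\<not> tr w K' q" using 3 pq by (simp_all add: tr_q tr_k tr_q')
    have E: "Eset w K = Tset w K' k \<union> Eset w K'" by (rule Eset_split_k [OF 3])
    show ?thesis
    proof (rule pk [OF 3], rule cutI [OF _ _ E])
      show "circ K = Com \<union> {Eset w K}" using circ_K t by simp
      show "circ K' = Com \<union> {Tset w K' k, Eset w K'}" using circ_K' t by auto
      show "Tset w K' k \<inter> Eset w K' = {}" by (rule Eset_disj [OF t(2)])
      show "Tset w K' k \<noteq> {}" "Eset w K' \<noteq> {}" using ne by auto
      show "c \<noteq> {} \<and> c \<inter> Eset w K = {}" if "c \<in> Com" for c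
        using cK(1,3) [OF that] by simp
    qed
  next
    case 4
    have pq: "gi w p \<noteq> gi w q" using 4 by simp
    have t: "\<not> tr w K q" "\<not> tr w K' k" "tr w K' q" using 4 pq by (simp_all add: tr_q tr_k tr_q')
    have E: "Eset w K = Tset w K' q \<union> Eset w K'" by (rule Eset_split_q [OF 4])
    show ?thesis
    proof (rule kq [OF 4], rule cutI [OF _ _ E])
      show "circ K = Com \<union> {Eset w K}" using circ_K t by simp
      show "circ K' = Com \<union> {Tset w K' q, Eset w K'}" using circ_K' t by auto
      show "Tset w K' q \<inter> Eset w K' = {}" by (rule Eset_disj [OF t(3)])
      show "Tset w K' q \<noteq> {}" "Eset w K' \<noteq> {}" using ne qK by auto
      show "c \<noteq> {} \<and> c \<inter> Eset w K = {}" if "c \<in> Com" for c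
        using cK(1,3) [OF that] by simp
    qed
  qed
qed

definition ipair :: "nat option list \<Rightarrow> nat option list \<Rightarrow> nat \<Rightarrow> nat \<Rightarrow> nat \<Rightarrow> bool" where
  "ipair \<tau> \<tau>' D e f \<longleftrightarrow> \<tau> ! q = Some D \<and> \<tau>' ! k = Some e \<and> \<tau>' ! q = Some f \<and> (\<forall>l\<in>K. l \<noteq> q \<longrightarrow> \<tau> ! l = \<tau>' ! l)"

text \<open>With the essential label held fixed, the Khovanov rules say in every pattern that the
  coproduct raises the total degree by 2; \<open>\<epsilon>\<close> drops out of the
  condition.\<close>

theorem kh_insert:
  assumes d: "degs w K \<tau>" "degs w K' \<tau>'"
    and c: "circles w s = circ K" "circles w s' = circ K'"
    and fl: "\<exists>k<length w. k \<notin> s \<and> s' = insert k s"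
  shows "kh_term w (s, lset w \<epsilon> K \<tau>) (s', lset w \<epsilon> K' \<tau>') \<longleftrightarrow> (\<exists>D e f. ipair \<tau> \<tau>' D e f \<and> e + f = D + 2)"
proof -
  from deg_ex [OF d] obtain D e f where dp: "degprop \<tau> \<tau>' D e f" by blast
  note va = dp [unfolded degprop_def, THEN conjunct1]
  note vb = dp [unfolded degprop_def, THEN conjunct2, THEN conjunct1]
  note vc = dp [unfolded degprop_def, THEN conjunct2, THEN conjunct2]
  note v = va [THEN conjunct1] va [THEN conjunct2, THEN conjunct1] va [THEN conjunct2, THEN conjunct2]
    vb [THEN conjunct1] vb [THEN conjunct2, THEN conjunct1] vb [THEN conjunct2, THEN conjunct2]
    vc [THEN conjunct1] vc [THEN conjunct2, THEN conjunct1] vc [THEN conjunct2, THEN conjunct2]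
  have R: "(\<exists>D e f. ipair \<tau> \<tau>' D e f \<and> e + f = D + 2) \<longleftrightarrow> (\<forall>l\<in>K. l \<noteq> q \<longrightarrow> \<tau> ! l = \<tau>' ! l) \<and> e + f = D + 2"
    using v(1-3) by (auto simp: ipair_def)
  note A = Com_agree [OF d, of \<epsilon>]
  have E: "Eset w K \<in> lset w \<epsilon> K \<tau> \<longleftrightarrow> \<epsilon>" "Eset w K' \<in> lset w \<epsilon> K' \<tau>' \<longleftrightarrow> \<epsilon>"
    using mem_lset(2) [of K \<epsilon> \<tau>] mem_lset(2) [of K' \<epsilon> \<tau>'] by simp_all
  show ?thesis
  proof (cases rule: circ_cases)
    case pkq
    have t: "tr w K q" "tr w K' k" "tr w K' q" using pkq by (simp_all add: tr_q tr_k tr_q')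
    have M: "Tset w K q \<in> lset w \<epsilon> K \<tau> \<longleftrightarrow> D = 0" "Tset w K' k \<in> lset w \<epsilon> K' \<tau>' \<longleftrightarrow> e = 0" "Tset w K' q \<in> lset w \<epsilon> K' \<tau>' \<longleftrightarrow> f = 0"
      using mem_lset(1) [of K q \<epsilon> \<tau>] mem_lset(1) [of K' k \<epsilon> \<tau>'] mem_lset(1) [of K' q \<epsilon> \<tau>'] t qK v by auto
    have A': "lset w \<epsilon> K \<tau> \<inter> (Com \<union> {Eset w K}) = lset w \<epsilon> K' \<tau>' \<inter> (Com \<union> {Eset w K}) \<longleftrightarrow> (\<forall>l\<in>K. l \<noteq> q \<longrightarrow> \<tau> ! l = \<tau>' ! l)"
      using E pkq(4) A by auto
    have pa: "even D" "even e" "even f" using pkq v by auto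
    show ?thesis unfolding R kh_term_split [OF pkq(3) [folded c]] A' M using fl v(4-6) pa by auto
  next
    case none
    then have pq: "gi w p = gi w q" using gi_neq by blast
    have t: "tr w K q" using pq by (simp add: tr_q)
    have M: "Tset w K q \<in> lset w \<epsilon> K \<tau> \<longleftrightarrow> D = 0" using mem_lset(1) [of K q \<epsilon> \<tau>] t qK v by auto
    have pa: "even D" "odd e" "odd f" using none pq v by auto
    show ?thesis unfolding R kh_term_merge [OF none(3) [folded c]] A M E using fl v(4-6) pa by auto
  next
    case pk
    have t: "tr w K' k" using pk by (simp add: tr_k)
    have M: "Tset w K' k \<in> lset w \<epsilon> K' \<tau>' \<longleftrightarrow> e = 0" using mem_lset(1) [of K' k \<epsilon> \<tau>'] t v by auto
    have pa: "odd D" "even e" "odd f" using pk v by auto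
    show ?thesis unfolding R kh_term_split [OF pk(3) [folded c]] A M E using fl v(4-6) pa by auto
  next
    case kq
    have t: "tr w K' q" using kq by (simp add: tr_q')
    have M: "Tset w K' q \<in> lset w \<epsilon> K' \<tau>' \<longleftrightarrow> f = 0" using mem_lset(1) [of K' q \<epsilon> \<tau>'] t v qK by auto
    have pa: "odd D" "odd e" "even f" using kq v by auto
    show ?thesis unfolding R kh_term_split [OF kq(3) [folded c]] A M E using fl v(4-6) pa by auto
  qed
qed

text \<open>The same four patterns with merges and splits exchanged: the product preserves the total
  degree.\<close>

theorem kh_remove:
  assumes d: "degs w K \<tau>" "degs w K' \<tau>'"
    and c: "circles w s = circ K" "circles w s' = circ K'"
    and fl: "\<exists>k<length w. k \<notin> s' \<and> s = insert k s'"
  shows "kh_term w (s', lset w \<epsilon> K' \<tau>') (s, lset w \<epsilon> K \<tau>) \<longleftrightarrow> (\<exists>D e f. ipair \<tau> \<tau>' D e f \<and> e + f = D)"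
proof -
  from deg_ex [OF d] obtain D e f where dp: "degprop \<tau> \<tau>' D e f" by blast
  note va = dp [unfolded degprop_def, THEN conjunct1]
  note vb = dp [unfolded degprop_def, THEN conjunct2, THEN conjunct1]
  note vc = dp [unfolded degprop_def, THEN conjunct2, THEN conjunct2]
  note v = va [THEN conjunct1] va [THEN conjunct2, THEN conjunct1] va [THEN conjunct2, THEN conjunct2]
    vb [THEN conjunct1] vb [THEN conjunct2, THEN conjunct1] vb [THEN conjunct2, THEN conjunct2]
    vc [THEN conjunct1] vc [THEN conjunct2, THEN conjunct1] vc [THEN conjunct2, THEN conjunct2]
  have R: "(\<exists>D e f. ipair \<tau> \<tau>' D e f \<and> e + f = D) \<longleftrightarrow> (\<forall>l\<in>K. l \<noteq> q \<longrightarrow> \<tau> ! l = \<tau>' ! l) \<and> e + f = D"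
    using v(1-3) by (auto simp: ipair_def)
  have A: "lset w \<epsilon> K' \<tau>' \<inter> Com = lset w \<epsilon> K \<tau> \<inter> Com \<longleftrightarrow> (\<forall>l\<in>K. l \<noteq> q \<longrightarrow> \<tau> ! l = \<tau>' ! l)"
    using Com_agree [OF d, of \<epsilon>] by (subst eq_commute)
  have E: "Eset w K \<in> lset w \<epsilon> K \<tau> \<longleftrightarrow> \<epsilon>" "Eset w K' \<in> lset w \<epsilon> K' \<tau>' \<longleftrightarrow> \<epsilon>"
    using mem_lset(2) [of K \<epsilon> \<tau>] mem_lset(2) [of K' \<epsilon> \<tau>'] by simp_all
  show ?thesis
  proof (cases rule: circ_cases)
    case pkq
    have t: "tr w K q" "tr w K' k" "tr w K' q" using pkq by (simp_all add: tr_q tr_k tr_q')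
    have M: "Tset w K q \<in> lset w \<epsilon> K \<tau> \<longleftrightarrow> D = 0" "Tset w K' k \<in> lset w \<epsilon> K' \<tau>' \<longleftrightarrow> e = 0" "Tset w K' q \<in> lset w \<epsilon> K' \<tau>' \<longleftrightarrow> f = 0"
      using mem_lset(1) [of K q \<epsilon> \<tau>] mem_lset(1) [of K' k \<epsilon> \<tau>'] mem_lset(1) [of K' q \<epsilon> \<tau>'] t qK v by auto
    have A': "lset w \<epsilon> K' \<tau>' \<inter> (Com \<union> {Eset w K}) = lset w \<epsilon> K \<tau> \<inter> (Com \<union> {Eset w K}) \<longleftrightarrow> (\<forall>l\<in>K. l \<noteq> q \<longrightarrow> \<tau> ! l = \<tau>' ! l)"
      using E pkq(4) A by auto
    have pa: "even D" "even e" "even f" using pkq v by auto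
    show ?thesis unfolding R kh_term_merge [OF pkq(3) [folded c]] A' M using fl v(4-6) pa by auto
  next
    case none
    then have pq: "gi w p = gi w q" using gi_neq by blast
    have t: "tr w K q" using pq by (simp add: tr_q)
    have M: "Tset w K q \<in> lset w \<epsilon> K \<tau> \<longleftrightarrow> D = 0" using mem_lset(1) [of K q \<epsilon> \<tau>] t qK v by auto
    have pa: "even D" "odd e" "odd f" using none pq v by auto
    show ?thesis unfolding R kh_term_split [OF none(3) [folded c]] A M E using fl v(4-6) pa by auto
  next
    case pk
    have t: "tr w K' k" using pk by (simp add: tr_k)
    have M: "Tset w K' k \<in> lset w \<epsilon> K' \<tau>' \<longleftrightarrow> e = 0" using mem_lset(1) [of K' k \<epsilon> \<tau>'] t v by auto
    have pa: "odd D" "even e" "odd f" using pk v by auto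
    show ?thesis unfolding R kh_term_merge [OF pk(3) [folded c]] A M E using fl v(4-6) pa by auto
  next
    case kq
    have t: "tr w K' q" using kq by (simp add: tr_q')
    have M: "Tset w K' q \<in> lset w \<epsilon> K' \<tau>' \<longleftrightarrow> f = 0" using mem_lset(1) [of K' q \<epsilon> \<tau>'] t v qK by auto
    have pa: "odd D" "odd e" "even f" using kq v by auto
    show ?thesis unfolding R kh_term_merge [OF kq(3) [folded c]] A M E using fl v(4-6) pa by auto
  qed
qed

end

section \<open>States of the annular complex\<close>

definition Js :: "nat option list \<Rightarrow> nat set" where
  "Js \<tau> = {l. l < length \<tau> \<and> \<tau> ! l \<noteq> None}"

lemma finite_Js [simp]: "finite (Js \<tau>)" by (simp add: Js_def)

lemma Js_Cons: "Js (t # \<tau>) = (if t = None then {} else {0}) \<union> Suc ` Js \<tau>"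
proof -
  have "l \<in> Js (t # \<tau>) \<longleftrightarrow> l \<in> (if t = None then {} else {0}) \<union> Suc ` Js \<tau>" for l
    by (cases l) (auto simp: Js_def)
  then show ?thesis by blast
qed

text \<open>The position of the last cup-cap before a slot; \<open>j\<close> stands for the cup-cap
  in front of the word.\<close>

primrec pg :: "braid3 \<Rightarrow> nat option list \<Rightarrow> gen3 \<Rightarrow> nat \<Rightarrow> gen3" where
  "pg w \<tau> j 0 = j"
| "pg w \<tau> j (Suc l) = (case \<tau> ! l of None \<Rightarrow> pg w \<tau> j l | Some _ \<Rightarrow> fst (w ! l))"

lemma pg_Cons: "pg (a # w) (t # \<tau>) j (Suc l) = pg w \<tau> (case t of None \<Rightarrow> j | Some _ \<Rightarrow> fst a) l"
  by (induction l) (auto split: option.split)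

lemma validM_iff: "validM w j k \<tau> x \<longleftrightarrow> length \<tau> = length w \<and>
   (\<forall>l<length w. \<forall>e. \<tau> ! l = Some e \<longrightarrow> par (pg w \<tau> j l) (fst (w ! l)) e) \<and> par (pg w \<tau> j (length w)) k x"
proof (induction w arbitrary: j \<tau>)
  case Nil
  then show ?case by (cases \<tau>) auto
next
  case (Cons a w)
  show ?case
  proof (cases \<tau>)
    case Nil
    then show ?thesis by simp
  next
    case (Cons t \<sigma>)
    then show ?thesis
      using Cons.IH [of "case t of None \<Rightarrow> j | Some _ \<Rightarrow> fst a" \<sigma>]
      by (cases t) (auto simp: All_less_Suc2 pg_Cons simp del: pg.simps(2))
  qed
qed

text \<open>The inner \<open>pg\<close> runs through the whole word and finds its last cup-cap, the
  cyclic predecessor of the first one.\<close>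

lemma validC_iff:
  assumes "Js \<tau> \<noteq> {}"
  shows "validC w \<tau> x \<longleftrightarrow> length \<tau> = length w \<and> x = 0 \<and>
   (\<forall>l<length w. \<forall>e. \<tau> ! l = Some e \<longrightarrow> par (pg w \<tau> (pg w \<tau> Sig1 (length w)) l) (fst (w ! l)) e)"
  using assms
proof (induction w arbitrary: \<tau>)
  case Nil
  then show ?case by (cases \<tau>) (auto simp: Js_def)
next
  case (Cons a w)
  show ?case
  proof (cases \<tau>)
    case Nil
    then show ?thesis by simp
  next
    case \<tau>: (Cons t \<sigma>)
    show ?thesis
    proof (cases t)
      case None
      then have "Js \<sigma> \<noteq> {}" using Cons.prems by (auto simp: \<tau> Js_Cons)
      from Cons.IH [OF this] show ?thesis
        by (auto simp: \<tau> None All_less_Suc2 pg_Cons simp del: pg.simps(2))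
    next
      case (Some e)
      show ?thesis
        by (auto simp: \<tau> Some All_less_Suc2 pg_Cons validM_iff simp del: pg.simps(2))
    qed
  qed
qed

lemma allN_Js: "Js \<tau> = {} \<longleftrightarrow> \<tau> = replicate (length \<tau>) None"
proof
  assume "Js \<tau> = {}"
  then have "\<tau> ! l = None" if "l < length \<tau>" for l using that by (auto simp: Js_def)
  then show "\<tau> = replicate (length \<tau>) None" by (intro nth_equalityI) auto
next
  have "Js (replicate n None) = {}" for n by (auto simp: Js_def)
  moreover assume "\<tau> = replicate (length \<tau>) None"
  ultimately show "Js \<tau> = {}" by metis
qed

lemma validC_None: "validC w (replicate (length w) None) x \<longleftrightarrow> x \<le> 4"
  by (induction w) auto

lemma pg_between:
  assumes "p < q" "p \<in> Js \<tau>" "\<And>l. p < l \<Longrightarrow> l < q \<Longrightarrow> l \<notin> Js \<tau>" "q \<le> length \<tau>"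
  shows "pg w \<tau> j q = fst (w ! p)"
  using assms
proof (induction q)
  case (Suc q)
  show ?case
  proof (cases "p = q")
    case True
    then show ?thesis using Suc.prems(2) by (auto simp: Js_def split: option.split)
  next
    case False
    then have "pg w \<tau> j q = fst (w ! p)" using Suc by simp
    moreover have "\<tau> ! q = None" using Suc.prems False by (auto simp: Js_def)
    ultimately show ?thesis by simp
  qed
qed simp

lemma pg_none:
  assumes "\<And>l. l < q \<Longrightarrow> l \<notin> Js \<tau>" "q \<le> length \<tau>"
  shows "pg w \<tau> j q = j"
  using assms
proof (induction q)
  case (Suc q)
  then have "\<tau> ! q = None" by (auto simp: Js_def)
  then show ?case using Suc by simp
qed simp

lemma gi_eq: "gi w p = gi w q \<longleftrightarrow> fst (w ! p) = fst (w ! q)"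
  by (simp add: gi_def)

lemma validC_degs:
  assumes J: "Js \<tau> \<noteq> {}"
  shows "validC w \<tau> x \<longleftrightarrow> length \<tau> = length w \<and> x = 0 \<and> degs w (Js \<tau>) \<tau>"
proof (cases "length \<tau> = length w")
  case len: True
  let ?J = "Js \<tau>" and ?n = "length w"
  have lt: "l < ?n" if "l \<in> ?J" for l using that len by (simp add: Js_def)
  have key: "par (pg w \<tau> (pg w \<tau> Sig1 ?n) q) (fst (w ! q)) e \<longleftrightarrow> e \<le> 2 \<and> (even e \<longleftrightarrow> tr w ?J q)" if q: "q \<in> ?J" for q e
  proof -
    obtain p where p: "p \<in> ?J" "nx ?J (Suc p) = q" using nx_Suc_surj [OF finite_Js J q] by blast
    have "(Suc p \<le> q \<and> (\<forall>l\<in>?J. \<not> (Suc p \<le> l \<and> l < q))) \<or> (\<forall>l\<in>?J. l < Suc p \<and> q \<le> l)"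
      using nx_eq_iff [OF finite_Js J, of "Suc p" q] p(2) by blast
    then have "pg w \<tau> (pg w \<tau> Sig1 ?n) q = fst (w ! p)"
    proof
      assume "Suc p \<le> q \<and> (\<forall>l\<in>?J. \<not> (Suc p \<le> l \<and> l < q))"
      then show ?thesis using p(1) lt [OF q] len by (intro pg_between) auto
    next
      assume a: "\<forall>l\<in>?J. l < Suc p \<and> q \<le> l"
      have "pg w \<tau> Sig1 ?n = fst (w ! p)"
        using a p(1) lt [OF p(1)] len by (intro pg_between) auto
      moreover have "pg w \<tau> j q = j" for j
        using a lt [OF q] len by (intro pg_none) auto
      ultimately show ?thesis by simp
    qed
    then show ?thesis using tr_iff [where w = w, OF finite_Js J p] by (auto simp: par_def gi_eq)
  qed
  have "(\<forall>l<?n. \<forall>e. \<tau> ! l = Some e \<longrightarrow> par (pg w \<tau> (pg w \<tau> Sig1 ?n) l) (fst (w ! l)) e) \<longleftrightarrow>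
     (\<forall>l\<in>?J. \<forall>e. \<tau> ! l = Some e \<longrightarrow> par (pg w \<tau> (pg w \<tau> Sig1 ?n) l) (fst (w ! l)) e)"
    using len by (auto simp: Js_def)
  also have "\<dots> \<longleftrightarrow> degs w ?J \<tau>"
  proof -
    have "(\<forall>e. \<tau> ! l = Some e \<longrightarrow> par (pg w \<tau> (pg w \<tau> Sig1 ?n) l) (fst (w ! l)) e) \<longleftrightarrow>
       (\<exists>e\<le>2. \<tau> ! l = Some e \<and> (even e \<longleftrightarrow> tr w ?J l))" if l: "l \<in> ?J" for l
    proof -
      obtain e where "\<tau> ! l = Some e" using l by (auto simp: Js_def)
      then show ?thesis using key [OF l] by auto
    qed
    then show ?thesis unfolding degs_def by blast
  qed
  finally show ?thesis using validC_iff [OF J] len by blast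
next
  case False
  then show ?thesis using validC_length by blast
qed

text \<open>One basis for the annular degrees 1 and -1 alike; the bound on the index leaves out the
  two extra generators.\<close>

definition Bst :: "braid3 \<Rightarrow> (nat option list \<times> nat) set" where
  "Bst w = {(\<tau>, x). validC w \<tau> x \<and> x \<le> 2}"

definition sres :: "braid3 \<Rightarrow> nat option list \<Rightarrow> nat set" where
  "sres w \<tau> = {k. k < length w \<and> (snd (w ! k) \<longleftrightarrow> \<tau> ! k \<noteq> None)}"

text \<open>\<open>\<epsilon>\<close> selects annular degree 1 or -1. With all slots vertical the
  index names the strand whose label differs from the other two.\<close>

definition phi :: "braid3 \<Rightarrow> bool \<Rightarrow> nat option list \<times> nat \<Rightarrow> nat set \<times> node set set" where
  "phi w \<epsilon> b = (sres w (fst b), if Js (fst b) = {} then (if \<epsilon> then Sset w ` ({..<3} - {snd b}) else {Sset w (snd b)})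
     else lset w \<epsilon> (Js (fst b)) (fst b))"

lemma Uset_sres: "length \<tau> = length w \<Longrightarrow> Uset w (sres w \<tau>) = Js \<tau>"
  by (auto simp: Uset_def sres_def Js_def vertical_smoothing_def)

lemma Bst_length: "(\<tau>, x) \<in> Bst w \<Longrightarrow> length \<tau> = length w"
  by (auto simp: Bst_def dest: validC_length)

lemma Bst_iff: "(\<tau>, x) \<in> Bst w \<longleftrightarrow> length \<tau> = length w \<and>
   (if Js \<tau> = {} then x \<le> 2 else x = 0 \<and> degs w (Js \<tau>) \<tau>)"
proof (cases "Js \<tau> = {}")
  case True
  then have "\<tau> = replicate (length \<tau>) None" using allN_Js by blast
  then have "length \<tau> = length w \<Longrightarrow> validC w \<tau> x \<longleftrightarrow> x \<le> 4" using validC_None [of w x] by metis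
  then show ?thesis using True validC_length by (auto simp: Bst_def)
next
  case False
  then show ?thesis using validC_degs [OF False] by (auto simp: Bst_def)
qed

lemma Sset_inj: "j < 3 \<Longrightarrow> Sset w i = Sset w j \<longleftrightarrow> i = j"
proof -
  assume "j < 3"
  then have "(0, j, False) \<in> Sset w j" by (auto simp: Sset_def in_diag_nodes)
  then show ?thesis by (auto simp: Sset_def)
qed

lemma Sset_ne: "j < 3 \<Longrightarrow> Sset w j \<noteq> {}"
proof -
  assume "j < 3"
  then have "(0, j, False) \<in> Sset w j" by (auto simp: Sset_def in_diag_nodes)
  then show ?thesis by auto
qed

section \<open>Edges between the vertical resolution and those with a single cup-cap\<close>

lemma nx_single: "nx {k} x = k"
  by (simp add: nx_def Collect_conv_if)

lemma tr_single: "tr w {k} k"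
  by (simp add: tr_def nx_single)

lemma circles_single:
  assumes "Uset w s = {k}"
  shows "circles w s = {Tset w {k} k, Eset w {k}}"
  using circles_Uset [of w s] assms by (auto simp: tr_single)

lemma Tset_single: "Tset w {k} k = Sset w (gi w k) \<union> Sset w (Suc (gi w k))"
  by (auto simp: Tset_def Sset_def nx_single)

lemma Eset_single: "Eset w {k} = Sset w (thd w k)"
proof -
  have "lab w {k} x = None \<longleftrightarrow> fst (snd x) = thd w k" if "x \<in> diag_nodes w" for x
  proof -
    have "fst (snd x) < 3" using that by (auto simp: diag_nodes_def)
    then have "fst (snd x) = thd w k \<longleftrightarrow> \<not> (fst (snd x) = gi w k \<or> fst (snd x) = Suc (gi w k))"
      using thd_props(2,3) [of w k] thd_props(4) [where j = "fst (snd x)" and w = w and k = k] by metis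
    then show ?thesis by (simp add: lab_def nx_single tr_single Let_def)
  qed
  then show ?thesis by (auto simp: Eset_def Sset_def)
qed

lemma three: "{..<3} = {gi w k, Suc (gi w k), thd w k}"
  using gi_01 [of w k] by (auto simp: thd_def)

lemma cut_single:
  assumes "Uset w s = {}" "Uset w s' = {k}"
  shows "cut (circles w s') (circles w s) {Sset w (thd w k)} (Tset w {k} k) (Sset w (gi w k)) (Sset w (Suc (gi w k)))"
proof (rule cutI)
  have lt: "gi w k < 3" "Suc (gi w k) < 3" "thd w k < 3" using gi_01 [of w k] by (auto simp: thd_def)
  show "circles w s' = {Sset w (thd w k)} \<union> {Tset w {k} k}"
    using circles_single [OF assms(2)] Eset_single by auto
  show "circles w s = {Sset w (thd w k)} \<union> {Sset w (gi w k), Sset w (Suc (gi w k))}"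
    using circles_empty [OF assms(1)] three [of w k] by auto
  show "Tset w {k} k = Sset w (gi w k) \<union> Sset w (Suc (gi w k))" by (rule Tset_single)
  show "Sset w (gi w k) \<inter> Sset w (Suc (gi w k)) = {}" by (auto simp: Sset_def)
  show "Sset w (gi w k) \<noteq> {}" "Sset w (Suc (gi w k)) \<noteq> {}" by (rule Sset_ne [OF lt(1)], rule Sset_ne [OF lt(2)])
  show "c \<noteq> {} \<and> c \<inter> Tset w {k} k = {}" if "c \<in> {Sset w (thd w k)}" for c
  proof -
    have "c = Sset w (thd w k)" using that by simp
    then show ?thesis using Sset_ne [OF lt(3)] thd_props(2,3) [of w k] by (auto simp: Tset_single Sset_def)
  qed
qed

definition strands :: "braid3 \<Rightarrow> bool \<Rightarrow> nat \<Rightarrow> node set set" where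
  "strands w \<epsilon> x = (if \<epsilon> then Sset w ` ({..<3} - {x}) else {Sset w x})"

lemma mem_strands: "j < 3 \<Longrightarrow> x < 3 \<Longrightarrow> Sset w j \<in> strands w \<epsilon> x \<longleftrightarrow> (\<epsilon> \<longleftrightarrow> j \<noteq> x)"
  using Sset_inj [of _ w] by (auto simp: strands_def)

lemma mem_lset_single:
  assumes "k < length w"
  shows "Tset w {k} k \<in> lset w \<epsilon> {k} \<tau> \<longleftrightarrow> \<tau> ! k = Some 0" "Sset w (thd w k) \<in> lset w \<epsilon> {k} \<tau> \<longleftrightarrow> \<epsilon>"
proof -
  have "Tset w {k} k \<inter> Eset w {k} = {}" by (auto simp: Tset_def Eset_def lab_def tr_single)
  moreover have "Tset w {k} k \<noteq> {}" using Tset_nonempty [of "{k}" k w] assms by auto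
  ultimately have "Tset w {k} k \<noteq> Eset w {k}" by auto
  then show "Tset w {k} k \<in> lset w \<epsilon> {k} \<tau> \<longleftrightarrow> \<tau> ! k = Some 0" "Sset w (thd w k) \<in> lset w \<epsilon> {k} \<tau> \<longleftrightarrow> \<epsilon>"
    unfolding lset_def Eset_single [symmetric] by (auto simp: tr_single)
qed

text \<open>The third strand keeps its label, which must be \<open>\<epsilon>\<close>. So the
  exceptional strand is one of the two that merge, and labels + and - merge to -, which is degree
  2.\<close>

lemma kh_base_insert:
  assumes U: "Uset w s = {}" "Uset w s' = {k}" and k: "k < length w" and x: "x < 3"
    and d: "\<tau> ! k = Some e" "e = 0 \<or> e = 2"
    and fl: "\<exists>k<length w. k \<notin> s \<and> s' = insert k s"
  shows "kh_term w (s, strands w \<epsilon> x) (s', lset w \<epsilon> {k} \<tau>) \<longleftrightarrow> e = 2 \<and> (x = gi w k \<or> x = Suc (gi w k))"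
proof -
  have lt: "gi w k < 3" "Suc (gi w k) < 3" "thd w k < 3" using gi_01 [of w k] by (auto simp: thd_def)
  have x3: "x = gi w k \<or> x = Suc (gi w k) \<or> x = thd w k" using x three [of w k] by auto
  have A: "strands w \<epsilon> x \<inter> {Sset w (thd w k)} = lset w \<epsilon> {k} \<tau> \<inter> {Sset w (thd w k)} \<longleftrightarrow> x \<noteq> thd w k"
    using mem_strands [OF lt(3) x, of w \<epsilon>] mem_lset_single(2) [OF k, of \<epsilon> \<tau>] by auto
  show ?thesis
    unfolding kh_term_merge [OF cut_single [OF U]] A mem_lset_single(1) [OF k] mem_strands [OF lt(1) x] mem_strands [OF lt(2) x]
    using fl d x3 thd_props(2,3) [of w k] by auto
qed

lemma kh_base_remove:
  assumes U: "Uset w s = {}" "Uset w s' = {k}" and k: "k < length w" and x: "x < 3"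
    and d: "\<tau> ! k = Some e" "e = 0 \<or> e = 2"
    and fl: "\<exists>k<length w. k \<notin> s' \<and> s = insert k s'"
  shows "kh_term w (s', lset w \<epsilon> {k} \<tau>) (s, strands w \<epsilon> x) \<longleftrightarrow> e = 0 \<and> (x = gi w k \<or> x = Suc (gi w k))"
proof -
  have lt: "gi w k < 3" "Suc (gi w k) < 3" "thd w k < 3" using gi_01 [of w k] by (auto simp: thd_def)
  have x3: "x = gi w k \<or> x = Suc (gi w k) \<or> x = thd w k" using x three [of w k] by auto
  have A: "lset w \<epsilon> {k} \<tau> \<inter> {Sset w (thd w k)} = strands w \<epsilon> x \<inter> {Sset w (thd w k)} \<longleftrightarrow> x \<noteq> thd w k"
    using mem_strands [OF lt(3) x, of w \<epsilon>] mem_lset_single(2) [OF k, of \<epsilon> \<tau>] by auto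
  show ?thesis
    unfolding kh_term_split [OF cut_single [OF U]] A mem_lset_single(1) [OF k] mem_strands [OF lt(1) x] mem_strands [OF lt(2) x]
    using fl d x3 thd_props(2,3) [of w k] by auto
qed

text \<open>The matrix entries of \<open>dC\<close>, with the source expressed by the target
  \<open>\<tau>\<close>. At a positive slot the two arcs meeting there rejoin with degree reduced by
  2; at a negative slot one arc is cut into two of the same total degree.\<close>

fun step :: "braid3 \<Rightarrow> nat \<Rightarrow> nat option list \<times> nat \<Rightarrow> nat option list \<times> nat \<Rightarrow> bool" where
  "step w k (\<sigma>, y) (\<tau>, x) \<longleftrightarrow>
    (if snd (w ! k) then (\<exists>e. \<tau> ! k = Some e \<and> (if Js \<tau> = {k} then \<sigma> = \<tau>[k := None] \<and> e = 2 \<and> (y = gi w k \<or> y = Suc (gi w k))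
        else (\<exists>f. \<tau> ! nx (Js \<tau>) (Suc k) = Some f \<and> 2 \<le> e + f \<and> \<sigma> = \<tau>[nx (Js \<tau>) (Suc k) := Some (e + f - 2), k := None] \<and> y = 0)))
     else \<tau> ! k = None \<and> (if Js \<tau> = {} then (x = gi w k \<or> x = Suc (gi w k)) \<and> \<sigma> = \<tau>[k := Some 0] \<and> y = 0
        else (\<exists>e f. \<tau> ! nx (Js \<tau>) (Suc k) = Some f \<and> e \<le> f \<and> \<sigma> = \<tau>[nx (Js \<tau>) (Suc k) := Some (f - e), k := Some e] \<and> y = 0)))"

definition ind :: "nat option list \<times> nat \<Rightarrow> vec" where
  "ind b = (\<lambda>\<tau> x. of_bool ((\<tau>, x) = b))"

lemma lw_at:
  assumes "m < length r" "r ! m = Some f" "\<And>l. l < m \<Longrightarrow> r ! l = None"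
  shows "lw e v r 0 = (if e \<le> f then v (r[m := Some (f - e)]) 0 else 0)"
  using assms
proof (induction r arbitrary: m v)
  case (Cons t r)
  show ?case
  proof (cases m)
    case 0
    then show ?thesis using Cons.prems by simp
  next
    case (Suc m')
    then have "t = None" using Cons.prems(3) [of 0] by simp
    moreover have "lw e (sub None v) r 0 = (if e \<le> f then sub None v (r[m' := Some (f - e)]) 0 else 0)"
      by (rule Cons.IH) (use Cons.prems(1,2) Cons.prems(3) [of "Suc _"] Suc in auto)
    ultimately show ?thesis using Suc by (simp add: sub_def)
  qed
qed simp

lemma nth_rotated:
  assumes "k < length \<tau>" "l < length \<tau>" "l \<noteq> k"
  shows "(drop (Suc k) \<tau> @ take k \<tau>) ! (if k < l then l - Suc k else l + (length \<tau> - Suc k)) = \<tau> ! l"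
  using assms by (auto simp: nth_append)

lemma lw_rotated:
  assumes k: "k < length \<tau>" and J: "Js \<tau> \<noteq> {}" "Js \<tau> \<noteq> {k}" and q: "q = nx (Js \<tau>) (Suc k)"
  obtains f where "\<tau> ! q = Some f" "q \<noteq> k" "q < length \<tau>"
    "\<And>e v. lw e v (drop (Suc k) \<tau> @ take k \<tau>) 0 =
      (if e \<le> f then v (drop (Suc k) (\<tau>[q := Some (f - e)]) @ take k (\<tau>[q := Some (f - e)])) 0 else 0)"
proof -
  let ?J = "Js \<tau>"
  have qe: "q \<in> ?J" "(Suc k \<le> q \<and> (\<forall>l\<in>?J. \<not> (Suc k \<le> l \<and> l < q))) \<or> (\<forall>l\<in>?J. l < Suc k \<and> q \<le> l)"
    using nx_eq_iff [OF finite_Js J(1), of "Suc k" q] q by auto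
  have qk: "q \<noteq> k"
  proof
    assume "q = k"
    then have "\<forall>l\<in>?J. l < Suc k \<and> k \<le> l" using qe(2) by auto
    then have "?J \<subseteq> {k}" by force
    then show False using J by auto
  qed
  have qn: "q < length \<tau>" using qe(1) by (simp add: Js_def)
  obtain f where f: "\<tau> ! q = Some f" using qe(1) by (auto simp: Js_def)
  \<comment> \<open>The place of \<open>q\<close> in the state read cyclically from behind slot
    \<open>k\<close>.\<close>
  let ?m = "if k < q then q - Suc k else q + (length \<tau> - Suc k)"
  let ?r = "drop (Suc k) \<tau> @ take k \<tau>"
  have m: "?m < length ?r" using k qn qk by auto
  have rm: "?r ! ?m = Some f" using nth_rotated [OF k qn qk] f by simp
  have none: "?r ! i = None" if i: "i < ?m" for i
  proof -
    let ?l = "if i < length \<tau> - Suc k then Suc k + i else i - (length \<tau> - Suc k)"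
    have l: "?l < length \<tau>" "?l \<noteq> k" "?r ! i = \<tau> ! ?l"
      using i m k by (auto simp: nth_append split: if_splits)
    have "?l \<notin> ?J"
    proof
      assume "?l \<in> ?J"
      then show False using qe(2) i k qn by (auto split: if_splits)
    qed
    then show ?thesis using l by (simp add: Js_def)
  qed
  have upd: "?r[?m := y] = drop (Suc k) (\<tau>[q := y]) @ take k (\<tau>[q := y])" for y
  proof (cases "k < q")
    case True
    then have "q - Suc k < length \<tau> - Suc k" using qn by linarith
    then show ?thesis using qn True by (simp add: list_update_append drop_update_swap)
  next
    case False
    then have "q < k" using qk by simp
    moreover from this have "\<not> q + (length \<tau> - Suc k) < length \<tau> - Suc k" "q + (length \<tau> - Suc k) - (length \<tau> - Suc k) = q"
      by linarith+
    ultimately show ?thesis using k False by (simp only: list_update_append length_drop if_False take_update_swap) simp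
  qed
  show thesis
    by (rule that [OF f qk qn]) (simp only: lw_at [OF m rm none] upd)
qed

lemma place_rotated: "k < length \<tau> \<Longrightarrow> place (length \<tau> - Suc k) h (drop (Suc k) \<tau> @ take k \<tau>) = \<tau>[k := h]"
  by (simp add: place_def upd_conv_take_nth_drop)

lemma L0_ind:
  assumes k: "k < length w" and b: "(\<sigma>, y) \<in> Bst w" "(\<tau>, x) \<in> Bst w"
  shows "L0 (w ! k) (\<lambda>h \<rho>. ind (\<sigma>, y) (place (length w - Suc k) h \<rho>)) (\<tau> ! k) (drop (Suc k) \<tau> @ take k \<tau>) x
    = of_bool (step w k (\<sigma>, y) (\<tau>, x))"
proof -
  have len: "length \<tau> = length w" using b(2) by (rule Bst_length)
  let ?r = "drop (Suc k) \<tau> @ take k \<tau>"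
  let ?cf = "\<lambda>h \<rho>. ind (\<sigma>, y) (place (length w - Suc k) h \<rho>)"
  have ex: "\<exists>i<length \<tau>. i \<noteq> k \<and> ?r ! j = \<tau> ! i" if "j < length ?r" for j
    using that k len by (intro exI [of _ "if j < length \<tau> - Suc k then Suc k + j else j - (length \<tau> - Suc k)"]) (auto simp: nth_append)
  have allN: "allN ?r \<longleftrightarrow> Js \<tau> \<subseteq> {k}"
  proof
    assume a: "allN ?r"
    show "Js \<tau> \<subseteq> {k}"
    proof
      fix l assume l: "l \<in> Js \<tau>"
      show "l \<in> {k}"
      proof (rule ccontr)
        assume "l \<notin> {k}"
        then have lk: "l \<noteq> k" by simp
        have ln: "l < length \<tau>" using l by (simp add: Js_def)
        let ?m = "if k < l then l - Suc k else l + (length \<tau> - Suc k)"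
        have "?m < length ?r" using k ln lk len by auto
        then have "?r ! ?m \<in> set ?r" by (rule nth_mem)
        then have "?r ! ?m = None" using a by (auto simp: allN_def)
        then show False using nth_rotated [of k \<tau> l] k len ln lk l by (simp add: Js_def)
      qed
    qed
  next
    assume a: "Js \<tau> \<subseteq> {k}"
    have "t = None" if "t \<in> set ?r" for t
    proof -
      have "\<exists>j<length ?r. ?r ! j = t" using that by (simp only: in_set_conv_nth)
      then obtain j where jj: "j < length ?r \<and> ?r ! j = t" by (rule exE)
      note j = jj [THEN conjunct1] jj [THEN conjunct2]
      from ex [OF j(1)] obtain i where ii: "i < length \<tau> \<and> i \<noteq> k \<and> ?r ! j = \<tau> ! i" by (rule exE)
      note i = ii [THEN conjunct1] ii [THEN conjunct2, THEN conjunct1] trans [OF j(2) [symmetric] ii [THEN conjunct2, THEN conjunct2]]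
      then show ?thesis using a by (auto simp: Js_def)
    qed
    then show "allN ?r" by (auto simp: allN_def)
  qed
  have cf: "?cf h ?r z = of_bool (\<sigma> = \<tau>[k := h] \<and> y = z)" for h z
    using place_rotated [of k \<tau> h] k len by (auto simp: ind_def)
  have y: "y \<le> 2" using b(1) by (simp add: Bst_def)
  have x: "x \<le> 2" using b(2) by (simp add: Bst_def)
  have kJ: "k \<in> Js \<tau> \<longleftrightarrow> \<tau> ! k \<noteq> None" using k len by (simp add: Js_def)
  show ?thesis
  proof (cases "allN ?r")
    case True
    show ?thesis
    proof (cases "snd (w ! k)")
      case pos: True
      show ?thesis
      proof (cases "\<tau> ! k")
        case None
        then show ?thesis using pos by (simp add: L0_def)
      next
        case (Some e)
        then have "Js \<tau> = {k}" using True allN kJ by auto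
        then have e: "e = 0 \<or> e = 2"
        proof -
          have "e \<le> 2 \<and> even e" using b(2) Some \<open>Js \<tau> = {k}\<close> by (simp add: Bst_iff degs_def tr_single)
          then show ?thesis by presburger
        qed
        show ?thesis using True pos Some e y \<open>Js \<tau> = {k}\<close>
          by (auto simp: L0_def cf gi_def)
      qed
    next
      case neg: False
      show ?thesis
      proof (cases "\<tau> ! k")
        case None
        then have "Js \<tau> = {}" using True allN kJ by auto
        then show ?thesis using True neg None x by (auto simp: L0_def cf gi_def)
      next
        case (Some e)
        then show ?thesis using neg by (simp add: L0_def)
      qed
    qed
  next
    case False
    then have J: "Js \<tau> \<noteq> {}" "Js \<tau> \<noteq> {k}" using allN by auto
    let ?q = "nx (Js \<tau>) (Suc k)"
    have k': "k < length \<tau>" using k len by simp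
    obtain f where f: "\<tau> ! ?q = Some f" "?q \<noteq> k" "?q < length \<tau>"
      "\<And>e v. lw e v ?r 0 = (if e \<le> f then v (drop (Suc k) (\<tau>[?q := Some (f - e)]) @ take k (\<tau>[?q := Some (f - e)])) 0 else 0)"
      by (rule lw_rotated [OF k' J refl]) blast
    have pl: "place (length w - Suc k) h (drop (Suc k) (\<tau>[?q := z]) @ take k (\<tau>[?q := z])) = \<tau>[?q := z, k := h]" for h z
      using place_rotated [of k "\<tau>[?q := z]" h] k len by simp
    have lw: "lw e (\<lambda>\<rho> x. ?cf h \<rho> 0) ?r 0 = of_bool (e \<le> f \<and> \<sigma> = \<tau>[?q := Some (f - e), k := h] \<and> y = 0)" for e h
      unfolding f(4) pl by (auto simp: ind_def)
    have deg2: "d \<le> 2" if "\<tau> ! l = Some d" "l < length \<tau>" for l d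
    proof -
      have "l \<in> Js \<tau>" using that by (simp add: Js_def)
      then show ?thesis using b(2) that J(1) by (auto simp: Bst_iff degs_def split: if_splits)
    qed
    have f2: "f \<le> 2" using deg2 [OF f(1,3)] .
    show ?thesis
    proof (cases "snd (w ! k)")
      case pos: True
      show ?thesis
      proof (cases "\<tau> ! k")
        case None
        then show ?thesis using pos by (simp add: L0_def)
      next
        case (Some e)
        have e2: "e \<le> 2" using deg2 [OF Some k'] .
        then have ef: "2 - e \<le> f \<longleftrightarrow> 2 \<le> e + f" "f - (2 - e) = e + f - 2" by linarith+
        have "L0 (w ! k) ?cf (\<tau> ! k) ?r x = lw (2 - e) (\<lambda>\<rho> x. ?cf None \<rho> 0) ?r 0"
          by (simp only: L0_def pos if_True Some option.case False if_False)
        moreover have "step w k (\<sigma>, y) (\<tau>, x) \<longleftrightarrow> 2 \<le> e + f \<and> \<sigma> = \<tau>[?q := Some (e + f - 2), k := None] \<and> y = 0"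
          using pos Some J f(1) by simp
        ultimately show ?thesis unfolding lw ef by (simp only:)
      qed
    next
      case neg: False
      show ?thesis
      proof (cases "\<tau> ! k")
        case None
        \<comment> \<open>The entry of the source at \<open>k\<close> determines \<open>e\<close>,
          so at most one of the three summands is nonzero and nothing cancels over Z/2.\<close>
        have dist: "\<sigma> = \<tau>[?q := Some (f - e), k := Some e] \<Longrightarrow> \<sigma> ! k = Some e" for e
          using k' f(2) by simp
        have "step w k (\<sigma>, y) (\<tau>, x) \<longleftrightarrow> (\<exists>e\<le>f. \<sigma> = \<tau>[?q := Some (f - e), k := Some e] \<and> y = 0)"
          using neg None J f(1) by auto
        also have "\<dots> \<longleftrightarrow> (\<exists>e\<in>{0, 1, 2}. e \<le> f \<and> \<sigma> = \<tau>[?q := Some (f - e), k := Some e] \<and> y = 0)"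
        proof -
          have "e \<in> {0, 1, 2}" if "e \<le> f" for e
          proof -
            have "e = 0 \<or> e = 1 \<or> e = 2" using that f2 by linarith
            then show ?thesis by simp
          qed
          then show ?thesis by blast
        qed
        finally have st: "step w k (\<sigma>, y) (\<tau>, x) \<longleftrightarrow> (\<exists>e\<in>{0, 1, 2}. e \<le> f \<and> \<sigma> = \<tau>[?q := Some (f - e), k := Some e] \<and> y = 0)" .
        have L: "L0 (w ! k) ?cf (\<tau> ! k) ?r x = (\<Sum>e\<in>{0, 1, 2}. of_bool (e \<le> f \<and> \<sigma> = \<tau>[?q := Some (f - e), k := Some e] \<and> y = 0))"
        proof -
          have "L0 (w ! k) ?cf (\<tau> ! k) ?r x = lw 0 (\<lambda>\<rho> x. ?cf (Some 0) \<rho> 0) ?r 0 +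
             lw 1 (\<lambda>\<rho> x. ?cf (Some 1) \<rho> 0) ?r 0 + lw 2 (\<lambda>\<rho> x. ?cf (Some 2) \<rho> 0) ?r 0"
            by (simp only: L0_def neg if_True None option.case False if_False)
          then show ?thesis unfolding lw by (simp add: add.assoc)
        qed
        show ?thesis
        proof (cases "\<exists>e\<in>{0, 1, 2}. e \<le> f \<and> \<sigma> = \<tau>[?q := Some (f - e), k := Some e] \<and> y = 0")
          case True
          then obtain e where e: "e \<in> {0, 1, 2}" "e \<le> f \<and> \<sigma> = \<tau>[?q := Some (f - e), k := Some e] \<and> y = 0" by (rule bexE)
          have "e' \<le> f \<and> \<sigma> = \<tau>[?q := Some (f - e'), k := Some e'] \<and> y = 0 \<longleftrightarrow> e' = e" for e'
          proof
            assume a: "e' \<le> f \<and> \<sigma> = \<tau>[?q := Some (f - e'), k := Some e'] \<and> y = 0"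
            have "Some e' = Some e"
              using dist [OF a [THEN conjunct2, THEN conjunct1]] dist [OF e(2) [THEN conjunct2, THEN conjunct1]] by (rule trans [OF sym])
            then show "e' = e" by simp
          next
            assume "e' = e"
            then show "e' \<le> f \<and> \<sigma> = \<tau>[?q := Some (f - e'), k := Some e'] \<and> y = 0" using e(2) by (simp only:)
          qed
          then have "L0 (w ! k) ?cf (\<tau> ! k) ?r x = (\<Sum>e'\<in>{0, 1, 2}. of_bool (e' = e))" unfolding L by simp
          also have "\<dots> = (1 :: bit)" using e(1) by (auto simp: of_bool_def)
          finally show ?thesis using st True by simp
        next
          case False
          then have "L0 (w ! k) ?cf (\<tau> ! k) ?r x = 0" unfolding L by (intro sum.neutral) auto
          then show ?thesis using st False by simp
        qed
      next
        case (Some e)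
        then show ?thesis using neg by (simp add: L0_def)
      qed
    qed
  qed
qed

lemma step_None:
  assumes "step w k (\<sigma>, y) (\<tau>, x)" "k < length \<tau>"
  shows "length \<sigma> = length \<tau>" "\<sigma> ! k = None \<longleftrightarrow> snd (w ! k)" "\<tau> ! k = None \<longleftrightarrow> \<not> snd (w ! k)"
    "\<And>l. l < length \<tau> \<Longrightarrow> l \<noteq> k \<Longrightarrow> \<sigma> ! l = None \<longleftrightarrow> \<tau> ! l = None"
proof -
  have "length \<sigma> = length \<tau> \<and> (\<sigma> ! k = None \<longleftrightarrow> snd (w ! k)) \<and> (\<tau> ! k = None \<longleftrightarrow> \<not> snd (w ! k)) \<and>
    (\<forall>l<length \<tau>. l \<noteq> k \<longrightarrow> (\<sigma> ! l = None \<longleftrightarrow> \<tau> ! l = None))"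
  proof -
    have *: "\<exists>h. (\<sigma> = \<tau>[k := h] \<or> (\<exists>q z. \<tau> ! q \<noteq> None \<and> \<sigma> = \<tau>[q := Some z, k := h])) \<and>
       (h = None \<longleftrightarrow> snd (w ! k)) \<and> (\<tau> ! k = None \<longleftrightarrow> \<not> snd (w ! k))"
    proof (cases "snd (w ! k)")
      case True
      show ?thesis
      proof (cases "Js \<tau> = {k}")
        case J: True
        then have "\<sigma> = \<tau>[k := None]" "\<tau> ! k \<noteq> None" using assms(1) True by auto
        then show ?thesis using True by (intro exI [of _ None]) simp
      next
        case False
        then obtain e f where "\<tau> ! nx (Js \<tau>) (Suc k) = Some f" "\<sigma> = \<tau>[nx (Js \<tau>) (Suc k) := Some (e + f - 2), k := None]" "\<tau> ! k = Some e"
          using assms(1) True by auto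
        then show ?thesis using True by (intro exI [of _ None]) fastforce
      qed
    next
      case False
      show ?thesis
      proof (cases "Js \<tau> = {}")
        case True
        then show ?thesis using assms(1) False by (intro exI [of _ "Some 0"]) simp
      next
        case J: False
        then obtain e f where "\<tau> ! nx (Js \<tau>) (Suc k) = Some f" "\<sigma> = \<tau>[nx (Js \<tau>) (Suc k) := Some (f - e), k := Some e]" "\<tau> ! k = None"
          using assms(1) False by auto
        then show ?thesis using False by (intro exI [of _ "Some e"]) fastforce
      qed
    qed
    then obtain h where hh: "(\<sigma> = \<tau>[k := h] \<or> (\<exists>q z. \<tau> ! q \<noteq> None \<and> \<sigma> = \<tau>[q := Some z, k := h])) \<and>
       (h = None \<longleftrightarrow> snd (w ! k)) \<and> (\<tau> ! k = None \<longleftrightarrow> \<not> snd (w ! k))" by (rule exE)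
    note h = hh [THEN conjunct1] hh [THEN conjunct2, THEN conjunct1] hh [THEN conjunct2, THEN conjunct2]
    have "length \<sigma> = length \<tau>" "\<sigma> ! k = h" using h(1) assms(2) by auto
    moreover have "\<sigma> ! l = None \<longleftrightarrow> \<tau> ! l = None" if "l < length \<tau>" "l \<noteq> k" for l
      using h(1)
    proof
      assume "\<exists>q z. \<tau> ! q \<noteq> None \<and> \<sigma> = \<tau>[q := Some z, k := h]"
      then obtain q z where "\<tau> ! q \<noteq> None" "\<sigma> = \<tau>[q := Some z, k := h]" by blast
      then show ?thesis using that by (cases "l = q") auto
    qed (use that in auto)
    ultimately show ?thesis using h(2,3) by simp
  qed
  then show "length \<sigma> = length \<tau>" "\<sigma> ! k = None \<longleftrightarrow> snd (w ! k)" "\<tau> ! k = None \<longleftrightarrow> \<not> snd (w ! k)"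
    "\<And>l. l < length \<tau> \<Longrightarrow> l \<noteq> k \<Longrightarrow> \<sigma> ! l = None \<longleftrightarrow> \<tau> ! l = None" by blast+
qed

definition mdiff :: "braid3 \<Rightarrow> nat option list \<times> nat \<Rightarrow> nat option list \<times> nat \<Rightarrow> bool" where
  "mdiff w b' b \<longleftrightarrow> dC w (ind b) (fst b') (snd b') = 1"

lemma pC_ind: "b \<in> Bst w \<Longrightarrow> ind b = pC w (ind b)"
  by (intro ext) (auto simp: ind_def pC_def Bst_def)

text \<open>By \<open>step_None\<close> the slot \<open>k\<close> is the only one where the two
  states differ in their smoothing, so at most one letter contributes to the sum in Z/2.\<close>

theorem mdiff_iff:
  assumes b: "b \<in> Bst w" "b' \<in> Bst w"
  shows "mdiff w b' b \<longleftrightarrow> (\<exists>k<length w. step w k b b')"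
proof -
  obtain \<sigma> y \<tau> x where be: "b = (\<sigma>, y)" "b' = (\<tau>, x)" by (cases b; cases b')
  have v: "validC w \<tau> x" using b be by (simp add: Bst_def)
  have len: "length \<tau> = length w" using validC_length [OF v] .
  have eq: "dC w (ind b) \<tau> x = (\<Sum>k<length w. of_bool (step w k (\<sigma>, y) (\<tau>, x)))"
    using dC_explicit [OF v pC_ind [OF b(1)]] L0_ind [of _ w \<sigma> y \<tau> x] b be by simp
  show ?thesis
  proof (cases "\<exists>k<length w. step w k b b'")
    case True
    then obtain k where k: "k < length w" "step w k (\<sigma>, y) (\<tau>, x)" using be by auto
    have "step w l (\<sigma>, y) (\<tau>, x) \<longleftrightarrow> l = k" if l: "l < length w" for l
    proof
      assume s: "step w l (\<sigma>, y) (\<tau>, x)"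
      show "l = k"
        using step_None(2,3) [OF s] step_None(4) [OF k(2), of l] k l len by (metis)
    qed (use k in simp)
    then have "(\<Sum>l<length w. of_bool (step w l (\<sigma>, y) (\<tau>, x))) = (\<Sum>l<length w. if l = k then 1 else (0::bit))"
      by (intro sum.cong) auto
    also have "\<dots> = 1" using k(1) by simp
    finally show ?thesis using True eq be by (simp add: mdiff_def)
  next
    case False
    then have "(\<Sum>l<length w. of_bool (step w l (\<sigma>, y) (\<tau>, x))) = (0::bit)"
      using be by (intro sum.neutral) auto
    then show ?thesis using False eq be by (simp add: mdiff_def)
  qed
qed

section \<open>Annular Khovanov homology in degrees one and minus one\<close>

definition flips :: "braid3 \<Rightarrow> nat set \<Rightarrow> nat set \<Rightarrow> nat \<Rightarrow> bool" where
  "flips w s s' k \<longleftrightarrow> k < length w \<and> k \<notin> s \<and> s' = insert k s"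

lemma kh_term_flips: "kh_term w x y \<Longrightarrow> \<exists>k. flips w (fst x) (fst y) k"
  by (auto simp: kh_term_def Let_def flips_def)

lemma sres_flips:
  assumes "length \<sigma> = length w" "length \<tau> = length w" "k < length w"
  shows "flips w (sres w \<sigma>) (sres w \<tau>) k \<longleftrightarrow>
    (\<sigma> ! k = None \<longleftrightarrow> snd (w ! k)) \<and> (\<tau> ! k = None \<longleftrightarrow> \<not> snd (w ! k)) \<and>
    (\<forall>l<length w. l \<noteq> k \<longrightarrow> (\<sigma> ! l = None \<longleftrightarrow> \<tau> ! l = None))"
proof -
  have mem: "l \<in> sres w \<rho> \<longleftrightarrow> (snd (w ! l) \<longleftrightarrow> \<rho> ! l \<noteq> None)" if "l < length w" for l \<rho>
    using that by (simp add: sres_def)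
  have lt: "l < length w" if "l \<in> sres w \<rho>" for l \<rho> using that by (simp add: sres_def)
  show ?thesis
  proof
    assume f: "flips w (sres w \<sigma>) (sres w \<tau>) k"
    then have e: "l \<in> sres w \<tau> \<longleftrightarrow> l = k \<or> l \<in> sres w \<sigma>" for l by (simp add: flips_def)
    have ks: "k \<notin> sres w \<sigma>" using f by (simp add: flips_def)
    have "\<sigma> ! l = None \<longleftrightarrow> \<tau> ! l = None" if "l < length w" "l \<noteq> k" for l
      using e [of l] mem [OF that(1), of \<sigma>] mem [OF that(1), of \<tau>] that(2) by blast
    moreover have "\<sigma> ! k = None \<longleftrightarrow> snd (w ! k)" "\<tau> ! k = None \<longleftrightarrow> \<not> snd (w ! k)"
      using ks e [of k] mem [OF assms(3), of \<sigma>] mem [OF assms(3), of \<tau>] by blast+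
    ultimately show "(\<sigma> ! k = None \<longleftrightarrow> snd (w ! k)) \<and> (\<tau> ! k = None \<longleftrightarrow> \<not> snd (w ! k)) \<and>
      (\<forall>l<length w. l \<noteq> k \<longrightarrow> (\<sigma> ! l = None \<longleftrightarrow> \<tau> ! l = None))" by blast
  next
    assume a: "(\<sigma> ! k = None \<longleftrightarrow> snd (w ! k)) \<and> (\<tau> ! k = None \<longleftrightarrow> \<not> snd (w ! k)) \<and>
      (\<forall>l<length w. l \<noteq> k \<longrightarrow> (\<sigma> ! l = None \<longleftrightarrow> \<tau> ! l = None))"
    have "k \<notin> sres w \<sigma>" using a mem [OF assms(3), of \<sigma>] by blast
    moreover have "l \<in> sres w \<tau> \<longleftrightarrow> l \<in> insert k (sres w \<sigma>)" for l
    proof (cases "l < length w")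
      case True
      show ?thesis
      proof (cases "l = k")
        case True
        then show ?thesis using a mem [OF assms(3), of \<tau>] by simp
      next
        case False
        then have "\<sigma> ! l = None \<longleftrightarrow> \<tau> ! l = None" using a True by blast
        then show ?thesis using False mem [OF True, of \<sigma>] mem [OF True, of \<tau>] by simp
      qed
    next
      case False
      then show ?thesis using lt assms(3) by auto
    qed
    ultimately show "flips w (sres w \<sigma>) (sres w \<tau>) k" using assms(3) unfolding flips_def by blast
  qed
qed

lemma phi_simps:
  "Js \<tau> = {} \<Longrightarrow> phi w \<epsilon> (\<tau>, x) = (sres w \<tau>, strands w \<epsilon> x)"
  "Js \<tau> \<noteq> {} \<Longrightarrow> phi w \<epsilon> (\<tau>, x) = (sres w \<tau>, lset w \<epsilon> (Js \<tau>) \<tau>)"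
  by (simp_all add: phi_def strands_def)

lemma circles_sres:
  assumes "length \<tau> = length w" "Js \<tau> \<noteq> {}"
  shows "circles w (sres w \<tau>) = Tset w (Js \<tau>) ` {l \<in> Js \<tau>. tr w (Js \<tau>) l} \<union> {Eset w (Js \<tau>)}"
  using circles_Uset [of w "sres w \<tau>"] Uset_sres [OF assms(1)] assms(2) by simp

lemma degs_Bst: "(\<tau>, x) \<in> Bst w \<Longrightarrow> Js \<tau> \<noteq> {} \<Longrightarrow> degs w (Js \<tau>) \<tau> \<and> x = 0"
  by (auto simp: Bst_iff)

lemma list_eq_update2:
  assumes "length \<sigma> = length \<tau>" "q < length \<tau>" "k < length \<tau>" "q \<noteq> k"
  shows "\<sigma> = \<tau>[q := a, k := b] \<longleftrightarrow> \<sigma> ! q = a \<and> \<sigma> ! k = b \<and> (\<forall>l<length \<tau>. l \<noteq> q \<longrightarrow> l \<noteq> k \<longrightarrow> \<sigma> ! l = \<tau> ! l)"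
proof
  assume e: "\<sigma> = \<tau>[q := a, k := b]"
  show "\<sigma> ! q = a \<and> \<sigma> ! k = b \<and> (\<forall>l<length \<tau>. l \<noteq> q \<longrightarrow> l \<noteq> k \<longrightarrow> \<sigma> ! l = \<tau> ! l)"
    unfolding e using assms(2-4) by (simp add: nth_list_update)
next
  assume e: "\<sigma> ! q = a \<and> \<sigma> ! k = b \<and> (\<forall>l<length \<tau>. l \<noteq> q \<longrightarrow> l \<noteq> k \<longrightarrow> \<sigma> ! l = \<tau> ! l)"
  show "\<sigma> = \<tau>[q := a, k := b]"
  proof (rule nth_equalityI)
    fix l assume "l < length \<sigma>"
    then show "\<sigma> ! l = \<tau>[q := a, k := b] ! l"
      using e assms by (cases "l = k"; cases "l = q") (simp_all add: nth_list_update)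
  qed (use assms in simp)
qed

lemma list_eq_update1:
  assumes "length \<sigma> = length \<tau>" "k < length \<tau>"
  shows "\<sigma> = \<tau>[k := b] \<longleftrightarrow> \<sigma> ! k = b \<and> (\<forall>l<length \<tau>. l \<noteq> k \<longrightarrow> \<sigma> ! l = \<tau> ! l)"
proof
  assume e: "\<sigma> = \<tau>[k := b]"
  show "\<sigma> ! k = b \<and> (\<forall>l<length \<tau>. l \<noteq> k \<longrightarrow> \<sigma> ! l = \<tau> ! l)"
    unfolding e using assms(2) by simp
next
  assume e: "\<sigma> ! k = b \<and> (\<forall>l<length \<tau>. l \<noteq> k \<longrightarrow> \<sigma> ! l = \<tau> ! l)"
  show "\<sigma> = \<tau>[k := b]"
  proof (rule nth_equalityI)
    fix l assume "l < length \<sigma>"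
    then show "\<sigma> ! l = \<tau>[k := b] ! l"
      using e assms by (cases "l = k") simp_all
  qed (use assms in simp)
qed

lemma Js_insert:
  assumes "length \<sigma> = n" "length \<tau> = n" "k < n" "\<sigma> ! k = None" "\<tau> ! k \<noteq> None"
    and "\<And>l. l < n \<Longrightarrow> l \<noteq> k \<Longrightarrow> \<sigma> ! l = None \<longleftrightarrow> \<tau> ! l = None"
  shows "Js \<tau> = insert k (Js \<sigma>)" "k \<notin> Js \<sigma>"
proof -
  have "l \<in> Js \<tau> \<longleftrightarrow> l \<in> insert k (Js \<sigma>)" for l
  proof (cases "l = k")
    case True
    then show ?thesis using assms(2,3,5) by (simp add: Js_def)
  next
    case False
    show ?thesis
    proof (cases "l < n")
      case True
      then show ?thesis using False assms(6) [OF True False] assms(1,2) by (simp add: Js_def del: not_None_eq)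
    next
      case False
      then show ?thesis using assms(1-3) by (auto simp: Js_def)
    qed
  qed
  then show "Js \<tau> = insert k (Js \<sigma>)" by blast
  show "k \<notin> Js \<sigma>" using assms(4) by (simp add: Js_def)
qed

lemma notin_Js: "l \<notin> Js \<tau> \<Longrightarrow> l < length \<tau> \<Longrightarrow> \<tau> ! l = None"
  by (simp add: Js_def)

text \<open>The edge adds a cup-cap at a positive letter and removes one at a negative letter. The
  vertical resolution is treated apart because it has three essential circles.\<close>

theorem kh_term_phi:
  assumes b: "(\<sigma>, y) \<in> Bst w" "(\<tau>, x) \<in> Bst w"
    and k: "k < length w" and fl: "flips w (sres w \<sigma>) (sres w \<tau>) k"
  shows "kh_term w (phi w \<epsilon> (\<sigma>, y)) (phi w \<epsilon> (\<tau>, x)) \<longleftrightarrow> step w k (\<sigma>, y) (\<tau>, x)"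
proof -
  have len: "length \<sigma> = length w" "length \<tau> = length w" using b by (auto dest: Bst_length)
  have N: "\<sigma> ! k = None \<longleftrightarrow> snd (w ! k)" "\<tau> ! k = None \<longleftrightarrow> \<not> snd (w ! k)"
    "\<And>l. l < length w \<Longrightarrow> l \<noteq> k \<Longrightarrow> \<sigma> ! l = None \<longleftrightarrow> \<tau> ! l = None"
    using fl sres_flips [OF len k] by auto
  have fl': "\<exists>k<length w. k \<notin> sres w \<sigma> \<and> sres w \<tau> = insert k (sres w \<sigma>)"
    using fl by (auto simp: flips_def)
  have U: "Uset w (sres w \<sigma>) = Js \<sigma>" "Uset w (sres w \<tau>) = Js \<tau>" using Uset_sres len by auto
  show ?thesis
  proof (cases "snd (w ! k)")
    case pos: True
    have J: "Js \<tau> = insert k (Js \<sigma>)" "k \<notin> Js \<sigma>"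
      using Js_insert [OF len k] N pos by metis+
    obtain e where e: "\<tau> ! k = Some e" using N(2) pos by auto
    show ?thesis
    proof (cases "Js \<sigma> = {}")
      case True
      have J1: "Js \<tau> = {k}" using J(1) True by simp
      have "e \<le> 2 \<and> even e" using b(2) e J1 by (simp add: Bst_iff degs_def tr_single)
      then have e2: "e = 0 \<or> e = 2" by presburger
      have y3: "y < 3" using b(1) by (auto simp: Bst_def)
      have "\<sigma> = \<tau>[k := None]"
      proof (subst list_eq_update1)
        show "\<sigma> ! k = None \<and> (\<forall>l<length \<tau>. l \<noteq> k \<longrightarrow> \<sigma> ! l = \<tau> ! l)"
          using N(1) pos notin_Js [of _ \<sigma>] notin_Js [of _ \<tau>] True J1 len by simp
      qed (use len k in auto)
      then have "step w k (\<sigma>, y) (\<tau>, x) \<longleftrightarrow> e = 2 \<and> (y = gi w k \<or> y = Suc (gi w k))"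
        using pos e J1 by simp
      moreover have "kh_term w (sres w \<sigma>, strands w \<epsilon> y) (sres w \<tau>, lset w \<epsilon> {k} \<tau>) \<longleftrightarrow> e = 2 \<and> (y = gi w k \<or> y = Suc (gi w k))"
        by (rule kh_base_insert [OF _ _ k y3 e e2 fl']) (simp_all add: U True J1)
      ultimately show ?thesis using True J1 by (simp add: phi_simps del: step.simps)
    next
      case False
      interpret insertion w "Js \<sigma>" k
        by unfold_locales (use False J(2) k len in \<open>auto simp: Js_def\<close>)
      have J\<tau>: "Js \<tau> \<noteq> {}" using J(1) by simp
      have Jk: "Js \<tau> \<noteq> {k}" using J False by auto
      have d: "degs w (Js \<sigma>) \<sigma>" "degs w (insert k (Js \<sigma>)) \<tau>"
        using degs_Bst [OF b(1) False] degs_Bst [OF b(2) J\<tau>] J(1) by auto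
      have c: "circles w (sres w \<sigma>) = circ (Js \<sigma>)" "circles w (sres w \<tau>) = circ (insert k (Js \<sigma>))"
        using circles_sres [OF len(1) False] circles_sres [OF len(2) J\<tau>] J(1) by (simp_all add: circ_def)
      have y0: "y = 0" using degs_Bst [OF b(1) False] by simp
      have q: "nx (Js \<tau>) (Suc k) = q" using nx_next J(1) by simp
      have qn: "q < length \<tau>" "q \<noteq> k" "q \<in> Js \<sigma>" using qK q_neq len by (auto simp: Js_def)
      have rest: "(\<forall>l\<in>Js \<sigma>. l \<noteq> q \<longrightarrow> \<sigma> ! l = \<tau> ! l) \<longleftrightarrow> (\<forall>l<length \<tau>. l \<noteq> q \<longrightarrow> l \<noteq> k \<longrightarrow> \<sigma> ! l = \<tau> ! l)"
      proof -
        have "l < length w" if "l \<in> Js \<sigma>" for l using that len by (simp add: Js_def)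
        moreover have "\<sigma> ! l = \<tau> ! l" if "l < length w" "l \<noteq> k" "l \<notin> Js \<sigma>" for l
          using N(3) [OF that(1,2)] notin_Js [OF that(3)] that(1) len by simp
        ultimately show ?thesis using J(2) len by metis
      qed
      obtain D where D: "\<sigma> ! q = Some D" using qn by (auto simp: Js_def)
      obtain f where f: "\<tau> ! q = Some f" using N(3) [of q] D qn len by auto
      have "kh_term w (phi w \<epsilon> (\<sigma>, y)) (phi w \<epsilon> (\<tau>, x)) \<longleftrightarrow> (\<exists>D e f. ipair \<sigma> \<tau> D e f \<and> e + f = D + 2)"
        using kh_insert [OF d c fl', of \<epsilon>] False J\<tau> J(1) by (simp add: phi_simps)
      also have "\<dots> \<longleftrightarrow> e + f = D + 2 \<and> (\<forall>l<length \<tau>. l \<noteq> q \<longrightarrow> l \<noteq> k \<longrightarrow> \<sigma> ! l = \<tau> ! l)"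
        using D e f rest by (auto simp: ipair_def)
      also have "\<dots> \<longleftrightarrow> step w k (\<sigma>, y) (\<tau>, x)"
      proof -
        have "step w k (\<sigma>, y) (\<tau>, x) \<longleftrightarrow> 2 \<le> e + f \<and> \<sigma> = \<tau>[q := Some (e + f - 2), k := None]"
          using pos e f Jk q y0 by simp
        also have "\<dots> \<longleftrightarrow> 2 \<le> e + f \<and> \<sigma> ! q = Some (e + f - 2) \<and> \<sigma> ! k = None \<and> (\<forall>l<length \<tau>. l \<noteq> q \<longrightarrow> l \<noteq> k \<longrightarrow> \<sigma> ! l = \<tau> ! l)"
          using list_eq_update2 [of \<sigma> \<tau> q k "Some (e + f - 2)" None] len k qn by simp
        also have "\<dots> \<longleftrightarrow> e + f = D + 2 \<and> (\<forall>l<length \<tau>. l \<noteq> q \<longrightarrow> l \<noteq> k \<longrightarrow> \<sigma> ! l = \<tau> ! l)"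
          using D N(1) pos by auto
        finally show ?thesis by simp
      qed
      finally show ?thesis .
    qed
  next
    case neg: False
    have J: "Js \<sigma> = insert k (Js \<tau>)" "k \<notin> Js \<tau>"
      using Js_insert [OF len(2,1) k] N neg by metis+
    obtain e where e: "\<sigma> ! k = Some e" using N(1) neg by auto
    show ?thesis
    proof (cases "Js \<tau> = {}")
      case True
      have J1: "Js \<sigma> = {k}" using J(1) True by simp
      have "e \<le> 2 \<and> even e" using b(1) e J1 by (simp add: Bst_iff degs_def tr_single)
      then have e2: "e = 0 \<or> e = 2" by presburger
      have x3: "x < 3" using b(2) by (auto simp: Bst_def)
      have y0: "y = 0" using degs_Bst [OF b(1)] J1 by simp
      have "\<sigma> = \<tau>[k := Some 0] \<longleftrightarrow> e = 0"
      proof (subst list_eq_update1)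
        show "\<sigma> ! k = Some 0 \<and> (\<forall>l<length \<tau>. l \<noteq> k \<longrightarrow> \<sigma> ! l = \<tau> ! l) \<longleftrightarrow> e = 0"
          using notin_Js [of _ \<sigma>] notin_Js [of _ \<tau>] True J1 len e by simp
      qed (use len k in auto)
      then have "step w k (\<sigma>, y) (\<tau>, x) \<longleftrightarrow> e = 0 \<and> (x = gi w k \<or> x = Suc (gi w k))"
        using neg N(2) True y0 by auto
      moreover have "kh_term w (sres w \<sigma>, lset w \<epsilon> {k} \<sigma>) (sres w \<tau>, strands w \<epsilon> x) \<longleftrightarrow> e = 0 \<and> (x = gi w k \<or> x = Suc (gi w k))"
        by (rule kh_base_remove [OF _ _ k x3 e e2 fl']) (simp_all add: U True J1)
      ultimately show ?thesis using True J1 by (simp add: phi_simps del: step.simps)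
    next
      case False
      interpret insertion w "Js \<tau>" k
        by unfold_locales (use False J(2) k len in \<open>auto simp: Js_def\<close>)
      have J\<sigma>: "Js \<sigma> \<noteq> {}" using J(1) by simp
      have d: "degs w (Js \<tau>) \<tau>" "degs w (insert k (Js \<tau>)) \<sigma>"
        using degs_Bst [OF b(2) False] degs_Bst [OF b(1) J\<sigma>] J(1) by auto
      have c: "circles w (sres w \<tau>) = circ (Js \<tau>)" "circles w (sres w \<sigma>) = circ (insert k (Js \<tau>))"
        using circles_sres [OF len(2) False] circles_sres [OF len(1) J\<sigma>] J(1) by (simp_all add: circ_def)
      have y0: "y = 0" using degs_Bst [OF b(1) J\<sigma>] by simp
      have q: "nx (Js \<tau>) (Suc k) = q" unfolding q_def by (rule nx_Suc [OF finK neK kK])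
      have qn: "q < length \<tau>" "q \<noteq> k" "q \<in> Js \<tau>" using qK q_neq len by (auto simp: Js_def)
      have rest: "(\<forall>l\<in>Js \<tau>. l \<noteq> q \<longrightarrow> \<tau> ! l = \<sigma> ! l) \<longleftrightarrow> (\<forall>l<length \<tau>. l \<noteq> q \<longrightarrow> l \<noteq> k \<longrightarrow> \<sigma> ! l = \<tau> ! l)"
      proof -
        have "l < length w" if "l \<in> Js \<tau>" for l using that len by (simp add: Js_def)
        moreover have "\<sigma> ! l = \<tau> ! l" if "l < length w" "l \<noteq> k" "l \<notin> Js \<tau>" for l
          using N(3) [OF that(1,2)] notin_Js [OF that(3)] that(1) len by simp
        ultimately show ?thesis using J(2) len by metis
      qed
      obtain D where D: "\<tau> ! q = Some D" using qn by (auto simp: Js_def)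
      obtain f where f: "\<sigma> ! q = Some f" using N(3) [of q] D qn len by auto
      have "kh_term w (phi w \<epsilon> (\<sigma>, y)) (phi w \<epsilon> (\<tau>, x)) \<longleftrightarrow> (\<exists>D e f. ipair \<tau> \<sigma> D e f \<and> e + f = D)"
        using kh_remove [OF d c fl', of \<epsilon>] False J\<sigma> J(1) by (simp add: phi_simps)
      also have "\<dots> \<longleftrightarrow> e + f = D \<and> (\<forall>l<length \<tau>. l \<noteq> q \<longrightarrow> l \<noteq> k \<longrightarrow> \<sigma> ! l = \<tau> ! l)"
        using D e f rest by (auto simp: ipair_def)
      also have "\<dots> \<longleftrightarrow> step w k (\<sigma>, y) (\<tau>, x)"
      proof -
        have "step w k (\<sigma>, y) (\<tau>, x) \<longleftrightarrow> (\<exists>e'\<le>D. \<sigma> = \<tau>[q := Some (D - e'), k := Some e'])"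
          using neg N(2) D False q y0 by auto
        also have "\<dots> \<longleftrightarrow> (\<exists>e'\<le>D. \<sigma> ! q = Some (D - e') \<and> \<sigma> ! k = Some e' \<and> (\<forall>l<length \<tau>. l \<noteq> q \<longrightarrow> l \<noteq> k \<longrightarrow> \<sigma> ! l = \<tau> ! l))"
          using list_eq_update2 [of \<sigma> \<tau> q k] len k qn by simp
        also have "\<dots> \<longleftrightarrow> e + f = D \<and> (\<forall>l<length \<tau>. l \<noteq> q \<longrightarrow> l \<noteq> k \<longrightarrow> \<sigma> ! l = \<tau> ! l)"
          using e f by auto
        finally show ?thesis by simp
      qed
      finally show ?thesis .
    qed
  qed
qed

lemma step_flips:
  assumes "step w k (\<sigma>, y) (\<tau>, x)" "k < length w" "length \<tau> = length w"
  shows "flips w (sres w \<sigma>) (sres w \<tau>) k"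
proof -
  have k: "k < length \<tau>" using assms by simp
  have len: "length \<sigma> = length w" using step_None(1) [OF assms(1) k] assms(3) by simp
  show ?thesis
    using sres_flips [OF len assms(3,2)] step_None [OF assms(1) k] assms(3) by auto
qed

theorem kh_term_mdiff:
  assumes b: "b \<in> Bst w" "b' \<in> Bst w"
  shows "kh_term w (phi w \<epsilon> b) (phi w \<epsilon> b') \<longleftrightarrow> mdiff w b' b"
proof -
  obtain \<sigma> y \<tau> x where be: "b = (\<sigma>, y)" "b' = (\<tau>, x)" by (cases b; cases b')
  have len: "length \<tau> = length w" using b be by (auto dest: Bst_length)
  have f: "fst (phi w \<epsilon> b) = sres w \<sigma>" "fst (phi w \<epsilon> b') = sres w \<tau>" by (simp_all add: phi_def be)
  show ?thesis
  proof
    assume a: "kh_term w (phi w \<epsilon> b) (phi w \<epsilon> b')"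
    then obtain k where k: "flips w (sres w \<sigma>) (sres w \<tau>) k" using kh_term_flips f by metis
    then have "k < length w" by (simp add: flips_def)
    then show "mdiff w b' b" using kh_term_phi [OF _ _ _ k, where \<epsilon> = \<epsilon>] a b be mdiff_iff [OF b] by blast
  next
    assume "mdiff w b' b"
    then obtain k where k: "k < length w" "step w k (\<sigma>, y) (\<tau>, x)" using mdiff_iff [OF b] be by blast
    show "kh_term w (phi w \<epsilon> b) (phi w \<epsilon> b')"
      using kh_term_phi [OF _ _ k(1) step_flips [OF k(2,1) len], where \<epsilon> = \<epsilon>] b be k(2) by blast
  qed
qed

section \<open>Annular degrees of the generators\<close>

lemma essential_Tset: "\<not> essential w (Tset w K q)"
proof -
  have "{j. (length w, j, True) \<in> Tset w K q} = (if nx K (Suc (length w)) = q then {gi w q, Suc (gi w q)} else {})"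
    using gi_01 [of w q] by (auto simp: Tset_def in_diag_nodes)
  then show ?thesis by (simp add: essential_def)
qed

text \<open>The essential circle crosses the seam with its third strand only, or with all three
  strands if the region at the seam contains no trivial circle.\<close>

lemma essential_Eset: "essential w (Eset w K)"
proof -
  let ?q = "nx K (Suc (length w))"
  have "{j. (length w, j, True) \<in> Eset w K} = {j. j < 3 \<and> \<not> (tr w K ?q \<and> (j = gi w ?q \<or> j = Suc (gi w ?q)))}"
    by (auto simp: Eset_def in_diag_nodes lab_def Let_def)
  also have "\<dots> = (if tr w K ?q then {thd w ?q} else {0, 1, 2})"
    using gi_01 [of w ?q] by (auto simp: thd_def)
  finally show ?thesis by (simp add: essential_def)
qed

lemma essential_Sset: "j < 3 \<Longrightarrow> essential w (Sset w j)"
proof -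
  assume "j < 3"
  then have "{i. (length w, i, True) \<in> Sset w j} = {j}" by (auto simp: Sset_def in_diag_nodes)
  then show ?thesis by (simp add: essential_def)
qed

lemma finite_circles [simp]: "finite (circles w s)"
  by (simp add: circles_def diag_nodes_def)

lemma finite_gens: "finite (gens w)"
proof -
  have "gens w \<subseteq> (\<Union>s\<in>Pow {..<length w}. Pair s ` Pow (circles w s))" by (auto simp: gens_def)
  then show ?thesis by (rule finite_subset) auto
qed

lemma kgr_K:
  assumes K: "Uset w s \<noteq> {}" and P: "P \<subseteq> circles w s"
  shows "kgr w (s, P) = (if Eset w (Uset w s) \<in> P then 1 else - 1)"
proof -
  let ?E = "Eset w (Uset w s)"
  have ess: "c \<in> circles w s \<Longrightarrow> essential w c \<longleftrightarrow> c = ?E" for c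
    using circles_Uset [OF K] essential_Tset essential_Eset by fastforce
  have E: "?E \<in> circles w s" using circles_Uset [OF K] by simp
  have "{c \<in> P. essential w c} = (if ?E \<in> P then {?E} else {})" using ess P E by auto
  moreover have "{c \<in> circles w s - P. essential w c} = (if ?E \<in> P then {} else {?E})" using ess E by auto
  ultimately show ?thesis by (simp add: kgr_def)
qed

lemma kgr_0:
  assumes K: "Uset w s = {}" and P: "P \<subseteq> circles w s"
  shows "kgr w (s, P) = 2 * int (card P) - 3" "card P \<le> 3"
proof -
  have c: "circles w s = Sset w ` {..<3}" by (rule circles_empty [OF K])
  have inj: "inj_on (Sset w) {..<3}" using Sset_inj [of _ w] by (auto simp: inj_on_def)
  have card: "card (circles w s) = 3" using c inj by (simp add: card_image)
  have ess: "c \<in> circles w s \<Longrightarrow> essential w c" for c using c essential_Sset by auto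
  have "{c \<in> P. essential w c} = P" using ess P by auto
  moreover have "{c \<in> circles w s - P. essential w c} = circles w s - P" using ess by auto
  moreover have "card (circles w s - P) = 3 - card P" using P card by (simp add: card_Diff_subset finite_subset [OF P])
  moreover show le: "card P \<le> 3" using card_mono [OF finite_circles P] card by simp
  ultimately show "kgr w (s, P) = 2 * int (card P) - 3" by (simp add: kgr_def of_nat_diff)
qed

definition esgn :: "bool \<Rightarrow> int" where "esgn \<epsilon> = (if \<epsilon> then 1 else - 1)"

lemma card_strands: "x < 3 \<Longrightarrow> card (strands w \<epsilon> x) = (if \<epsilon> then 2 else 1)"
proof -
  assume x: "x < 3"
  have inj: "inj_on (Sset w) ({..<3} - {x})" using Sset_inj [of _ w] by (auto simp: inj_on_def)
  have "card ({..<3} - {x}) = 2" using x by (simp add: card_Diff_singleton)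
  then show ?thesis using inj by (simp add: strands_def card_image)
qed

lemma phi_gens:
  assumes "b \<in> Bst w"
  shows "phi w \<epsilon> b \<in> gens w" "kgr w (phi w \<epsilon> b) = esgn \<epsilon>"
proof -
  obtain \<tau> x where b: "b = (\<tau>, x)" by (cases b)
  have len: "length \<tau> = length w" using assms b by (auto dest: Bst_length)
  have U: "Uset w (sres w \<tau>) = Js \<tau>" by (rule Uset_sres [OF len])
  have s: "sres w \<tau> \<subseteq> {..<length w}" by (auto simp: sres_def)
  have "phi w \<epsilon> b \<in> gens w \<and> kgr w (phi w \<epsilon> b) = esgn \<epsilon>"
  proof (cases "Js \<tau> = {}")
    case True
    have x: "x < 3" using assms b by (auto simp: Bst_def)
    have sub: "strands w \<epsilon> x \<subseteq> circles w (sres w \<tau>)"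
      using circles_empty [of w "sres w \<tau>"] U True x by (auto simp: strands_def)
    show ?thesis using sub s kgr_0 [of w "sres w \<tau>", OF _ sub] U True card_strands [OF x, of w \<epsilon>]
      by (simp add: b phi_simps gens_def esgn_def)
  next
    case False
    have sub: "lset w \<epsilon> (Js \<tau>) \<tau> \<subseteq> circles w (sres w \<tau>)"
      using circles_sres [OF len False] by (auto simp: lset_def)
    have T: "Tset w (Js \<tau>) l \<noteq> Eset w (Js \<tau>)" for l
      using essential_Tset essential_Eset by metis
    have "Eset w (Js \<tau>) \<in> lset w \<epsilon> (Js \<tau>) \<tau> \<longleftrightarrow> \<epsilon>"
      using T [THEN not_sym] by (auto simp: lset_def)
    then show ?thesis using sub s kgr_K [of w "sres w \<tau>", OF _ sub] U False
      by (simp add: b phi_simps gens_def esgn_def)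
  qed
  then show "phi w \<epsilon> b \<in> gens w" "kgr w (phi w \<epsilon> b) = esgn \<epsilon>" by auto
qed

lemma Tset_eq_iff: "finite K \<Longrightarrow> l \<in> K \<Longrightarrow> l < length w \<Longrightarrow> Tset w K l = Tset w K m \<longleftrightarrow> l = m"
  using Tset_nonempty [of K l w] by (auto simp: Tset_def)

lemma phi_inj: "inj_on (phi w \<epsilon>) (Bst w)"
proof (rule inj_onI)
  fix b b' assume b: "b \<in> Bst w" "b' \<in> Bst w" and eq: "phi w \<epsilon> b = phi w \<epsilon> b'"
  obtain \<sigma> y \<tau> x where be: "b = (\<sigma>, y)" "b' = (\<tau>, x)" by (cases b; cases b')
  have len: "length \<sigma> = length w" "length \<tau> = length w" using b be by (auto dest: Bst_length)
  have s: "sres w \<sigma> = sres w \<tau>" using eq by (simp add: phi_def be)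
  have J: "Js \<sigma> = Js \<tau>" using Uset_sres len s by metis
  show "b = b'"
  proof (cases "Js \<tau> = {}")
    case True
    then have "\<sigma> = \<tau>" using J allN_Js len by metis
    moreover have "y = x"
    proof -
      have lt: "y < 3" "x < 3" using b be by (auto simp: Bst_def)
      have "strands w \<epsilon> y = strands w \<epsilon> x" using eq True J by (simp add: be phi_simps)
      then show ?thesis using mem_strands [OF lt(1) lt(1), of w \<epsilon>] mem_strands [OF lt(1) lt(2), of w \<epsilon>] by (cases \<epsilon>) simp_all
    qed
    ultimately show ?thesis by (simp add: be)
  next
    case False
    have le: "lset w \<epsilon> (Js \<tau>) \<sigma> = lset w \<epsilon> (Js \<tau>) \<tau>" using eq False J by (simp add: be phi_simps)
    have T: "Tset w (Js \<tau>) l \<noteq> Eset w (Js \<tau>)" for l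
      using essential_Tset essential_Eset by metis
    have mem: "Tset w (Js \<tau>) l \<in> lset w \<epsilon> (Js \<tau>) \<rho> \<longleftrightarrow> \<rho> ! l = Some 0" if "l \<in> Js \<tau>" "tr w (Js \<tau>) l" for l \<rho>
    proof -
      have "l < length w" using that len by (simp add: Js_def)
      then show ?thesis using that T [of l] Tset_eq_iff [OF finite_Js that(1)] by (auto simp: lset_def)
    qed
    have d: "degs w (Js \<tau>) \<sigma>" "degs w (Js \<tau>) \<tau>" "y = 0" "x = 0"
      using degs_Bst [of \<sigma> y w] degs_Bst [of \<tau> x w] b be J False by auto
    have "\<sigma> ! l = \<tau> ! l" if l: "l < length w" for l
    proof (cases "l \<in> Js \<tau>")
      case True
      obtain e where e: "e \<le> 2" "\<sigma> ! l = Some e" "even e \<longleftrightarrow> tr w (Js \<tau>) l" using d(1) True by (auto simp: degs_def)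
      obtain f where f: "f \<le> 2" "\<tau> ! l = Some f" "even f \<longleftrightarrow> tr w (Js \<tau>) l" using d(2) True by (auto simp: degs_def)
      have "e = 0 \<longleftrightarrow> f = 0" if "tr w (Js \<tau>) l" using mem [OF True that, of \<sigma>] mem [OF True that, of \<tau>] le e f by simp
      moreover have "e = 0 \<or> e = 1 \<or> e = 2" "f = 0 \<or> f = 1 \<or> f = 2" using e(1) f(1) by linarith+
      ultimately have "e = f" using e(3) f(3) by (cases "tr w (Js \<tau>) l") auto
      then show ?thesis using e f by simp
    next
      case False
      then have "\<sigma> ! l = None" "\<tau> ! l = None" using J l len notin_Js [of l \<sigma>] notin_Js [of l \<tau>] by simp_all
      then show ?thesis by simp
    qed
    then have "\<sigma> = \<tau>" using len by (intro nth_equalityI) auto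
    then show ?thesis using d be by simp
  qed
qed

lemma phi_onto:
  assumes g: "g \<in> gens w" and k: "kgr w g = esgn \<epsilon>"
  shows "g \<in> phi w \<epsilon> ` Bst w"
proof -
  obtain s P where ge: "g = (s, P)" by (cases g)
  have s: "s \<subseteq> {..<length w}" and P: "P \<subseteq> circles w s" using g ge by (auto simp: gens_def)
  let ?K = "Uset w s" and ?n = "length w"
  show ?thesis
  proof (cases "?K = {}")
    case True
    have c: "circles w s = Sset w ` {..<3}" by (rule circles_empty [OF True])
    let ?\<tau> = "replicate ?n None :: nat option list"
    have J: "Js ?\<tau> = {}" by (auto simp: Js_def)
    have sr: "sres w ?\<tau> = s" using True s by (auto simp: sres_def Uset_def vertical_smoothing_def)
    have card: "card P = (if \<epsilon> then 2 else 1)" using kgr_0 [OF True P] k ge by (auto simp: esgn_def split: if_splits)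
    have inj: "inj_on (Sset w) {..<3}" using Sset_inj [of _ w] by (auto simp: inj_on_def)
    obtain A where A: "A \<subseteq> {..<3}" "P = Sset w ` A" using P c by (metis subset_image_iff)
    have cA: "card A = (if \<epsilon> then 2 else 1)" using card A inj by (metis card_image inj_on_subset)
    have finA: "finite A" using A(1) finite_subset by blast
    have "\<exists>x<3. P = strands w \<epsilon> x"
    proof (cases \<epsilon>)
      case True
      have "card ({..<3} - A) = 1" using cA True A(1) finA by (simp add: card_Diff_subset)
      then obtain x where x: "{..<3} - A = {x}" by (auto simp: card_1_singleton_iff)
      then have "x < 3" "A = {..<3} - {x}" using A(1) by auto
      then show ?thesis using A(2) True by (auto simp: strands_def)
    next
      case False
      then obtain x where "A = {x}" using cA by (auto simp: card_1_singleton_iff)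
      then show ?thesis using A False by (auto simp: strands_def)
    qed
    then obtain x where x: "x < 3" "P = strands w \<epsilon> x" by blast
    have "(?\<tau>, x) \<in> Bst w" using x J by (simp add: Bst_iff)
    moreover have "g = phi w \<epsilon> (?\<tau>, x)" using J sr x ge by (simp add: phi_simps)
    ultimately show ?thesis by blast
  next
    case False
    \<comment> \<open>The state is read off the labels: degree 1 for an arc of the essential circle,
      0 or 2 for a trivial circle with label + or -.\<close>
    define \<tau> :: "nat option list" where "\<tau> = map (\<lambda>l. if l \<in> ?K then Some (if tr w ?K l then (if Tset w ?K l \<in> P then 0 else 2) else 1) else None) [0..<?n]"
    have len: "length \<tau> = ?n" by (simp add: \<tau>_def)
    have nth: "\<tau> ! l = (if l \<in> ?K then Some (if tr w ?K l then (if Tset w ?K l \<in> P then 0 else 2) else 1) else None)" if "l < ?n" for l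
      using that by (simp add: \<tau>_def)
    have J: "Js \<tau> = ?K"
    proof (rule set_eqI)
      fix l
      show "l \<in> Js \<tau> \<longleftrightarrow> l \<in> ?K"
        using nth [of l] Uset_less [of l w s] len by (cases "l < ?n") (auto simp: Js_def)
    qed
    have sr: "sres w \<tau> = s"
    proof (rule set_eqI)
      fix l show "l \<in> sres w \<tau> \<longleftrightarrow> l \<in> s"
      proof (cases "l < ?n")
        case True
        have "\<tau> ! l \<noteq> None \<longleftrightarrow> l \<in> ?K" using nth [OF True] by simp
        then show ?thesis using True by (auto simp: sres_def Uset_def vertical_smoothing_def)
      next
        case False
        then show ?thesis using s by (auto simp: sres_def)
      qed
    qed
    have d: "degs w ?K \<tau>" using nth Uset_less by (auto simp: degs_def)
    have B: "(\<tau>, 0) \<in> Bst w" using len J False d by (simp add: Bst_iff)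
    have "P = lset w \<epsilon> ?K \<tau>"
    proof -
      have E: "Eset w ?K \<in> P \<longleftrightarrow> \<epsilon>" using kgr_K [OF False P] k ge by (auto simp: esgn_def split: if_splits)
      have T: "Tset w ?K l \<in> P \<longleftrightarrow> \<tau> ! l = Some 0" if "l \<in> ?K" "tr w ?K l" for l
        using nth [OF Uset_less [OF that(1)]] that by auto
      have "P = {c \<in> Tset w ?K ` {l \<in> ?K. tr w ?K l} \<union> {Eset w ?K}. c \<in> P}"
        using P circles_Uset [OF False] by auto
      also have "\<dots> = Tset w ?K ` {l \<in> ?K. tr w ?K l \<and> Tset w ?K l \<in> P} \<union> (if Eset w ?K \<in> P then {Eset w ?K} else {})"
        by auto
      also have "{l \<in> ?K. tr w ?K l \<and> Tset w ?K l \<in> P} = {l \<in> ?K. tr w ?K l \<and> \<tau> ! l = Some 0}"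
        using T by auto
      finally show ?thesis using E by (simp add: lset_def)
    qed
    then have "g = phi w \<epsilon> (\<tau>, 0)" using J sr False ge by (simp add: phi_simps)
    then show ?thesis using B by blast
  qed
qed

definition gensk :: "braid3 \<Rightarrow> int \<Rightarrow> (nat set \<times> node set set) set" where
  "gensk w m = {g \<in> gens w. kgr w g = m}"

lemma gensk_phi: "gensk w (esgn \<epsilon>) = phi w \<epsilon> ` Bst w"
  using phi_gens phi_onto by (auto simp: gensk_def)

lemma finite_Bst: "finite (Bst w)"
  using finite_gens [of w] gensk_phi [of w True] finite_imageD [OF _ phi_inj [of w True]]
  by (metis (no_types, lifting) gensk_def finite_subset mem_Collect_eq subsetI)

lemma kgr_values: "g \<in> gens w \<Longrightarrow> kgr w g \<in> {3, - 3, 1, - 1}"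
proof -
  assume g: "g \<in> gens w"
  obtain s P where ge: "g = (s, P)" by (cases g)
  have P: "P \<subseteq> circles w s" using g ge by (auto simp: gens_def)
  show ?thesis
  proof (cases "Uset w s = {}")
    case True
    have "card P \<in> {0, 1, 2, 3}" using kgr_0(2) [OF True P] by auto
    then show ?thesis using kgr_0(1) [OF True P] ge by auto
  next
    case False
    then show ?thesis using kgr_K [OF False P] ge by auto
  qed
qed

text \<open>Annular degree 3 or -3 needs three essential circles with equal labels, which only the
  vertical resolution provides.\<close>

lemma gensk_three:
  assumes m: "m = 3 \<or> m = - 3"
  shows "card (gensk w m) = 1"
proof -
  let ?s = "{k. k < length w \<and> \<not> snd (w ! k)}"
  have U: "Uset w ?s = {}" by (auto simp: Uset_def vertical_smoothing_def)
  have uniq: "s = ?s" if "s \<subseteq> {..<length w}" "Uset w s = {}" for s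
    using that by (auto simp: Uset_def vertical_smoothing_def)
  let ?P = "if m = 3 then circles w ?s else {}"
  have c: "card (circles w ?s) = 3"
  proof -
    have "inj_on (Sset w) {..<3}" using Sset_inj [of _ w] by (auto simp: inj_on_def)
    then show ?thesis using circles_empty [OF U] by (simp add: card_image)
  qed
  have "gensk w m = {(?s, ?P)}"
  proof
    show "gensk w m \<subseteq> {(?s, ?P)}"
    proof
      fix g assume "g \<in> gensk w m"
      then have g: "g \<in> gens w" "kgr w g = m" by (auto simp: gensk_def)
      obtain s P where ge: "g = (s, P)" by (cases g)
      have s: "s \<subseteq> {..<length w}" and P: "P \<subseteq> circles w s" using g ge by (auto simp: gens_def)
      have U': "Uset w s = {}"
      proof (rule ccontr)
        assume "Uset w s \<noteq> {}"
        from kgr_K [OF this P] show False using g(2) ge m by (auto split: if_splits)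
      qed
      have se: "s = ?s" by (rule uniq [OF s U'])
      have k: "2 * int (card P) - 3 = m" using kgr_0(1) [OF U' P] g(2) ge by simp
      have "P = ?P"
      proof (cases "m = 3")
        case True
        then have "card P = card (circles w s)" using k c se by simp
        then have "P = circles w s" using card_subset_eq [OF finite_circles P] by simp
        then show ?thesis using True se by simp
      next
        case False
        then have "card P = 0" using k m by simp
        then show ?thesis using False finite_subset [OF P finite_circles] by simp
      qed
      then show "g \<in> {(?s, ?P)}" using ge se by simp
    qed
    have "(?s, ?P) \<in> gens w" by (auto simp: gens_def)
    moreover have "kgr w (?s, ?P) = m"
      using kgr_0(1) [OF U, of "circles w ?s"] kgr_0(1) [OF U, of "{}"] c m by auto
    ultimately show "{(?s, ?P)} \<subseteq> gensk w m" by (simp add: gensk_def)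
  qed
  then show ?thesis by simp
qed

lemma akh_apply_ap: "akh_apply w S = ap (akh_diff w) (gens w) S"
  by (simp add: akh_apply_def ap_def)

text \<open>The dimension is the number of generators minus twice the rank. The outer parts
  contribute one generator each and no rank, the inner parts two copies of the complex on
  \<open>Bst w\<close>.\<close>

theorem akh_dim_Bst: "akh_dim w = 2 + 2 * card (Bst w) - 4 * rk (mdiff w) (Bst w) (Bst w)"
proof -
  let ?R = "\<lambda>A. rk (akh_diff w) (gens w) A"
  have rk1: "?R (gensk w (esgn \<epsilon>)) = rk (mdiff w) (Bst w) (Bst w)" for \<epsilon>
    unfolding gensk_phi
  proof (rule rk_bij [OF phi_inj _ finite_Bst])
    show "phi w \<epsilon> ` Bst w \<subseteq> gens w" using phi_gens by auto
    show "akh_diff w (phi w \<epsilon> y) (phi w \<epsilon> x) \<longleftrightarrow> mdiff w y x" if "x \<in> Bst w" "y \<in> Bst w" for x y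
      using that phi_gens [of _ w \<epsilon>] kh_term_mdiff [OF that] by (simp add: akh_diff_def)
    show "z \<in> phi w \<epsilon> ` Bst w" if "x \<in> Bst w" "z \<in> gens w" "akh_diff w z (phi w \<epsilon> x)" for x z
      using that phi_gens(2) [of x w \<epsilon>] by (intro phi_onto) (auto simp: akh_diff_def)
  qed
  have rk3: "?R (gensk w m) = 0" if m: "m = 3 \<or> m = - 3" for m
  proof (rule rk_zero)
    fix x y assume x: "x \<in> gensk w m" and y: "y \<in> gens w"
    show "\<not> akh_diff w y x"
    proof
      assume d: "akh_diff w y x"
      then have "y \<in> gensk w m" using x y by (auto simp: akh_diff_def gensk_def)
      then have "y = x" using x gensk_three [OF m, of w] by (auto simp: card_1_singleton_iff)
      then have "kh_term w x x" using d by (simp add: akh_diff_def)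
      then show False using kh_term_flips [of w x x] by (auto simp: flips_def)
    qed
  qed
  have fin: "finite (gensk w m)" for m using finite_gens by (auto simp: gensk_def)
  have part: "gens w = {x \<in> gens w. kgr w x \<in> {3, - 3, 1, - 1}}" using kgr_values by auto
  have "?R (gens w) = ?R {x \<in> gens w. kgr w x \<in> {3, - 3, 1, - 1}}" using part by simp
  also have "\<dots> = (\<Sum>m\<in>{3, - 3, 1, - 1}. ?R {x \<in> gens w. kgr w x = m})"
    by (rule rk_UN [where s = "\<lambda>m. m"]) (auto simp: finite_gens akh_diff_def)
  also have "\<dots> = 2 * rk (mdiff w) (Bst w) (Bst w)"
    using rk3 [of 3] rk3 [of "- 3"] rk1 [of True] rk1 [of False] by (simp add: gensk_def esgn_def)
  finally have R: "?R (gens w) = 2 * rk (mdiff w) (Bst w) (Bst w)" .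
  have all: "gens w = gensk w 3 \<union> gensk w (- 3) \<union> gensk w 1 \<union> gensk w (- 1)"
    using kgr_values by (fastforce simp: gensk_def)
  then have "card (gens w) = card (gensk w 3) + card (gensk w (- 3)) + card (gensk w 1) + card (gensk w (- 1))"
  proof -
    have d: "gensk w a \<inter> gensk w b = {}" if "a \<noteq> b" for a b using that by (auto simp: gensk_def)
    have "(gensk w 3 \<union> gensk w (- 3)) \<inter> gensk w 1 = {}" "(gensk w 3 \<union> gensk w (- 3) \<union> gensk w 1) \<inter> gensk w (- 1) = {}"
      "gensk w 3 \<inter> gensk w (- 3) = {}"
      using d [of 3 1] d [of "- 3" 1] d [of 3 "- 1"] d [of "- 3" "- 1"] d [of 1 "- 1"] d [of 3 "- 3"] by auto
    then have "card (gensk w 3 \<union> gensk w (- 3) \<union> gensk w 1 \<union> gensk w (- 1)) =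
      card (gensk w 3) + card (gensk w (- 3)) + card (gensk w 1) + card (gensk w (- 1))"
      using fin by (simp add: card_Un_disjoint)
    then show ?thesis using all by simp
  qed
  moreover have "card (gensk w (esgn \<epsilon>)) = card (Bst w)" for \<epsilon>
    unfolding gensk_phi by (rule card_image [OF phi_inj])
  from this [of True] this [of False] have "card (gensk w 1) = card (Bst w)" "card (gensk w (- 1)) = card (Bst w)"
    by (simp_all add: esgn_def)
  ultimately have card: "card (gens w) = 2 + 2 * card (Bst w)"
    using gensk_three [of 3 w] gensk_three [of "- 3" w] by simp
  have "gf2_dim {S. S \<subseteq> gens w \<and> akh_apply w S = {}} = card (gens w) - ?R (gens w)"
    unfolding akh_apply_ap by (rule gf2_dim_eq) (rule card_image_rk(3) [OF finite_gens])
  moreover have "gf2_dim (akh_apply w ` Pow (gens w)) = ?R (gens w)"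
    unfolding akh_apply_ap rk_def ..
  ultimately show ?thesis unfolding akh_dim_def by (simp add: R card)
qed

section \<open>Gradings and the classes of the two extra generators\<close>

text \<open>The homological degree relative to the vertical resolution, and an internal degree that
  the differential preserves: the summand 2 of a positive cup-cap compensates for the
  coproduct.\<close>

definition gr :: "braid3 \<Rightarrow> nat option list \<times> nat \<Rightarrow> int \<times> int" where
  "gr w b = ((\<Sum>k<length w. case fst b ! k of None \<Rightarrow> 0 | Some d \<Rightarrow> if snd (w ! k) then 1 else - 1),
     (\<Sum>k<length w. case fst b ! k of None \<Rightarrow> 0 | Some d \<Rightarrow> (if snd (w ! k) then 2 else 0) - int d))"

lemma sum_list_update:
  fixes g :: "nat \<Rightarrow> 'a \<Rightarrow> int"
  assumes "k < length \<tau>"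
  shows "(\<Sum>l<length \<tau>. g l (\<tau>[k := b] ! l)) = (\<Sum>l<length \<tau>. g l (\<tau> ! l)) - g k (\<tau> ! k) + g k b"
proof -
  have "(\<Sum>l<length \<tau>. g l (\<tau>[k := b] ! l)) = g k b + (\<Sum>l\<in>{..<length \<tau>} - {k}. g l (\<tau>[k := b] ! l))"
    using assms by (subst sum.remove [of _ k]) auto
  also have "(\<Sum>l\<in>{..<length \<tau>} - {k}. g l (\<tau>[k := b] ! l)) = (\<Sum>l\<in>{..<length \<tau>} - {k}. g l (\<tau> ! l))"
    by (intro sum.cong) auto
  also have "\<dots> = (\<Sum>l<length \<tau>. g l (\<tau> ! l)) - g k (\<tau> ! k)"
    using assms by (simp add: sum_diff1)
  finally show ?thesis by simp
qed

lemma sum_list_update2: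
  fixes g :: "nat \<Rightarrow> 'a \<Rightarrow> int"
  assumes "k < length \<tau>" "q < length \<tau>" "q \<noteq> k"
  shows "(\<Sum>l<length \<tau>. g l (\<tau>[q := a, k := b] ! l)) =
    (\<Sum>l<length \<tau>. g l (\<tau> ! l)) - g k (\<tau> ! k) - g q (\<tau> ! q) + g k b + g q a"
  using sum_list_update [of k "\<tau>[q := a]" g b] sum_list_update [of q \<tau> g a] assms by simp

lemma gr_step:
  assumes s: "step w k (\<sigma>, y) (\<tau>, x)" and k: "k < length w" and len: "length \<tau> = length w"
  shows "gr w (\<tau>, x) = (fst (gr w (\<sigma>, y)) + 1, snd (gr w (\<sigma>, y)))"
proof -
  let ?g = "\<lambda>l t. case t of None \<Rightarrow> (0::int) | Some d \<Rightarrow> if snd (w ! l) then 1 else - 1"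
  let ?m = "\<lambda>l t. case t of None \<Rightarrow> (0::int) | Some d \<Rightarrow> (if snd (w ! l) then 2 else 0) - int d"
  have k': "k < length \<tau>" using k len by simp
  have gr: "gr w (\<rho>, z) = ((\<Sum>l<length \<tau>. ?g l (\<rho> ! l)), (\<Sum>l<length \<tau>. ?m l (\<rho> ! l)))" for \<rho> z
    by (simp add: gr_def len)
  have q: "nx (Js \<tau>) (Suc k) < length \<tau>" if "Js \<tau> \<noteq> {}"
    using nx_in [OF finite_Js that] by (auto simp: Js_def)
  have qk: "nx (Js \<tau>) (Suc k) \<noteq> k" if "Js \<tau> \<noteq> {}" "Js \<tau> \<noteq> {k}"
  proof
    assume a: "nx (Js \<tau>) (Suc k) = k"
    then have "(Suc k \<le> k \<and> (\<forall>l\<in>Js \<tau>. \<not> (Suc k \<le> l \<and> l < k))) \<or> (\<forall>l\<in>Js \<tau>. l < Suc k \<and> k \<le> l)"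
      using nx_eq_iff [OF finite_Js that(1), of "Suc k" k] by blast
    then have "\<forall>l\<in>Js \<tau>. l = k" by auto
    then have "Js \<tau> \<subseteq> {k}" by blast
    then show False using that by (simp add: subset_singleton_iff)
  qed
  show ?thesis
  proof (cases "snd (w ! k)")
    case pos: True
    then obtain e where e: "\<tau> ! k = Some e" using s by auto
    show ?thesis
    proof (cases "Js \<tau> = {k}")
      case True
      then have "\<sigma> = \<tau>[k := None]" "e = 2" using s pos e by auto
      then show ?thesis using sum_list_update [OF k', of ?g None] sum_list_update [OF k', of ?m None] pos e by (simp add: gr)
    next
      case False
      have J: "Js \<tau> \<noteq> {}" using e k' by (auto simp: Js_def)
      from s pos e False obtain f where f: "\<tau> ! nx (Js \<tau>) (Suc k) = Some f" "2 \<le> e + f"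
        "\<sigma> = \<tau>[nx (Js \<tau>) (Suc k) := Some (e + f - 2), k := None]" by auto
      have i: "int (e + f - 2) = int e + int f - 2" using f(2) by linarith
      show ?thesis unfolding gr f(3) sum_list_update2 [OF k' q [OF J] qk [OF J False], of ?g "Some (e + f - 2)" None]
          sum_list_update2 [OF k' q [OF J] qk [OF J False], of ?m "Some (e + f - 2)" None] e f(1)
        by (simp add: pos i)
    qed
  next
    case neg: False
    then have N: "\<tau> ! k = None" using s by simp
    show ?thesis
    proof (cases "Js \<tau> = {}")
      case True
      then have "\<sigma> = \<tau>[k := Some 0]" using s neg by auto
      then show ?thesis using sum_list_update [OF k', of ?g "Some 0"] sum_list_update [OF k', of ?m "Some 0"] neg N by (simp add: gr)
    next
      case J: False
      have J': "Js \<tau> \<noteq> {k}"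
      proof
        assume "Js \<tau> = {k}"
        then have "k \<in> Js \<tau>" by simp
        then show False using N by (simp add: Js_def)
      qed
      from s neg J obtain e f where f: "\<tau> ! nx (Js \<tau>) (Suc k) = Some f" "e \<le> f"
        "\<sigma> = \<tau>[nx (Js \<tau>) (Suc k) := Some (f - e), k := Some e]" by auto
      have i: "int (f - e) = int f - int e" using f(2) by linarith
      show ?thesis unfolding gr f(3) sum_list_update2 [OF k' q [OF J] qk [OF J J'], of ?g "Some (f - e)" "Some e"]
          sum_list_update2 [OF k' q [OF J] qk [OF J J'], of ?m "Some (f - e)" "Some e"] N f(1)
        by (simp add: neg i)
    qed
  qed
qed

section \<open>The sum of the three strands, and the two extra generators\<close>

definition nones :: "braid3 \<Rightarrow> nat option list" where
  "nones w = replicate (length w) None"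

lemma nones_simps [simp]: "nones [] = []" "nones (a # w) = None # nones w" "length (nones w) = length w"
  by (simp_all add: nones_def)

definition evec :: "braid3 \<Rightarrow> vec" where
  "evec w = (\<lambda>\<tau> x. of_bool (\<tau> = nones w \<and> x = 3))"

definition avec :: "braid3 \<Rightarrow> vec" where
  "avec w = (\<lambda>\<tau> x. of_bool (\<tau> = nones w \<and> x \<le> 2))"

lemma special_vec_simps [simp]:
  "sub None (evec (a # w)) = evec w" "uh (evec (a # w)) = 0"
  "sub None (avec (a # w)) = avec w" "uh (avec (a # w)) = 0"
  "sub None (ehat (a # w)) = ehat w" "uh (ehat (a # w)) = 0"
  by (auto simp: evec_def avec_def ehat_def sub_def uh_def vec_apply fun_eq_iff)

text \<open>The coproduct over a vertical word adds the coefficients of two strands, which cancel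
  over Z/2.\<close>

lemma del_avec: "del w i (avec w) = 0"
proof (induction w)
  case Nil
  show ?case by (intro ext) (cases i; simp add: vec_apply avec_def)
next
  case (Cons a w)
  show ?case by (rule vec_cons_eqI [where u = "del (a # w) i (avec (a # w))"]) (auto simp: Cons)
qed

lemma dC_avec: "dC w (avec w) = 0"
proof (induction w)
  case Nil
  show ?case by (intro ext) (simp add: vec_apply)
next
  case (Cons a w)
  have "dC (a # w) (avec (a # w)) \<tau> x = 0" for \<tau> x
  proof (cases \<tau>)
    case (Cons t \<sigma>)
    then show ?thesis by (cases t) (simp_all add: Cons.IH del_avec vec_apply)
  qed simp
  then show ?case by (intro ext) (simp add: vec_apply)
qed

lemma dC_ehat: "dC w (ehat w) = 0"
proof (induction w)
  case Nil
  show ?case by (intro ext) (simp add: vec_apply)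
next
  case (Cons a w)
  have "dC (a # w) (ehat (a # w)) \<tau> x = 0" for \<tau> x
  proof (cases \<tau>)
    case (Cons t \<sigma>)
    then show ?thesis by (cases t) (simp_all add: Cons.IH del_ehat vec_apply)
  qed simp
  then show ?case by (intro ext) (simp add: vec_apply)
qed

lemma mu_nones:
  "mu w i n (nones w) x = (if x = gidx i \<or> x = Suc (gidx i) then n (nones w) 0 else if x = 4 then n (nones w) 2 else 0)"
proof (induction w arbitrary: n)
  case (Cons a w)
  show ?case using Cons [of "sub None n"] by (simp add: sub_def)
qed simp

text \<open>Each product gives two of the three strands the same coefficient, so the sum of the
  three coefficients is a cocycle.\<close>

lemma dC_nones_sum: "dC w c (nones w) 0 + dC w c (nones w) 1 + dC w c (nones w) 2 = 0"
proof (induction w arbitrary: c)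
  case (Cons a w)
  have m: "mu w (fst a) (uh c) (nones w) 0 + mu w (fst a) (uh c) (nones w) 1 + mu w (fst a) (uh c) (nones w) 2 = 0"
    by (cases "fst a") (simp_all add: mu_nones)
  have e: "dC (a # w) c (nones (a # w)) x = dC w (sub None c) (nones w) x + (if snd a then 0 else mu w (fst a) (uh c) (nones w) x)" for x
    by (simp add: vec_apply)
  have "dC (a # w) c (nones (a # w)) 0 + dC (a # w) c (nones (a # w)) 1 + dC (a # w) c (nones (a # w)) 2 =
    (dC w (sub None c) (nones w) 0 + dC w (sub None c) (nones w) 1 + dC w (sub None c) (nones w) 2) +
    (if snd a then 0 else mu w (fst a) (uh c) (nones w) 0 + mu w (fst a) (uh c) (nones w) 1 + mu w (fst a) (uh c) (nones w) 2)"
    unfolding e by (simp add: ac_simps)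
  then show ?case unfolding Cons m by simp
qed simp

lemma dC_nones_3: "dC w c (nones w) 3 = 0"
proof (induction w arbitrary: c)
  case (Cons a w)
  then show ?case by (cases "fst a") (simp_all add: mu_nones vec_apply)
qed simp

text \<open>Only single negative cup-caps with label - contribute to \<open>ehat\<close>, so two
  chains that agree on them have the same coefficient of \<open>ehat\<close> in their
  boundaries.\<close>

lemma dC_nones_4: "dC w c (nones w) 4 = (\<Sum>k<length w. if snd (w ! k) then 0 else c ((nones w)[k := Some 2]) 0)"
proof (induction w arbitrary: c)
  case (Cons a w)
  have "mu w (fst a) (uh c) (nones w) 4 = c (Some 2 # nones w) 0"
    by (cases "fst a") (simp_all add: mu_nones uh_def)
  moreover have "(\<Sum>k<length (a # w). if snd ((a # w) ! k) then 0 else c ((nones (a # w))[k := Some 2]) 0) =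
    (if snd a then 0 else c (Some 2 # nones w) 0) + (\<Sum>k<length w. if snd (w ! k) then 0 else c (None # (nones w)[k := Some 2]) 0)"
  proof -
    have "(nones (a # w))[Suc k := Some 2] = None # (nones w)[k := Some 2]" "(nones (a # w))[0 := Some 2] = Some 2 # nones w" for k by simp_all
    then show ?thesis unfolding length_Cons sum.lessThan_Suc_shift by (simp only: nth_Cons_0 nth_Cons_Suc)
  qed
  ultimately show ?case using Cons [of "sub None c", unfolded sub_def [of None c]]
    by (simp add: sub_def [of None c] vec_apply add.commute del: sum.lessThan_Suc)
qed simp

lemma del_evec: "del w i (evec w) \<tau> e = 1 \<Longrightarrow> \<tau> = nones w \<and> e = 0"
proof (induction w arbitrary: \<tau>)
  case Nil
  then show ?case by (cases i) (auto simp: evec_def split: if_splits)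
next
  case (Cons a w)
  show ?case
  proof (cases \<tau>)
    case Nil
    then show ?thesis using Cons by simp
  next
    case (Cons t \<sigma>)
    then show ?thesis using Cons.IH [of \<sigma>] Cons.prems by (cases t) (auto simp: vec_apply split: if_splits)
  qed
qed

lemma dC_evec: "dC w (evec w) \<tau> x = 1 \<Longrightarrow> \<exists>k<length w. snd (w ! k) \<and> \<tau> = (nones w)[k := Some 0] \<and> x = 0"
proof (induction w arbitrary: \<tau>)
  case (Cons a w)
  show ?case
  proof (cases \<tau>)
    case Nil
    then show ?thesis using Cons by simp
  next
    case \<tau>: (Cons t \<sigma>)
    show ?thesis
    proof (cases t)
      case None
      then have "dC w (evec w) \<sigma> x = 1" using Cons.prems \<tau> by (auto simp: vec_apply split: if_splits)
      then obtain k where "k < length w" "snd (w ! k)" "\<sigma> = (nones w)[k := Some 0]" "x = 0" using Cons.IH by blast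
      then show ?thesis using \<tau> None by (intro exI [of _ "Suc k"]) simp
    next
      case (Some e)
      then have "x = 0 \<and> snd a \<and> del w (fst a) (evec w) \<sigma> e = 1"
        using Cons.prems \<tau> by (auto simp: vec_apply split: if_splits)
      then show ?thesis using \<tau> Some del_evec [of w "fst a" \<sigma> e] by (intro exI [of _ 0]) auto
    qed
  qed
qed simp

section \<open>Translation between functions and sets of generators\<close>

definition vset :: "(nat option list \<times> nat) set \<Rightarrow> vec" where
  "vset S = (\<lambda>\<tau> x. of_bool ((\<tau>, x) \<in> S))"

definition supp :: "braid3 \<Rightarrow> vec \<Rightarrow> (nat option list \<times> nat) set" where
  "supp w c = {b \<in> Bst w. c (fst b) (snd b) = 1}"

lemma supp_sub: "supp w c \<subseteq> Bst w" by (auto simp: supp_def)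

lemma supp_vset: "S \<subseteq> Bst w \<Longrightarrow> supp w (vset S) = S"
  by (auto simp: supp_def vset_def)

lemma dC_vset_sum: "finite S \<Longrightarrow> dC w (vset S) \<tau> x = (\<Sum>b\<in>S. dC w (ind b) \<tau> x)"
proof (induction S rule: finite_induct)
  case empty
  have "vset {} = 0" by (intro ext) (simp add: vset_def vec_apply)
  then have "dC w (vset {}) = 0" by (simp only: dC_0)
  then show ?case by (simp add: vec_apply)
next
  case (insert b S)
  have "vset (insert b S) = ind b + vset S"
    using insert(2) by (intro ext) (auto simp: vset_def ind_def vec_apply)
  then have "dC w (vset (insert b S)) = dC w (ind b) + dC w (vset S)" by (simp only: dC_add)
  then show ?case using insert by (simp add: vec_apply)
qed

lemma bit_of_nat: "(of_nat n :: bit) = of_bool (odd n)"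
  by (induction n) auto

lemma dC_vset:
  assumes S: "S \<subseteq> Bst w" and b: "(\<tau>, x) \<in> Bst w"
  shows "dC w (vset S) \<tau> x = of_bool ((\<tau>, x) \<in> ap (mdiff w) (Bst w) S)"
proof -
  have fin: "finite S" using S finite_Bst finite_subset by blast
  have "dC w (ind b) \<tau> x = of_bool (mdiff w (\<tau>, x) b)" for b
    by (auto simp: mdiff_def)
  then have "dC w (vset S) \<tau> x = (\<Sum>b\<in>S. of_bool (mdiff w (\<tau>, x) b))" using dC_vset_sum [OF fin] by simp
  also have "\<dots> = of_nat (card {b \<in> S. mdiff w (\<tau>, x) b})"
    using fin by (simp add: of_bool_def sum.If_cases Int_def)
  finally show ?thesis using b by (simp add: bit_of_nat ap_def)
qed

lemma validC_extra: "validC w \<tau> x \<Longrightarrow> \<not> x \<le> 2 \<Longrightarrow> \<tau> = nones w \<and> (x = 3 \<or> x = 4)"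
proof (induction w \<tau> x rule: validC.induct)
  case (1 x)
  then show ?case by auto
qed auto

text \<open>Isolates the two extra generators: what remains of a valid chain is a set of generators
  of the annular complex.\<close>

lemma pC_split: "pC w c = vset (supp w c) + (if ecoef w c = 1 then evec w else 0) + (if c (nones w) 4 = 1 then ehat w else 0)"
proof (intro ext)
  fix \<tau> x
  have n: "validC w (nones w) x \<longleftrightarrow> x \<le> 4" by (simp add: nones_def validC_None)
  have b1: "(u::bit) = 1 \<or> u = 0" for u by (cases u) auto
  show "pC w c \<tau> x = (vset (supp w c) + (if ecoef w c = 1 then evec w else 0) + (if c (nones w) 4 = 1 then ehat w else 0)) \<tau> x"
  proof (cases "x \<le> 2")
    case True
    then have "evec w \<tau> x = 0" "ehat w \<tau> x = 0" by (auto simp: evec_def ehat_def)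
    then show ?thesis using True b1 [of "c \<tau> x"] by (auto simp: pC_def vset_def supp_def Bst_def vec_apply)
  next
    case False
    have v: "vset (supp w c) \<tau> x = 0" using False by (simp add: vset_def supp_def Bst_def)
    show ?thesis
    proof (cases "validC w \<tau> x")
      case True
      from validC_extra [OF True False] show ?thesis
        using v True b1 [of "c (nones w) 3"] b1 [of "c (nones w) 4"]
        by (auto simp: pC_def vec_apply evec_def ehat_def ecoef_def nones_def)
    next
      case F: False
      then have "evec w \<tau> x = 0" "ehat w \<tau> x = 0" using n by (auto simp: evec_def ehat_def nones_def)
      then show ?thesis using F v by (simp add: pC_def vec_apply)
    qed
  qed
qed

lemma dC_Bst:
  assumes b: "(\<tau>, x) \<in> Bst w"
  shows "dC w c \<tau> x = of_bool ((\<tau>, x) \<in> ap (mdiff w) (Bst w) (supp w c)) + (if ecoef w c = 1 then dC w (evec w) \<tau> x else 0)"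
proof -
  have v: "validC w \<tau> x" using b by (simp add: Bst_def)
  then have "dC w c \<tau> x = dC w (pC w c) \<tau> x" by (simp add: dC_pC) (simp add: pC_def)
  also have "\<dots> = dC w (vset (supp w c)) \<tau> x + (if ecoef w c = 1 then dC w (evec w) \<tau> x else 0)"
    unfolding pC_split by (simp add: vec_apply dC_ehat)
  finally show ?thesis using dC_vset [OF supp_sub b] by simp
qed

lemma supp_dC: "ecoef w c = 0 \<Longrightarrow> supp w (dC w c) = ap (mdiff w) (Bst w) (supp w c)"
  using dC_Bst [of _ _ w c] by (auto simp: supp_def ap_def)

lemma ecoef_vset: "S \<subseteq> Bst w \<Longrightarrow> ecoef w (vset S) = 0"
  by (auto simp: ecoef_def vset_def Bst_def)

lemma ecoef_dC: "ecoef w (dC w c) = 0"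
  using dC_nones_3 [of w c] by (simp add: ecoef_def nones_def)

lemma ap_vset: "S \<subseteq> Bst w \<Longrightarrow> ap (mdiff w) (Bst w) S = supp w (dC w (vset S))"
  using supp_dC [OF ecoef_vset [of S w]] supp_vset by simp

interpretation C: graded_complex "mdiff w" "Bst w" "gr w" for w
proof
  show "finite (Bst w)" by (rule finite_Bst)
next
  fix x y assume xy: "x \<in> Bst w" "y \<in> Bst w" "mdiff w y x"
  then obtain k where k: "k < length w" "step w k x y" using mdiff_iff by blast
  show "gr w y = (fst (gr w x) + 1, snd (gr w x))"
    using gr_step [of w k "fst x" "snd x" "fst y" "snd y"] k xy Bst_length [of "fst y" "snd y" w] by simp
next
  fix S assume S: "S \<subseteq> Bst w"
  have "ap (mdiff w) (Bst w) (ap (mdiff w) (Bst w) S) = supp w (dC w (dC w (vset S)))"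
    using supp_dC [OF ecoef_dC] ap_vset [OF S] by simp
  then show "ap (mdiff w) (Bst w) (ap (mdiff w) (Bst w) S) = {}" by (simp add: dC_dC supp_def vec_apply)
qed

lemma exact_atD:
  "C.exact_at w g \<Longrightarrow> S \<subseteq> C.piece w g \<Longrightarrow> ap (mdiff w) (Bst w) S = {} \<Longrightarrow>
   \<exists>T. T \<subseteq> C.piece w (C.prv g) \<and> ap (mdiff w) (Bst w) T = S"
  unfolding C.exact_at_def by simp

lemma nones_in_Bst: "x \<le> 2 \<Longrightarrow> (nones w, x) \<in> Bst w"
  by (simp add: Bst_def nones_def validC_None)

lemma gr_nones: "gr w (nones w, x) = (0, 0)"
  by (simp add: gr_def nones_def)

text \<open>The sum of the three strands is a cycle on which the cocycle of
  \<open>dC_nones_sum\<close> takes the value 1 + 1 + 1 = 1.\<close>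

lemma not_exact_0: "\<not> C.exact_at w (0, 0)"
proof
  assume ex: "C.exact_at w (0, 0)"
  let ?S = "{nones w} \<times> {..2}"
  have S: "?S \<subseteq> Bst w" using nones_in_Bst by auto
  have v: "vset ?S = avec w" by (intro ext) (auto simp: vset_def avec_def)
  have ap0: "ap (mdiff w) (Bst w) ?S = {}" using ap_vset [OF S] v dC_avec by (simp add: supp_def vec_apply)
  have sub0: "?S \<subseteq> C.piece w (0, 0)" using S gr_nones by (auto simp: C.piece_def)
  obtain T where T: "T \<subseteq> C.piece w (C.prv (0, 0))" "ap (mdiff w) (Bst w) T = ?S"
    using exact_atD [OF ex sub0 ap0] by (elim exE conjE)
  have TB: "T \<subseteq> Bst w" using T(1) by (auto simp: C.piece_def)
  have "dC w (vset T) (nones w) x = 1" if "x \<le> 2" for x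
    using dC_vset [OF TB nones_in_Bst [OF that]] T(2) that by simp
  then show False using dC_nones_sum [of w "vset T"] by simp
qed

lemma ap_Int_piece:
  assumes "S \<subseteq> Bst w"
  shows "ap (mdiff w) (Bst w) (S \<inter> C.piece w g) = ap (mdiff w) (Bst w) S \<inter> C.piece w (C.nxt g)"
proof -
  have e: "{x \<in> S \<inter> C.piece w g. mdiff w y x} = (if gr w y = C.nxt g then {x \<in> S. mdiff w y x} else {})" if "y \<in> Bst w" for y
  proof -
    have "gr w x = g \<longleftrightarrow> gr w y = C.nxt g" if "x \<in> S" "mdiff w y x" for x
      using C.graded [of x w y] that assms \<open>y \<in> Bst w\<close> by (cases "gr w x"; cases g) (auto simp: C.nxt_def)
    then show ?thesis using assms by (auto simp: C.piece_def)
  qed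
  have "y \<in> ap (mdiff w) (Bst w) (S \<inter> C.piece w g) \<longleftrightarrow> y \<in> ap (mdiff w) (Bst w) S \<inter> C.piece w (C.nxt g)" for y
  proof (cases "y \<in> Bst w")
    case True
    show ?thesis unfolding ap_def mem_Collect_eq Int_iff [of y] e [OF True] by (simp add: True C.piece_def)
  qed (simp add: ap_def)
  then show ?thesis by blast
qed

lemma gr_single:
  assumes k: "k < length w"
  shows "gr w ((nones w)[k := Some d], x) = (if snd (w ! k) then (1, 2 - int d) else (- 1, - int d))"
  using sum_list_update [of k "nones w" "\<lambda>l t. case t of None \<Rightarrow> 0 | Some d \<Rightarrow> if snd (w ! l) then 1 else - 1" "Some d"]
    sum_list_update [of k "nones w" "\<lambda>l t. case t of None \<Rightarrow> 0 | Some d \<Rightarrow> (if snd (w ! l) then 2 else 0) - int d" "Some d"] k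
  by (simp add: gr_def) (simp add: nones_def)

lemma dM_nones: "(\<forall>a\<in>set w. snd a) \<Longrightarrow> dM w i v (nones w) x = 0"
  by (induction w arbitrary: v) (auto simp: vec_apply)

text \<open>The boundary of the generator e is a cycle in grade (1, 2). If it bounded, a chain with coefficient 1 at e
  would be closed up to ehat, which is impossible for a positive word.\<close>

lemma not_exact_pos:
  assumes t: "transports w w'" and w': "w' = a # u" "\<forall>b\<in>set w'. snd b"
  shows "\<not> C.exact_at w (1, 2)"
proof
  assume ex: "C.exact_at w (1, 2)"
  let ?Z = "supp w (dC w (evec w))"
  have sub0: "?Z \<subseteq> C.piece w (1, 2)"
  proof
    fix b assume b: "b \<in> ?Z"
    then obtain k where "k < length w" "snd (w ! k)" "fst b = (nones w)[k := Some 0]" "snd b = 0"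
      using dC_evec [of w "fst b" "snd b"] by (auto simp: supp_def)
    then show "b \<in> C.piece w (1, 2)" using gr_single [of k w 0 0] b by (cases b) (auto simp: C.piece_def supp_def)
  qed
  have ap0: "ap (mdiff w) (Bst w) ?Z = {}"
    using supp_dC [OF ecoef_dC, of w "evec w"] by (simp add: dC_dC) (simp add: supp_def vec_apply)
  obtain T where T: "T \<subseteq> C.piece w (C.prv (1, 2))" "ap (mdiff w) (Bst w) T = ?Z"
    using exact_atD [OF ex sub0 ap0] by (elim exE conjE)
  have TB: "T \<subseteq> Bst w" using T(1) by (auto simp: C.piece_def)
  let ?c = "vset T + evec w"
  have ec: "ecoef w ?c = 1" using ecoef_vset [OF TB] by (simp add: ecoef_def vec_apply evec_def nones_def)
  have s: "supp w ?c = T" using TB by (auto simp: supp_def vset_def evec_def vec_apply Bst_def)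
  have b1: "(u::bit) = 1 \<or> u = 0" for u by (cases u) auto
  have z: "dC w ?c \<tau> x = 0" if "(\<tau>, x) \<in> Bst w" for \<tau> x
    using dC_Bst [OF that, of ?c] ec that b1 [of "dC w (evec w) \<tau> x"] unfolding s T(2) by (auto simp: supp_def)
  have c: "pC w ?c = ?c"
    unfolding pC_split [of w ?c] s ec by (auto simp: vset_def evec_def vec_apply TB Bst_def dest!: subsetD [OF TB])
  have "dC w ?c = (if dC w ?c (nones w) 4 = 1 then ehat w else 0)"
  proof -
    have "supp w (dC w ?c) = {}" using z by (auto simp: supp_def)
    moreover have "vset {} = 0" by (intro ext) (simp add: vset_def vec_apply)
    moreover have "dC w ?c = pC w (dC w ?c)" using dC_pC [of w ?c] unfolding c .
    ultimately show ?thesis using pC_split [of w "dC w ?c"] ecoef_dC [of w ?c] by simp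
  qed
  moreover obtain F where F: "F 0 = 0" "\<And>c. dC w' (F c) = F (dC w c)" "\<And>c. ecoef w' (F c) = ecoef w c" "F (ehat w) = ehat w'"
    using t by (auto simp: transports_def)
  ultimately have "dC w' (F ?c) = 0 \<or> dC w' (F ?c) = ehat w'" by (metis (full_types))
  moreover have "ehat w' (Some 0 # nones u) 0 = 0" "(0::vec) (Some 0 # nones u) 0 = 0" by (simp_all add: ehat_def vec_apply)
  ultimately have "dC w' (F ?c) (Some 0 # nones u) 0 = 0" by metis
  \<comment> \<open>In a positive word a single cup-cap arises only from the vertical state, and
    with label + only from the generator 3.\<close>
  moreover have "dC w' (F ?c) (Some 0 # nones u) 0 = 1"
  proof -
    have "del u i v (nones u) 0 = v (nones u) 3" for i v
    proof (induction u arbitrary: v)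
      case (Cons a u)
      then show ?case by (simp add: sub_def)
    qed simp
    moreover have "F ?c (nones w') 3 = 1" using F(3) [of ?c] ec by (simp add: ecoef_def nones_def)
    ultimately show ?thesis using dM_nones [of u "fst a" "uh (F ?c)" 0] w' by (simp add: sub_def vec_apply)
  qed
  ultimately show False by simp
qed

text \<open>Dually, ehat is a boundary for a negative word, so the part in grade (-1, -2) of a chain with boundary
  ehat is a cycle, and it does not bound because ehat is not a double boundary.\<close>

lemma not_exact_neg:
  assumes t: "transports w' w" and w': "w' = (i, False) # u" "\<forall>b\<in>set w'. \<not> snd b"
  shows "\<not> C.exact_at w (- 1, - 2)"
proof
  assume ex: "C.exact_at w (- 1, - 2)"
  let ?n = "\<lambda>v. (\<lambda>\<tau> x. of_bool (\<tau> = nones v \<and> x = 2)) :: vec"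
  \<comment> \<open>A single cup-cap with label - in the first slot; in a negative word its boundary
    is exactly \<open>ehat\<close>.\<close>
  let ?s = "(\<lambda>\<tau> x. of_bool (\<tau> = Some 2 # nones u \<and> x = 0)) :: vec"
  have n: "sub None (?n (a # v)) = ?n v" "sub (Some e) (?n (a # v)) = 0" for a v e
    by (auto simp: sub_def vec_apply fun_eq_iff)
  have m: "mu v i (?n v) = ehat v" for v
  proof (induction v)
    case Nil
    show ?case by (intro ext) (cases i; auto simp: ehat_def)
  next
    case (Cons a v)
    show ?case
    proof (intro ext)
      fix \<tau> x
      show "mu (a # v) i (?n (a # v)) \<tau> x = ehat (a # v) \<tau> x"
      proof (cases \<tau>)
        case Nil
        then show ?thesis by (simp add: ehat_def)
      next
        case (Cons t \<sigma>)
        show ?thesis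
        proof (cases t)
          case None
          have "mu (a # v) i (?n (a # v)) \<tau> x = mu v i (sub None (?n (a # v))) \<sigma> x" by (simp add: Cons None)
          also have "\<dots> = ehat v \<sigma> x" unfolding n Cons.IH ..
          finally show ?thesis by (simp add: ehat_def Cons None)
        next
          case (Some e)
          have "mu (a # v) i (?n (a # v)) \<tau> x = 0" unfolding Cons Some mu.simps n by (simp add: vec_apply)
          then show ?thesis by (simp add: ehat_def Cons Some)
        qed
      qed
    qed
  qed
  have d: "\<forall>b\<in>set v. \<not> snd b \<Longrightarrow> dM v j (?n v) = 0" for v j
  proof (induction v arbitrary: j)
    case Nil
    show ?case by (intro ext) (simp add: vec_apply)
  next
    case (Cons a v)
    have na: "\<not> snd a" and IH: "dM v j (?n v) = 0" for j using Cons by auto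
    show ?case
    proof (rule vec_cons_eqI [where u = "dM (a # v) j (?n (a # v))" and v = 0])
      show "sub None (dM (a # v) j (?n (a # v))) = sub None 0" unfolding dM_sub n IH by simp
      show "sub (Some e) (dM (a # v) j (?n (a # v))) = sub (Some e) 0" for e unfolding dM_sub n IH using na by simp
    qed simp
  qed
  have s0: "sub None ?s = 0" by (intro ext) (simp add: sub_def vec_apply)
  have u0: "uh ?s = ?n u" by (intro ext) (auto simp: uh_def)
  have neg: "\<forall>b\<in>set u. \<not> snd b" using w' by simp
  have dc0: "dC w' ?s = ehat w'"
  proof (intro ext)
    fix \<tau> x show "dC w' ?s \<tau> x = ehat w' \<tau> x"
    proof (cases \<tau>)
      case Nil
      then show ?thesis by (simp add: ehat_def w')
    next
      case (Cons t \<sigma>)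
      show ?thesis
      proof (cases t)
        case None
        show ?thesis unfolding w' Cons None dC.simps s0 u0 snd_conv fst_conv m by (simp add: vec_apply ehat_def)
      next
        case (Some e)
        show ?thesis unfolding w' Cons Some dC.simps s0 u0 snd_conv fst_conv d [OF neg] by (simp add: vec_apply ehat_def)
      qed
    qed
  qed
  obtain F where F: "F 0 = 0" "\<And>c. dC w (F c) = F (dC w' c)" "\<And>c. ecoef w (F c) = ecoef w' c" "F (ehat w') = ehat w"
    using t by (auto simp: transports_def)
  let ?c = "F ?s"
  have dc: "dC w ?c = ehat w" using F(2) [of ?s] dc0 F(4) by simp
  have ec: "ecoef w ?c = 0" using F(3) [of ?s] by (simp add: ecoef_def w')
  let ?S = "supp w ?c \<inter> C.piece w (- 1, - 2)"
  have "supp w (ehat w) = {}" by (auto simp: supp_def ehat_def Bst_def)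
  then have "ap (mdiff w) (Bst w) (supp w ?c) = {}" using supp_dC [OF ec] dc by simp
  then have ap0: "ap (mdiff w) (Bst w) ?S = {}" using ap_Int_piece [OF supp_sub, of w ?c "(- 1, - 2)"] by simp
  have sub0: "?S \<subseteq> C.piece w (- 1, - 2)" by simp
  obtain T where T: "T \<subseteq> C.piece w (C.prv (- 1, - 2))" "ap (mdiff w) (Bst w) T = ?S"
    using exact_atD [OF ex sub0 ap0] by (elim exE conjE)
  have TB: "T \<subseteq> Bst w" using T(1) by (auto simp: C.piece_def)
  have ST: "supp w (dC w (vset T)) = ?S" using ap_vset [OF TB] T(2) by simp
  have b1: "(u::bit) = 1 \<or> u = 0" for u by (cases u) auto
  \<comment> \<open>All states that \<open>dC_nones_4\<close> reads have grade (-1, -2), where the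
    chain equals the boundary of \<open>T\<close> by assumption.\<close>
  have agree: "dC w (vset T) ((nones w)[k := Some 2]) 0 = ?c ((nones w)[k := Some 2]) 0" if k: "k < length w" "\<not> snd (w ! k)" for k
  proof -
    let ?b = "((nones w)[k := Some 2], 0)"
    have J: "Js ((nones w)[k := Some 2]) = {k}" using k(1) by (auto simp: Js_def nones_def nth_list_update)
    have B: "?b \<in> Bst w" using k(1) J by (simp add: Bst_iff degs_def tr_single)
    have "?b \<in> C.piece w (- 1, - 2)" using B gr_single [OF k(1), of 2 0] k(2) by (simp add: C.piece_def)
    then have "?b \<in> supp w (dC w (vset T)) \<longleftrightarrow> ?b \<in> supp w ?c" using ST by simp
    then show ?thesis using B b1 [of "dC w (vset T) ((nones w)[k := Some 2]) 0"] b1 [of "?c ((nones w)[k := Some 2]) 0"]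
      by (auto simp: supp_def)
  qed
  have "dC w ?c (nones w) 4 = dC w (dC w (vset T)) (nones w) 4"
    unfolding dC_nones_4 by (intro sum.cong refl) (simp add: agree)
  then show False by (simp add: dc dC_dC vec_apply) (simp add: ehat_def nones_def)
qed

definition euler :: "braid3 \<Rightarrow> complex \<Rightarrow> complex" where
  "euler w r = (\<Sum>b\<in>Bst w. (if even (fst (gr w b)) then 1 else - 1) * r powi snd (gr w b))"

text \<open>\<open>m0\<close> is the internal degree of the second class. A transport to a positive
  word or from a negative one forces its grade to be (1, 2) or (-1, -2); the bounds 4 and -4 are the
  smallest degrees of the words to be excluded later.\<close>

theorem akh_dim_6:
  assumes "akh_dim w = 6"
  obtains \<epsilon> m0 where "\<epsilon> = 1 \<or> \<epsilon> = - 1" "\<And>r. euler w r = 1 + \<epsilon> * r powi m0"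
    "\<And>w'. transports w w' \<Longrightarrow> w' \<noteq> [] \<Longrightarrow> \<forall>b\<in>set w'. snd b \<Longrightarrow> m0 < 4"
    "\<And>w'. transports w' w \<Longrightarrow> w' \<noteq> [] \<Longrightarrow> \<forall>b\<in>set w'. \<not> snd b \<Longrightarrow> - 4 < m0"
proof -
  have "card (Bst w) = 2 * rk (mdiff w) (Bst w) (Bst w) + 2" using assms akh_dim_Bst [of w] by linarith
  from C.two_dimensional [OF this not_exact_0]
  obtain g0 where g0: "\<And>f. (\<And>g. f (C.nxt g) = - f g) \<Longrightarrow> (\<Sum>x\<in>Bst w. f (gr w x)) = (f (0, 0) + f g0 :: complex)"
    "\<And>g. g \<noteq> (0, 0) \<Longrightarrow> g \<noteq> g0 \<Longrightarrow> C.exact_at w g" by blast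
  show thesis
  proof (rule that [of "if even (fst g0) then 1 else - 1" "snd g0"])
    show "(if even (fst g0) then 1 else - 1) = (1::complex) \<or> (if even (fst g0) then 1 else - 1) = (- 1 :: complex)" by simp
    show "euler w r = 1 + (if even (fst g0) then 1 else - 1) * r powi snd g0" for r
      using g0(1) [of "\<lambda>g. (if even (fst g) then 1 else - 1) * r powi snd g"] by (simp add: euler_def C.nxt_def)
    fix w'
    {
      assume a: "transports w w'" "w' \<noteq> []" "\<forall>b\<in>set w'. snd b"
      then obtain b u where "w' = b # u" by (cases w') auto
      then have "\<not> C.exact_at w (1, 2)" using not_exact_pos [OF a(1)] a(3) by blast
      then have "g0 = (1, 2)" using g0(2) [of "(1, 2)"] by auto
      then show "snd g0 < 4" by simp
    next
      assume a: "transports w' w" "w' \<noteq> []" "\<forall>b\<in>set w'. \<not> snd b"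
      then obtain i u where "w' = (i, False) # u" by (cases w') auto
      then have "\<not> C.exact_at w (- 1, - 2)" using not_exact_neg [OF a(1)] a(3) by blast
      then have "g0 = (- 1, - 2)" using g0(2) [of "(- 1, - 2)"] by auto
      then show "- 4 < snd g0" by simp
    }
  qed
qed

section \<open>The graded Euler characteristic\<close>

type_synonym m2 = "complex \<times> complex \<times> complex \<times> complex"

fun mm :: "m2 \<Rightarrow> m2 \<Rightarrow> m2" where
  "mm (a, b, c, d) (a', b', c', d') = (a * a' + b * c', a * b' + b * d', c * a' + d * c', c * b' + d * d')"

fun tr2 :: "m2 \<Rightarrow> complex" where
  "tr2 (a, b, c, d) = a + d"

fun ent :: "m2 \<Rightarrow> gen3 \<Rightarrow> gen3 \<Rightarrow> complex" where
  "ent (a, b, c, d) i j = (if i = Sig1 then (if j = Sig1 then a else b) else (if j = Sig1 then c else d))"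

lemma mm_assoc: "mm (mm A B) C = mm A (mm B C)"
  by (cases A; cases B; cases C) (simp add: algebra_simps)

lemma tr2_mm: "tr2 (mm A B) = tr2 (mm B A)"
  by (cases A; cases B) (simp add: algebra_simps)

lemma mm_one [simp]: "mm (1, 0, 0, 1) A = A" "mm A (1, 0, 0, 1) = A"
  by (cases A; simp)+

text \<open>The reduced Burau representation, up to rescaling.\<close>

definition letter :: "complex \<Rightarrow> gen3 \<times> bool \<Rightarrow> m2" where
  "letter r a = (let z = if snd a then r else inverse r in
     case fst a of Sig1 \<Rightarrow> (- (z\<^sup>2), 0, - z, 1) | Sig2 \<Rightarrow> (1, - z, 0, - (z\<^sup>2)))"

primrec bur :: "complex \<Rightarrow> braid3 \<Rightarrow> m2" where
  "bur r [] = (1, 0, 0, 1)"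
| "bur r (a # w) = mm (letter r a) (bur r w)"

lemma bur_append: "bur r (u @ v) = mm (bur r u) (bur r v)"
  by (induction u) (simp_all add: mm_assoc)

text \<open>The signed monomial of a state as a product over its slots, the form suited to
  induction.\<close>

fun wt :: "braid3 \<Rightarrow> complex \<Rightarrow> nat option list \<Rightarrow> complex" where
  "wt [] r \<tau> = 1"
| "wt (a # w) r [] = 1"
| "wt (a # w) r (None # \<tau>) = wt w r \<tau>"
| "wt (a # w) r (Some d # \<tau>) = - (if snd a then r\<^sup>2 else 1) * inverse r ^ d * wt w r \<tau>"

lemma gr_Cons: "gr (a # w) (None # \<tau>, x) = gr w (\<tau>, y)"
  "gr (a # w) (Some d # \<tau>, x) = ((if snd a then 1 else - 1) + fst (gr w (\<tau>, y)), (if snd a then 2 else 0) - int d + snd (gr w (\<tau>, y)))"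
  unfolding gr_def length_Cons sum.lessThan_Suc_shift nth_Cons_Suc nth_Cons_0 fst_conv by (simp_all del: sum.lessThan_Suc)

lemma wt_gr:
  assumes "r \<noteq> 0" "length \<tau> = length w"
  shows "(if even (fst (gr w (\<tau>, x))) then 1 else - 1) * r powi snd (gr w (\<tau>, x)) = wt w r \<tau>"
  using assms(2)
proof (induction w arbitrary: \<tau>)
  case Nil
  then show ?case by (simp add: gr_def)
next
  case (Cons a w)
  then obtain t \<sigma> where \<tau>: "\<tau> = t # \<sigma>" "length \<sigma> = length w" by (cases \<tau>) auto
  note IH = Cons.IH [OF \<tau>(2)]
  show ?case
  proof (cases t)
    case None
    then show ?thesis using IH gr_Cons(1) [of a w \<sigma> x x] \<tau> by simp
  next
    case (Some d)
    define h m where "h = fst (gr w (\<sigma>, x))" and "m = snd (gr w (\<sigma>, x))"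
    have g: "gr (a # w) (\<tau>, x) = ((if snd a then 1 else - 1) + h, (if snd a then 2 else 0) - int d + m)"
      using gr_Cons(2) [of a w d \<sigma> x x] \<tau> Some by (simp add: h_def m_def)
    have p: "r powi ((if snd a then 2 else 0) - int d + m) = (if snd a then r\<^sup>2 else 1) * inverse r ^ d * r powi m"
      using assms(1) by (simp add: power_int_add power_int_diff power_inverse divide_inverse)
    have e: "(if even ((if snd a then 1 else - 1) + h) then 1 else - 1) = - (if even h then 1 else (- 1 :: complex))"
      by simp
    show ?thesis unfolding g fst_conv snd_conv p e unfolding \<tau> Some wt.simps IH [symmetric] h_def [symmetric] m_def [symmetric]
      by (simp only: mult_minus_left mult_minus_right mult.assoc mult.left_commute)
  qed
qed

definition MS :: "braid3 \<Rightarrow> gen3 \<Rightarrow> gen3 \<Rightarrow> (nat option list \<times> nat) set" where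
  "MS w j k = {(\<tau>, x). validM w j k \<tau> x}"

text \<open>The graded Euler characteristic of the open word between the positions \<open>j\<close>
  and \<open>k\<close>.\<close>

definition EM :: "braid3 \<Rightarrow> complex \<Rightarrow> gen3 \<Rightarrow> gen3 \<Rightarrow> complex" where
  "EM w r j k = (\<Sum>(\<tau>, x)\<in>MS w j k. wt w r \<tau> * inverse r ^ x)"

lemma par_set: "{e. par i j e} = (if i = j then {0, 2} else {1})"
proof -
  have "par i j e \<longleftrightarrow> e \<in> (if i = j then {0, 2} else {1})" for e
  proof -
    have "e \<le> 2 \<longleftrightarrow> e = 0 \<or> e = 1 \<or> e = 2" by linarith
    then show ?thesis by (auto simp: par_def)
  qed
  then show ?thesis by blast
qed

lemma MS_Nil: "MS [] j k = Pair [] ` {e. par j k e}"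
proof -
  have "validM [] j k \<tau> x \<longleftrightarrow> \<tau> = [] \<and> par j k x" for \<tau> x by (cases \<tau>) auto
  then show ?thesis by (auto simp: MS_def)
qed

lemma MS_Cons: "MS (a # w) j k = (\<lambda>(\<tau>, x). (None # \<tau>, x)) ` MS w j k \<union>
   (\<Union>e\<in>{e. par j (fst a) e}. (\<lambda>(\<tau>, x). (Some e # \<tau>, x)) ` MS w (fst a) k)"
proof -
  have "validM (a # w) j k \<tau> x \<longleftrightarrow> (\<exists>\<sigma>. \<tau> = None # \<sigma> \<and> validM w j k \<sigma> x) \<or>
    (\<exists>e \<sigma>. \<tau> = Some e # \<sigma> \<and> par j (fst a) e \<and> validM w (fst a) k \<sigma> x)" for \<tau> x
  proof (cases \<tau>)
    case (Cons t \<sigma>)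
    then show ?thesis by (cases t) auto
  qed simp
  then show ?thesis by (auto simp: MS_def image_iff)
qed

lemma finite_MS: "finite (MS w j k)"
proof (induction w arbitrary: j)
  case Nil
  show ?case unfolding MS_Nil par_set by simp
next
  case (Cons a w)
  then show ?case unfolding MS_Cons par_set by simp
qed

text \<open>The graded Cartan matrix of the zigzag algebra of type A2.\<close>

definition Amat :: "complex \<Rightarrow> m2" where
  "Amat r = (1 + inverse r ^ 2, inverse r, inverse r, 1 + inverse r ^ 2)"

lemma ent_Amat: "(\<Sum>e\<in>{e. par i j e}. inverse r ^ e) = ent (Amat r) i j"
  by (cases i; cases j) (simp_all add: par_set Amat_def)

lemma EM_Nil: "EM [] r j k = ent (Amat r) j k"
proof -
  have "EM [] r j k = (\<Sum>e\<in>{e. par j k e}. inverse r ^ e)"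
    unfolding EM_def MS_Nil by (subst sum.reindex) (auto simp: inj_on_def)
  then show ?thesis by (simp only: ent_Amat)
qed

lemma EM_Cons: "EM (a # w) r j k = EM w r j k - (if snd a then r\<^sup>2 else 1) * ent (Amat r) j (fst a) * EM w r (fst a) k"
proof -
  let ?f = "\<lambda>(\<tau>, x). wt (a # w) r \<tau> * inverse r ^ x"
  let ?c = "- (if snd a then r\<^sup>2 else 1) :: complex"
  let ?E = "{e. par j (fst a) e}"
  let ?S = "\<lambda>e. (\<lambda>(\<tau>, x). (Some e # \<tau>, x)) ` MS w (fst a) k"
  have finE: "finite ?E" by (simp add: par_set)
  have N: "sum ?f ((\<lambda>(\<tau>, x). (None # \<tau>, x)) ` MS w j k) = EM w r j k"
    unfolding EM_def by (subst sum.reindex) (auto simp: inj_on_def intro!: sum.cong)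
  have S: "sum ?f (?S e) = ?c * inverse r ^ e * EM w r (fst a) k" for e
    unfolding EM_def sum_distrib_left by (subst sum.reindex) (auto simp: inj_on_def intro!: sum.cong)
  have "EM (a # w) r j k = sum ?f ((\<lambda>(\<tau>, x). (None # \<tau>, x)) ` MS w j k) + sum ?f (\<Union>e\<in>?E. ?S e)"
    unfolding EM_def MS_Cons using finE finite_MS by (intro sum.union_disjoint) auto
  also have "sum ?f (\<Union>e\<in>?E. ?S e) = (\<Sum>e\<in>?E. sum ?f (?S e))"
    using finE finite_MS by (intro sum.UNION_disjoint) auto
  also have "\<dots> = ?c * (\<Sum>e\<in>?E. inverse r ^ e) * EM w r (fst a) k"
    unfolding S by (simp add: sum_distrib_left sum_distrib_right mult.assoc)
  finally show ?thesis unfolding N ent_Amat by simp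
qed

text \<open>A letter is \<open>1 - c * A * E\<close>, where \<open>A\<close> is the Cartan matrix
  and \<open>E\<close> the diagonal matrix unit of its position: the class of a cone over a
  cup-cap.\<close>

lemma letter_eq:
  assumes "r \<noteq> 0"
  shows "letter r a = (let c = (if snd a then r\<^sup>2 else 1) in case fst a of
    Sig1 \<Rightarrow> (1 - c * (1 + inverse r ^ 2), 0, - c * inverse r, 1) | Sig2 \<Rightarrow> (1, - c * inverse r, 0, 1 - c * (1 + inverse r ^ 2)))"
proof -
  have "r\<^sup>2 * inverse r ^ 2 = 1" "r\<^sup>2 * inverse r = r"
    using assms by (simp_all add: power2_eq_square field_simps)
  then show ?thesis
    by (cases "fst a"; cases "snd a") (simp_all add: letter_def Let_def distrib_left)
qed

lemma EM_bur:
  assumes "r \<noteq> 0"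
  shows "EM w r j k = ent (mm (bur r w) (Amat r)) j k"
proof (induction w arbitrary: j)
  case Nil
  show ?case by (simp add: EM_Nil)
next
  case (Cons a w)
  obtain p q s t where P: "mm (bur r w) (Amat r) = (p, q, s, t)" by (cases "mm (bur r w) (Amat r)")
  have IH: "EM w r j k = ent (p, q, s, t) j k" for j using Cons P by simp
  show ?case unfolding EM_Cons IH bur.simps mm_assoc P letter_eq [OF assms]
    by (cases "fst a"; cases j; cases k; simp add: Amat_def Let_def) (simp_all add: algebra_simps)
qed

lemma Bst_Nil: "Bst [] = Pair [] ` {..2}"
proof -
  have "validC [] \<tau> x \<and> x \<le> 2 \<longleftrightarrow> \<tau> = [] \<and> x \<le> 2" for \<tau> x by (cases \<tau>) auto
  then show ?thesis by (auto simp: Bst_def)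
qed

lemma Bst_Cons: "Bst (a # w) = (\<lambda>(\<tau>, x). (None # \<tau>, x)) ` Bst w \<union> (\<lambda>(\<tau>, e). (Some e # \<tau>, 0)) ` MS w (fst a) (fst a)"
proof -
  have "validC (a # w) \<tau> x \<longleftrightarrow> (\<exists>\<sigma>. \<tau> = None # \<sigma> \<and> validC w \<sigma> x) \<or>
    (\<exists>e \<sigma>. \<tau> = Some e # \<sigma> \<and> x = 0 \<and> validM w (fst a) (fst a) \<sigma> e)" for \<tau> x
  proof (cases \<tau>)
    case (Cons t \<sigma>)
    then show ?thesis by (cases t) auto
  qed simp
  then show ?thesis by (auto simp: MS_def Bst_def image_iff)
qed

text \<open>The empty word gives 3, which is 1 plus the trace of the identity. A new letter
  subtracts \<open>c\<close> times a diagonal entry of the Burau matrix times \<open>Amat r\<close>,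
  which by \<open>letter_eq\<close> is its effect on the trace.\<close>

theorem euler_bur:
  assumes r: "r \<noteq> 0"
  shows "euler w r = 1 + tr2 (bur r w)"
proof -
  have "euler w r = (\<Sum>(\<tau>, x)\<in>Bst w. wt w r \<tau>)"
    unfolding euler_def
  proof (intro sum.cong refl)
    fix b assume b: "b \<in> Bst w"
    obtain \<tau> x where "b = (\<tau>, x)" by (cases b)
    then show "(if even (fst (gr w b)) then 1 else - 1) * r powi snd (gr w b) = (case b of (\<tau>, x) \<Rightarrow> wt w r \<tau>)"
      using wt_gr [OF r, of \<tau> w x] Bst_length [of \<tau> x w] b by simp
  qed
  also have "\<dots> = 1 + tr2 (bur r w)"
  proof (induction w)
    case Nil
    have "(\<Sum>(\<tau>, x)\<in>Bst []. wt [] r \<tau>) = of_nat (card {..(2::nat)})"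
      unfolding Bst_Nil by (subst sum.reindex) (auto simp: inj_on_def)
    then show ?case by simp
  next
    case (Cons a w)
    let ?f = "\<lambda>(\<tau>, x). wt (a # w) r \<tau>"
    have N: "sum ?f ((\<lambda>(\<tau>, x). (None # \<tau>, x)) ` Bst w) = (\<Sum>(\<tau>, x)\<in>Bst w. wt w r \<tau>)"
      by (subst sum.reindex) (auto simp: inj_on_def intro!: sum.cong)
    have S: "sum ?f ((\<lambda>(\<tau>, e). (Some e # \<tau>, 0)) ` MS w (fst a) (fst a)) = - (if snd a then r\<^sup>2 else 1) * EM w r (fst a) (fst a)"
      unfolding EM_def sum_distrib_left by (subst sum.reindex) (auto simp: inj_on_def intro!: sum.cong)
    have "sum ?f (Bst (a # w)) = (\<Sum>(\<tau>, x)\<in>Bst w. wt w r \<tau>) - (if snd a then r\<^sup>2 else 1) * EM w r (fst a) (fst a)"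
      unfolding Bst_Cons using finite_Bst finite_MS by (subst sum.union_disjoint) (auto simp: N S)
    also have "\<dots> = 1 + tr2 (bur r w) - (if snd a then r\<^sup>2 else 1) * ent (mm (bur r w) (Amat r)) (fst a) (fst a)"
      unfolding Cons.IH EM_bur [OF r] ..
    also have "\<dots> = 1 + tr2 (bur r (a # w))"
      unfolding bur.simps letter_eq [OF r] Amat_def
      by (cases "bur r w"; cases "fst a") (simp_all add: algebra_simps Let_def)
    finally show ?case .
  qed
  finally show ?thesis .
qed

lemma letter_cancel: "r \<noteq> 0 \<Longrightarrow> mm (letter r (i, b)) (letter r (i, \<not> b)) = (1, 0, 0, 1)"
  by (cases i) (auto simp: letter_def Let_def power2_eq_square field_simps)

lemma letter_braid:
  "i \<noteq> j \<Longrightarrow> bur r [(i, True), (j, True), (i, True)] = bur r [(j, True), (i, True), (j, True)]"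
  by (cases i; cases j) (auto simp: letter_def Let_def power2_eq_square algebra_simps)

section \<open>Conjugacy classes of 3-braids\<close>

text \<open>Conjugation appears as rotation of the word; the other two relations are applied at the front only.\<close>

inductive beq :: "braid3 \<Rightarrow> braid3 \<Rightarrow> bool" where
  refl: "beq u u"
| sym: "beq u v \<Longrightarrow> beq v u"
| trans: "beq u v \<Longrightarrow> beq v w \<Longrightarrow> beq u w"
| rot: "beq (a # u) (u @ [a])"
| cancel: "beq ((i, b) # (i, \<not> b) # u) u"
| braid: "i \<noteq> j \<Longrightarrow> beq ((i, True) # (j, True) # (i, True) # u) ((j, True) # (i, True) # (j, True) # u)"

lemma transports_comm: "transports (p @ q) (q @ p)"
proof (induction p arbitrary: q)
  case Nil
  show ?case by (simp add: transports_refl)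
next
  case (Cons a p)
  show ?case using transports_trans [OF transports_rotate [of a "p @ q"]] Cons [of "q @ [a]"] by simp
qed

text \<open>Both directions are needed because \<open>beq\<close> is symmetric. A rotation is undone
  by further rotations, which \<open>transports_comm\<close> composes.\<close>

lemma beq_transports: "beq u v \<Longrightarrow> transports u v \<and> transports v u"
proof (induction rule: beq.induct)
  case (rot a u)
  show ?case using transports_comm [of "[a]" u] transports_comm [of u "[a]"] by simp
qed (auto intro: transports_refl transports_trans transports_cancel transports_uncancel transports_braid)

lemma beq_tr2:
  assumes "r \<noteq> 0" "beq u v"
  shows "tr2 (bur r u) = tr2 (bur r v)"
  using assms(2)
proof (induction rule: beq.induct)
  case (rot a u)
  show ?case by (simp add: bur_append tr2_mm [of "letter r a"])
next
  case (cancel i b u)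
  show ?case by (simp add: mm_assoc [symmetric] letter_cancel [OF assms(1)])
next
  case (braid i j u)
  show ?case using letter_braid [OF braid, of r] by (simp add: mm_assoc [symmetric])
qed auto

lemma beq_comm: "beq (p @ q) (q @ p)"
proof (induction p arbitrary: q)
  case Nil
  show ?case by (simp add: beq.refl)
next
  case (Cons a p)
  show ?case using beq.trans [OF beq.rot [of a "p @ q"]] Cons [of "q @ [a]"] by simp
qed

text \<open>\<open>beq\<close> is conjugacy and hence no congruence. Requiring it for all
  continuations gives a congruence under which words may be rewritten anywhere.\<close>

definition beqv :: "braid3 \<Rightarrow> braid3 \<Rightarrow> bool" (infix "\<doteq>" 50) where
  "u \<doteq> v \<longleftrightarrow> (\<forall>x. beq (u @ x) (v @ x))"

lemma beqv_refl [simp]: "u \<doteq> u" by (simp add: beqv_def beq.refl)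
lemma beqv_sym: "u \<doteq> v \<Longrightarrow> v \<doteq> u" by (auto simp: beqv_def intro: beq.sym)
lemma beqv_trans [trans]: "u \<doteq> v \<Longrightarrow> v \<doteq> w \<Longrightarrow> u \<doteq> w" unfolding beqv_def by (blast intro: beq.trans)
lemma beqv_beq: "u \<doteq> v \<Longrightarrow> beq u v" unfolding beqv_def by (metis append_Nil2)

text \<open>The second factor is rotated to the front, replaced there, and rotated back.\<close>

lemma beqv_append:
  assumes "u \<doteq> u'" "v \<doteq> v'"
  shows "u @ v \<doteq> u' @ v'"
  unfolding beqv_def
proof
  fix x
  have "beq (u @ v @ x) (u' @ v @ x)" using assms(1) by (simp add: beqv_def)
  moreover have "beq (u' @ v @ x) (v @ x @ u')" using beq_comm [of u' "v @ x"] by simp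
  moreover have "beq (v @ x @ u') (v' @ x @ u')" using assms(2) by (simp add: beqv_def)
  moreover have "beq (v' @ x @ u') (u' @ v' @ x)" using beq_comm [of "v' @ x" u'] by simp
  ultimately have "beq (u @ v @ x) (u' @ v' @ x)" by (blast intro: beq.trans)
  then show "beq ((u @ v) @ x) ((u' @ v') @ x)" by simp
qed

lemma beqv_left: "v \<doteq> v' \<Longrightarrow> u @ v \<doteq> u @ v'" by (rule beqv_append) auto
lemma beqv_right: "u \<doteq> u' \<Longrightarrow> u @ v \<doteq> u' @ v" by (rule beqv_append) auto

definition winv :: "braid3 \<Rightarrow> braid3" where
  "winv w = rev (map (\<lambda>(i, b). (i, \<not> b)) w)"

lemma winv_right: "u @ winv u \<doteq> []"
proof (induction u)
  case Nil
  show ?case by (simp add: winv_def)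
next
  case (Cons a u)
  obtain i b where a: "a = (i, b)" by (cases a)
  have "(a # u) @ winv (a # u) = [a] @ (u @ winv u) @ [(i, \<not> b)]" by (simp add: winv_def a)
  also have "\<dots> \<doteq> [a] @ [] @ [(i, \<not> b)]" by (intro beqv_append beqv_refl Cons)
  also have "\<dots> \<doteq> []" using beq.cancel [of i b] by (simp add: beqv_def a)
  finally show ?case .
qed

lemma winv_winv [simp]: "winv (winv u) = u"
  by (simp add: winv_def rev_map comp_def case_prod_unfold)

lemma winv_left: "winv u @ u \<doteq> []"
  using winv_right [of "winv u"] by simp

lemma comm_inv:
  assumes "h @ u \<doteq> u @ h"
  shows "h @ winv u \<doteq> winv u @ h"
proof -
  have "h @ winv u \<doteq> (winv u @ u) @ h @ winv u"
    using beqv_right [OF beqv_sym [OF winv_left [of u]], of "h @ winv u"] by simp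
  also have "\<dots> = winv u @ (u @ h) @ winv u" by simp
  also have "\<dots> \<doteq> winv u @ (h @ u) @ winv u" by (intro beqv_append beqv_refl beqv_sym [OF assms])
  also have "\<dots> = winv u @ h @ (u @ winv u)" by simp
  also have "\<dots> \<doteq> winv u @ h @ []" by (intro beqv_append beqv_refl winv_right)
  finally show ?thesis by simp
qed

section \<open>The half twist, the full twist and its powers\<close>

abbreviation "s1 \<equiv> (Sig1, True)"
abbreviation "s2 \<equiv> (Sig2, True)"
abbreviation "t1 \<equiv> (Sig1, False)"
abbreviation "t2 \<equiv> (Sig2, False)"

definition wx :: braid3 where "wx = [s1, s2, s1]"
definition wy :: braid3 where "wy = [s1, s2]"
definition wh :: braid3 where "wh = wx @ wx"

lemma wx_alt: "wx \<doteq> [s2, s1, s2]"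
  using beq.braid [of Sig1 Sig2] by (simp add: beqv_def wx_def)

lemma wyyy: "wy @ wy @ wy \<doteq> wh"
proof -
  have "wy @ wy @ wy = wx @ [s2, s1, s2]" by (simp add: wx_def wy_def)
  also have "\<dots> \<doteq> wh" unfolding wh_def by (intro beqv_left beqv_sym [OF wx_alt])
  finally show ?thesis .
qed

lemma wx_s1: "wx @ [s1] \<doteq> [s2] @ wx"
  using beqv_right [OF wx_alt, of "[s1]"] by (simp add: wx_def)

lemma wx_s2: "wx @ [s2] \<doteq> [s1] @ wx"
  using beqv_left [OF beqv_sym [OF wx_alt], of "[s1]"] by (simp add: wx_def)

lemma wh_letter: "wh @ [a] \<doteq> [a] @ wh"
proof -
  have 1: "wh @ [s1] \<doteq> [s1] @ wh"
  proof -
    have "wh @ [s1] \<doteq> wx @ [s2] @ wx" unfolding wh_def using beqv_left [OF wx_s1] by simp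
    also have "\<dots> \<doteq> [s1] @ wh" unfolding wh_def using beqv_right [OF wx_s2, of wx] by simp
    finally show ?thesis .
  qed
  have 2: "wh @ [s2] \<doteq> [s2] @ wh"
  proof -
    have "wh @ [s2] \<doteq> wx @ [s1] @ wx" unfolding wh_def using beqv_left [OF wx_s2] by simp
    also have "\<dots> \<doteq> [s2] @ wh" unfolding wh_def using beqv_right [OF wx_s1, of wx] by simp
    finally show ?thesis .
  qed
  obtain i b where a: "a = (i, b)" by (cases a)
  show ?thesis using 1 2 comm_inv [OF 1] comm_inv [OF 2] by (cases i; cases b) (simp_all add: a winv_def)
qed

lemma wh_central: "wh @ u \<doteq> u @ wh"
proof (induction u)
  case (Cons a u)
  have "wh @ a # u \<doteq> [a] @ wh @ u" using beqv_right [OF wh_letter [of a], of u] by simp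
  also have "\<dots> \<doteq> [a] @ u @ wh" by (intro beqv_left Cons)
  finally show ?case by simp
qed simp

lemma wh_inv_central: "winv wh @ u \<doteq> u @ winv wh"
  using comm_inv [OF beqv_sym [OF wh_central], of u] by (rule beqv_sym)

definition Hp :: "int \<Rightarrow> braid3" where
  "Hp d = (if 0 \<le> d then concat (replicate (nat d) wh) else concat (replicate (nat (- d)) (winv wh)))"

lemma Hp_0 [simp]: "Hp 0 = []" by (simp add: Hp_def)

lemma Hp_Suc: "Hp (d + 1) \<doteq> wh @ Hp d"
proof (cases "0 \<le> d")
  case True
  then have "nat (d + 1) = Suc (nat d)" by simp
  then show ?thesis using True by (simp add: Hp_def)
next
  case False
  have e: "concat (replicate (nat (- d - 1)) (winv wh)) = Hp (d + 1)"
    using False by (cases "d = - 1") (auto simp: Hp_def)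
  have "nat (- d) = Suc (nat (- d - 1))" using False by simp
  then have "Hp d = winv wh @ Hp (d + 1)" using False e by (simp add: Hp_def)
  then have "wh @ Hp d = (wh @ winv wh) @ Hp (d + 1)" by simp
  also have "\<dots> \<doteq> Hp (d + 1)" using beqv_right [OF winv_right, of wh "Hp (d + 1)"] by simp
  finally show ?thesis by (rule beqv_sym)
qed

lemma Hp_pred: "Hp (d - 1) \<doteq> winv wh @ Hp d"
proof -
  have "winv wh @ Hp d \<doteq> winv wh @ wh @ Hp (d - 1)" using beqv_left [OF Hp_Suc [of "d - 1"]] by simp
  also have "\<dots> \<doteq> Hp (d - 1)" using beqv_right [OF winv_left [of wh], of "Hp (d - 1)"] by simp
  finally show ?thesis by (rule beqv_sym)
qed

lemma Hp_add: "Hp (d + e) \<doteq> Hp d @ Hp e"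
proof (induction d rule: int_induct [where k = 0])
  case base
  show ?case by simp
next
  case (step1 d)
  have "Hp (d + 1 + e) \<doteq> wh @ Hp (d + e)" using Hp_Suc [of "d + e"] by (simp add: algebra_simps)
  also have "\<dots> \<doteq> wh @ Hp d @ Hp e" by (intro beqv_left step1)
  also have "\<dots> \<doteq> Hp (d + 1) @ Hp e" using beqv_right [OF beqv_sym [OF Hp_Suc [of d]], of "Hp e"] by simp
  finally show ?case .
next
  case (step2 d)
  have "Hp (d - 1 + e) \<doteq> winv wh @ Hp (d + e)" using Hp_pred [of "d + e"] by (simp add: algebra_simps)
  also have "\<dots> \<doteq> winv wh @ Hp d @ Hp e" by (intro beqv_left step2)
  also have "\<dots> \<doteq> Hp (d - 1) @ Hp e" using beqv_right [OF beqv_sym [OF Hp_pred [of d]], of "Hp e"] by simp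
  finally show ?case .
qed

lemma pow_central:
  assumes "\<And>u. h @ u \<doteq> u @ h"
  shows "concat (replicate n h) @ u \<doteq> u @ concat (replicate n h)"
proof (induction n)
  case (Suc n)
  have "concat (replicate (Suc n) h) @ u \<doteq> h @ u @ concat (replicate n h)" using beqv_left [OF Suc] by simp
  also have "\<dots> \<doteq> u @ concat (replicate (Suc n) h)" using beqv_right [OF assms [of u]] by simp
  finally show ?case .
qed simp

lemma Hp_central: "Hp d @ u \<doteq> u @ Hp d"
  unfolding Hp_def using pow_central [OF wh_central] pow_central [OF wh_inv_central] by simp

lemma Hp_1: "Hp 1 = wh" "Hp (- 1) = winv wh" by (simp_all add: Hp_def)

text \<open>Modulo the centre the braid group is the free product of the cyclic groups generated by
  wx (order 2) and wy (order 3); Z stands for the inverse of wy.\<close>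

datatype xy = X | Y | Z

primrec ev :: "xy \<Rightarrow> braid3" where
  "ev X = wx" | "ev Y = wy" | "ev Z = winv wy"

definition evl :: "xy list \<Rightarrow> braid3" where
  "evl l = concat (map ev l)"

lemma evl_simps [simp]: "evl [] = []" "evl (a # l) = ev a @ evl l" "evl (l @ m) = evl l @ evl m"
  by (simp_all add: evl_def)

lemma XZ: "wx @ winv wy \<doteq> [s2]"
proof -
  have "wx @ winv wy \<doteq> [s2] @ wy @ winv wy" using beqv_right [OF wx_alt, of "winv wy"] by (simp add: wy_def)
  also have "\<dots> \<doteq> [s2]" using beqv_left [OF winv_right [of wy], of "[s2]"] by simp
  finally show ?thesis .
qed

lemma XY: "wx @ wy \<doteq> wh @ [t1]"
proof -
  have "wh @ [t1] = (wx @ wy) @ [s1] @ winv [s1]" by (simp add: wh_def wx_def wy_def winv_def)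
  also have "\<dots> \<doteq> (wx @ wy) @ []" by (intro beqv_left winv_right)
  finally show ?thesis using beqv_sym by simp
qed

lemma YX: "wy @ wx \<doteq> wh @ [t2]"
proof -
  have "wh @ [t2] \<doteq> (wy @ wy @ wy) @ [t2]" by (intro beqv_right beqv_sym [OF wyyy])
  also have "\<dots> = (wy @ wx) @ [s2] @ winv [s2]" by (simp add: wx_def wy_def winv_def)
  also have "\<dots> \<doteq> (wy @ wx) @ []" by (intro beqv_left winv_right)
  finally show ?thesis using beqv_sym by simp
qed

lemma YY: "wy @ wy \<doteq> wh @ winv wy"
proof -
  have "wh @ winv wy \<doteq> (wy @ wy @ wy) @ winv wy" by (intro beqv_right beqv_sym [OF wyyy])
  also have "\<dots> = (wy @ wy) @ wy @ winv wy" by simp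
  also have "\<dots> \<doteq> (wy @ wy) @ []" by (intro beqv_left winv_right)
  finally show ?thesis using beqv_sym by simp
qed

lemma ZZ: "winv wy @ winv wy \<doteq> winv wh @ wy"
proof -
  have "winv wy @ winv wy \<doteq> (winv wh @ wh) @ winv wy @ winv wy"
    using beqv_right [OF beqv_sym [OF winv_left [of wh]], of "winv wy @ winv wy"] by simp
  also have "\<dots> = winv wh @ wh @ winv wy @ winv wy" by simp
  also have "\<dots> \<doteq> winv wh @ (wy @ wy @ wy) @ winv wy @ winv wy" by (intro beqv_left beqv_right beqv_sym [OF wyyy])
  also have "\<dots> = winv wh @ wy @ wy @ (wy @ winv wy) @ winv wy" by simp
  also have "\<dots> \<doteq> winv wh @ wy @ wy @ [] @ winv wy" by (intro beqv_left beqv_right winv_right)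
  also have "\<dots> = winv wh @ wy @ (wy @ winv wy)" by simp
  also have "\<dots> \<doteq> winv wh @ wy @ []" by (intro beqv_left winv_right)
  finally show ?thesis by simp
qed

abbreviation "alt a b \<equiv> (a = X) \<noteq> (b = X)"

text \<open>Two neighbours that do not alternate lie in the same cyclic factor, so modulo the centre
  they reduce to at most one letter.\<close>

lemma pair_reduce: "\<not> alt a b \<Longrightarrow> \<exists>d l. length l \<le> 1 \<and> ev a @ ev b \<doteq> Hp d @ evl l"
proof -
  assume n: "\<not> alt a b"
  have r: "\<exists>d l. length l \<le> 1 \<and> u \<doteq> Hp d @ evl l" if "u \<doteq> Hp d @ evl l" "length l \<le> 1" for u d l
    using that by blast
  have l: "length ([]::xy list) \<le> 1" "length [Y] \<le> 1" "length [Z] \<le> 1" by simp_all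
  have xx: "wx @ wx \<doteq> Hp 1 @ evl []" by (simp add: Hp_1 wh_def)
  have yy: "wy @ wy \<doteq> Hp 1 @ evl [Z]" using YY by (simp add: Hp_1)
  have zz: "winv wy @ winv wy \<doteq> Hp (- 1) @ evl [Y]" using ZZ by (simp add: Hp_1)
  have yz: "wy @ winv wy \<doteq> Hp 0 @ evl []" and zy: "winv wy @ wy \<doteq> Hp 0 @ evl []"
    using winv_right [of wy] winv_left [of wy] by simp_all
  show ?thesis
    using n r [OF xx l(1)] r [OF yy l(3)] r [OF zz l(2)] r [OF yz l(1)] r [OF zy l(1)]
    by (cases a; cases b; simp only: ev.simps; simp)
qed

lemma list_reduce:
  assumes "\<not> alt a b"
  shows "\<exists>d l. length l < length (p @ [a, b] @ q) \<and> Hp d0 @ evl (p @ [a, b] @ q) \<doteq> Hp d @ evl l"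
proof -
  obtain d l where l: "length l \<le> 1" "ev a @ ev b \<doteq> Hp d @ evl l" using pair_reduce [OF assms] by blast
  have "Hp d0 @ evl (p @ [a, b] @ q) = Hp d0 @ evl p @ (ev a @ ev b) @ evl q" by simp
  also have "\<dots> \<doteq> Hp d0 @ evl p @ (Hp d @ evl l) @ evl q" by (intro beqv_left beqv_right l(2))
  also have "\<dots> = Hp d0 @ (evl p @ Hp d) @ evl l @ evl q" by simp
  also have "\<dots> \<doteq> Hp d0 @ (Hp d @ evl p) @ evl l @ evl q" by (intro beqv_left beqv_right beqv_sym [OF Hp_central])
  also have "\<dots> = (Hp d0 @ Hp d) @ evl (p @ l @ q)" by simp
  also have "\<dots> \<doteq> Hp (d0 + d) @ evl (p @ l @ q)" by (intro beqv_right beqv_sym [OF Hp_add])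
  finally show ?thesis using l(1) by (intro exI [of _ "d0 + d"] exI [of _ "p @ l @ q"]) simp
qed

lemma not_successively: "\<not> successively P l \<Longrightarrow> \<exists>p a b q. l = p @ [a, b] @ q \<and> \<not> P a b"
proof (induction P l rule: successively.induct)
  case (3 P x y xs)
  show ?case
  proof (cases "P x y")
    case True
    then have "\<not> successively P (y # xs)" using 3 by simp
    then obtain p a b q where "y # xs = p @ [a, b] @ q" "\<not> P a b" using 3 True by blast
    then show ?thesis by (intro exI [of _ "x # p"] exI) auto
  next
    case False
    then show ?thesis by (intro exI [of _ "[]"] exI) auto
  qed
qed auto

text \<open>Such a list splits into pairs \<open>X\<close>, \<open>Y\<close> and \<open>X\<close>,
  \<open>Z\<close>. By \<open>XY\<close> and \<open>XZ\<close> these are \<open>t1\<close> times the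
  full twist and \<open>s2\<close>.\<close>

lemma alternating:
  assumes "successively alt (X # l)" "last (X # l) \<noteq> X"
  shows "\<exists>d v. set v \<subseteq> {s2, t1} \<and> evl (X # l) \<doteq> Hp d @ v"
  using assms
proof (induction l rule: length_induct)
  case (1 l)
  then obtain b m where l: "l = b # m" by (cases l) auto
  have b: "b = Y \<or> b = Z" using 1 l by (cases b) auto
  obtain d v where v: "set v \<subseteq> {s2, t1}" "evl m \<doteq> Hp d @ v"
  proof (cases m)
    case Nil
    then show thesis using that [of "[]" 0] by simp
  next
    case (Cons c n)
    then have "c = X" using 1 l b by auto
    moreover have "successively alt (X # n)" "last (X # n) \<noteq> X" using 1(2,3) l Cons \<open>c = X\<close> by auto
    moreover have "length n < length l" using l Cons by simp
    ultimately show thesis using 1(1) Cons that by blast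
  qed
  obtain e a where a: "a \<in> {s2, t1}" "wx @ ev b \<doteq> Hp e @ [a]"
  proof (cases b)
    case Y
    then show thesis using that [of t1 1] XY by (simp add: Hp_1)
  next
    case Z
    then show thesis using that [of s2 0] XZ by simp
  qed (use b in auto)
  have "evl (X # l) = (wx @ ev b) @ evl m" by (simp add: l)
  also have "\<dots> \<doteq> (Hp e @ [a]) @ (Hp d @ v)" by (intro beqv_append a v)
  also have "\<dots> = Hp e @ ([a] @ Hp d) @ v" by simp
  also have "\<dots> \<doteq> Hp e @ (Hp d @ [a]) @ v" by (intro beqv_left beqv_right beqv_sym [OF Hp_central])
  also have "\<dots> = (Hp e @ Hp d) @ [a] @ v" by simp
  also have "\<dots> \<doteq> Hp (e + d) @ [a] @ v" by (intro beqv_right beqv_sym [OF Hp_add])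
  finally show ?case using a(1) v(1) by (intro exI [of _ "e + d"] exI [of _ "[a] @ v"]) simp
qed

lemma beq_move: "beq (Hp d @ u @ v) (Hp d @ v @ u)"
proof -
  have "beq (Hp d @ u @ v) (v @ Hp d @ u)" using beq_comm [of "Hp d @ u" v] by simp
  moreover have "v @ Hp d @ u \<doteq> Hp d @ v @ u" using beqv_right [OF beqv_sym [OF Hp_central [of d v]], of u] by simp
  ultimately show ?thesis using beqv_beq beq.trans by blast
qed

text \<open>Cyclic reduction in the free product: a pair that does not alternate, possibly formed by
  the last and the first letter, shortens the list. Otherwise some rotation starts with
  \<open>X\<close> and does not end with it.\<close>

lemma Hp_evl_normal: "\<exists>d v. (v = wx \<or> v = wy \<or> v = winv wy \<or> set v \<subseteq> {s2, t1}) \<and> beq (Hp e @ evl l) (Hp d @ v)"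
proof (induction l arbitrary: e rule: length_induct)
  case (1 l)
  let ?goal = "\<lambda>e l. \<exists>d v. (v = wx \<or> v = wy \<or> v = winv wy \<or> set v \<subseteq> {s2, t1}) \<and> beq (Hp e @ evl l) (Hp d @ v)"
  have red: "?goal e (p @ [a, b] @ q)" if len: "length (p @ [a, b] @ q) = length l" and n: "\<not> alt a b" for p a b q
  proof -
    obtain d m where m: "length m < length l" "Hp e @ evl (p @ [a, b] @ q) \<doteq> Hp d @ evl m"
      using list_reduce [OF n, of p q e] len by auto
    have "?goal d m" using 1 m(1) by simp
    then obtain d' v where v: "v = wx \<or> v = wy \<or> v = winv wy \<or> set v \<subseteq> {s2, t1}" "beq (Hp d @ evl m) (Hp d' @ v)"
      by (elim exE conjE)
    show ?thesis by (intro exI conjI) (rule v(1), rule beq.trans [OF beqv_beq [OF m(2)] v(2)])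
  qed
  show ?case
  proof (cases "successively alt l")
    case False
    then obtain p a b q where l: "l = p @ [a, b] @ q" "\<not> alt a b" using not_successively by blast
    then show ?thesis using red [of p a b q] by simp
  next
    case suc: True
    show ?thesis
    proof (cases "length l \<le> 1")
      case True
      then have "l = [] \<or> (\<exists>a. l = [a])" by (cases l) (auto simp: le_Suc_eq)
      then show ?thesis
      proof
        assume "l = []"
        then show ?thesis by (intro exI [of _ e] exI [of _ "[]"]) (simp add: beq.refl)
      next
        assume "\<exists>a. l = [a]"
        then obtain a where "l = [a]" by blast
        then show ?thesis by (intro exI [of _ e] exI [of _ "ev a"]) (cases a; simp add: beq.refl)
      qed
    next
      case long: False
      then obtain b m a where l: "l = b # m @ [a]"
      proof -
        obtain b t where t: "l = b # t" using long by (cases l) auto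
        then have "t \<noteq> []" using long by auto
        then have "l = b # butlast t @ [last t]" using t by simp
        then show thesis by (rule that)
      qed
      show ?thesis
      proof (cases "alt a b")
        case False
        have "beq (Hp e @ evl l) (Hp e @ evl ([] @ [a, b] @ m))"
          using beq_move [of e "evl (b # m)" "ev a"] by (simp add: l)
        moreover have "?goal e ([] @ [a, b] @ m)" by (rule red) (use False l in auto)
        ultimately show ?thesis using beq.trans by blast
      next
        case ab: True
        have "\<exists>n. successively alt (X # n) \<and> last (X # n) \<noteq> X \<and> beq (Hp e @ evl l) (Hp e @ evl (X # n))"
        proof (cases "b = X")
          case True
          then show ?thesis using suc ab l by (intro exI [of _ "m @ [a]"]) (auto simp: beq.refl)
        next
          case False
          then have a: "a = X" using ab by simp
          have "beq (Hp e @ evl l) (Hp e @ evl (X # b # m))"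
            using beq_move [of e "evl (b # m)" "ev a"] by (simp add: l a)
          moreover have "successively alt ((b # m) @ [X])" using suc l a by simp
          then have "successively alt (b # m)" "last (b # m) \<noteq> X"
            unfolding successively_append_iff by auto
          ultimately show ?thesis using False by (intro exI [of _ "b # m"]) auto
        qed
        then obtain n where n: "successively alt (X # n)" "last (X # n) \<noteq> X" "beq (Hp e @ evl l) (Hp e @ evl (X # n))" by blast
        obtain d v where v: "set v \<subseteq> {s2, t1}" "evl (X # n) \<doteq> Hp d @ v" using alternating [OF n(1,2)] by blast
        have "Hp e @ evl (X # n) \<doteq> Hp e @ Hp d @ v" by (intro beqv_left v)
        also have "\<dots> = (Hp e @ Hp d) @ v" by simp
        also have "\<dots> \<doteq> Hp (e + d) @ v" by (intro beqv_right beqv_sym [OF Hp_add])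
        finally have "beq (Hp e @ evl l) (Hp (e + d) @ v)" using n(3) beqv_beq beq.trans by blast
        then show ?thesis using v(1) by blast
      qed
    qed
  qed
qed

lemma letter_evl: "\<exists>d l. [a] \<doteq> Hp d @ evl l"
proof -
  obtain i b where a: "a = (i, b)" by (cases a)
  have "[s1] \<doteq> Hp 0 @ evl [Z, X]"
    using beqv_right [OF beqv_sym [OF winv_left [of wy]], of "[s1]"] by (simp add: wx_def wy_def)
  moreover have "[s2] \<doteq> Hp 0 @ evl [X, Z]" using beqv_sym [OF XZ] by simp
  moreover have h: "u \<doteq> Hp (- 1) @ v" if "v \<doteq> wh @ u" for u v
  proof -
    have "Hp (- 1) @ v \<doteq> winv wh @ wh @ u" unfolding Hp_1 by (intro beqv_left that)
    also have "\<dots> \<doteq> u" using beqv_right [OF winv_left [of wh], of u] by simp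
    finally show ?thesis by (rule beqv_sym)
  qed
  have "[t1] \<doteq> Hp (- 1) @ evl [X, Y]" "[t2] \<doteq> Hp (- 1) @ evl [Y, X]"
    using h [OF XY] h [OF YX] by simp_all
  ultimately show ?thesis by (cases i; cases b; simp only: a; blast)
qed

lemma word_evl: "\<exists>d l. w \<doteq> Hp d @ evl l"
proof (induction w)
  case Nil
  show ?case by (intro exI [of _ 0] exI [of _ "[]"]) simp
next
  case (Cons a w)
  then obtain d l where l: "w \<doteq> Hp d @ evl l" by blast
  obtain e m where m: "[a] \<doteq> Hp e @ evl m" using letter_evl by blast
  have "a # w = [a] @ w" by simp
  also have "\<dots> \<doteq> (Hp e @ evl m) @ (Hp d @ evl l)" by (intro beqv_append l m)
  also have "\<dots> = Hp e @ (evl m @ Hp d) @ evl l" by simp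
  also have "\<dots> \<doteq> Hp e @ (Hp d @ evl m) @ evl l" by (intro beqv_left beqv_right beqv_sym [OF Hp_central])
  also have "\<dots> = (Hp e @ Hp d) @ evl (m @ l)" by simp
  also have "\<dots> \<doteq> Hp (e + d) @ evl (m @ l)" by (intro beqv_right beqv_sym [OF Hp_add])
  finally show ?case by blast
qed

theorem normal_form:
  obtains d v where "v = wx \<or> v = wy \<or> v = winv wy \<or> set v \<subseteq> {s2, t1}" "beq w (Hp d @ v)"
  using word_evl [of w] Hp_evl_normal beqv_beq beq.trans by meson

section \<open>Evaluations of the Burau trace\<close>

lemma bur_words:
  "bur r wx = (0, r ^ 3, r ^ 3, 0)" "bur r wh = (r ^ 6, 0, 0, r ^ 6)"
  "bur r (winv wh) = (inverse r ^ 6, 0, 0, inverse r ^ 6)" if "r \<noteq> 0"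
proof -
  show x: "bur r wx = (0, r ^ 3, r ^ 3, 0)"
    by (simp add: wx_def letter_def Let_def power2_eq_square power3_eq_cube)
  show h: "bur r wh = (r ^ 6, 0, 0, r ^ 6)"
    by (simp add: wh_def bur_append x power_add [symmetric])
  have "beq (wh @ winv wh @ [a]) [a]" for a using winv_right [of wh] by (simp add: beqv_def)
  have "mm (bur r wh) (bur r (winv wh)) = (1, 0, 0, 1)"
  proof -
    have "mm (bur r u) (bur r (winv u)) = (1, 0, 0, 1)" for u
    proof (induction u)
      case Nil
      show ?case by (simp add: winv_def)
    next
      case (Cons a u)
      obtain i b where a: "a = (i, b)" by (cases a)
      have "bur r (winv (a # u)) = mm (bur r (winv u)) (letter r (i, \<not> b))"
        by (simp add: winv_def a bur_append)
      then have "mm (bur r (a # u)) (bur r (winv (a # u))) =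
        mm (letter r a) (mm (mm (bur r u) (bur r (winv u))) (letter r (i, \<not> b)))" by (simp add: mm_assoc)
      then show ?case unfolding Cons a by (simp add: letter_cancel [OF that])
    qed
    then show ?thesis .
  qed
  then show "bur r (winv wh) = (inverse r ^ 6, 0, 0, inverse r ^ 6)"
    unfolding h using that by (cases "bur r (winv wh)") (auto simp: field_simps)
qed

lemma bur_Hp:
  assumes "r \<noteq> 0"
  shows "tr2 (bur r (Hp d @ v)) = r powi (6 * d) * tr2 (bur r v)"
proof -
  have pow: "bur r (concat (replicate n u)) = (z ^ n, 0, 0, z ^ n)" if "bur r u = (z, 0, 0, z)" for n u z
    by (induction n) (simp_all add: bur_append that)
  have "bur r (Hp d) = (r powi (6 * d), 0, 0, r powi (6 * d))"
  proof (cases "0 \<le> d")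
    case True
    then obtain n where d: "d = int n" by (metis nonneg_int_cases)
    have "r powi (6 * d) = (r ^ 6) ^ n" by (simp add: d power_int_def nat_mult_distrib power_mult)
    then show ?thesis using pow [OF bur_words(2) [OF assms]] by (simp add: Hp_def d)
  next
    case False
    then obtain n where d: "d = - int n" by (metis int_cases2 int_nat_eq nle_le nat_0_le of_nat_0_le_iff)
    have "r powi (6 * d) = (inverse r ^ 6) ^ n"
      by (simp add: d power_int_minus power_inverse power_mult [symmetric]) (simp add: power_int_def nat_mult_distrib)
    then show ?thesis using pow [OF bur_words(3) [OF assms]] False by (simp add: Hp_def d)
  qed
  then show ?thesis by (cases "bur r v") (simp add: bur_append algebra_simps)
qed

text \<open>At the fourth root of unity \<open>s2\<close> and \<open>t1\<close> become, up to
  conjugation by a diagonal matrix, the elementary upper and lower unipotent integer matrices. Their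
  products have natural entries and diagonal at least 1, so the trace is at least 2.\<close>

lemma bur_i:
  assumes "set v \<subseteq> {s2, t1}"
  shows "\<exists>a b c d :: nat. 1 \<le> a \<and> 1 \<le> d \<and> bur \<i> v = (of_nat a, - \<i> * of_nat b, \<i> * of_nat c, of_nat d)"
  using assms
proof (induction v)
  case Nil
  show ?case by (intro exI [of _ 1] exI [of _ 0]) simp
next
  case (Cons x v)
  then obtain a b c d :: nat where m: "1 \<le> a" "1 \<le> d" "bur \<i> v = (of_nat a, - \<i> * of_nat b, \<i> * of_nat c, of_nat d)"
    by auto
  have "x = s2 \<or> x = t1" using Cons.prems by auto
  then show ?case
  proof
    assume "x = s2"
    then have "bur \<i> (x # v) = (of_nat (a + c), - \<i> * of_nat (b + d), \<i> * of_nat c, of_nat d)"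
      by (simp add: letter_def m(3) algebra_simps)
    then show ?thesis using m(1,2) by (meson le_add1 le_trans)
  next
    assume "x = t1"
    then have "bur \<i> (x # v) = (of_nat a, - \<i> * of_nat b, \<i> * of_nat (a + c), of_nat (b + d))"
      by (simp add: letter_def m(3) algebra_simps)
    then show ?thesis using m(1,2) by (meson le_add2 le_trans)
  qed
qed

lemma tr2_wy:
  assumes "r \<noteq> 0"
  shows "tr2 (bur r wy) = - (r powi 2)" "tr2 (bur r (winv wy)) = - (r powi - 2)"
  using assms by (simp_all add: wy_def winv_def letter_def Let_def power_int_minus power2_eq_square)

lemma set_Hp: "0 \<le> d \<Longrightarrow> a \<in> set (Hp d) \<Longrightarrow> snd a" "d \<le> 0 \<Longrightarrow> a \<in> set (Hp d) \<Longrightarrow> \<not> snd a"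
proof -
  have p: "\<forall>a\<in>set wh. snd a" by (simp add: wh_def wx_def)
  have n: "\<forall>a\<in>set (winv wh). \<not> snd a" by (simp add: wh_def wx_def winv_def)
  show "0 \<le> d \<Longrightarrow> a \<in> set (Hp d) \<Longrightarrow> snd a" using p by (auto simp: Hp_def)
  show "d \<le> 0 \<Longrightarrow> a \<in> set (Hp d) \<Longrightarrow> \<not> snd a" using n by (cases "d = 0") (auto simp: Hp_def)
qed

theorem akh_dim_6_word:
  assumes "akh_dim w = 6"
  shows "beq w [s1, s2] \<or> beq w [t1, t2]"
proof -
  obtain \<epsilon> m0 where \<epsilon>: "\<epsilon> = 1 \<or> \<epsilon> = - 1" and eul: "\<And>r. euler w r = 1 + \<epsilon> * r powi m0"
    and pos: "\<And>w'. transports w w' \<Longrightarrow> w' \<noteq> [] \<Longrightarrow> \<forall>b\<in>set w'. snd b \<Longrightarrow> m0 < 4"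
    and neg: "\<And>w'. transports w' w \<Longrightarrow> w' \<noteq> [] \<Longrightarrow> \<forall>b\<in>set w'. \<not> snd b \<Longrightarrow> - 4 < m0"
    using akh_dim_6 [OF assms] by blast
  obtain d v where v: "v = wx \<or> v = wy \<or> v = winv wy \<or> set v \<subseteq> {s2, t1}" and w: "beq w (Hp d @ v)"
    by (rule normal_form)
  have tr: "r powi (6 * d) * tr2 (bur r v) = \<epsilon> * r powi m0" if "r \<noteq> 0" for r
    using eul [of r] euler_bur [OF that, of w] beq_tr2 [OF that w] bur_Hp [OF that, of d v] by simp
  \<comment> \<open>All powers of the root of unity have modulus 1, so the unknown exponents
    disappear and only the trace of \<open>v\<close> is left.\<close>
  have "cmod (\<i> powi (6 * d) * tr2 (bur \<i> v)) = 1"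
    using tr [of \<i>] \<epsilon> by (auto simp: norm_mult norm_power_int)
  then have one: "cmod (tr2 (bur \<i> v)) = 1" by (simp add: norm_mult norm_power_int)
  have "v \<noteq> wx"
  proof
    assume "v = wx"
    then show False using one bur_words(1) [of \<i>] by simp
  qed
  moreover have "\<not> set v \<subseteq> {s2, t1}"
  proof
    assume "set v \<subseteq> {s2, t1}"
    then obtain a b c e :: nat where m: "1 \<le> a" "1 \<le> e" "bur \<i> v = (of_nat a, - \<i> * of_nat b, \<i> * of_nat c, of_nat e)"
      using bur_i by blast
    then have "tr2 (bur \<i> v) = of_nat (a + e)" by simp
    then have "cmod (tr2 (bur \<i> v)) = real (a + e)" by (simp only: norm_of_nat)
    then show False using one m by simp
  qed
  ultimately have vy: "v = wy \<or> v = winv wy" using v by blast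
  \<comment> \<open>The exponent of the Burau trace: 6 for each full twist and 2 or -2 for
    \<open>wy\<close> or its inverse.\<close>
  define k where "k = 6 * d + (if v = wy then 2 else - 2)"
  have ne: "wy \<noteq> winv wy" by (simp add: wy_def winv_def)
  have "2 powi (6 * d) * tr2 (bur 2 v) = - (2 powi k)"
  proof -
    have "(2::complex) powi (6 * d) * - (2 powi e) = - (2 powi (6 * d + e))" for e
      using power_int_add [of "2::complex" "6 * d" e] by simp
    moreover have "tr2 (bur 2 v) = - (2 powi (if v = wy then 2 else - 2))"
    proof (cases "v = wy")
      case True
      show ?thesis unfolding True using tr2_wy(1) [OF zero_neq_numeral [THEN not_sym]] by (simp only: simp_thms if_True)
    next
      case False
      then have v: "v = winv wy" using vy by blast
      show ?thesis unfolding if_not_P [OF False] unfolding v by (rule tr2_wy(2)) simp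
    qed
    ultimately show ?thesis unfolding k_def by (simp only:)
  qed
  then have "\<epsilon> * 2 powi m0 = - (2 powi k)" using tr [of 2] by simp
  \<comment> \<open>At 2 the powers are positive and pairwise distinct, so both the sign and the
    exponent can be read off.\<close>
  then have "Re (\<epsilon> * 2 powi m0) = Re (- (2 powi k))" by simp
  moreover have "(2::complex) powi n = complex_of_real (2 powi n)" for n by simp
  then have re: "Re (2 powi n) = 2 powi n" "Im (2 powi n) = 0" for n by (metis Re_complex_of_real, metis Im_complex_of_real)
  have gt: "(2::real) powi n > 0" for n by simp
  ultimately have "(2::real) powi m0 = 2 powi k"
  proof -
    assume a: "Re (\<epsilon> * 2 powi m0) = Re (- (2 powi k))"
    from \<epsilon> show ?thesis
    proof
      assume "\<epsilon> = 1"
      then have "(2::real) powi m0 = - (2 powi k)" using a by (simp only: mult_1 uminus_complex.sel re)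
      then show ?thesis using gt [of m0] gt [of k] by linarith
    next
      assume "\<epsilon> = - 1"
      then have "- ((2::real) powi m0) = - (2 powi k)" using a by (simp only: mult_minus1 uminus_complex.sel re)
      then show ?thesis by linarith
    qed
  qed
  then have m0: "m0 = k"
    using power_int_strict_increasing [of m0 k "2::real"] power_int_strict_increasing [of k m0 "2::real"]
    by (cases m0 k rule: linorder_cases) auto
  have pos': "\<not> 4 \<le> k" if "Hp d @ v \<doteq> w'" "w' \<noteq> []" "\<forall>b\<in>set w'. snd b" for w'
    using pos [of w'] beq_transports [OF beq.trans [OF w beqv_beq [OF that(1)]]] that(2,3) m0 by auto
  have neg': "\<not> k \<le> - 4" if "Hp d @ v \<doteq> w'" "w' \<noteq> []" "\<forall>b\<in>set w'. \<not> snd b" for w'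
    using neg [of w'] beq_transports [OF beq.trans [OF w beqv_beq [OF that(1)]]] that(2,3) m0 by auto
  have py: "\<forall>b\<in>set wy. snd b" and ny: "\<forall>b\<in>set (winv wy). \<not> snd b" and ey: "wy \<noteq> []" "winv wy \<noteq> []"
    by (simp_all add: wy_def winv_def)
  from vy show ?thesis
  proof
    assume vw: "v = wy"
    have "\<not> 1 \<le> d"
    proof
      assume d: "1 \<le> d"
      then have "\<forall>b\<in>set (Hp d @ v). snd b" using set_Hp(1) [of d] py vw by auto
      then show False using pos' [OF beqv_refl] d ey vw by (simp add: k_def)
    qed
    moreover have "\<not> d \<le> - 1"
    proof
      assume d: "d \<le> - 1"
      \<comment> \<open>One negative full twist absorbs the positive \<open>wy\<close>, leaving the
        square of its inverse: the word becomes negative.\<close>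
      have "Hp d @ v \<doteq> (Hp (d + 1) @ winv wh) @ wy"
        using beqv_right [OF Hp_add [of "d + 1" "- 1"], of wy] vw by (simp add: Hp_1)
      also have "\<dots> = Hp (d + 1) @ winv wh @ wy" by simp
      also have "\<dots> \<doteq> Hp (d + 1) @ winv wy @ winv wy" by (intro beqv_left beqv_sym [OF ZZ])
      finally have e: "Hp d @ v \<doteq> Hp (d + 1) @ winv wy @ winv wy" .
      have "\<forall>b\<in>set (Hp (d + 1) @ winv wy @ winv wy). \<not> snd b" using set_Hp(2) [of "d + 1"] ny d by auto
      then show False using neg' [OF e] d ey vw by (simp add: k_def)
    qed
    ultimately have "d = 0" by simp
    then show ?thesis using w vw by (simp add: wy_def)
  next
    assume vw: "v = winv wy"
    have "\<not> 1 \<le> d"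
    proof
      assume d: "1 \<le> d"
      \<comment> \<open>One positive full twist absorbs the inverse of \<open>wy\<close>, leaving
        the square of \<open>wy\<close>: the word becomes positive.\<close>
      have "Hp d @ v \<doteq> (Hp (d - 1) @ wh) @ winv wy"
        using beqv_right [OF Hp_add [of "d - 1" 1], of "winv wy"] vw by (simp add: Hp_1)
      also have "\<dots> = Hp (d - 1) @ wh @ winv wy" by simp
      also have "\<dots> \<doteq> Hp (d - 1) @ wy @ wy" by (intro beqv_left beqv_sym [OF YY])
      finally have e: "Hp d @ v \<doteq> Hp (d - 1) @ wy @ wy" .
      have "\<forall>b\<in>set (Hp (d - 1) @ wy @ wy). snd b" using set_Hp(1) [of "d - 1"] py d by auto
      then show False using pos' [OF e] d ey vw ne by (simp add: k_def)
    qed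
    moreover have "\<not> d \<le> - 1"
    proof
      assume d: "d \<le> - 1"
      then have "\<forall>b\<in>set (Hp d @ v). \<not> snd b" using set_Hp(2) [of d] ny vw by auto
      then show False using neg' [OF beqv_refl] d ey vw ne by (simp add: k_def)
    qed
    ultimately have "d = 0" by simp
    then have "beq w [t2, t1]" using w vw by (simp add: wy_def winv_def)
    then show ?thesis using beq.trans [OF _ beq.rot [of t2 "[t1]"]] by simp
  qed
qed

section \<open>Annular isotopies\<close>

lemma annular_isotopic_refl: "L \<subseteq> annular_space \<Longrightarrow> annular_isotopic L L"
  unfolding annular_isotopic_def
proof (intro conjI exI [of _ "\<lambda>t p. p"] ballI)
  show "continuous_on ({0..1} \<times> annular_space) (\<lambda>(t::real, p::R3). p)"
    by (simp add: case_prod_unfold continuous_on_snd continuous_on_id)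
  show "\<exists>g. homeomorphism annular_space annular_space (\<lambda>p. p) g"
    using homeomorphism_ident by blast
qed auto

lemma annular_isotopic_trans [trans]:
  assumes "annular_isotopic L L'" "annular_isotopic L' L''"
  shows "annular_isotopic L L''"
proof -
  let ?A = annular_space
  obtain H where H: "L \<subseteq> ?A" "continuous_on ({0..1} \<times> ?A) (\<lambda>(t, p). H t p)"
    "\<And>t. t \<in> {0..1} \<Longrightarrow> \<exists>g. homeomorphism ?A ?A (H t) g" "\<And>p. p \<in> ?A \<Longrightarrow> H (0::real) p = p" "H 1 ` L = L'"
    using assms(1) unfolding annular_isotopic_def by auto
  obtain K where K: "L'' \<subseteq> ?A" "continuous_on ({0..1} \<times> ?A) (\<lambda>(t, p). K t p)"
    "\<And>t. t \<in> {0..1} \<Longrightarrow> \<exists>g. homeomorphism ?A ?A (K t) g" "\<And>p. p \<in> ?A \<Longrightarrow> K (0::real) p = p" "K 1 ` L' = L''"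
    using assms(2) unfolding annular_isotopic_def by auto
  define M where "M = (\<lambda>t p. if t \<le> 1/2 then H (2 * t) p else K (2 * t - 1) (H 1 p))"
  obtain g1 where g1: "homeomorphism ?A ?A (H 1) g1" using H(3) [of 1] by auto
  have H1: "continuous_on ?A (H 1)" "H 1 ` ?A = ?A" using g1 by (auto simp: homeomorphism_def)
  have c1: "continuous_on ({0..1/2::real} \<times> ?A) (\<lambda>x. H (2 * fst x) (snd x))"
  proof (rule continuous_on_compose2 [OF H(2), of _ "\<lambda>x. (2 * fst x, snd x)", simplified])
    show "continuous_on ({0..1/2::real} \<times> ?A) (\<lambda>x. (2 * fst x, snd x))" by (intro continuous_intros)
  qed auto
  have c2: "continuous_on ({1/2..1::real} \<times> ?A) (\<lambda>x. K (2 * fst x - 1) (H 1 (snd x)))"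
  proof (rule continuous_on_compose2 [OF K(2), of _ "\<lambda>x. (2 * fst x - 1, H 1 (snd x))", simplified])
    show "continuous_on ({1/2..1::real} \<times> ?A) (\<lambda>x. (2 * fst x - 1, H 1 (snd x)))"
      by (intro continuous_intros continuous_on_compose2 [OF H1(1)]) auto
  qed (use H1 in auto)
  have un: "{0..1::real} \<times> ?A = {0..1/2} \<times> ?A \<union> {1/2..1::real} \<times> ?A"
    by (simp add: Sigma_Un_distrib1 [symmetric] ivl_disj_un_two_touch)
  have cl: "closedin (top_of_set {0..1}) {0..1/2::real}" "closedin (top_of_set {0..1}) {1/2..1::real}"
    by (auto intro!: closed_subset)
  have "continuous_on ({0..1/2::real} \<times> ?A \<union> {1/2..1::real} \<times> ?A) (\<lambda>x. if fst x \<le> 1/2 then H (2 * fst x) (snd x) else K (2 * fst x - 1) (H 1 (snd x)))"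
  proof (rule continuous_on_cases_local [OF _ _ c1 c2])
    show "closedin (top_of_set ({0..1/2::real} \<times> ?A \<union> {1/2..1::real} \<times> ?A)) ({0..1/2::real} \<times> ?A)"
      "closedin (top_of_set ({0..1/2::real} \<times> ?A \<union> {1/2..1::real} \<times> ?A)) ({1/2..1::real} \<times> ?A)"
      unfolding un [symmetric] using cl by (auto intro: closedin_Times)
    show "H (2 * fst x) (snd x) = K (2 * fst x - 1) (H 1 (snd x))"
      if "x \<in> {0..1/2} \<times> ?A \<and> \<not> fst x \<le> 1/2 \<or> x \<in> {1/2..1} \<times> ?A \<and> fst x \<le> 1/2" for x
    proof -
      obtain t p where x: "x = (t, p)" by (cases x)
      then have t: "t = 1/2" and p: "p \<in> ?A" using that by auto
      have "H 1 p \<in> ?A" using p H1(2) by blast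
      then show ?thesis using K(4) by (simp add: x t)
    qed
  qed
  then have cM: "continuous_on ({0..1} \<times> ?A) (\<lambda>(t, p). M t p)"
    unfolding un by (simp add: M_def case_prod_unfold)
  have hM: "\<exists>g. homeomorphism ?A ?A (M t) g" if t: "t \<in> {0..1}" for t
  proof (cases "t \<le> 1/2")
    case True
    then show ?thesis using H(3) [of "2 * t"] t by (simp add: M_def)
  next
    case False
    then obtain k where k: "homeomorphism ?A ?A (K (2 * t - 1)) k" using K(3) [of "2 * t - 1"] t by auto
    have "M t = K (2 * t - 1) \<circ> H 1" using False by (auto simp: M_def)
    then show ?thesis using homeomorphism_compose [OF g1 k] by metis
  qed
  show ?thesis unfolding annular_isotopic_def
  proof (intro conjI exI [of _ M] ballI)
    show "M 1 ` L = L''" using H(5) K(5) by (simp add: M_def image_image [symmetric])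
    show "M 0 p = p" if "p \<in> ?A" for p using H(4) that by (simp add: M_def)
  qed (use H K cM hM in auto)
qed

lemma cyl_annular: "r > 0 \<Longrightarrow> cyl r \<theta> z \<in> annular_space"
proof -
  assume "r > 0"
  moreover have "cos \<theta> \<noteq> 0 \<or> sin \<theta> \<noteq> 0" using sin_zero_abs_cos_one [of \<theta>] by auto
  ultimately show ?thesis by (auto simp: annular_space_def cyl_def)
qed

lemma cyl_cong: "cos \<theta> = cos \<phi> \<Longrightarrow> sin \<theta> = sin \<phi> \<Longrightarrow> cyl r \<theta> z = cyl r \<phi> z"
  by (simp add: cyl_def)

lemma annular_cases:
  assumes "p \<in> annular_space"
  obtains r t z where "r > 0" "0 \<le> t" "t < 1" "p = cyl r (2 * pi * t) z"
proof -
  obtain x y z where p: "p = (x, y, z)" by (cases p)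
  define r where "r = sqrt (x\<^sup>2 + y\<^sup>2)"
  have pos: "x\<^sup>2 + y\<^sup>2 > 0" using assms p by (simp add: annular_space_def sum_power2_gt_zero_iff)
  then have r: "r > 0" "r\<^sup>2 = x\<^sup>2 + y\<^sup>2" by (simp_all add: r_def)
  have "(x / r)\<^sup>2 + (y / r)\<^sup>2 = (x\<^sup>2 + y\<^sup>2) / r\<^sup>2" by (simp add: power_divide add_divide_distrib)
  also have "\<dots> = 1" unfolding r(2) [symmetric] using r(1) by simp
  finally have "(x / r)\<^sup>2 + (y / r)\<^sup>2 = 1" .
  then obtain \<theta> where \<theta>: "0 \<le> \<theta>" "\<theta> < 2 * pi" "x / r = cos \<theta>" "y / r = sin \<theta>" using sincos_total_2pi by metis
  then have "p = cyl r (2 * pi * (\<theta> / (2 * pi))) z" using r by (simp add: p cyl_def field_simps)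
  then show thesis using that [of r "\<theta> / (2 * pi)" z] r \<theta> by simp
qed

definition turn :: "real \<Rightarrow> R3 \<Rightarrow> R3" where
  "turn c p = (fst p * cos c - fst (snd p) * sin c, fst p * sin c + fst (snd p) * cos c, snd (snd p))"

lemma turn_cyl: "turn c (cyl r \<theta> z) = cyl r (\<theta> + c) z"
  by (simp add: turn_def cyl_def cos_add sin_add algebra_simps)

lemma turn_annular: "p \<in> annular_space \<Longrightarrow> turn c p \<in> annular_space"
  by (elim annular_cases) (simp add: turn_cyl cyl_annular)

lemma turn_turn: "p \<in> annular_space \<Longrightarrow> turn c (turn d p) = turn (d + c) p"
  by (elim annular_cases) (simp add: turn_cyl add.assoc)

lemma turn_0 [simp]: "turn 0 p = p" by (simp add: turn_def)

lemma annular_isotopic_turn: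
  assumes "L \<subseteq> annular_space"
  shows "annular_isotopic L (turn c ` L)"
  unfolding annular_isotopic_def
proof (intro conjI exI [of _ "\<lambda>t. turn (c * t)"] ballI)
  show "continuous_on ({0..1} \<times> annular_space) (\<lambda>(t, p). turn (c * t) p)"
    unfolding turn_def case_prod_unfold by (intro continuous_intros)
  have "continuous_on annular_space (turn e)" for e
    unfolding turn_def by (intro continuous_intros)
  then have "homeomorphism annular_space annular_space (turn e) (turn (- e))" for e
    unfolding homeomorphism_def using turn_annular turn_turn [of _ _ e] turn_turn [of _ _ "- e"]
    by (auto simp: image_iff) (metis add.right_inverse add.left_inverse turn_0 turn_annular turn_turn)+
  then show "\<exists>g. homeomorphism annular_space annular_space (turn (c * t)) g" for t by blast
qed (use assms turn_annular in auto)

section \<open>Extending a small motion of three points to an ambient isotopy\<close>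

type_synonym R2 = "real \<times> real"
type_synonym cfg = "R2 \<times> R2 \<times> R2"

definition cmp :: "nat \<Rightarrow> cfg \<Rightarrow> R2" where
  "cmp j c = (if j = 0 then fst c else if j = 1 then fst (snd c) else snd (snd c))"

lemma cmp_diff: "cmp j (c - d) = cmp j c - cmp j d"
  by (simp add: cmp_def)

lemma norm_cmp_le: "norm (cmp j c) \<le> norm c"
  using norm_fst_le [of "fst c" "snd c"] norm_snd_le [of "snd c" "fst c"]
    norm_fst_le [of "fst (snd c)" "snd (snd c)"] norm_snd_le [of "snd (snd c)" "fst (snd c)"]
  by (auto simp: cmp_def)

lemma continuous_on_cmp [continuous_intros]: "continuous_on S f \<Longrightarrow> continuous_on S (\<lambda>x. cmp j (f x))"
  unfolding cmp_def by (cases "j = 0"; cases "j = 1") (auto intro!: continuous_intros)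

definition set3 :: "cfg \<Rightarrow> R2 set" where
  "set3 c = (\<lambda>j. cmp j c) ` {..<3}"

lemma set3_eq: "set3 (a, b, c) = {a, b, c}"
proof -
  have "{..<3} = {0, 1, 2::nat}" by auto
  then show ?thesis by (auto simp: set3_def cmp_def)
qed

text \<open>Only the underlying set of points enters, so a path whose ends agree up to a permutation
  closes up to a link.\<close>

definition clo :: "(real \<Rightarrow> cfg) \<Rightarrow> R3 set" where
  "clo g = (\<Union>t\<in>{0..1}. (\<lambda>x. cyl (fst x) (2 * pi * t) (snd x)) ` set3 (g t))"

definition bump :: "real \<Rightarrow> R2 \<Rightarrow> R2 \<Rightarrow> real" where
  "bump \<rho> p x = max 0 (1 - dist x p / \<rho>)"

lemma bump_bounds: "\<rho> > 0 \<Longrightarrow> 0 \<le> bump \<rho> p x" "\<rho> > 0 \<Longrightarrow> bump \<rho> p x \<le> 1"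
  by (auto simp: bump_def)

lemma bump_lipschitz: "\<rho> > 0 \<Longrightarrow> \<bar>bump \<rho> p x - bump \<rho> p y\<bar> \<le> dist x y / \<rho>"
proof -
  assume \<rho>: "\<rho> > 0"
  have "\<bar>bump \<rho> p x - bump \<rho> p y\<bar> \<le> \<bar>dist y p / \<rho> - dist x p / \<rho>\<bar>" by (simp add: bump_def)
  also have "\<dots> = \<bar>dist y p - dist x p\<bar> / \<rho>" using \<rho> by (simp add: diff_divide_distrib [symmetric])
  also have "\<dots> \<le> dist x y / \<rho>"
  proof -
    have "\<bar>dist y p - dist x p\<bar> \<le> dist x y"
      using dist_triangle [of y p x] dist_triangle [of x p y] by (simp add: dist_commute abs_le_iff)
    then show ?thesis using \<rho> by (simp add: divide_right_mono)
  qed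
  finally show ?thesis .
qed

text \<open>Three bumps of slope \<open>1 / \<rho>\<close> and displacements up to
  \<open>\<rho> / 6\<close> give a field of size at most \<open>\<rho> / 2\<close> with Lipschitz
  constant 1/2. Distances of at least \<open>\<rho>\<close> keep each bump away from the other
  points, and radii of at least \<open>2 * \<rho>\<close> keep the field away from the axis. The
  common ends make it vanish at the seam, where the numbering of the points may jump.\<close>

locale small_step =
  fixes g h :: "real \<Rightarrow> cfg" and \<rho> :: real
  assumes pg: "path g" and ph: "path h" and \<rho>: "\<rho> > 0"
    and far: "t \<in> {0..1} \<Longrightarrow> i < 3 \<Longrightarrow> j < 3 \<Longrightarrow> i \<noteq> j \<Longrightarrow> \<rho> \<le> dist (cmp i (g t)) (cmp j (g t))"
    and posn: "t \<in> {0..1} \<Longrightarrow> j < 3 \<Longrightarrow> 2 * \<rho> \<le> fst (cmp j (g t))"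
    and near: "t \<in> {0..1} \<Longrightarrow> norm (h t - g t) \<le> \<rho> / 6"
    and ends: "g 0 = h 0" "g 1 = h 1"
begin

definition V :: "real \<Rightarrow> R2 \<Rightarrow> R2" where
  "V t x = (\<Sum>j<3. bump \<rho> (cmp j (g t)) x *\<^sub>R (cmp j (h t) - cmp j (g t)))"

lemma cmp_near: "t \<in> {0..1} \<Longrightarrow> norm (cmp j (h t) - cmp j (g t)) \<le> \<rho> / 6"
  using near [of t] norm_cmp_le [of j "h t - g t"] by (simp add: cmp_diff)

lemma V_ends [simp]: "V 0 x = 0" "V 1 x = 0"
  using ends by (simp_all add: V_def)

lemma V_bound: "t \<in> {0..1} \<Longrightarrow> norm (V t x) \<le> \<rho> / 2"
proof -
  assume t: "t \<in> {0..1}"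
  have "norm (V t x) \<le> (\<Sum>j<(3::nat). \<rho> / 6)"
    unfolding V_def
  proof (rule order.trans [OF norm_sum sum_mono])
    fix j
    have "norm (bump \<rho> (cmp j (g t)) x *\<^sub>R (cmp j (h t) - cmp j (g t))) \<le> 1 * (\<rho> / 6)"
      unfolding norm_scaleR using bump_bounds [OF \<rho>] cmp_near [OF t] by (intro mult_mono) (auto simp: abs_le_iff intro: order.trans [of _ 0])
    then show "norm (bump \<rho> (cmp j (g t)) x *\<^sub>R (cmp j (h t) - cmp j (g t))) \<le> \<rho> / 6" by simp
  qed
  then show ?thesis by simp
qed

lemma V_lipschitz: "t \<in> {0..1} \<Longrightarrow> norm (V t x - V t y) \<le> dist x y / 2"
proof -
  assume t: "t \<in> {0..1}"
  have "V t x - V t y = (\<Sum>j<3. (bump \<rho> (cmp j (g t)) x - bump \<rho> (cmp j (g t)) y) *\<^sub>R (cmp j (h t) - cmp j (g t)))"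
    by (simp add: V_def sum_subtractf [symmetric] scaleR_diff_left)
  also have "norm \<dots> \<le> (\<Sum>j<(3::nat). dist x y / \<rho> * (\<rho> / 6))"
  proof (rule order.trans [OF norm_sum sum_mono])
    fix j
    show "norm ((bump \<rho> (cmp j (g t)) x - bump \<rho> (cmp j (g t)) y) *\<^sub>R (cmp j (h t) - cmp j (g t))) \<le> dist x y / \<rho> * (\<rho> / 6)"
      unfolding norm_scaleR using bump_lipschitz [OF \<rho>] cmp_near [OF t] \<rho> by (intro mult_mono) auto
  qed
  finally show ?thesis using \<rho> by simp
qed

lemma V_support: "t \<in> {0..1} \<Longrightarrow> V t x \<noteq> 0 \<Longrightarrow> \<rho> < fst x"
proof -
  assume t: "t \<in> {0..1}" and "V t x \<noteq> 0"
  then obtain j where j: "j < 3" "bump \<rho> (cmp j (g t)) x \<noteq> 0"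
    unfolding V_def by (metis (no_types, lifting) lessThan_iff scaleR_zero_left sum.neutral)
  then have "dist x (cmp j (g t)) < \<rho>" using \<rho> by (auto simp: bump_def max_def split: if_splits)
  moreover have "\<bar>fst x - fst (cmp j (g t))\<bar> \<le> dist x (cmp j (g t))"
    using dist_fst_le [of x "cmp j (g t)"] by (simp add: dist_real_def)
  ultimately show ?thesis using posn [OF t j(1)] by linarith
qed

lemma V_pos:
  assumes t: "t \<in> {0..1}" and s: "s \<in> {0..1}" and x: "fst x > 0"
  shows "fst x + s * fst (V t x) > 0"
proof (cases "V t x = 0")
  case False
  have "\<bar>fst (V t x)\<bar> \<le> \<rho> / 2" using V_bound [OF t, of x] norm_fst_le [of "fst (V t x)" "snd (V t x)"] by simp
  then have "\<bar>s * fst (V t x)\<bar> \<le> 1 * (\<rho> / 2)" unfolding abs_mult using s by (intro mult_mono) auto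
  then show ?thesis using V_support [OF t False] \<rho> by linarith
qed (use x in simp)

lemma V_target: "t \<in> {0..1} \<Longrightarrow> j < 3 \<Longrightarrow> cmp j (g t) + V t (cmp j (g t)) = cmp j (h t)"
proof -
  assume t: "t \<in> {0..1}" and j: "j < 3"
  have "V t (cmp j (g t)) = (\<Sum>i<3. if i = j then cmp j (h t) - cmp j (g t) else 0)"
    unfolding V_def
  proof (rule sum.cong)
    fix i :: nat assume i: "i \<in> {..<3}"
    show "bump \<rho> (cmp i (g t)) (cmp j (g t)) *\<^sub>R (cmp i (h t) - cmp i (g t)) = (if i = j then cmp j (h t) - cmp j (g t) else 0)"
    proof (cases "i = j")
      case False
      then have "1 \<le> dist (cmp j (g t)) (cmp i (g t)) / \<rho>" using far [OF t j, of i] i \<rho> by (simp add: field_simps)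
      then show ?thesis using False by (simp add: bump_def)
    qed (simp add: bump_def)
  qed simp
  then show ?thesis using j by simp
qed

lemma V_continuous: "continuous_on ({0..1} \<times> UNIV) (\<lambda>q. V (fst q) (snd q))"
proof -
  have g: "continuous_on ({0..1} \<times> (UNIV :: R2 set)) (\<lambda>q. g (fst q))"
    by (rule continuous_on_compose2 [OF pg [unfolded path_def]]) (auto intro!: continuous_intros)
  have h: "continuous_on ({0..1} \<times> (UNIV :: R2 set)) (\<lambda>q. h (fst q))"
    by (rule continuous_on_compose2 [OF ph [unfolded path_def]]) (auto intro!: continuous_intros)
  show ?thesis unfolding V_def bump_def using \<rho> by (intro continuous_intros g h) auto
qed

definition rad :: "R3 \<Rightarrow> real" where "rad p = sqrt ((fst p)\<^sup>2 + (fst (snd p))\<^sup>2)"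
definition ang :: "R3 \<Rightarrow> real" where "ang p = arccos (fst p / rad p) / (2 * pi)"

text \<open>\<open>arccos\<close> sees an angle only up to reflection, so the half with negative
  second coordinate uses \<open>1 - ang p\<close>. Where the halves meet, \<open>ang\<close> is 1/2
  or the field vanishes.\<close>

definition W :: "R3 \<Rightarrow> R2" where
  "W p = (if 0 \<le> fst (snd p) then V (ang p) (rad p, snd (snd p)) else V (1 - ang p) (rad p, snd (snd p)))"

lemma rad_cyl: "r > 0 \<Longrightarrow> rad (cyl r \<theta> z) = r"
proof -
  assume "r > 0"
  have "(r * cos \<theta>)\<^sup>2 + (r * sin \<theta>)\<^sup>2 = r\<^sup>2"
    using sin_cos_squared_add [of \<theta>] by (simp add: power_mult_distrib distrib_left [symmetric] add.commute)
  then show ?thesis using \<open>r > 0\<close> by (simp add: rad_def cyl_def)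
qed

lemma W_cyl:
  assumes r: "r > 0" and t: "t \<in> {0..1}"
  shows "W (cyl r (2 * pi * t) z) = V t (r, z)"
proof -
  let ?p = "cyl r (2 * pi * t) z"
  have ang: "ang ?p = arccos (cos (2 * pi * t)) / (2 * pi)" using r rad_cyl [OF r] by (simp add: ang_def) (simp add: cyl_def)
  have y: "0 \<le> fst (snd ?p) \<longleftrightarrow> 0 \<le> sin (2 * pi * t)" using r by (simp add: cyl_def zero_le_mult_iff)
  have z: "snd (snd ?p) = z" by (simp add: cyl_def)
  show ?thesis
  proof (cases "t \<le> 1/2")
    case True
    have le: "2 * pi * t \<le> pi" using True by (simp add: field_simps)
    have "0 \<le> sin (2 * pi * t)" using t le by (intro sin_ge_zero) auto
    moreover have "ang ?p = t" using ang arccos_cos [of "2 * pi * t"] t le by simp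
    ultimately show ?thesis using y by (simp add: W_def rad_cyl [OF r] z)
  next
    case False
    have ge: "0 \<le> 2 * pi - 2 * pi * t" "2 * pi - 2 * pi * t \<le> pi" using False t by (simp_all add: field_simps)
    have c: "cos (2 * pi * t) = cos (2 * pi - 2 * pi * t)" "sin (2 * pi * t) = - sin (2 * pi - 2 * pi * t)"
      by (simp_all add: cos_diff sin_diff)
    have "ang ?p = (2 * pi - 2 * pi * t) / (2 * pi)" using ang c(1) arccos_cos [OF ge] by (simp only:)
    then have a: "ang ?p = 1 - t" by (simp add: diff_divide_distrib)
    have "0 \<le> sin (2 * pi - 2 * pi * t)" using ge by (intro sin_ge_zero) auto
    show ?thesis
    proof (cases "t = 1")
      case True
      then show ?thesis using a by (simp add: W_def)
    next
      case False
      have "2 * pi * t < 2 * pi * 1" using False t by (intro mult_strict_left_mono) auto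
      then have "0 < 2 * pi - 2 * pi * t" by simp
      moreover have "pi * 1 < pi * (2 * t)" using \<open>\<not> t \<le> 1/2\<close> by (intro mult_strict_left_mono) auto
      then have "2 * pi - 2 * pi * t < pi" by simp
      ultimately have "0 < sin (2 * pi - 2 * pi * t)" by (rule sin_gt_zero)
      then have "sin (2 * pi * t) < 0" unfolding c(2) by linarith
      then have "\<not> 0 \<le> fst (snd ?p)" using y by linarith
      then show ?thesis unfolding W_def a rad_cyl [OF r] z by simp
    qed
  qed
qed

lemma W_continuous: "continuous_on annular_space W"
proof -
  let ?S = "annular_space \<inter> {p. 0 \<le> fst (snd p)}" and ?T = "annular_space \<inter> {p. fst (snd p) \<le> 0}"
  have un: "annular_space = ?S \<union> ?T" by auto
  have rp: "rad p > 0" if "p \<in> annular_space" for p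
    using that by (elim annular_cases) (simp add: rad_cyl)
  have le: "- 1 \<le> fst p / rad p \<and> fst p / rad p \<le> 1" if "p \<in> annular_space" for p
    using that
  proof (elim annular_cases)
    fix r t z assume "r > 0" "p = cyl r (2 * pi * t) z"
    then have "fst p / rad p = cos (2 * pi * t)" by (simp add: rad_cyl) (simp add: cyl_def)
    then show ?thesis by simp
  qed
  have cr: "continuous_on annular_space rad" unfolding rad_def by (intro continuous_intros)
  have ca: "continuous_on annular_space ang"
    unfolding ang_def using le rp by (intro continuous_intros cr) (auto simp: less_imp_neq [THEN not_sym])
  have an: "0 \<le> ang p" "ang p \<le> 1" if "p \<in> annular_space" for p
    using arccos_bounded [of "fst p / rad p"] le [OF that] by (auto simp: ang_def field_simps)
  have sub: "?S \<subseteq> annular_space" "?T \<subseteq> annular_space" by auto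
  have c1: "continuous_on ?S (\<lambda>p. V (ang p) (rad p, snd (snd p)))"
    using an by (intro continuous_on_compose2 [OF V_continuous, of _ "\<lambda>p. (ang p, rad p, snd (snd p))", simplified]
      continuous_intros continuous_on_subset [OF cr sub(1)] continuous_on_subset [OF ca sub(1)]) auto
  have c2: "continuous_on ?T (\<lambda>p. V (1 - ang p) (rad p, snd (snd p)))"
    using an by (intro continuous_on_compose2 [OF V_continuous, of _ "\<lambda>p. (1 - ang p, rad p, snd (snd p))", simplified]
      continuous_intros continuous_on_subset [OF cr sub(2)] continuous_on_subset [OF ca sub(2)]) auto
  have "continuous_on (?S \<union> ?T) (\<lambda>p. if 0 \<le> fst (snd p) then V (ang p) (rad p, snd (snd p)) else V (1 - ang p) (rad p, snd (snd p)))"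
  proof (rule continuous_on_cases_local [OF _ _ c1 c2])
    show "closedin (top_of_set (?S \<union> ?T)) ?S" unfolding un [symmetric]
      by (intro closedin_closed_Int closed_Collect_le continuous_intros)
    show "closedin (top_of_set (?S \<union> ?T)) ?T" unfolding un [symmetric]
      by (intro closedin_closed_Int closed_Collect_le continuous_intros)
    fix p assume "p \<in> ?S \<and> \<not> 0 \<le> fst (snd p) \<or> p \<in> ?T \<and> 0 \<le> fst (snd p)"
    then have p: "p \<in> annular_space" "fst (snd p) = 0" by auto
    then have "fst p \<noteq> 0" "rad p = \<bar>fst p\<bar>" by (auto simp: annular_space_def rad_def)
    then have "ang p = 0 \<or> ang p = 1/2" by (cases "fst p > 0") (auto simp: ang_def)
    then show "V (ang p) (rad p, snd (snd p)) = V (1 - ang p) (rad p, snd (snd p))"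
    proof
      assume "ang p = 1/2"
      then have "1 - ang p = ang p" by simp
      then show ?thesis by (simp only:)
    qed simp
  qed
  then show ?thesis unfolding un [symmetric] W_def .
qed

text \<open>The factor stretches the radius from \<open>rad p\<close> to
  \<open>rad p + s * fst (W p)\<close> and leaves the angle alone.\<close>

definition F :: "real \<Rightarrow> R3 \<Rightarrow> R3" where
  "F s p = ((1 + s * fst (W p) / rad p) * fst p, (1 + s * fst (W p) / rad p) * fst (snd p), snd (snd p) + s * snd (W p))"

lemma F_cyl:
  assumes "r > 0" "t \<in> {0..1}"
  shows "F s (cyl r (2 * pi * t) z) = cyl (r + s * fst (V t (r, z))) (2 * pi * t) (z + s * snd (V t (r, z)))"
  unfolding F_def W_cyl [OF assms] rad_cyl [OF assms(1)] using assms(1) by (simp add: cyl_def field_simps)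

text \<open>In each half-plane the map is the identity plus a map with Lipschitz constant 1/2: the
  estimate gives injectivity, a fixed point gives surjectivity, and invariance of domain makes the
  inverse continuous.\<close>

lemma F_homeomorphism:
  assumes s: "s \<in> {0..1}"
  shows "\<exists>k. homeomorphism annular_space annular_space (F s) k"
proof -
  have half: "norm (s *\<^sub>R (V t x) - s *\<^sub>R (V t y)) \<le> dist x y / 2" if "t \<in> {0..1}" for t x y
  proof -
    have "norm (s *\<^sub>R (V t x) - s *\<^sub>R (V t y)) = s * norm (V t x - V t y)"
      using s by (simp add: scaleR_diff_right [symmetric] del: scaleR_diff_right)
    also have "\<dots> \<le> 1 * norm (V t x - V t y)" using s by (intro mult_right_mono) auto
    finally show ?thesis using V_lipschitz [OF that, of x y] by linarith
  qed
  have inj: "inj_on (F s) annular_space"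
  proof (rule inj_onI)
    fix p q assume p: "p \<in> annular_space" and q: "q \<in> annular_space" and eq: "F s p = F s q"
    obtain r t z where rt: "r > 0" "0 \<le> t" "t < 1" "p = cyl r (2 * pi * t) z" using p by (rule annular_cases)
    obtain r' t' z' where rt': "r' > 0" "0 \<le> t'" "t' < 1" "q = cyl r' (2 * pi * t') z'" using q by (rule annular_cases)
    have t: "t \<in> {0..1}" "t' \<in> {0..1}" using rt rt' by auto
    let ?x = "(r, z)" and ?y = "(r', z')"
    let ?R = "r + s * fst (V t ?x)" and ?R' = "r' + s * fst (V t' ?y)"
    have R: "?R > 0" "?R' > 0" using V_pos [OF t(1) s, of ?x] V_pos [OF t(2) s, of ?y] rt rt' by auto
    have e: "cyl ?R (2 * pi * t) (z + s * snd (V t ?x)) = cyl ?R' (2 * pi * t') (z' + s * snd (V t' ?y))"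
      using eq F_cyl [OF rt(1) t(1)] F_cyl [OF rt'(1) t(2)] rt(4) rt'(4) by simp
    have RR: "?R = ?R'" using arg_cong [OF e, of rad] rad_cyl R by simp
    then have "cos (2 * pi * t) = cos (2 * pi * t')" "sin (2 * pi * t) = sin (2 * pi * t')"
      and zz: "z + s * snd (V t ?x) = z' + s * snd (V t' ?y)" using e R by (auto simp: cyl_def)
    then have "cyl 1 (2 * pi * t) 0 = cyl 1 (2 * pi * t') 0" by (intro cyl_cong)
    then have q2: "q = cyl r' (2 * pi * t) z'" using rt'(4) cyl_cong [OF \<open>cos _ = _\<close> \<open>sin _ = _\<close>] by simp
    have VV: "V t ?y = V t' ?y" using W_cyl [OF rt'(1) t(1), of z'] W_cyl [OF rt'(1) t(2), of z'] q2 rt'(4) by simp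
    then have "?x + s *\<^sub>R V t ?x = ?y + s *\<^sub>R V t ?y"
      using RR zz by (simp add: prod_eq_iff VV)
    moreover have "a - b = v - u" if "a + u = b + v" for a b u v :: R2
    proof -
      have "a = b + v - u" using that by (metis add_diff_cancel_right')
      then show ?thesis by simp
    qed
    ultimately have "?x - ?y = s *\<^sub>R V t ?y - s *\<^sub>R V t ?x" by blast
    then have "dist ?x ?y \<le> dist ?y ?x / 2" using half [OF t(1), of ?y ?x] by (simp only: dist_norm)
    then have "?x = ?y" by (simp only: dist_commute [of ?y]) (smt (verit) dist_eq_0_iff field_sum_of_halves zero_le_dist)
    then show "p = q" using rt(4) q2 by simp
  qed
  have img: "F s p \<in> annular_space" if "p \<in> annular_space" for p
    using that
  proof (elim annular_cases)
    fix r t z assume a: "r > 0" "0 \<le> t" "t < 1" "p = cyl r (2 * pi * t) z"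
    then have t: "t \<in> {0..1}" by auto
    show ?thesis unfolding a(4) F_cyl [OF a(1) t] using V_pos [OF t s, of "(r, z)"] a(1) by (intro cyl_annular) simp
  qed
  have surj: "q \<in> F s ` annular_space" if "q \<in> annular_space" for q
    using that
  proof (elim annular_cases)
    fix r t z assume a: "r > 0" "0 \<le> t" "t < 1" "q = cyl r (2 * pi * t) z"
    then have t: "t \<in> {0..1}" by auto
    \<comment> \<open>A fixed point of this contraction is a preimage of \<open>(r, z)\<close> in
      the half-plane of angle \<open>t\<close>.\<close>
    have "\<exists>!x. (r, z) - s *\<^sub>R V t x = x"
    proof (rule banach_fix_type [where c = "1/2"])
      show "\<forall>x y. dist ((r, z) - s *\<^sub>R V t x) ((r, z) - s *\<^sub>R V t y) \<le> 1/2 * dist x y"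
      proof (intro allI)
        fix x y
        have "((r, z) - s *\<^sub>R V t x) - ((r, z) - s *\<^sub>R V t y) = s *\<^sub>R V t y - s *\<^sub>R V t x" by simp
        then show "dist ((r, z) - s *\<^sub>R V t x) ((r, z) - s *\<^sub>R V t y) \<le> 1/2 * dist x y"
          using half [OF t, of y x] by (simp only: dist_norm) (simp add: dist_norm norm_minus_commute)
      qed
    qed auto
    then obtain x where x: "(r, z) - s *\<^sub>R V t x = x" by blast
    \<comment> \<open>The preimage stays off the axis: either the field vanishes at it or it lies in
      the support of the field.\<close>
    have xr: "fst x > 0"
    proof (cases "V t x = 0")
      case True
      then have "x = (r, z)" using x by simp
      then show ?thesis using a(1) by simp
    next
      case False
      then show ?thesis using V_support [OF t] \<rho> by fastforce
    qed
    obtain r0 z0 where x0: "x = (r0, z0)" by (cases x)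
    have "(r, z) = x + s *\<^sub>R V t x" using x by (metis diff_add_cancel)
    then have "r = r0 + s * fst (V t (r0, z0))" "z = z0 + s * snd (V t (r0, z0))"
      using x0 by (cases "V t (r0, z0)", simp)+
    then have "F s (cyl r0 (2 * pi * t) z0) = q" using F_cyl [of r0 t s z0] xr x0 t a(4) by simp
    then show ?thesis using cyl_annular xr x0 by force
  qed
  have cont: "continuous_on annular_space (F s)"
  proof -
    have rp: "rad p \<noteq> 0" if "p \<in> annular_space" for p
      using that by (elim annular_cases) (simp add: rad_cyl)
    have cr: "continuous_on annular_space rad" unfolding rad_def by (intro continuous_intros)
    show ?thesis unfolding F_def using rp by (intro continuous_intros W_continuous cr) auto
  qed
  have op: "open annular_space"
  proof -
    have "annular_space = - ({0} \<times> {0} \<times> UNIV)" by (auto simp: annular_space_def)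
    moreover have "closed ({0::real} \<times> {0::real} \<times> (UNIV :: real set))" by (intro closed_Times) auto
    ultimately show ?thesis by (metis open_Compl)
  qed
  have "F s ` annular_space = annular_space" using img surj by auto
  moreover obtain k where "homeomorphism annular_space (F s ` annular_space) (F s) k"
    using invariance_of_domain_homeomorphism [OF op cont _ inj] by blast
  ultimately show ?thesis by auto
qed

theorem isotopic: "annular_isotopic (clo g) (clo h)"
proof -
  have sub: "clo g \<subseteq> annular_space"
    using posn \<rho> by (force simp: clo_def set3_def intro!: cyl_annular)
  have Fg: "F 1 (cyl (fst x) (2 * pi * t) (snd x)) = cyl (fst y) (2 * pi * t) (snd y)"
    if "t \<in> {0..1}" "j < 3" "x = cmp j (g t)" "y = cmp j (h t)" for t j x y
  proof -
    have "fst x > 0" using posn [OF that(1,2)] \<rho> unfolding that(3) by linarith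
    moreover have "x + V t x = y" using V_target [OF that(1,2)] that(3,4) by simp
    ultimately show ?thesis using F_cyl [of "fst x" t 1 "snd x"] that(1) by (cases x; cases "V t x") auto
  qed
  have img: "F 1 ` clo g = clo h"
  proof -
    have "F 1 ` clo g = (\<Union>t\<in>{0..1}. (\<lambda>j. F 1 (cyl (fst (cmp j (g t))) (2 * pi * t) (snd (cmp j (g t))))) ` {..<3})"
      by (simp add: clo_def set3_def image_UN image_image)
    also have "\<dots> = (\<Union>t\<in>{0..1}. (\<lambda>j. cyl (fst (cmp j (h t))) (2 * pi * t) (snd (cmp j (h t)))) ` {..<3})"
      using Fg by (intro SUP_cong image_cong refl) auto
    also have "\<dots> = clo h" by (simp add: clo_def set3_def image_image)
    finally show ?thesis .
  qed
  have F1: "F 1 ` annular_space = annular_space" using F_homeomorphism [of 1] by (auto simp: homeomorphism_def)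
  have cont: "continuous_on ({0..1} \<times> annular_space) (\<lambda>(s, p). F s p)"
  proof -
    have rp: "rad p \<noteq> 0" if "p \<in> annular_space" for p
      using that by (elim annular_cases) (simp add: rad_cyl)
    have cr: "continuous_on annular_space rad" unfolding rad_def by (intro continuous_intros)
    have "continuous_on ({0..1} \<times> annular_space) (\<lambda>x. rad (snd x))" "continuous_on ({0..1} \<times> annular_space) (\<lambda>x. W (snd x))"
      by (rule continuous_on_compose2 [OF cr] continuous_on_compose2 [OF W_continuous]; auto intro!: continuous_intros)+
    then show ?thesis unfolding F_def case_prod_unfold using rp by (intro continuous_intros) auto
  qed
  show ?thesis unfolding annular_isotopic_def
  proof (intro conjI exI [of _ F] ballI)
    show "clo h \<subseteq> annular_space" using sub img F1 by blast
    show "F 0 p = p" for p by (simp add: F_def)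
  qed (use sub cont F_homeomorphism img in auto)
qed

end

section \<open>Closures of paths of configurations\<close>

definition conf :: "cfg set" where
  "conf = {c. (\<forall>i<3. 0 < fst (cmp i c)) \<and> (\<forall>i<3. \<forall>j<3. i \<noteq> j \<longrightarrow> cmp i c \<noteq> cmp j c)}"

lemma all_less_3: "(\<forall>i<3. P i) \<longleftrightarrow> P 0 \<and> P 1 \<and> P (2::nat)"
proof -
  have "i < 3 \<longleftrightarrow> i = 0 \<or> i = 1 \<or> i = 2" for i :: nat by linarith
  then show ?thesis by auto
qed

lemma conf_iff: "(a, b, c) \<in> conf \<longleftrightarrow> 0 < fst a \<and> 0 < fst b \<and> 0 < fst c \<and> a \<noteq> b \<and> a \<noteq> c \<and> b \<noteq> c"
  unfolding conf_def mem_Collect_eq all_less_3 by (auto simp: cmp_def)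

lemma clo_cong: "(\<And>t. t \<in> {0..1} \<Longrightarrow> set3 (g t) = set3 (h t)) \<Longrightarrow> clo g = clo h"
  by (simp add: clo_def)

lemma clo_subset: "path_image g \<subseteq> conf \<Longrightarrow> clo g \<subseteq> annular_space"
  by (force simp: clo_def set3_def path_image_def conf_def intro!: cyl_annular)

lemma conf_gap:
  assumes "compact K" "K \<noteq> {}" "K \<subseteq> conf"
  obtains \<rho> where "\<rho> > 0" "\<And>c j. c \<in> K \<Longrightarrow> j < 3 \<Longrightarrow> 2 * \<rho> \<le> fst (cmp j c)"
    "\<And>c i j. c \<in> K \<Longrightarrow> i < 3 \<Longrightarrow> j < 3 \<Longrightarrow> i \<noteq> j \<Longrightarrow> \<rho> \<le> dist (cmp i c) (cmp j c)"
proof -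
  let ?m = "\<lambda>c. min (min (fst (cmp 0 c)) (min (fst (cmp 1 c)) (fst (cmp 2 c))))
    (min (dist (cmp 0 c) (cmp 1 c)) (min (dist (cmp 0 c) (cmp 2 c)) (dist (cmp 1 c) (cmp 2 c))))"
  have "continuous_on K ?m" by (intro continuous_intros)
  then obtain c0 where c0: "c0 \<in> K" "\<And>c. c \<in> K \<Longrightarrow> ?m c0 \<le> ?m c" using continuous_attains_inf [OF assms(1,2)] by blast
  define \<rho> where "\<rho> = ?m c0 / 2"
  have "c0 \<in> conf" using c0 assms(3) by blast
  then have pos: "\<rho> > 0" by (cases c0) (auto simp: \<rho>_def conf_iff cmp_def)
  have le: "2 * \<rho> \<le> ?m c" if "c \<in> K" for c using c0(2) [OF that] by (simp add: \<rho>_def)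
  have "\<forall>j<3. 2 * \<rho> \<le> fst (cmp j c)" if "c \<in> K" for c
    unfolding all_less_3 using le [OF that] by simp
  moreover have "\<forall>i<3. \<forall>j<3. i \<noteq> j \<longrightarrow> \<rho> \<le> dist (cmp i c) (cmp j c)" if "c \<in> K" for c
    unfolding all_less_3 using le [OF that] pos by (simp add: dist_commute)
  ultimately show thesis using that [OF pos] by blast
qed

text \<open>Compactness gives a common gap \<open>\<rho>\<close>, and uniform continuity cuts the
  homotopy into steps shorter than \<open>\<rho> / 6\<close>. Path homotopies fix the ends, as
  \<open>small_step\<close> demands.\<close>

theorem homotopic_isotopic:
  assumes "homotopic_paths conf g h"
  shows "annular_isotopic (clo g) (clo h)"
proof -
  obtain H :: "real \<times> real \<Rightarrow> cfg" where H: "continuous_on ({0..1} \<times> {0..1}) H" "H ` ({0..1} \<times> {0..1}) \<subseteq> conf"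
    "\<And>x. x \<in> {0..1} \<Longrightarrow> H (0, x) = g x" "\<And>x. x \<in> {0..1} \<Longrightarrow> H (1, x) = h x"
    "\<And>t. t \<in> {0..1} \<Longrightarrow> H (t, 0) = g 0 \<and> H (t, 1) = g 1"
  proof -
    obtain H :: "real \<times> real \<Rightarrow> cfg" where H: "continuous_on ({0..1} \<times> {0..1}) H" "H \<in> ({0..1} \<times> {0..1}) \<rightarrow> conf"
      "\<forall>x\<in>{0..1}. H (0, x) = g x" "\<forall>x\<in>{0..1}. H (1, x) = h x"
      "\<forall>t\<in>{0..1::real}. pathstart (H \<circ> Pair t) = pathstart g \<and> pathfinish (H \<circ> Pair t) = pathfinish g"
      using assms unfolding homotopic_paths by blast
    show thesis
    proof (rule that [of H])
      show "H ` ({0..1::real} \<times> {0..1}) \<subseteq> conf" using H(2) by blast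
    qed (use H in \<open>auto simp: pathstart_def pathfinish_def\<close>)
  qed
  let ?K = "H ` ({0..1} \<times> {0..1})"
  have K: "compact ?K" by (intro compact_continuous_image H compact_Times) auto
  obtain \<rho> where \<rho>: "\<rho> > 0" "\<And>c j. c \<in> ?K \<Longrightarrow> j < 3 \<Longrightarrow> 2 * \<rho> \<le> fst (cmp j c)"
    "\<And>c i j. c \<in> ?K \<Longrightarrow> i < 3 \<Longrightarrow> j < 3 \<Longrightarrow> i \<noteq> j \<Longrightarrow> \<rho> \<le> dist (cmp i c) (cmp j c)"
    using conf_gap [OF K _ H(2)] by auto
  have "uniformly_continuous_on ({0..1} \<times> {0..1}) H"
    by (intro compact_uniformly_continuous H compact_Times) auto
  then obtain \<delta> where \<delta>: "\<delta> > 0" "\<And>x x'. x \<in> {0..1} \<times> {0..1} \<Longrightarrow> x' \<in> {0..1} \<times> {0..1} \<Longrightarrow> dist x' x < \<delta> \<Longrightarrow> dist (H x') (H x) < \<rho> / 6"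
    unfolding uniformly_continuous_on_def using \<rho>(1) by (metis zero_less_divide_iff zero_less_numeral)
  obtain n where n: "1 / real (Suc n) < \<delta>" using \<delta>(1) nat_approx_posE by blast
  let ?N = "real (Suc n)"
  have mem: "k \<le> Suc n \<Longrightarrow> real k / ?N \<in> {0..1}" for k by (auto simp: field_simps)
  have p: "path (\<lambda>t. H (u, t))" if "u \<in> {0..1}" for u
    unfolding path_def using that by (intro continuous_on_compose2 [OF H(1)] continuous_intros) auto
  have "annular_isotopic (clo g) (clo (\<lambda>t. H (real k / ?N, t)))" if "k \<le> Suc n" for k
    using that
  proof (induction k)
    case 0
    have "clo (\<lambda>t. H (real 0 / ?N, t)) = clo g" using H(3) by (intro clo_cong) simp
    moreover have "path_image g \<subseteq> conf" using homotopic_paths_imp_subset [OF assms] by simp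
    ultimately show ?case using annular_isotopic_refl [OF clo_subset] by simp
  next
    case (Suc k)
    let ?u = "real k / ?N" and ?v = "real (Suc k) / ?N"
    have u: "?u \<in> {0..1}" and v: "?v \<in> {0..1}" using mem Suc.prems by (auto simp del: of_nat_Suc)
    have d: "dist ?v ?u = 1 / ?N" by (simp add: dist_real_def diff_divide_distrib [symmetric])
    interpret S: small_step "\<lambda>t. H (?u, t)" "\<lambda>t. H (?v, t)" \<rho>
    proof
      show "path (\<lambda>t. H (?u, t))" "path (\<lambda>t. H (?v, t))" using p [OF u] p [OF v] by auto
      show "norm (H (?v, t) - H (?u, t)) \<le> \<rho> / 6" if "t \<in> {0..1}" for t
      proof -
        have "dist (?v, t) (?u, t) < \<delta>" unfolding dist_prod_def using d n by simp
        then have "dist (H (?v, t)) (H (?u, t)) < \<rho> / 6" using \<delta>(2) [of "(?u, t)" "(?v, t)"] u v that by blast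
        then show ?thesis by (simp add: dist_norm)
      qed
      show "H (?u, 0) = H (?v, 0)" "H (?u, 1) = H (?v, 1)" using H(5) [OF u] H(5) [OF v] by auto
      show "\<rho> \<le> dist (cmp i (H (?u, t))) (cmp j (H (?u, t)))" if "t \<in> {0..1}" "i < 3" "j < 3" "i \<noteq> j" for t i j
        using \<rho>(3) [OF _ that(2-4), of "H (?u, t)"] u that(1) by blast
      show "2 * \<rho> \<le> fst (cmp j (H (?u, t)))" if "t \<in> {0..1}" "j < 3" for t j
        using \<rho>(2) [OF _ that(2), of "H (?u, t)"] u that(1) by blast
    qed (rule \<rho>(1))
    show ?case using Suc S.isotopic annular_isotopic_trans by auto
  qed
  from this [of "Suc n"] have "annular_isotopic (clo g) (clo (\<lambda>t. H (1, t)))" by simp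
  moreover have "clo (\<lambda>t. H (1, t)) = clo h" using H(4) by (intro clo_cong) simp
  ultimately show ?thesis by simp
qed

text \<open>Carrying both directions makes symmetry immediate, without inverting an ambient
  isotopy.\<close>

definition iso2 :: "R3 set \<Rightarrow> R3 set \<Rightarrow> bool" where
  "iso2 L L' \<longleftrightarrow> annular_isotopic L L' \<and> annular_isotopic L' L"

lemma iso2_sym: "iso2 L L' \<Longrightarrow> iso2 L' L" by (auto simp: iso2_def)
lemma iso2_trans [trans]: "iso2 L L' \<Longrightarrow> iso2 L' L'' \<Longrightarrow> iso2 L L''"
  by (auto simp: iso2_def intro: annular_isotopic_trans)

lemma homotopic_iso2: "homotopic_paths conf g h \<Longrightarrow> iso2 (clo g) (clo h)"
  by (simp add: iso2_def homotopic_isotopic homotopic_paths_sym)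

lemma clo_join:
  assumes "set3 (pathfinish p) = set3 (pathstart q)"
  shows "clo (p +++ q) = (\<Union>t\<in>{0..1}. (\<lambda>x. cyl (fst x) (pi * t) (snd x)) ` set3 (p t)) \<union>
     (\<Union>t\<in>{0..1}. (\<lambda>x. cyl (fst x) (pi + pi * t) (snd x)) ` set3 (q t))" (is "_ = ?A \<union> ?B")
proof
  show "clo (p +++ q) \<subseteq> ?A \<union> ?B"
  proof
    fix u assume "u \<in> clo (p +++ q)"
    then obtain t x where t: "t \<in> {0..1}" "x \<in> set3 ((p +++ q) t)" "u = cyl (fst x) (2 * pi * t) (snd x)"
      by (auto simp: clo_def)
    show "u \<in> ?A \<union> ?B"
    proof (cases "t \<le> 1/2")
      case True
      then have "x \<in> set3 (p (2 * t))" using t by (simp add: joinpaths_def)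
      moreover have "u = cyl (fst x) (pi * (2 * t)) (snd x)" using t(3) by (simp add: mult_ac)
      moreover have "2 * t \<in> {0..1}" using True t by auto
      ultimately show ?thesis by blast
    next
      case False
      then have "x \<in> set3 (q (2 * t - 1))" using t by (simp add: joinpaths_def)
      moreover have "u = cyl (fst x) (pi + pi * (2 * t - 1)) (snd x)" using t(3) by (simp add: algebra_simps)
      moreover have "2 * t - 1 \<in> {0..1}" using False t by auto
      ultimately show ?thesis by blast
    qed
  qed
  have A: "u \<in> clo (p +++ q)" if "t \<in> {0..1}" "x \<in> set3 (p t)" "u = cyl (fst x) (pi * t) (snd x)" for t x u
  proof -
    have "x \<in> set3 ((p +++ q) (t / 2))" using that by (simp add: joinpaths_def)
    moreover have "u = cyl (fst x) (2 * pi * (t / 2)) (snd x)" using that by simp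
    moreover have "t / 2 \<in> {0..1}" using that by auto
    ultimately show ?thesis unfolding clo_def by blast
  qed
  have B: "u \<in> clo (p +++ q)" if "t \<in> {0..1}" "x \<in> set3 (q t)" "u = cyl (fst x) (pi + pi * t) (snd x)" for t x u
  proof (cases "t = 0")
    case True
    then have "x \<in> set3 (p 1)" using that assms by (simp add: pathfinish_def pathstart_def)
    then show ?thesis using A [of 1 x u] that True by simp
  next
    case False
    then have "(p +++ q) ((t + 1) / 2) = q (2 * ((t + 1) / 2) - 1)" using that by (simp add: joinpaths_def)
    also have "2 * ((t + 1) / 2) - 1 = t" by (simp add: field_simps)
    finally have "x \<in> set3 ((p +++ q) ((t + 1) / 2))" using that by simp
    moreover have "2 * pi * ((t + 1) / 2) = pi + pi * t" by (simp add: field_simps)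
    then have "u = cyl (fst x) (2 * pi * ((t + 1) / 2)) (snd x)" using that by (simp only:)
    moreover have "(t + 1) / 2 \<in> {0..1}" using that by auto
    ultimately show ?thesis unfolding clo_def by blast
  qed
  show "?A \<union> ?B \<subseteq> clo (p +++ q)" using A B by blast
qed

text \<open>A concatenation spends half of the full angle on each factor, so half a turn about the
  axis exchanges them.\<close>

lemma turn_clo_join:
  assumes "set3 (pathfinish p) = set3 (pathstart q)" "set3 (pathfinish q) = set3 (pathstart p)"
  shows "turn pi ` clo (p +++ q) = clo (q +++ p)"
proof -
  have c: "cyl r (pi + pi * t + pi) z = cyl r (pi * t) z" for r t z
    using cos_periodic [of "pi * t"] sin_periodic [of "pi * t"] by (intro cyl_cong) (simp_all add: algebra_simps)
  have c': "cyl r (pi * t + pi) z = cyl r (pi + pi * t) z" for r t z by (simp add: add.commute)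
  show ?thesis
    unfolding clo_join [OF assms(1)] clo_join [OF assms(2)] image_Un image_UN image_image turn_cyl c c'
    by (rule Un_commute)
qed

lemma iso2_join_commute:
  assumes "set3 (pathfinish p) = set3 (pathstart q)" "set3 (pathfinish q) = set3 (pathstart p)"
    "clo (p +++ q) \<subseteq> annular_space" "clo (q +++ p) \<subseteq> annular_space"
  shows "iso2 (clo (p +++ q)) (clo (q +++ p))"
  using annular_isotopic_turn [OF assms(3), of pi] annular_isotopic_turn [OF assms(4), of pi]
    turn_clo_join [OF assms(1,2)] turn_clo_join [OF assms(2,1)]
  by (simp add: iso2_def)

section \<open>Braid words as paths of numbered points\<close>

definition b0 :: cfg where "b0 = ((1, 0), (2, 0), (3, 0))"

text \<open>The closure is drawn by strand positions, while a path follows numbered points. After a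
  slot two numbers have been exchanged, and \<open>sw\<close> renumbers the rest of the path
  accordingly.\<close>

fun sw :: "gen3 \<Rightarrow> cfg \<Rightarrow> cfg" where
  "sw Sig1 (a, b, c) = (b, a, c)"
| "sw Sig2 (a, b, c) = (a, c, b)"

fun sl :: "gen3 \<times> bool \<Rightarrow> real \<Rightarrow> cfg" where
  "sl (Sig1, b) t = ((1 + t, (if b then 1 else - 1) * sin (pi * t)), (2 - t, - (if b then 1 else - 1) * sin (pi * t)), (3, 0))"
| "sl (Sig2, b) t = ((1, 0), (2 + t, (if b then 1 else - 1) * sin (pi * t)), (3 - t, - (if b then 1 else - 1) * sin (pi * t)))"

lemma sw_sw [simp]: "sw i (sw i c) = c"
  by (cases i; cases c) auto

lemma set3_sw [simp]: "set3 (sw i c) = set3 c"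
  by (cases i; cases c) (auto simp: set3_eq)

lemma sw_conf: "sw i ` conf \<subseteq> conf"
proof
  fix d assume "d \<in> sw i ` conf"
  then obtain a b c where "d = sw i (a, b, c)" "(a, b, c) \<in> conf" by auto
  then show "d \<in> conf" by (cases i) (auto simp: conf_iff)
qed

lemma sw_continuous: "continuous_on S (sw i)"
proof (cases i)
  case Sig1
  have "sw Sig1 = (\<lambda>c. (fst (snd c), fst c, snd (snd c)))" by auto
  then show ?thesis using Sig1 by (simp add: continuous_intros)
next
  case Sig2
  have "sw Sig2 = (\<lambda>c. (fst c, snd (snd c), fst (snd c)))" by auto
  then show ?thesis using Sig2 by (simp add: continuous_intros)
qed

lemma sl_ends [simp]: "sl a 0 = b0" "sl a 1 = sw (fst a) b0"
  by (cases a; cases "fst a"; simp add: b0_def)+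

lemma path_sl [simp]: "path (sl a)"
proof -
  obtain i b where a: "a = (i, b)" by (cases a)
  show ?thesis
  proof (cases i)
    case Sig1
    have "sl a = (\<lambda>t. ((1 + t, (if b then 1 else - 1) * sin (pi * t)), (2 - t, - (if b then 1 else - 1) * sin (pi * t)), (3, 0)))"
      by (auto simp: a Sig1)
    then show ?thesis unfolding path_def by (simp only:) (intro continuous_intros)
  next
    case Sig2
    have "sl a = (\<lambda>t. ((1, 0), (2 + t, (if b then 1 else - 1) * sin (pi * t)), (3 - t, - (if b then 1 else - 1) * sin (pi * t))))"
      by (auto simp: a Sig2)
    then show ?thesis unfolding path_def by (simp only:) (intro continuous_intros)
  qed
qed

lemma sl_conf: "t \<in> {0..1} \<Longrightarrow> sl a t \<in> conf"
proof -
  assume t: "t \<in> {0..1}"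
  have s: "sin (pi * t) = 1" if "t * 2 = 1"
  proof -
    have "pi * t = pi / 2" using that by (simp add: field_simps)
    then show ?thesis by (simp only: sin_pi_half)
  qed
  obtain i b where a: "a = (i, b)" by (cases a)
  have "1 + t = 2 - t \<longleftrightarrow> t * 2 = 1" "2 + t = 3 - t \<longleftrightarrow> t * 2 = 1" by auto
  then show ?thesis using t s by (cases i; cases b) (auto simp: a conf_iff)
qed

lemma image_sl [simp]: "path_image (sl a) \<subseteq> conf"
  using sl_conf unfolding path_image_def by blast

lemma sl_start [simp]: "pathstart (sl a) = b0" "pathfinish (sl a) = sw (fst a) b0"
  by (simp_all add: pathstart_def pathfinish_def)

lemma path_sw [simp]: "path p \<Longrightarrow> path (sw i \<circ> p)"
  by (simp add: path_continuous_image sw_continuous)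

lemma image_sw: "path_image p \<subseteq> conf \<Longrightarrow> path_image (sw i \<circ> p) \<subseteq> conf"
  using sw_conf [of i] by (force simp: path_image_compose)

lemma ends_sw [simp]: "pathstart (sw i \<circ> p) = sw i (pathstart p)" "pathfinish (sw i \<circ> p) = sw i (pathfinish p)"
  by (simp_all add: pathstart_def pathfinish_def)

primrec braid_path :: "braid3 \<Rightarrow> real \<Rightarrow> cfg" where
  "braid_path [] = (\<lambda>t. b0)"
| "braid_path (a # w) = sl a +++ (sw (fst a) \<circ> braid_path w)"

lemma braid_path_props [simp]: "path (braid_path w)" "path_image (braid_path w) \<subseteq> conf" "pathstart (braid_path w) = b0" "set3 (pathfinish (braid_path w)) = set3 b0"
proof -
  have "path (braid_path w) \<and> path_image (braid_path w) \<subseteq> conf \<and> pathstart (braid_path w) = b0 \<and> set3 (pathfinish (braid_path w)) = set3 b0"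
  proof (induction w)
    case Nil
    have "b0 \<in> conf" by (simp add: b0_def conf_iff)
    then show ?case by (auto simp: path_def path_image_def pathstart_def pathfinish_def)
  next
    case (Cons a w)
    then have p: "path (braid_path w)" "path_image (braid_path w) \<subseteq> conf" "pathstart (braid_path w) = b0" "set3 (pathfinish (braid_path w)) = set3 b0" by simp_all
    have "path_image (braid_path (a # w)) \<subseteq> conf"
      using path_image_join_subset [of "sl a" "sw (fst a) \<circ> braid_path w"] image_sl [of a] image_sw [OF p(2), of "fst a"]
      unfolding braid_path.simps by blast
    then show ?case using p by simp
  qed
  then show "path (braid_path w)" "path_image (braid_path w) \<subseteq> conf" "pathstart (braid_path w) = b0" "set3 (pathfinish (braid_path w)) = set3 b0" by auto
qed

text \<open>\<open>+++\<close> always changes over at 1/2; the closure of a word has slots of equal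
  length, which asks for other breakpoints.\<close>

definition joinat :: "real \<Rightarrow> (real \<Rightarrow> cfg) \<Rightarrow> (real \<Rightarrow> cfg) \<Rightarrow> real \<Rightarrow> cfg" where
  "joinat c p q t = (if t \<le> c then p (t / c) else q ((t - c) / (1 - c)))"

lemma homotopic_joinat:
  assumes c: "0 < c" "c < 1" and "path p" "path q" "pathfinish p = pathstart q" "path_image p \<subseteq> S" "path_image q \<subseteq> S"
  shows "homotopic_paths S (p +++ q) (joinat c p q)"
proof -
  let ?f = "\<lambda>t. if t \<le> c then t / (2 * c) else 1/2 + (t - c) / (2 * (1 - c))"
  show ?thesis
  proof (rule homotopic_paths_reparametrize [where f = ?f])
    show "path (p +++ q)" using assms by simp
    show "path_image (p +++ q) \<subseteq> S" using path_image_join_subset [of p q] assms by blast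
    show "continuous_on {0..1} ?f"
      using c by (intro continuous_on_cases_le continuous_intros) auto
    show "?f \<in> {0..1} \<rightarrow> {0..1}"
    proof
      fix t :: real assume t: "t \<in> {0..1}"
      have "(t - c) / (2 * (1 - c)) \<le> 1/2" using t c by (simp add: divide_le_eq)
      moreover have "t \<le> c \<Longrightarrow> t / (2 * c) \<le> 1" using t c by (simp add: divide_le_eq)
      moreover have "0 \<le> t \<Longrightarrow> 0 \<le> t / (2 * c)" "c \<le> t \<Longrightarrow> 0 \<le> (t - c) / (2 * (1 - c))" using c by simp_all
      ultimately show "?f t \<in> {0..1}" using t unfolding atLeastAtMost_iff
        by (cases "t \<le> c"; simp only: if_True if_False; linarith)
    qed
    have h: "(1 - c) / (2 - 2 * c) = 1 / 2" using c by (simp add: field_simps)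
    have "?f 1 = 1 / 2 + (1 - c) / (2 - 2 * c)" using c by simp
    also have "\<dots> = 1" unfolding h by simp
    finally show "?f 1 = 1" .
    show "?f 0 = 0" using c by simp
    fix t :: real assume t: "t \<in> {0..1}"
    show "joinat c p q t = (p +++ q) (?f t)"
    proof (cases "t \<le> c")
      case True
      then have "t / (2 * c) \<le> 1/2" "2 * (t / (2 * c)) = t / c" using c by (auto simp: field_simps)
      then show ?thesis using True by (simp add: joinat_def joinpaths_def)
    next
      case False
      define y where "y = (t - c) / (2 * (1 - c))"
      have "y > 0" using False c by (simp add: y_def)
      moreover have "2 * y = (t - c) / (1 - c)" unfolding y_def by (simp only: times_divide_eq_right mult_divide_mult_cancel_left)
      ultimately have "(p +++ q) (1/2 + y) = q ((t - c) / (1 - c))" by (simp add: joinpaths_def)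
      then show ?thesis using False by (simp only: joinat_def y_def if_False)
    qed
  qed
qed

text \<open>With the final identity slot the word \<open>a # w\<close> has
  \<open>length w + 2\<close> slots, so its first slot ends at the reciprocal of this
  number.\<close>

primrec uniform_path :: "braid3 \<Rightarrow> real \<Rightarrow> cfg" where
  "uniform_path [] = (\<lambda>t. b0)"
| "uniform_path (a # w) = joinat (1 / (real (length w) + 2)) (sl a) (sw (fst a) \<circ> uniform_path w)"

lemma homotopic_uniform: "homotopic_paths conf (braid_path w) (uniform_path w)"
proof (induction w)
  case Nil
  show ?case using braid_path_props(1,2) [of "[]"] by (simp add: homotopic_paths_refl del: braid_path_props)
next
  case (Cons a w)
  have sw: "homotopic_paths conf (sw (fst a) \<circ> braid_path w) (sw (fst a) \<circ> uniform_path w)"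
    using sw_conf by (intro homotopic_paths_continuous_image [OF Cons] sw_continuous) auto
  note u = homotopic_paths_imp_path [OF sw, THEN conjunct2] homotopic_paths_imp_subset [OF sw, THEN conjunct2]
    homotopic_paths_imp_pathstart [OF sw]
  have "homotopic_paths conf (braid_path (a # w)) (sl a +++ (sw (fst a) \<circ> uniform_path w))"
    unfolding braid_path.simps by (rule homotopic_paths_join) (simp_all add: sw homotopic_paths_refl)
  also have "homotopic_paths conf (sl a +++ (sw (fst a) \<circ> uniform_path w)) (uniform_path (a # w))"
    unfolding uniform_path.simps by (rule homotopic_joinat) (use u in auto)
  finally show ?case .
qed

lemma uniform_path_0: "uniform_path w 0 = b0"
  using homotopic_paths_imp_pathstart [OF homotopic_uniform, of w] by (simp add: pathstart_def [of "uniform_path w"])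

lemma set3_uniform_path:
  assumes "k \<le> length w" "t \<in> {0..1}"
  shows "set3 (uniform_path w ((real k + t) / real (Suc (length w)))) = (\<lambda>j. strand_pos w k j t) ` {..<3}"
  using assms
proof (induction w arbitrary: k)
  case Nil
  have "{..<3} = {0, 1, 2::nat}" by auto
  then show ?case using Nil by (simp add: b0_def set3_eq strand_pos_def)
next
  case (Cons a w)
  let ?n = "real (length w)"
  let ?x = "(real k + t) / (?n + 2)" and ?c = "1 / (?n + 2)"
  have n: "?n + 2 > 0" by simp
  have Ux: "uniform_path (a # w) ((real k + t) / real (Suc (length (a # w)))) = joinat ?c (sl a) (sw (fst a) \<circ> uniform_path w) ?x"
    by (simp add: add.commute)
  show ?case
  proof (cases k)
    case 0
    have "?x \<le> ?c" using Cons.prems n by (simp add: 0 divide_right_mono)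
    moreover have "?x / ?c = t" using n by (simp add: 0)
    ultimately have "uniform_path (a # w) ((real k + t) / real (Suc (length (a # w)))) = sl a t" unfolding Ux joinat_def by simp
    moreover have "{..<3} = {0, 1, 2::nat}" by auto
    moreover obtain i b where "a = (i, b)" by (cases a)
    ultimately show ?thesis by (cases i; cases b) (auto simp: set3_eq strand_pos_def 0 Let_def add.commute)
  next
    case (Suc k')
    have "joinat ?c (sl a) (sw (fst a) \<circ> uniform_path w) ?x = sw (fst a) (uniform_path w ((real k' + t) / real (Suc (length w))))"
    proof (cases "?x \<le> ?c")
      case True
      \<comment> \<open>The point is the common end of the first two slots, where
        \<open>joinat\<close> takes the first piece; both pieces agree there.\<close>
      then have "real k' + t \<le> 0" using n by (simp add: Suc divide_le_cancel)
      then have z: "real k' + t = 0" using Cons.prems by auto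
      then have "?x / ?c = 1" using n Suc by (simp add: field_simps)
      then show ?thesis using True z by (simp add: joinat_def uniform_path_0)
    next
      case False
      have "(?x - ?c) / (1 - ?c) = (real k' + t) / real (Suc (length w))"
      proof -
        have "?x - ?c = (real k' + t) / (?n + 2)" by (simp add: Suc diff_divide_distrib [symmetric])
        moreover have "1 - ?c = (?n + 1) / (?n + 2)" using n by (simp add: field_simps)
        ultimately show ?thesis using n by (simp add: add.commute)
      qed
      then show ?thesis using False by (simp only: joinat_def if_False o_apply)
    qed
    moreover have "strand_pos (a # w) k j t = strand_pos w k' j t" for j
      by (simp add: strand_pos_def Suc)
    ultimately show ?thesis using Cons.IH [of k'] Cons.prems Suc unfolding Ux by simp
  qed
qed

lemma clo_uniform_path: "clo (uniform_path w) = braid_closure w"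
proof
  let ?n = "length w"
  have mem: "(real k + t) / real (Suc ?n) \<in> {0..1}" if "k \<le> ?n" "0 \<le> t" "t \<le> 1" for k t
  proof -
    have "real k + t \<le> real (Suc ?n)" using that by simp
    then show ?thesis using that by (simp add: divide_le_eq)
  qed
  have ang: "2 * pi * ((real k + t) / real (Suc ?n)) = 2 * pi * (real k + t) / real (Suc ?n)" for k t by simp
  show "braid_closure w \<subseteq> clo (uniform_path w)"
  proof
    fix u assume "u \<in> braid_closure w"
    then obtain k j t where a: "k \<le> ?n" "j < 3" "0 \<le> t" "t \<le> 1"
      "u = cyl (fst (strand_pos w k j t)) (2 * pi * (real k + t) / real (Suc ?n)) (snd (strand_pos w k j t))"
      unfolding braid_closure_def by blast
    have "strand_pos w k j t \<in> set3 (uniform_path w ((real k + t) / real (Suc ?n)))"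
      using set3_uniform_path [OF a(1), of t] a(2-4) by simp
    then show "u \<in> clo (uniform_path w)" unfolding clo_def a(5) ang [symmetric] using mem [OF a(1,3,4)] by blast
  qed
  show "clo (uniform_path w) \<subseteq> braid_closure w"
  proof
    fix u assume "u \<in> clo (uniform_path w)"
    then obtain \<tau> x where \<tau>: "\<tau> \<in> {0..1}" "x \<in> set3 (uniform_path w \<tau>)" "u = cyl (fst x) (2 * pi * \<tau>) (snd x)"
      unfolding clo_def by blast
    obtain k t where kt: "k \<le> ?n" "0 \<le> t" "t \<le> 1" "\<tau> = (real k + t) / real (Suc ?n)"
    proof (cases "\<tau> = 1")
      case True
      \<comment> \<open>The parameter 1 lies in no half-open slot and is taken as the end of the
        last one.\<close>
      then show thesis using that [of ?n 1] by simp
    next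
      case False
      let ?m = "real (Suc ?n) * \<tau>"
      have m: "0 \<le> ?m" "?m < real (Suc ?n)" using \<tau>(1) False by auto
      then have "\<lfloor>?m\<rfloor> < int (Suc ?n)" by (simp add: floor_less_iff)
      then have "nat \<lfloor>?m\<rfloor> \<le> ?n" by linarith
      moreover have "real (nat \<lfloor>?m\<rfloor>) = of_int \<lfloor>?m\<rfloor>" using m(1) by simp
      then have "0 \<le> ?m - real (nat \<lfloor>?m\<rfloor>)" "?m - real (nat \<lfloor>?m\<rfloor>) \<le> 1" by linarith+
      ultimately show thesis using that [of "nat \<lfloor>?m\<rfloor>" "?m - real (nat \<lfloor>?m\<rfloor>)"] by simp
    qed
    have "x \<in> (\<lambda>j. strand_pos w k j t) ` {..<3}" using set3_uniform_path [OF kt(1), of t] \<tau>(2) kt by simp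
    then obtain j where "j < 3" "x = strand_pos w k j t" by auto
    then show "u \<in> braid_closure w" unfolding braid_closure_def \<tau>(3) kt(4) ang using kt(1-3) by blast
  qed
qed

lemma iso2_braid_path: "iso2 (braid_closure w) (clo (braid_path w))"
  using homotopic_iso2 [OF homotopic_uniform, of w] clo_uniform_path by (simp add: iso2_sym)

lemma iso2_of_homotopic: "homotopic_paths conf (braid_path u) (braid_path v) \<Longrightarrow> iso2 (braid_closure u) (braid_closure v)"
  by (meson homotopic_iso2 iso2_braid_path iso2_sym iso2_trans)

text \<open>After renumbering, the inverse letter retraces the slot backwards; this is why a
  cancelling pair is a null-homotopic loop.\<close>

lemma sw_sl: "sw i \<circ> sl (i, \<not> b) = reversepath (sl (i, b))"
proof
  fix t
  have "sin (pi * (1 - t)) = sin (pi * t)" by (simp add: right_diff_distrib sin_diff)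
  then show "(sw i \<circ> sl (i, \<not> b)) t = reversepath (sl (i, b)) t" by (cases i) (auto simp: reversepath_def)
qed

theorem iso2_cancel: "iso2 (braid_closure ((i, b) # (i, \<not> b) # u)) (braid_closure u)"
proof (rule iso2_of_homotopic)
  let ?a = "sl (i, b)"
  have "sw i \<circ> (sw i \<circ> braid_path u) = braid_path u" by auto
  then have e: "braid_path ((i, b) # (i, \<not> b) # u) = ?a +++ (reversepath ?a +++ braid_path u)"
    by (simp add: path_compose_join sw_sl)
  have "homotopic_paths conf (?a +++ (reversepath ?a +++ braid_path u)) ((?a +++ reversepath ?a) +++ braid_path u)"
    by (intro homotopic_paths_assoc) auto
  also have "homotopic_paths conf ((?a +++ reversepath ?a) +++ braid_path u) (linepath b0 b0 +++ braid_path u)"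
    using homotopic_paths_rinv [of ?a conf] by (intro homotopic_paths_join) (simp_all add: homotopic_paths_refl)
  also have "homotopic_paths conf (linepath b0 b0 +++ braid_path u) (braid_path u)"
    using homotopic_paths_lid [of "braid_path u" conf] by simp
  finally show "homotopic_paths conf (braid_path ((i, b) # (i, \<not> b) # u)) (braid_path u)" unfolding e .
qed

fun perm :: "braid3 \<Rightarrow> cfg \<Rightarrow> cfg" where
  "perm [] c = c"
| "perm (a # w) c = sw (fst a) (perm w c)"

lemma perm_props [simp]: "set3 (perm w c) = set3 c"
  by (induction w) auto

lemma perm_path: "path p \<Longrightarrow> path (perm w \<circ> p)" "path_image p \<subseteq> conf \<Longrightarrow> path_image (perm w \<circ> p) \<subseteq> conf"
proof (induction w)
  case Nil
  have "perm [] \<circ> p = p" by auto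
  { case 1 then show ?case using \<open>perm [] \<circ> p = p\<close> by simp }
  { case 2 then show ?case using \<open>perm [] \<circ> p = p\<close> by simp }
next
  case (Cons a w)
  have "perm (a # w) \<circ> p = sw (fst a) \<circ> (perm w \<circ> p)" by auto
  { case 1 then show ?case unfolding \<open>perm (a # w) \<circ> p = _\<close> by (intro path_sw Cons) }
  { case 2 then show ?case unfolding \<open>perm (a # w) \<circ> p = _\<close> by (intro image_sw Cons) }
qed

lemma finish_braid_path: "pathfinish (braid_path w) = perm w b0"
  by (induction w) (auto simp: pathfinish_def joinpaths_def)

text \<open>\<open>braid_path\<close> splits off letters on the left. Rotation needs the last letter
  split off on the right, where the points have been renumbered by \<open>perm u\<close>.\<close>

lemma homotopic_snoc: "homotopic_paths conf (braid_path (u @ [a])) (braid_path u +++ (perm u \<circ> sl a))"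
proof (induction u)
  case Nil
  have l: "braid_path [] = linepath b0 b0" by (auto simp: linepath_refl)
  have "sw (fst a) \<circ> braid_path [] = linepath (sw (fst a) b0) (sw (fst a) b0)" by (auto simp: linepath_refl)
  then have "homotopic_paths conf (braid_path [a]) (sl a)" using homotopic_paths_rid [of "sl a" conf] by simp
  also have "homotopic_paths conf (sl a) (braid_path [] +++ sl a)"
    using homotopic_paths_lid [of "sl a" conf] by (simp add: l homotopic_paths_sym del: braid_path.simps)
  also have "sl a = perm [] \<circ> sl a" by auto
  finally show ?case by simp
next
  case (Cons b u)
  let ?q = "perm u \<circ> sl a"
  have q: "path ?q" "path_image ?q \<subseteq> conf" "pathstart ?q = perm u b0"
    using perm_path [of "sl a" u] by (simp_all add: pathstart_def)
  have "homotopic_paths conf (sw (fst b) \<circ> braid_path (u @ [a])) (sw (fst b) \<circ> (braid_path u +++ ?q))"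
    using sw_conf by (intro homotopic_paths_continuous_image [OF Cons] sw_continuous) auto
  then have "homotopic_paths conf (braid_path ((b # u) @ [a])) (sl b +++ (sw (fst b) \<circ> (braid_path u +++ ?q)))"
    unfolding append_Cons braid_path.simps by (intro homotopic_paths_join) (simp_all add: homotopic_paths_refl)
  also have "sl b +++ (sw (fst b) \<circ> (braid_path u +++ ?q)) = sl b +++ ((sw (fst b) \<circ> braid_path u) +++ (sw (fst b) \<circ> ?q))"
    by (simp add: path_compose_join)
  also have "homotopic_paths conf (sl b +++ ((sw (fst b) \<circ> braid_path u) +++ (sw (fst b) \<circ> ?q))) ((sl b +++ (sw (fst b) \<circ> braid_path u)) +++ (sw (fst b) \<circ> ?q))"
    using q image_sw by (intro homotopic_paths_assoc) (auto simp: finish_braid_path)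
  also have "(sl b +++ (sw (fst b) \<circ> braid_path u)) +++ (sw (fst b) \<circ> ?q) = braid_path (b # u) +++ (perm (b # u) \<circ> sl a)"
    by (auto simp: comp_def)
  finally show ?case .
qed

theorem iso2_rotate: "iso2 (braid_closure (a # u)) (braid_closure (u @ [a]))"
proof -
  let ?q = "perm u \<circ> sl a" and ?r = "sw (fst a) \<circ> braid_path u"
  have q: "path ?q" "path_image ?q \<subseteq> conf" "pathstart ?q = perm u b0" "set3 (pathfinish ?q) = set3 b0"
    using perm_path [of "sl a" u] by (simp_all add: pathstart_def pathfinish_def)
  have s1: "t \<in> {0..1} \<Longrightarrow> set3 ((braid_path u +++ ?q) t) = set3 ((?r +++ sl a) t)" for t
    by (auto simp: joinpaths_def)
  have sub: "clo (sl a +++ ?r) \<subseteq> annular_space" using clo_subset [OF braid_path_props(2), of "a # u"] by simp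
  \<comment> \<open>\<open>clo\<close> forgets the numbering, so the renumberings
    \<open>perm u\<close> and \<open>sw (fst a)\<close> disappear.\<close>
  have e: "clo (braid_path u +++ ?q) = clo (?r +++ sl a)" by (rule clo_cong) (rule s1)
  have "path_image (braid_path u +++ ?q) \<subseteq> conf" using path_image_join_subset [of "braid_path u" ?q] q(2) braid_path_props(2) [of u] by blast
  from clo_subset [OF this] have sub': "clo (?r +++ sl a) \<subseteq> annular_space" unfolding e .
  have "iso2 (braid_closure (a # u)) (clo (sl a +++ ?r))" using iso2_braid_path [of "a # u"] by simp
  also have "iso2 (clo (sl a +++ ?r)) (clo (?r +++ sl a))"
    by (rule iso2_join_commute) (use sub sub' in simp_all)
  also have "clo (?r +++ sl a) = clo (braid_path u +++ ?q)" by (rule e [symmetric])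
  also have "iso2 (clo (braid_path u +++ ?q)) (clo (braid_path (u @ [a])))" by (rule iso2_sym [OF homotopic_iso2 [OF homotopic_snoc]])
  also have "iso2 (clo (braid_path (u @ [a]))) (braid_closure (u @ [a]))" by (rule iso2_sym [OF iso2_braid_path])
  finally show ?thesis .
qed

text \<open>Both sides of the braid relation are paths of layered configurations, so they can be flattened to
  the heights s, 0, -s; the flattened paths are linearly homotopic.\<close>

fun layered :: "cfg \<Rightarrow> bool" where
  "layered ((ra, za), (rb, zb), (rc, zc)) \<longleftrightarrow> 0 < ra \<and> 0 < rb \<and> 0 < rc \<and>
     (ra = rb \<longrightarrow> zb < za) \<and> (ra = rc \<longrightarrow> zc < za) \<and> (rb = rc \<longrightarrow> zc < zb)"

definition flat :: "real \<Rightarrow> cfg \<Rightarrow> cfg" where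
  "flat s c = ((fst (fst c), s), (fst (fst (snd c)), 0), (fst (snd (snd c)), - s))"

lemma layered_conf: "layered c \<Longrightarrow> c \<in> conf"
  by (cases c rule: layered.cases) (auto simp: conf_iff)

lemma convex_less: "a < b \<Longrightarrow> c < d \<Longrightarrow> 0 \<le> u \<Longrightarrow> u \<le> 1 \<Longrightarrow> (1 - u) * a + u * c < (1 - u) * b + u * (d::real)"
proof (cases "u = 0")
  case False
  assume "a < b" "c < d" "0 \<le> u" "u \<le> 1"
  then show ?thesis using False by (intro add_le_less_mono mult_left_mono mult_strict_left_mono) auto
qed simp

lemma segment_flat:
  assumes "layered c" "s > 0"
  shows "closed_segment c (flat s c) \<subseteq> conf"
proof
  fix d assume "d \<in> closed_segment c (flat s c)"
  then obtain u where u: "0 \<le> u" "u \<le> 1" "d = (1 - u) *\<^sub>R c + u *\<^sub>R flat s c" by (auto simp: closed_segment_def)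
  obtain ra za rb zb rc zc where c: "c = ((ra, za), (rb, zb), (rc, zc))" by (cases c rule: layered.cases)
  have r: "(1 - u) * x + u * x = x" for x :: real by (simp add: algebra_simps)
  have d: "d = ((ra, (1 - u) * za + u * s), (rb, (1 - u) * zb + u * 0), (rc, (1 - u) * zc + u * (- s)))"
    unfolding u(3) c flat_def by (simp add: r)
  have "0 < ra" "0 < rb" "0 < rc" "ra = rb \<Longrightarrow> zb < za" "ra = rc \<Longrightarrow> zc < za" "rb = rc \<Longrightarrow> zc < zb"
    using assms(1) by (simp_all add: c)
  moreover have "0 < s" "- s < s" "- s < 0" using assms(2) by simp_all
  ultimately have "layered d" unfolding d layered.simps by (intro conjI impI convex_less [OF _ _ u(1,2)]) blast+
  then show "d \<in> conf" by (rule layered_conf)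
qed

lemma segment_flat_flat:
  assumes "layered c" "layered d" "s > 0"
  shows "closed_segment (flat s c) (flat s d) \<subseteq> conf"
proof
  fix e assume "e \<in> closed_segment (flat s c) (flat s d)"
  then obtain u where u: "0 \<le> u" "u \<le> 1" "e = (1 - u) *\<^sub>R flat s c + u *\<^sub>R flat s d" by (auto simp: closed_segment_def)
  obtain ra za rb zb rc zc where c: "c = ((ra, za), (rb, zb), (rc, zc))" by (cases c rule: layered.cases)
  obtain qa ya qb yb qc yc where d: "d = ((qa, ya), (qb, yb), (qc, yc))" by (cases d rule: layered.cases)
  have r: "(1 - u) * s + u * s = s" "- ((1 - u) * s) - u * s = - s" by (simp_all add: algebra_simps)
  have e: "e = (((1 - u) * ra + u * qa, s), ((1 - u) * rb + u * qb, 0), ((1 - u) * rc + u * qc, - s))"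
    unfolding u(3) c d flat_def using r by simp
  have "0 < (1 - u) * x + u * y" if "0 < x" "0 < y" for x y
    using convex_less [OF that u(1,2)] by simp
  then show "e \<in> conf" using assms unfolding e c d by (simp add: conf_iff)
qed

text \<open>Both paths are flattened to heights of size \<open>sin (pi * t)\<close>, which vanish at
  the ends, so the endpoints stay fixed. Between flattened configurations only the radii move, and
  different heights prevent collisions.\<close>

lemma homotopic_layered:
  assumes p: "path p" and q: "path q" and st: "pathstart p = pathstart q" "pathfinish p = pathfinish q"
    and ends: "flat 0 (pathstart p) = pathstart p" "flat 0 (pathfinish p) = pathfinish p"
    and lay: "\<And>t. t \<in> {0..1} \<Longrightarrow> layered (p t)" "\<And>t. t \<in> {0..1} \<Longrightarrow> layered (q t)"
  shows "homotopic_paths conf p q"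
proof -
  define fl where "fl = (\<lambda>p t. flat (sin (pi * t)) (p t))"
  have pf: "path (fl p)" if "path p" for p
    using that unfolding path_def fl_def flat_def by (intro continuous_intros)
  have s: "sin (pi * t) > 0" if "t \<in> {0..1}" "t \<noteq> 0" "t \<noteq> 1" for t
    using that by (intro sin_gt_zero) auto
  have 1: "homotopic_paths conf p (fl p)" if p: "path p" and ends: "flat 0 (pathstart p) = pathstart p" "flat 0 (pathfinish p) = pathfinish p"
      and lay: "\<And>t. t \<in> {0..1} \<Longrightarrow> layered (p t)" for p
  proof (rule homotopic_paths_linear [OF p pf [OF p]])
    show "pathstart (fl p) = pathstart p" "pathfinish (fl p) = pathfinish p"
      using ends by (simp_all add: fl_def pathstart_def pathfinish_def)
    fix t :: real assume t: "t \<in> {0..1}"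
    show "closed_segment (p t) (fl p t) \<subseteq> conf"
    proof (cases "t = 0 \<or> t = 1")
      case True
      then have "fl p t = p t" using ends by (auto simp: fl_def pathstart_def pathfinish_def)
      then show ?thesis using layered_conf [OF lay [OF t]] by simp
    next
      case False
      then show ?thesis unfolding fl_def using segment_flat [OF lay [OF t] s [OF t]] by blast
    qed
  qed
  have "homotopic_paths conf (fl p) (fl q)"
  proof (rule homotopic_paths_linear [OF pf [OF p] pf [OF q]])
    show "pathstart (fl q) = pathstart (fl p)" "pathfinish (fl q) = pathfinish (fl p)"
      using st by (simp_all add: fl_def pathstart_def pathfinish_def)
    fix t :: real assume t: "t \<in> {0..1}"
    show "closed_segment (fl p t) (fl q t) \<subseteq> conf"
    proof (cases "t = 0 \<or> t = 1")
      case True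
      then have "fl p t = p t" "fl q t = p t" using ends st by (auto simp: fl_def pathstart_def pathfinish_def)
      then show ?thesis using layered_conf [OF lay(1) [OF t]] by simp
    next
      case False
      then show ?thesis unfolding fl_def using segment_flat_flat [OF lay(1) [OF t] lay(2) [OF t] s [OF t]] by blast
    qed
  qed
  moreover have "homotopic_paths conf p (fl p)" by (rule 1 [OF p ends lay(1)])
  moreover have "homotopic_paths conf (fl q) q"
    using 1 [OF q _ _ lay(2)] ends st by (simp add: homotopic_paths_sym)
  ultimately show ?thesis by (meson homotopic_paths_trans)
qed

text \<open>In either positive word, of two points that cross the one starting nearer to the axis
  passes above, so the numbering is the layering in all six slots.\<close>

lemma layered_slots:
  assumes t: "t \<in> {0..1}"
  shows "layered (sl (Sig1, True) t)" "layered (sw Sig1 (sl (Sig2, True) t))" "layered (sw Sig1 (sw Sig2 (sl (Sig1, True) t)))"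
    "layered (sl (Sig2, True) t)" "layered (sw Sig2 (sl (Sig1, True) t))" "layered (sw Sig2 (sw Sig1 (sl (Sig2, True) t)))"
proof -
  have s: "sin (pi * t) = 1" if "t * 2 = 1"
  proof -
    have "pi * t = pi / 2" using that by (simp add: field_simps)
    then show ?thesis by (simp only: sin_pi_half)
  qed
  have e: "1 + t = 2 - t \<longleftrightarrow> t * 2 = 1" "2 + t = 3 - t \<longleftrightarrow> t * 2 = 1" by auto
  show "layered (sl (Sig1, True) t)" "layered (sw Sig1 (sl (Sig2, True) t))" "layered (sw Sig1 (sw Sig2 (sl (Sig1, True) t)))"
    "layered (sl (Sig2, True) t)" "layered (sw Sig2 (sl (Sig1, True) t))" "layered (sw Sig2 (sw Sig1 (sl (Sig2, True) t)))"
    using t s by (auto simp: e)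
qed

lemma homotopic_braid:
  "homotopic_paths conf (braid_path ((Sig1, True) # (Sig2, True) # (Sig1, True) # u)) (braid_path ((Sig2, True) # (Sig1, True) # (Sig2, True) # u))"
proof -
  let ?a = "sl (Sig1, True)" and ?b = "sl (Sig2, True)"
  let ?p = "?a +++ ((sw Sig1 \<circ> ?b) +++ (sw Sig1 \<circ> (sw Sig2 \<circ> ?a)))"
  let ?q = "?b +++ ((sw Sig2 \<circ> ?a) +++ (sw Sig2 \<circ> (sw Sig1 \<circ> ?b)))"
  let ?r = "sw Sig1 \<circ> (sw Sig2 \<circ> (sw Sig1 \<circ> braid_path u))"
  have sw: "sw Sig2 (sw Sig1 (sw Sig2 c)) = sw Sig1 (sw Sig2 (sw Sig1 c))" for c by (cases c) simp
  then have r: "sw Sig2 \<circ> (sw Sig1 \<circ> (sw Sig2 \<circ> braid_path u)) = ?r" by (auto simp: comp_def)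
  have assoc: "homotopic_paths conf (x +++ (y +++ (z +++ v))) ((x +++ (y +++ z)) +++ v)"
    if "path x" "path y" "path z" "path v" "pathfinish x = pathstart y" "pathfinish y = pathstart z" "pathfinish z = pathstart v"
      "path_image x \<subseteq> conf" "path_image y \<subseteq> conf" "path_image z \<subseteq> conf" "path_image v \<subseteq> conf" for x y z v
  proof -
    have im: "path_image (y +++ z) \<subseteq> conf" using path_image_join_subset [of y z] that by blast
    have "homotopic_paths conf (x +++ (y +++ (z +++ v))) (x +++ ((y +++ z) +++ v))"
      using that by (intro homotopic_paths_join homotopic_paths_assoc) (simp_all add: homotopic_paths_refl)
    also have "homotopic_paths conf (x +++ ((y +++ z) +++ v)) ((x +++ (y +++ z)) +++ v)"
      using that im by (intro homotopic_paths_assoc) simp_all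
    finally show ?thesis .
  qed
  have e: "braid_path ((Sig1, True) # (Sig2, True) # (Sig1, True) # u) = ?a +++ ((sw Sig1 \<circ> ?b) +++ ((sw Sig1 \<circ> (sw Sig2 \<circ> ?a)) +++ ?r))"
    "braid_path ((Sig2, True) # (Sig1, True) # (Sig2, True) # u) = ?b +++ ((sw Sig2 \<circ> ?a) +++ ((sw Sig2 \<circ> (sw Sig1 \<circ> ?b)) +++ ?r))"
    unfolding r [symmetric] by (simp_all add: path_compose_join r)
  have pq: "path ?p" "path ?q" "pathstart ?p = b0" "pathstart ?q = b0"
    "pathfinish ?p = ((3, 0), (2, 0), (1, 0))" "pathfinish ?q = ((3, 0), (2, 0), (1, 0))"
    by (simp_all add: b0_def)
  have lay: "layered (?p t)" "layered (?q t)" if t: "t \<in> {0..1}" for t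
  proof -
    have "?p t \<in> path_image ?p" "?q t \<in> path_image ?q" using t by (auto simp: path_image_def)
    then have "?p t \<in> path_image ?a \<union> path_image (sw Sig1 \<circ> ?b) \<union> path_image (sw Sig1 \<circ> (sw Sig2 \<circ> ?a))"
      "?q t \<in> path_image ?b \<union> path_image (sw Sig2 \<circ> ?a) \<union> path_image (sw Sig2 \<circ> (sw Sig1 \<circ> ?b))"
      using path_image_join_subset by blast+
    then show "layered (?p t)" "layered (?q t)" using layered_slots by (auto simp: path_image_def simp del: sl.simps layered.simps)
  qed
  have hom: "homotopic_paths conf ?p ?q"
    using pq lay by (intro homotopic_layered) (simp_all add: flat_def b0_def)
  have "homotopic_paths conf (braid_path ((Sig1, True) # (Sig2, True) # (Sig1, True) # u)) (?p +++ ?r)"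
    unfolding e by (intro assoc) (simp_all add: image_sw)
  also have "homotopic_paths conf (?p +++ ?r) (?q +++ ?r)"
    using pq by (intro homotopic_paths_join hom) (simp_all add: homotopic_paths_refl image_sw b0_def)
  also have "homotopic_paths conf (?q +++ ?r) (braid_path ((Sig2, True) # (Sig1, True) # (Sig2, True) # u))"
    unfolding e by (rule homotopic_paths_sym, intro assoc) (simp_all add: image_sw b0_def)
  finally show ?thesis .
qed

theorem iso2_braid:
  "i \<noteq> j \<Longrightarrow> iso2 (braid_closure ((i, True) # (j, True) # (i, True) # u)) (braid_closure ((j, True) # (i, True) # (j, True) # u))"
  using iso2_of_homotopic [OF homotopic_braid, of u] by (cases i; cases j) (auto intro: iso2_sym)

section \<open>The theorem\<close>

lemma beq_iso2: "beq u v \<Longrightarrow> iso2 (braid_closure u) (braid_closure v)"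
proof (induction rule: beq.induct)
  case (refl u)
  \<comment> \<open>Reflexivity comes from inserting a cancelling pair and removing it
    again.\<close>
  show ?case using iso2_cancel iso2_sym iso2_trans by blast
next
  case (sym u v)
  show ?case by (rule iso2_sym [OF sym.IH])
next
  case (trans u v w)
  show ?case by (rule iso2_trans [OF trans.IH])
qed (auto intro: iso2_rotate iso2_cancel iso2_braid)

theorem theorem10p1:
  fixes w :: braid3
  assumes "akh_dim w = 6"
  shows "annular_isotopic (braid_closure w) (braid_closure [(Sig1, True), (Sig2, True)])
       \<or> annular_isotopic (braid_closure w) (braid_closure [(Sig1, False), (Sig2, False)])"
  using akh_dim_6_word [OF assms] beq_iso2 by (auto simp: iso2_def)

end
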